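(* For integers $n\ge 0$ and a parameter $u\in\mathbb{C}$ define elements $C_n(u)\in U(\mathfrak{so}_n)$ inductively by $C_0(u)=C_1(u)=1$ and, for $n=2,3,\dots$, \begin{align*} C_n(u)=&-\Big\{\big(H-\tfrac{n-2}{2}\big)^2-u^2+\sum_{i=1}^{n-2}X_i^2\Big\}\,C_{n-2}(u)\\ &+\sum_{i=1}^{n-2}X_i\big(H-\tfrac{n-5}{2}\big)[A_{n-1,i},C_{n-2}(u)]+2\sum_{i=1}^{n-2}X_i\,C_{n-2}(u)\,A_{n-1,i}\\ &-\tfrac12\sum_{i=1}^{n-2}X_i\,[\Omega_{n-2},[A_{n-1,i},C_{n-2}(u)]]\\ &-\tfrac12\sum_{i,j=1}^{n-2}X_iX_j\,[A_{n-1,i},[A_{n-1,j},C_{n-2}(u)]], \end{align*} where $H=\sqrt{-1}A_{n,n-1}$, $X_i=A_{n-1,i}+\sqrt{-1}A_{n,i}$ and $\Omega_{n-2}=\sum_{1\le i<j\le n-2}(A_{j,i})^2$. Then $C_n(u)$ is an element of the center $Z(\mathfrak{so}_n)$ of $U(\mathfrak{so}_n)$ for every $u\in\mathbb{C}$. Moreover, the image of $C_n(u)$ under the Harish-Chandra map $\gamma$ is $$\gamma(C_n(u))=(u^2-H^2)(u^2-T_1^2)\cdots(u^2-T_{\lfloor (n-2)/2\rfloor}^2)$$ (a product of $\lfloor n/2\rfloor$ factors, read as $1$ when $n=0,1$).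
   Context: $E_{i,j}$ are the $n\times n$ matrix units, $A_{j,i}=E_{j,i}-E_{i,j}$, and $\mathfrak g=\mathfrak{so}_n$ is the complex Lie algebra of alternating (skew-symmetric) $n\times n$ matrices, spanned by $A_{j,i}$, $1\le i<j\le n$. $U(\cdot)$ denotes the universal enveloping algebra; $[\cdot,\cdot]$ is the commutator in it. $\mathfrak{so}_{n-2}$ is regarded as the subalgebra of $\mathfrak{so}_n$ spanned by $A_{j,i}$, $1\le i<j\le n-2$, so $U(\mathfrak{so}_{n-2})\subset U(\mathfrak{so}_n)$. The elements $H$ and $X_i$ depend on $n$ (they are those attached to the $n$ in the formula). Harish-Chandra map (for $n\ge2$): let $\mathfrak a=\mathbb{C}H$, $\mathfrak n=\sum_{i=1}^{n-2}\mathbb{C}X_i$, $\overline{\mathfrak n}=\sum_{i=1}^{n-2}\mathbb{C}(A_{n-1,i}-\sqrt{-1}A_{n,i})$, $\mathfrak m=\mathfrak{so}_{n-2}$ (which commutes with $\mathfrak a$), $T_i=\sqrt{-1}A_{n-2i,\,n-1-2i}$ for $1\le i\le\lfloor (n-2)/2\rfloor$, and $\mathfrak t_{\mathfrak m}=\sum_i\mathbb{C}T_i$, a Cartan subalgebra of $\mathfrak m$. Choose a Borel subalgebra $\mathfrak t_{\mathfrak m}\oplus\mathfrak u$ of $\mathfrak m$, with $\overline{\mathfrak u}$ opposite to $\mathfrak u$, and put $\mathfrak h=\mathfrak t_{\mathfrak m}\oplus\mathfrak a$, $\mathfrak N=\mathfrak n\oplus\mathfrak u$, $\overline{\mathfrak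 N}=\overline{\mathfrak n}\oplus\overline{\mathfrak u}$. The Harish-Chandra map $\gamma:U(\mathfrak g)\to U(\mathfrak h)$ is the projection along $U(\mathfrak g)=U(\mathfrak h)\oplus(\mathfrak N U(\mathfrak g)+U(\mathfrak g)\overline{\mathfrak N})$ followed by the rho shift, i.e. the algebra automorphism of $U(\mathfrak h)$ with $Y\mapsto Y+\rho(Y)$ for $Y\in\mathfrak h$, where $\rho$ is half the sum of the $\mathfrak h$-weights (with multiplicity) on $\mathfrak N$; in particular $\rho(H)=(n-2)/2$. *)

theory Defs
  imports
    Complex_Main
    "HOL-Library.Function_Algebras"
    "HOL-Library.Set_Algebras"
    "HOL-Library.Poly_Mapping"
    "HOL-Algebra.QuotRing"
    "HOL-Algebra.Generated_Groups"
begin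

section \<open>Matrices and orthogonal Lie algebras\<close>

text \<open>
  An \<open>n \<times> n\<close> matrix is represented by its extension by zero to the index set \<open>nat \<times> nat\<close>; rows and
  columns are numbered from 1. This makes \<open>so (n-2)\<close> literally a subset of \<open>so n\<close>.
  Addition of matrices is the pointwise one of \<^theory>\<open>HOL-Library.Function_Algebras\<close>; the
  pointwise product \<open>*\<close> is never used on matrices.
\<close>

type_synonym cmat = "nat \<Rightarrow> nat \<Rightarrow> complex"

definition smat :: "complex \<Rightarrow> cmat \<Rightarrow> cmat" where
  "smat c A = (\<lambda>i j. c * A i j)"

text \<open>\<^const>\<open>Sum_any\<close> is the sum over the finite support of the summand.\<close>

definition mmul :: "cmat \<Rightarrow> cmat \<Rightarrow> cmat" where
  "mmul A B = (\<lambda>i j. Sum_any (\<lambda>k. A i k * B k j))"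

definition lie :: "cmat \<Rightarrow> cmat \<Rightarrow> cmat" where
  "lie A B = mmul A B - mmul B A"

global_interpretation cmat: vector_space smat
  by unfold_locales (auto simp: smat_def fun_eq_iff algebra_simps)

definition munit :: "nat \<Rightarrow> nat \<Rightarrow> cmat" where
  "munit i j = (\<lambda>k l. if k = i \<and> l = j then 1 else 0)"

definition skew :: "nat \<Rightarrow> nat \<Rightarrow> cmat" where
  "skew j i = munit j i - munit i j"

definition so :: "nat \<Rightarrow> cmat set" where
  "so n = {A. (\<forall>i j. A j i = - A i j) \<and> (\<forall>i j. A i j \<noteq> 0 \<longrightarrow> i \<in> {1..n} \<and> j \<in> {1..n})}"

definition elemH :: "nat \<Rightarrow> cmat" where
  "elemH n = smat \<i> (skew n (n - 1))"

definition elemX :: "nat \<Rightarrow> nat \<Rightarrow> cmat" where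
  "elemX n i = skew (n - 1) i + smat \<i> (skew n i)"

definition elemXbar :: "nat \<Rightarrow> nat \<Rightarrow> cmat" where
  "elemXbar n i = skew (n - 1) i - smat \<i> (skew n i)"

definition elemT :: "nat \<Rightarrow> nat \<Rightarrow> cmat" where
  "elemT n i = smat \<i> (skew (n - 2 * i) (n - 1 - 2 * i))"


section \<open>Borel subalgebras\<close>

definition lie_subalgebra :: "cmat set \<Rightarrow> bool" where
  "lie_subalgebra g \<longleftrightarrow> cmat.subspace g \<and> (\<forall>x\<in>g. \<forall>y\<in>g. lie x y \<in> g)"

definition lie_derived :: "cmat set \<Rightarrow> cmat set" where
  "lie_derived g = cmat.span {lie x y | x y. x \<in> g \<and> y \<in> g}"

definition lie_solvable :: "cmat set \<Rightarrow> bool" where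
  "lie_solvable g \<longleftrightarrow> (\<exists>k. (lie_derived ^^ k) g = {0})"

definition borel_subalgebra :: "cmat set \<Rightarrow> cmat set \<Rightarrow> bool" where
  "borel_subalgebra g b \<longleftrightarrow>
     lie_subalgebra b \<and> b \<subseteq> g \<and> lie_solvable b \<and>
     (\<forall>b'. lie_subalgebra b' \<and> b' \<subseteq> g \<and> lie_solvable b' \<and> b \<subseteq> b' \<longrightarrow> b' = b)"

text \<open>
  The pairs of opposite Borel subalgebras \<open>t \<oplus> u\<close> and \<open>t \<oplus> ubar\<close> of a reductive Lie algebra \<open>m\<close>
  with Cartan subalgebra \<open>t\<close>. The summands \<open>u\<close>, \<open>ubar\<close>, i.e. the sums of the positive and of the
  negative root spaces, are the derived algebras of the two Borel subalgebras. (The largest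
  nilpotent ideal would be wrong here: it contains the centre of \<open>m\<close>, and \<open>m = so 2\<close> occurs.)
  Opposite means that the two Borel subalgebras intersect in \<open>t\<close> and together span \<open>m\<close>.
  Sums of sets of matrices are elementwise (\<^theory>\<open>HOL-Library.Set_Algebras\<close>).
\<close>

definition opposite_borels :: "cmat set \<Rightarrow> cmat set \<Rightarrow> cmat set \<Rightarrow> cmat set \<Rightarrow> bool" where
  "opposite_borels m t u ubar \<longleftrightarrow>
     borel_subalgebra m (t + u) \<and> t \<inter> u = {0} \<and> u = lie_derived (t + u) \<and>
     borel_subalgebra m (t + ubar) \<and> t \<inter> ubar = {0} \<and> ubar = lie_derived (t + ubar) \<and>
     (t + u) \<inter> (t + ubar) = t \<and> m = t + u + ubar"


section \<open>Universal enveloping algebras\<close>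

text \<open>
  Lists form the free monoid, so finitely supported functions \<open>'a list \<Rightarrow>\<^sub>0 complex\<close> with the
  convolution product of \<^theory>\<open>HOL-Library.Poly_Mapping\<close> form the free associative
  complex algebra.
\<close>

instantiation list :: (type) monoid_add
begin
definition zero_list :: "'a list" where "zero_list = []"
definition plus_list :: "'a list \<Rightarrow> 'a list \<Rightarrow> 'a list" where "plus_list = (@)"
instance by standard (simp_all add: zero_list_def plus_list_def)
end

definition free_alg :: "'a set \<Rightarrow> ('a list \<Rightarrow>\<^sub>0 complex) ring" where
  "free_alg S = \<lparr>carrier = {f. Poly_Mapping.keys f \<subseteq> lists S},
                 mult = (*), one = 1, zero = 0, add = (+)\<rparr>"

definition letter :: "'a \<Rightarrow> 'a list \<Rightarrow>\<^sub>0 complex" where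
  "letter x = Poly_Mapping.single [x] 1"

definition scalar :: "complex \<Rightarrow> 'a list \<Rightarrow>\<^sub>0 complex" where
  "scalar c = Poly_Mapping.single [] c"

text \<open>
  The first two families turn the free algebra on the set \<open>g\<close> into the tensor algebra of the vector
  space \<open>g\<close>; the third gives the universal enveloping algebra as its quotient.
\<close>

definition uea_relations :: "cmat set \<Rightarrow> (cmat list \<Rightarrow>\<^sub>0 complex) set" where
  "uea_relations g =
     {letter (x + y) - letter x - letter y | x y. x \<in> g \<and> y \<in> g} \<union>
     {letter (smat c x) - scalar c * letter x | c x. x \<in> g} \<union>
     {letter x * letter y - letter y * letter x - letter (lie x y) | x y. x \<in> g \<and> y \<in> g}"

definition uea_ideal :: "cmat set \<Rightarrow> (cmat list \<Rightarrow>\<^sub>0 complex) set" where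
  "uea_ideal g = Idl\<^bsub>free_alg g\<^esub> (uea_relations g)"

type_synonym uea_elem = "(cmat list \<Rightarrow>\<^sub>0 complex) set"

definition uea :: "cmat set \<Rightarrow> uea_elem ring" where
  "uea g = free_alg g Quot uea_ideal g"

definition uea_emb :: "cmat set \<Rightarrow> cmat \<Rightarrow> uea_elem" where
  "uea_emb g x = uea_ideal g +>\<^bsub>free_alg g\<^esub> letter x"

definition uea_const :: "cmat set \<Rightarrow> complex \<Rightarrow> uea_elem" where
  "uea_const g c = uea_ideal g +>\<^bsub>free_alg g\<^esub> scalar c"

text \<open>
  The canonical homomorphism \<open>U(g) \<rightarrow> U(g')\<close> for \<open>g \<subseteq> g'\<close>: it sends the coset \<open>uea_ideal g + f\<close>
  to \<open>uea_ideal g' + f\<close>.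
\<close>

definition uea_incl :: "cmat set \<Rightarrow> cmat set \<Rightarrow> uea_elem \<Rightarrow> uea_elem" where
  "uea_incl g g' a = uea_ideal g' <+>\<^bsub>free_alg g'\<^esub> a"

definition ring_center :: "('a, 'b) ring_scheme \<Rightarrow> 'a set" where
  "ring_center R = {z \<in> carrier R. \<forall>a \<in> carrier R. z \<otimes>\<^bsub>R\<^esub> a = a \<otimes>\<^bsub>R\<^esub> z}"

definition commutator :: "('a, 'b) ring_scheme \<Rightarrow> 'a \<Rightarrow> 'a \<Rightarrow> 'a" where
  "commutator R a b = a \<otimes>\<^bsub>R\<^esub> b \<ominus>\<^bsub>R\<^esub> b \<otimes>\<^bsub>R\<^esub> a"


section \<open>The elements $C_n(u)$ of $U(\mathfrak{so}_n)$\<close>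

definition Omega :: "nat \<Rightarrow> nat \<Rightarrow> uea_elem" where
  "Omega n m =
     (let R = uea (so n)
      in \<Oplus>\<^bsub>R\<^esub>j\<in>{1..m}. \<Oplus>\<^bsub>R\<^esub>i\<in>{1..<j}. uea_emb (so n) (skew j i) [^]\<^bsub>R\<^esub> (2::nat))"

text \<open>\<open>C_step n u c\<close> is the right-hand side of the recursion, for the image \<open>c\<close> of $C_{n-2}(u)$ in $U(\mathfrak{so}_n)$.\<close>

definition C_step :: "nat \<Rightarrow> complex \<Rightarrow> uea_elem \<Rightarrow> uea_elem" where
  "C_step n u c =
     (let R = uea (so n);
          H = uea_emb (so n) (elemH n);
          X = (\<lambda>i. uea_emb (so n) (elemX n i));
          A = (\<lambda>j i. uea_emb (so n) (skew j i));
          k = uea_const (so n);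
          I = {1..n - 2}
      in \<ominus>\<^bsub>R\<^esub> (((H \<ominus>\<^bsub>R\<^esub> k ((of_nat n - 2) / 2)) [^]\<^bsub>R\<^esub> (2::nat) \<ominus>\<^bsub>R\<^esub> k (u\<^sup>2)
                  \<oplus>\<^bsub>R\<^esub> (\<Oplus>\<^bsub>R\<^esub>i\<in>I. X i [^]\<^bsub>R\<^esub> (2::nat))) \<otimes>\<^bsub>R\<^esub> c)
         \<oplus>\<^bsub>R\<^esub> (\<Oplus>\<^bsub>R\<^esub>i\<in>I. X i \<otimes>\<^bsub>R\<^esub> (H \<ominus>\<^bsub>R\<^esub> k ((of_nat n - 5) / 2)) \<otimes>\<^bsub>R\<^esub> commutator R (A (n - 1) i) c)
         \<oplus>\<^bsub>R\<^esub> k 2 \<otimes>\<^bsub>R\<^esub> (\<Oplus>\<^bsub>R\<^esub>i\<in>I. X i \<otimes>\<^bsub>R\<^esub> c \<otimes>\<^bsub>R\<^esub> A (n - 1) i)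
         \<ominus>\<^bsub>R\<^esub> k (1 / 2) \<otimes>\<^bsub>R\<^esub>
             (\<Oplus>\<^bsub>R\<^esub>i\<in>I. X i \<otimes>\<^bsub>R\<^esub> commutator R (Omega n (n - 2)) (commutator R (A (n - 1) i) c))
         \<ominus>\<^bsub>R\<^esub> k (1 / 2) \<otimes>\<^bsub>R\<^esub>
             (\<Oplus>\<^bsub>R\<^esub>i\<in>I. \<Oplus>\<^bsub>R\<^esub>j\<in>I. X i \<otimes>\<^bsub>R\<^esub> X j \<otimes>\<^bsub>R\<^esub>
                commutator R (A (n - 1) i) (commutator R (A (n - 1) j) c)))"

fun Cn :: "nat \<Rightarrow> complex \<Rightarrow> uea_elem" where
  "Cn 0 u = \<one>\<^bsub>uea (so 0)\<^esub>"
| "Cn (Suc 0) u = \<one>\<^bsub>uea (so (Suc 0))\<^esub>"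
| "Cn (Suc (Suc m)) u =
     C_step (Suc (Suc m)) u (uea_incl (so m) (so (Suc (Suc m))) (Cn m u))"


section \<open>The Harish-Chandra map\<close>

text \<open>For \<open>n < 2\<close> there is no \<open>H\<close>; then \<open>so n\<close>, and with it everything below, is zero and the map is the
  identity of the complex numbers.\<close>

definition sub_a :: "nat \<Rightarrow> cmat set" where
  "sub_a n = (if 2 \<le> n then cmat.span {elemH n} else {0})"

definition sub_n :: "nat \<Rightarrow> cmat set" where
  "sub_n n = cmat.span (elemX n ` {1..n - 2})"

definition sub_nbar :: "nat \<Rightarrow> cmat set" where
  "sub_nbar n = cmat.span (elemXbar n ` {1..n - 2})"

definition sub_m :: "nat \<Rightarrow> cmat set" where
  "sub_m n = so (n - 2)"

definition sub_tm :: "nat \<Rightarrow> cmat set" where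
  "sub_tm n = cmat.span (elemT n ` {1..(n - 2) div 2})"

definition sub_h :: "nat \<Rightarrow> cmat set" where
  "sub_h n = sub_tm n + sub_a n"

text \<open>
  Weights are functionals on \<open>h\<close>, extended by 0 outside \<open>h\<close> so that each is counted once; the
  linearity of a weight is automatic, since its weight space is nonzero.
\<close>

definition weight_space :: "cmat set \<Rightarrow> cmat set \<Rightarrow> (cmat \<Rightarrow> complex) \<Rightarrow> cmat set" where
  "weight_space h V l = {x \<in> V. \<forall>Y\<in>h. lie Y x = smat (l Y) x}"

definition weights :: "cmat set \<Rightarrow> cmat set \<Rightarrow> (cmat \<Rightarrow> complex) set" where
  "weights h V = {l. (\<forall>Y. Y \<notin> h \<longrightarrow> l Y = 0) \<and> weight_space h V l \<noteq> {0}}"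

definition rho :: "cmat set \<Rightarrow> cmat set \<Rightarrow> cmat \<Rightarrow> complex" where
  "rho h V Y = (1 / 2) * (\<Sum>l\<in>weights h V. of_nat (cmat.dim (weight_space h V l)) * l Y)"

text \<open>The algebra automorphism of \<open>U(h)\<close> with \<open>Y \<mapsto> Y + r Y\<close> for \<open>Y \<in> h\<close>; functions on \<open>U(h)\<close> are made
  unique by being undefined outside the carrier.\<close>

definition uea_shift :: "cmat set \<Rightarrow> (cmat \<Rightarrow> complex) \<Rightarrow> uea_elem \<Rightarrow> uea_elem" where
  "uea_shift h r =
     (THE \<phi>. \<phi> \<in> ring_iso (uea h) (uea h) \<and> \<phi> \<in> extensional (carrier (uea h)) \<and>
             (\<forall>c. \<phi> (uea_const h c) = uea_const h c) \<and>
             (\<forall>Y\<in>h. \<phi> (uea_emb h Y) = uea_emb h Y \<oplus>\<^bsub>uea h\<^esub> uea_const h (r Y)))"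

text \<open>The subspace \<open>N U(g) + U(g) Nbar\<close>: sums of products, not just single products.\<close>

definition hc_complement :: "cmat set \<Rightarrow> cmat set \<Rightarrow> cmat set \<Rightarrow> uea_elem set" where
  "hc_complement g N Nbar =
     generate (add_monoid (uea g)) {uea_emb g x \<otimes>\<^bsub>uea g\<^esub> a | x a. x \<in> N \<and> a \<in> carrier (uea g)}
       <+>\<^bsub>uea g\<^esub>
     generate (add_monoid (uea g)) {a \<otimes>\<^bsub>uea g\<^esub> uea_emb g y | a y. a \<in> carrier (uea g) \<and> y \<in> Nbar}"

definition hc_proj :: "cmat set \<Rightarrow> cmat set \<Rightarrow> cmat set \<Rightarrow> cmat set \<Rightarrow> uea_elem \<Rightarrow> uea_elem" where
  "hc_proj g h N Nbar z =
     (THE p. p \<in> carrier (uea h) \<and>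
             (\<exists>q\<in>hc_complement g N Nbar. z = uea_incl h g p \<oplus>\<^bsub>uea g\<^esub> q))"

text \<open>The Harish-Chandra map \<open>U(so n) \<rightarrow> U(h)\<close> attached to the chosen \<open>u\<close> and \<open>ubar\<close> in \<open>m\<close>.\<close>

definition harish_chandra :: "nat \<Rightarrow> cmat set \<Rightarrow> cmat set \<Rightarrow> uea_elem \<Rightarrow> uea_elem" where
  "harish_chandra n u ubar z =
     (let N = sub_n n + u; Nbar = sub_nbar n + ubar
      in uea_shift (sub_h n) (rho (sub_h n) N) (hc_proj (so n) (sub_h n) N Nbar z))"

definition hc_image :: "nat \<Rightarrow> complex \<Rightarrow> uea_elem" where
  "hc_image n u =
     (let R = uea (sub_h n);
          H = uea_emb (sub_h n) (elemH n);
          T = (\<lambda>i. uea_emb (sub_h n) (elemT n i));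
          k = uea_const (sub_h n)
      in if n < 2 then \<one>\<^bsub>R\<^esub>
         else (k (u\<^sup>2) \<ominus>\<^bsub>R\<^esub> H [^]\<^bsub>R\<^esub> (2::nat)) \<otimes>\<^bsub>R\<^esub>
              (\<Otimes>\<^bsub>R\<^esub>i\<in>{1..(n - 2) div 2}. k (u\<^sup>2) \<ominus>\<^bsub>R\<^esub> T i [^]\<^bsub>R\<^esub> (2::nat)))"

end

theory Submission
  imports Defs
begin

text \<open>
  Let $\omega = \frac12\sum e_i e_j A_{ij}$ act on $\Lambda(\mathbb{C}^n)\otimes U(\mathfrak{so}_n)$. The components of
  $\omega^k\cdot 1$ are, up to a factor, the Pfaffians of size $2k$, and $\langle\omega^k 1,\omega^k 1\rangle$, the sum of their
  squares, is central because $[A_{ij},\omega^k]$ is the action of $A_{ij}$ on $\Lambda(\mathbb{C}^n)$, which is skew for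
  the pairing. Writing $\omega$ for $n$ through $\omega$ for $n-2$ and the last two indices shows that a suitable
  combination of these squares satisfies the recursion defining $C_n(u)$.

  For every pair of indices removed, the right-hand side of that recursion is
  $(u^2-(H-\frac{n-2}2)^2)\,C_{n-2}(u)$ modulo the right ideal generated by the null vectors $X_i$, and exchanging the
  two indices replaces $H$ by $-H$. A positive system always has a null vector all of whose roots are positive, so
  the pairs can be removed one after the other within $\mathfrak N U(\mathfrak g)$; what remains is
  $\prod_k(u^2-(T_k-\rho(T_k))^2)$. This determines the projection to $U(\mathfrak h)$, which is well defined because words
  in an ordered basis adapted to $\mathfrak N\oplus\mathfrak h\oplus\overline{\mathfrak N}$ can be straightened confluently.
\<close>


section \<open>Operators on the exterior algebra with coefficients in a ring\<close>


text \<open>The recursion always removes the last two indices, whereas an arbitrary Borel subalgebra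
  may order the T_i differently and change their signs. Hence a description of C_n(u) is needed that
  is symmetric in the indices and makes sense for every finite index set; the sums of squared
  Pfaffians provide it.

  Their weights are forced by the recursion. Let P_k be the pairing of \<omega>^k 1 with itself for
  m = n - 2 indices, and P'_k the one for n indices. The right-hand side of the recursion sends P_k
  to (u^2 - (m/2 - k)^2) P_k + (P'_{k+1} - P_{k+1}) / (k+1)^2. The factors 1 / (k!)^2 and the
  products of u^2 - (n/2 - j)^2 over j > k are what makes the P_k telescope.

  The obstacle is that the coefficients do not commute: the pairing is linear on the left in one
  argument and on the right in the other, and each exchange leaves a correction. Two facts dispose
  of most corrections: contractions annihilate the vacuum, and the odd element x = sum e_i X_i has
  square 0, because the null vectors X_i commute.\<close>

class calg = ring_1 +
  fixes cs :: "complex \<Rightarrow> 'a"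
  assumes cs_add: "cs (c + d) = cs c + cs d"
    and cs_mult: "cs (c * d) = cs c * cs d"
    and cs_1 [simp]: "cs 1 = 1"
    and cs_comm: "cs c * x = x * cs c"

lemma cs_0 [simp]: "cs 0 = 0"
  using cs_add[of 0 0] by simp

lemma cs_minus: "cs (- c) = - cs c"
  using cs_add[of c "- c"] by (simp add: eq_neg_iff_add_eq_0 add.commute)

lemma cs_diff: "cs (c - d) = cs c - cs d"
  using cs_add[of c "- d"] by (simp add: cs_minus)

lemma cs_of_nat [simp]: "cs (of_nat n) = of_nat n"
  by (induct n) (simp_all add: cs_add)

lemma cs_numeral [simp]: "cs (numeral n) = numeral n"
  using cs_of_nat[of "numeral n"] by simp

text \<open>
  A function \<open>v\<close> on sets of indices stands for $\sum_I e_I\otimes v(I)$, with arbitrary support. Operators are required to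
  commute with right multiplication by coefficients only, as left multiplications by coefficients are operators too.
\<close>

typedef (overloaded) 'a fop =
  "{T :: (nat set \<Rightarrow> 'a::ring_1) \<Rightarrow> nat set \<Rightarrow> 'a.
     (\<forall>v w. T (\<lambda>I. v I + w I) = (\<lambda>I. T v I + T w I)) \<and> (\<forall>v a. T (\<lambda>I. v I * a) = (\<lambda>I. T v I * a))}"
  morphisms fop_app Fop
  by (rule exI[of _ id]) auto

setup_lifting type_definition_fop

lemma fop_app_right: "fop_app T (\<lambda>I. v I * a) = (\<lambda>I. fop_app T v I * a)"
  using fop_app[of T] by blast

lemma fop_app_0: "fop_app T (\<lambda>I. 0) = (\<lambda>I. 0)"
  using fop_app_right[of T "\<lambda>I. 0" 0] by simp

instantiation fop :: (ring_1) ring_1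
begin
lift_definition zero_fop :: "'a fop" is "\<lambda>v I. 0" by auto
lift_definition one_fop :: "'a fop" is "\<lambda>v. v" by auto
lift_definition plus_fop :: "'a fop \<Rightarrow> 'a fop \<Rightarrow> 'a fop" is "\<lambda>S T v I. S v I + T v I"
  by (auto simp: algebra_simps fun_eq_iff)
lift_definition minus_fop :: "'a fop \<Rightarrow> 'a fop \<Rightarrow> 'a fop" is "\<lambda>S T v I. S v I - T v I"
  by (auto simp: algebra_simps fun_eq_iff)
lift_definition uminus_fop :: "'a fop \<Rightarrow> 'a fop" is "\<lambda>S v I. - S v I"
  by (auto simp: algebra_simps fun_eq_iff)
lift_definition times_fop :: "'a fop \<Rightarrow> 'a fop \<Rightarrow> 'a fop" is "\<lambda>S T v. S (T v)"
  by simp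
instance
proof
  fix a b c :: "'a fop"
  show "a + b + c = a + (b + c)" by transfer (auto simp: algebra_simps)
  show "a + b = b + a" by transfer (auto simp: algebra_simps)
  show "0 + a = a" by transfer auto
  show "- a + a = 0" by transfer auto
  show "a - b = a + - b" by transfer auto
  show "a * b * c = a * (b * c)" by transfer auto
  show "1 * a = a" by transfer auto
  show "a * 1 = a" by transfer auto
  show "(a + b) * c = a * c + b * c" by transfer auto
  show "a * (b + c) = a * b + a * c" by transfer auto
  show "(0::'a fop) \<noteq> 1"
    by (transfer) (auto simp: fun_eq_iff intro!: exI[of _ "\<lambda>_. 1"])
qed
end

text \<open>The sign of moving $e_i$ past the $e_j$ with $j<i$ in $e_I$.\<close>

definition sg :: "nat \<Rightarrow> nat set \<Rightarrow> 'a::ring_1" where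
  "sg i I = (- 1) ^ card {j \<in> I. j < i}"

lemma sg_comm: "sg i I * x = x * (sg i I :: 'a::ring_1)"
proof -
  have "(-1) ^ k * x = x * (-1) ^ k" for k by (induct k) auto
  then show ?thesis by (simp add: sg_def)
qed

lemma sg_mid: "a * (sg i I * b) = sg i I * (a * (b :: 'a::ring_1))"
  by (metis sg_comm mult.assoc)

lemma sg_sq [simp]: "sg i I * (sg i I :: 'a::ring_1) = 1"
  by (simp add: sg_def flip: power_add mult_2)

lemma sg_sq' [simp]: "sg i I * (sg i I * x) = (x :: 'a::ring_1)"
  by (simp flip: mult.assoc)

lemma sg_insert:
  "j \<notin> I \<Longrightarrow> sg i (insert j I) = (if j < i then - sg i I else (sg i I :: 'a::ring_1))"
proof -
  assume "j \<notin> I"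
  have "{k \<in> insert j I. k < i} = (if j < i then insert j {k \<in> I. k < i} else {k \<in> I. k < i})" by auto
  moreover have "finite {k \<in> I. k < i}" by (rule finite_subset[of _ "{..<i}"]) auto
  ultimately show ?thesis using \<open>j \<notin> I\<close> by (simp add: sg_def)
qed

lemma sg_remove:
  "j \<in> I \<Longrightarrow> sg i (I - {j}) = (if j < i then - sg i I else (sg i I :: 'a::ring_1))"
  using sg_insert[of j "I - {j}" i, where 'a='a] by (auto simp: insert_absorb split: if_splits)

text \<open>\<open>fe i\<close> is exterior multiplication by $e_i$, \<open>fi i\<close> the contraction dual to it, \<open>fL a\<close> the left multiplication by \<open>a\<close>.\<close>

lift_definition fe :: "nat \<Rightarrow> 'a::ring_1 fop" is
  "\<lambda>i v I. if i \<in> I then sg i I * v (I - {i}) else 0"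
  by (auto simp: algebra_simps fun_eq_iff)

lift_definition fi :: "nat \<Rightarrow> 'a::ring_1 fop" is
  "\<lambda>i v I. if i \<in> I then 0 else sg i I * v (insert i I)"
  by (auto simp: algebra_simps fun_eq_iff)

lift_definition fL :: "'a \<Rightarrow> 'a::ring_1 fop" is "\<lambda>a v I. a * v I"
  by (auto simp: algebra_simps fun_eq_iff)

lemma fL_add: "fL (a + b) = fL a + fL b" by transfer (auto simp: algebra_simps)
lemma fL_mult: "fL (a * b) = fL a * fL b" by transfer (auto simp: algebra_simps)
lemma fL_0 [simp]: "fL 0 = 0" by transfer auto
lemma fL_1 [simp]: "fL 1 = 1" by transfer auto
lemma fL_minus: "fL (- b) = - fL b" by transfer (auto simp: algebra_simps)
lemma fL_diff: "fL (a - b) = fL a - fL b" by transfer (auto simp: algebra_simps)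
lemma fop_eqI: "(\<And>v I. fop_app S v I = fop_app T v I) \<Longrightarrow> S = T"
  by (metis ext fop_app_inject)

lemma app_simps [simp]:
  "fop_app (S + T) v I = fop_app S v I + fop_app T v I"
  "fop_app (S - T) v I = fop_app S v I - fop_app T v I"
  "fop_app (- S) v I = - fop_app S v I"
  "fop_app (S * T) v = fop_app S (fop_app T v)"
  "fop_app 0 v I = 0" "fop_app 1 v = v"
  "fop_app (fL a) v I = a * v I"
  by (transfer, simp)+

lemma app_fe: "fop_app (fe i) v I = (if i \<in> I then sg i I * v (I - {i}) else 0)"
  by transfer auto

lemma app_fi: "fop_app (fi i) v I = (if i \<in> I then 0 else sg i I * v (insert i I))"
  by transfer auto

lemma sg_swap_minus: "i < j \<Longrightarrow> i \<in> I \<Longrightarrow> j \<in> I \<Longrightarrow>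
   sg i I * sg j (I - {i}) = - (sg j I * (sg i (I - {j}) :: 'a::ring_1))"
  by (simp add: sg_remove) (rule sg_comm)

text \<open>For i < j, exchanging the order of the two removals changes exactly one of the two signs
  \<open>sg\<close>, the one that belongs to the larger index.\<close>

lemma fe_anti: "fe i * fe j = - (fe j * (fe i :: 'a::ring_1 fop))"
proof -
  have *: "fe i * fe j = - (fe j * (fe i :: 'a::ring_1 fop))" if "i < j" for i j
  proof (rule fop_eqI)
    fix v :: "nat set \<Rightarrow> 'a" and I
    have "I - {i} - {j} = I - {j} - {i}" by auto
    then show "fop_app (fe i * fe j) v I = fop_app (- (fe j * fe i)) v I"
      using sg_swap_minus[OF that, of I, where 'a='a] that
      by (auto simp: app_fe simp flip: mult.assoc)
  qed
  have "fe i * fe i = (0 :: 'a fop)"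
    by (rule fop_eqI) (simp add: app_fe)
  then show ?thesis
    using *[of i j] *[of j i] by (cases i j rule: linorder_cases) auto
qed

lemma fi_anti: "fi i * fi j = - (fi j * (fi i :: 'a::ring_1 fop))"
proof -
  have *: "fi i * fi j = - (fi j * (fi i :: 'a::ring_1 fop))" if "i < j" for i j
  proof (rule fop_eqI)
    fix v :: "nat set \<Rightarrow> 'a" and I
    show "fop_app (fi i * fi j) v I = fop_app (- (fi j * fi i)) v I"
      using that sg_comm[of i I "sg j I :: 'a"]
      by (auto simp: app_fi sg_insert insert_commute simp flip: mult.assoc)
  qed
  have "fi i * fi i = (0 :: 'a fop)"
    by (rule fop_eqI) (simp add: app_fi)
  then show ?thesis
    using *[of i j] *[of j i] by (cases i j rule: linorder_cases) auto
qed

lemma fe_sq [simp]: "fe i * fe i = (0 :: 'a::ring_1 fop)"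
  by (rule fop_eqI) (simp add: app_fe)

text \<open>With \<open>fe_anti\<close> and \<open>fi_anti\<close> these are the canonical
  anticommutation relations of exterior multiplications and contractions. They let every
  \<open>fi\<close> be moved to the right end, where it meets \<open>vac\<close>.\<close>

lemma fi_fe: "fi i * fe j = (if i = j then 1 else 0) - fe j * (fi i :: 'a::ring_1 fop)"
proof (rule fop_eqI)
  fix v :: "nat set \<Rightarrow> 'a" and I
  consider "i = j" | "i < j" | "j < i" by linarith
  then show "fop_app (fi i * fe j) v I = fop_app ((if i = j then 1 else 0) - fe j * fi i) v I"
  proof cases
    case 1
    then show ?thesis
      by (auto simp: app_fi app_fe sg_insert sg_remove insert_absorb)
  next
    case 2
    then show ?thesis
      using sg_comm[of i I "sg j I :: 'a"] 
      by (auto simp: app_fi app_fe sg_insert sg_remove insert_Diff_if simp flip: mult.assoc)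
  next
    case 3
    then show ?thesis
      using sg_comm[of i I "sg j I :: 'a"] 
      by (auto simp: app_fi app_fe sg_insert sg_remove insert_Diff_if simp flip: mult.assoc)
  qed
qed

lemma fL_fe: "fL a * fe i = fe i * (fL a :: 'a::ring_1 fop)"
  by (rule fop_eqI) (simp add: app_fe sg_mid)

lemma fL_fi: "fL a * fi i = fi i * (fL a :: 'a::ring_1 fop)"
  by (rule fop_eqI) (simp add: app_fi sg_mid)

section \<open>The vacuum vector and the pairing over noncommutative coefficients\<close>

definition vac :: "nat set \<Rightarrow> 'a::ring_1" where
  "vac I = (if I = {} then 1 else 0)"

text \<open>\<open>fB G p q\<close> is the pairing of \<open>p vac\<close> and \<open>q vac\<close>; the finite set \<open>G\<close> only has to contain the indices that occur.\<close>

definition fB :: "nat set \<Rightarrow> 'a fop \<Rightarrow> 'a fop \<Rightarrow> 'a::ring_1" where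
  "fB G p q = (\<Sum>I\<in>Pow G. fop_app p vac I * fop_app q vac I)"

lemma fB_add_left: "fB G (p + p') q = fB G p q + fB G p' q"
  by (simp add: fB_def algebra_simps sum.distrib)
lemma fB_add_right: "fB G q (p + p') = fB G q p + fB G q p'"
  by (simp add: fB_def algebra_simps sum.distrib)
lemma fB_diff_left: "fB G (p - p') q = fB G p q - fB G p' q"
  by (simp add: fB_def algebra_simps sum_subtractf)
lemma fB_diff_right: "fB G q (p - p') = fB G q p - fB G q p'"
  by (simp add: fB_def algebra_simps sum_subtractf)
lemma fB_minus_left: "fB G (- p) q = - fB G p q"
  by (simp add: fB_def sum_negf)
lemma fB_minus_right: "fB G q (- p) = - fB G q p"
  by (simp add: fB_def sum_negf)
lemma fB_0_left [simp]: "fB G 0 q = 0"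
  by (simp add: fB_def)
lemma fB_0_right [simp]: "fB G q 0 = 0"
  by (simp add: fB_def)
lemma fB_sum_left: "fB G (\<Sum>i\<in>S. f i) q = (\<Sum>i\<in>S. fB G (f i) q)"
  by (induct S rule: infinite_finite_induct) (auto simp: fB_add_left)
lemma fB_sum_right: "fB G q (\<Sum>i\<in>S. f i) = (\<Sum>i\<in>S. fB G q (f i))"
  by (induct S rule: infinite_finite_induct) (auto simp: fB_add_right)

lemma fB_L_left: "fB G (fL a * p) q = a * fB G p q"
  by (simp add: fB_def sum_distrib_left mult.assoc)

text \<open>The entries 0 and 1 of \<open>vac\<close> commute with all coefficients, so left and
  right multiplication by a agree on it, and right multiplication passes through every operator. A
  coefficient at the right end of an operator thus becomes a right factor.\<close>

lemma fL_vac: "fop_app (p * fL a) vac = (\<lambda>I. fop_app p vac I * a)"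
proof -
  have "fop_app (fL a) vac = (\<lambda>I. vac I * a)" by (auto simp: vac_def)
  then show ?thesis by (simp add: fop_app_right)
qed

lemma fB_L_right: "fB G p (q * fL a) = fB G p q * a"
  by (simp add: fB_def fL_vac sum_distrib_right mult.assoc del: app_simps(4))

text \<open>The pairing multiplies entries in order, so a coefficient standing between the two
  vectors may be counted to either side. This is what replaces bilinearity over the noncommutative
  ring.\<close>

lemma fB_L_mid: "fB G (p * fL a) q = fB G p (fL a * q)"
  by (simp add: fB_def fL_vac mult.assoc del: app_simps(4)) simp

lemma fi_vac: "fop_app (p * fi i) vac = (\<lambda>I. 0)"
proof -
  have "fop_app (fi i) vac = (\<lambda>I. 0 :: 'a)" by (auto simp: vac_def app_fi fun_eq_iff)
  then show ?thesis by (simp add: fop_app_0)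
qed

lemma fB_fi_right [simp]: "fB G p (q * fi i) = 0"
  by (simp add: fB_def fi_vac del: app_simps(4))

lemma fB_fi_left [simp]: "fB G (p * fi i) q = 0"
  by (simp add: fB_def fi_vac del: app_simps(4))

lemma fB_1: "finite G \<Longrightarrow> fB G 1 1 = 1"
  by (simp add: fB_def vac_def if_distrib[of "\<lambda>x. x * _"] sum.If_cases cong: if_cong)

text \<open>Removing i is a bijection from the index sets containing i to those that do not, and
  \<open>sg i\<close> does not see whether i itself is present. The same bijection gives
  \<open>fB_fi_left'\<close>.\<close>

lemma fB_fe_left:
  assumes "finite G" "i \<in> G"
  shows "fB G (fe i * p) q = fB G p (fi i * q)"
proof -
  have "fB G (fe i * p) q = (\<Sum>I\<in>{I\<in>Pow G. i \<in> I}. sg i I * fop_app p vac (I - {i}) * fop_app q vac I)"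
    unfolding fB_def using assms by (intro sum.mono_neutral_cong_right) (auto simp: app_fe)
  also have "\<dots> = (\<Sum>I\<in>{I\<in>Pow G. i \<notin> I}. fop_app p vac I * (sg i I * fop_app q vac (insert i I)))"
    using assms by (intro sum.reindex_bij_witness[of _ "insert i" "\<lambda>I. I - {i}"])
      (auto simp: insert_absorb sg_remove sg_mid mult.assoc)
  also have "\<dots> = fB G p (fi i * q)"
    unfolding fB_def using assms by (intro sum.mono_neutral_cong_left) (auto simp: app_fi)
  finally show ?thesis .
qed

lemma fB_fi_left':
  assumes "finite G" "i \<in> G"
  shows "fB G (fi i * p) q = fB G p (fe i * q)"
proof -
  have "fB G p (fe i * q) = (\<Sum>I\<in>{I\<in>Pow G. i \<in> I}. fop_app p vac I * (sg i I * fop_app q vac (I - {i})))"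
    unfolding fB_def using assms by (intro sum.mono_neutral_cong_right) (auto simp: app_fe)
  also have "\<dots> = (\<Sum>I\<in>{I\<in>Pow G. i \<notin> I}. sg i I * fop_app p vac (insert i I) * fop_app q vac I)"
    using assms by (intro sum.reindex_bij_witness[of _ "insert i" "\<lambda>I. I - {i}"])
      (auto simp: insert_absorb sg_insert sg_remove sg_mid mult.assoc)
  also have "\<dots> = fB G (fi i * p) q"
    unfolding fB_def using assms by (intro sum.mono_neutral_cong_left) (auto simp: app_fi)
  finally show ?thesis by simp
qed


instantiation fop :: (calg) calg
begin
definition "cs_fop c = fL (cs c)"
text \<open>Operators commute with right multiplications only; multiplication by a central scalar is
  one of these.\<close>

lemma fL_cs_comm: "fL (cs c) * T = T * fL (cs c :: 'a)"
proof (rule fop_eqI)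
  fix v :: "nat set \<Rightarrow> 'a" and I
  have L: "fop_app (fL (cs c)) w = (\<lambda>I. w I * cs c)" for w :: "nat set \<Rightarrow> 'a"
    by (rule ext) (use cs_comm[of c] in simp)
  have "fop_app (fL (cs c) * T) v I = fop_app T v I * cs c"
    by (simp only: app_simps(4) L)
  also have "\<dots> = fop_app T (\<lambda>I. v I * cs c) I"
    using fop_app_right[of T v "cs c"] by simp
  finally show "fop_app (fL (cs c) * T) v I = fop_app (T * fL (cs c)) v I"
    by (simp only: app_simps(4) L)
qed
instance
proof
  fix c d and x :: "'a fop"
  show "cs (c + d) = (cs c + cs d :: 'a fop)" by (simp add: cs_fop_def cs_add fL_add)
  show "cs (c * d) = (cs c * cs d :: 'a fop)" by (simp add: cs_fop_def cs_mult fL_mult)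
  show "cs 1 = (1 :: 'a fop)" by (simp add: cs_fop_def)
  show "cs c * x = x * cs c" unfolding cs_fop_def by (rule fL_cs_comm)
qed
end

lemma fL_cs [simp]: "fL (cs c) = cs c"
  by (simp add: cs_fop_def)

lemma cs_half_double: "cs (1/2) * (x + x) = x" "cs (1/2) * x + cs (1/2) * x = x"
proof -
  have "cs (1/2) * (x + x) = (cs (1/2) + cs (1/2)) * x"
    by (simp add: algebra_simps)
  also have "\<dots> = x" by (simp flip: cs_add)
  finally show "cs (1/2) * (x + x) = x" .
  then show "cs (1/2) * x + cs (1/2) * x = x" by (simp add: algebra_simps)
qed

text \<open>\<open>W\<close> is half of a sum over ordered pairs, and squares of odd elements come
  out of anticommutators doubled. Such identities are proved in doubled form and then halved by this
  lemma.\<close>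

lemma calg_double_cancel: "x + x = y + y \<Longrightarrow> x = (y :: 'a::calg)"
  by (metis cs_half_double(1))

lemma calg_eq_minus: "x = - x \<Longrightarrow> x = (0 :: 'a::calg)"
  using calg_double_cancel[of x 0] by (simp add: eq_neg_iff_add_eq_0)

definition sc :: "complex \<Rightarrow> 'a \<Rightarrow> 'a::calg" where "sc c x = cs c * x"

lemma sc_mult_left: "sc c x * y = sc c (x * y)"
  by (simp add: sc_def mult.assoc)

lemma sc_mult_right: "x * sc c y = sc c (x * y)"
  by (simp add: sc_def cs_comm[of c x] flip: mult.assoc)

lemma sc_sc: "sc c (sc d x) = sc (c * d) x"
  by (simp add: sc_def cs_mult mult.assoc)

lemma sc_add_right: "sc c (x + y) = sc c x + sc c y"
  by (simp add: sc_def algebra_simps)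

lemma sc_diff_right: "sc c (x - y) = sc c x - sc c y"
  by (simp add: sc_def algebra_simps)

lemma sc_minus_right: "sc c (- x) = - sc c x"
  by (simp add: sc_def)

lemma sc_0_right [simp]: "sc c 0 = 0"
  by (simp add: sc_def)

lemma sc_sum: "sc c (sum f S) = (\<Sum>i\<in>S. sc c (f i))"
  by (simp add: sc_def sum_distrib_left)

lemma sc_add_left: "sc (c + d) x = sc c x + sc d x"
  by (simp add: sc_def cs_add algebra_simps)

lemma sc_diff_left: "sc (c - d) x = sc c x - sc d x"
  by (simp add: sc_def cs_diff algebra_simps)

lemma sc_minus_left: "sc (- c) x = - sc c x"
  by (simp add: sc_def cs_minus)

lemma sc_0_left [simp]: "sc 0 x = 0"
  by (simp add: sc_def)

lemma sc_1 [simp]: "sc 1 x = x"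
  by (simp add: sc_def)

lemma sc_2: "sc 2 x = x + x"
  using sc_add_left[of 1 1 x] by simp

lemmas sc_mult = sc_mult_left sc_mult_right
lemmas sc_right = sc_add_right sc_diff_right sc_minus_right
lemmas sc_left = sc_add_left sc_diff_left sc_minus_left sc_2

lemma sum_const_sc: "(\<Sum>i\<in>S. x) = sc (of_nat (card S)) x"
  by (simp add: sc_def)

lemma fL_sc: "fL (sc c x) = sc c (fL x)"
  by (simp add: sc_def fL_mult)

lemma fB_sc_left: "fB G (sc c p) q = sc c (fB G p q)"
  using fB_L_left[of G "cs c"] by (simp add: sc_def)

lemma fB_sc_right: "fB G p (sc c q) = sc c (fB G p q)"
  using fB_L_right[of G p q "cs c"] by (simp only: sc_def cs_comm fL_cs)

lemma if_zero_simps: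
  "a * (if P then b else 0) = (if P then a * b else (0::'a::ring_1))"
  "(if P then b else 0) * a = (if P then b * a else (0::'a::ring_1))"
  "- (if P then b else 0) = (if P then - b else (0::'a::ring_1))"
  "fL (if P then b else 0) = (if P then fL b else 0)"
  by auto

lemma sum_if_out: "(\<Sum>j\<in>M. if P then f j else 0) = (if P then (\<Sum>j\<in>M. f j) else (0::'a::ring_1))"
  by auto

lemma fe_fe_zero [simp]: "fe i * (fe i * x) = (0 :: 'a::ring_1 fop)"
  by (simp flip: mult.assoc)

lemma fe_fe_left: "fe i * (fe j * x) = - (fe j * (fe i * (x :: 'a::ring_1 fop)))"
proof -
  have "(fe i * fe j) * x = - (fe j * fe i) * x" by (subst fe_anti) (rule refl)
  then show ?thesis by (simp only: mult.assoc minus_mult_left[symmetric])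
qed

lemma fi_fe_left: "fi i * (fe j * x) = (if i = j then x else 0) - fe j * (fi i * (x :: 'a::ring_1 fop))"
  by (simp add: fi_fe algebra_simps flip: mult.assoc)

lemma fL_fe_left: "fL a * (fe i * x) = fe i * (fL a * (x :: 'a::ring_1 fop))"
  by (metis fL_fe mult.assoc)

lemma fL_fi_left: "fL a * (fi i * x) = fi i * (fL a * (x :: 'a::ring_1 fop))"
  by (metis fL_fi mult.assoc)

lemma fe_fe_fe_zero' [simp]: "fe i * (fe j * (fe i * x)) = (0 :: 'a::ring_1 fop)"
  using fe_fe_left[of i j "fe i * x"] by simp

text \<open>The relations of the \<open>A j i\<close> in the enveloping algebra of \<open>so n\<close>, for indices in any finite set.\<close>

locale so_alg =
  fixes A :: "nat \<Rightarrow> nat \<Rightarrow> 'a::calg" and M :: "nat set"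
  assumes fin: "finite M"
    and skewA: "i \<in> M \<Longrightarrow> j \<in> M \<Longrightarrow> A j i = - A i j"
    and brA: "i \<in> M \<Longrightarrow> j \<in> M \<Longrightarrow> k \<in> M \<Longrightarrow> l \<in> M \<Longrightarrow>
      A i j * A k l - A k l * A i j =
        (if j = k then A i l else 0) - (if i = k then A j l else 0)
        + (if j = l then A k i else 0) - (if i = l then A k j else 0)"
begin

lemma A_diag [simp]: "i \<in> M \<Longrightarrow> A i i = 0"
  using skewA[of i i] by (intro calg_eq_minus) auto

text \<open>The members of v transform under commutation with the \<open>A j l\<close> like the
  vectors of the standard representation. A row of a larger skew matrix, restricted to M, is of this
  kind if its own index is not in M.\<close>

definition vfam :: "(nat \<Rightarrow> 'a) \<Rightarrow> bool" where
  "vfam v \<longleftrightarrow> (\<forall>j\<in>M. \<forall>l\<in>M. \<forall>i\<in>M. A j l * v i - v i * A j l =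
     (if l = i then v j else 0) - (if j = i then v l else 0))"

definition Vec :: "(nat \<Rightarrow> 'a) \<Rightarrow> 'a fop" where
  "Vec v = (\<Sum>i\<in>M. fe i * fL (v i))"

definition W :: "'a fop" where
  "W = cs (1/2) * (\<Sum>i\<in>M. \<Sum>j\<in>M. fe i * fe j * fL (A i j))"

text \<open>The commutator of the contraction \<open>fi i\<close> with \<open>W\<close>, see
  \<open>fi_W\<close>.\<close>

definition Eta :: "nat \<Rightarrow> 'a fop" where
  "Eta i = (\<Sum>l\<in>M. fe l * fL (A i l))"

lemma W2: "W + W = (\<Sum>i\<in>M. \<Sum>j\<in>M. fe i * fe j * fL (A i j))"
  by (simp add: W_def cs_half_double)

lemma fe_W: "fe k * W = W * fe k"
proof (rule calg_double_cancel)
  have "fe k * (fe i * fe j * fL a) = fe i * fe j * fL a * fe k" for i j and a :: 'a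
    using fe_fe_left[of k i "fe j * fL a"] fe_fe_left[of k j "fL a"] by (simp add: mult.assoc fL_fe)
  then have "fe k * (W + W) = (W + W) * fe k"
    by (simp add: W2 sum_distrib_left sum_distrib_right)
  then show "fe k * W + fe k * W = W * fe k + W * fe k" by (simp add: algebra_simps)
qed

lemma fL_W_comm:
  assumes "\<And>i j. i \<in> M \<Longrightarrow> j \<in> M \<Longrightarrow> c * A i j = A i j * c"
  shows "fL c * W = W * fL c"
proof (rule calg_double_cancel)
  have "fL c * (fe i * fe j * fL (A i j)) = fe i * fe j * fL (A i j) * fL c" if "i \<in> M" "j \<in> M" for i j
    using assms[OF that] by (simp add: mult.assoc fL_fe_left flip: fL_mult)
  then have "fL c * (W + W) = (W + W) * fL c"
    by (simp add: W2 sum_distrib_left sum_distrib_right)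
  then show "fL c * W + fL c * W = W * fL c + W * fL c" by (simp add: algebra_simps)
qed

lemma vfamD: "vfam v \<Longrightarrow> j \<in> M \<Longrightarrow> l \<in> M \<Longrightarrow> i \<in> M \<Longrightarrow>
   v i * A j l = A j l * v i - (if l = i then v j else 0) + (if j = i then v l else 0)"
  unfolding vfam_def by (simp add: algebra_simps)

lemma fL_W:
  assumes "vfam v" "i \<in> M"
  shows "fL (v i) * W = W * fL (v i) + fe i * Vec v"
proof (rule calg_double_cancel)
  have *: "fL (v i) * (fe j * fe l * fL (A j l)) = fe j * fe l * fL (A j l) * fL (v i)
      + ((if j = i then fe j * fe l * fL (v l) else 0) - (if l = i then fe j * fe l * fL (v j) else 0))"
    if "j \<in> M" "l \<in> M" for j l
  proof -
    have "fL (v i) * fL (A j l) = fL (A j l) * fL (v i)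
        - (if l = i then fL (v j) else 0) + (if j = i then fL (v l) else 0)"
      using arg_cong[OF vfamD[OF assms(1) that assms(2)], of fL]
      by (simp add: fL_add fL_diff fL_mult if_zero_simps)
    then show ?thesis
      by (simp add: mult.assoc fL_fe_left) (simp add: algebra_simps if_zero_simps)
  qed
  have "fL (v i) * (W + W) = (W + W) * fL (v i) + (\<Sum>l\<in>M. fe i * fe l * fL (v l)) - (\<Sum>j\<in>M. fe j * fe i * fL (v j))"
    using assms fin
    by (simp add: W2 sum_distrib_left sum_distrib_right * sum.distrib sum_subtractf sum_if_out
       cong: sum.cong)
  also have "(\<Sum>j\<in>M. fe j * fe i * fL (v j)) = - (\<Sum>j\<in>M. fe i * fe j * fL (v j))"
    by (subst fe_anti) (simp add: sum_negf)
  finally have "fL (v i) * (W + W) = (W + W) * fL (v i) + fe i * Vec v + fe i * Vec v"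
    by (simp add: Vec_def sum_distrib_left mult.assoc)
  then show "fL (v i) * W + fL (v i) * W = (W * fL (v i) + fe i * Vec v) + (W * fL (v i) + fe i * Vec v)"
    by (simp add: algebra_simps)
qed

text \<open>Each commutator of a coefficient \<open>v i\<close> with \<open>W\<close> brings a
  second factor \<open>fe i\<close>, and \<open>fe i * fe i = 0\<close>.\<close>

lemma Vec_W:
  assumes "vfam v"
  shows "Vec v * W = W * Vec v"
proof -
  have "Vec v * W = (\<Sum>i\<in>M. fe i * (W * fL (v i) + fe i * Vec v))"
    unfolding Vec_def sum_distrib_right
    by (intro sum.cong refl) (simp add: mult.assoc fL_W[OF assms] Vec_def)
  also have "\<dots> = W * Vec v"
    by (simp add: Vec_def algebra_simps sum_distrib_left fe_W flip: mult.assoc)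
  finally show ?thesis .
qed

text \<open>As the \<open>fe\<close> anticommute, the anticommutator of two such sums sees only the
  commutators of their coefficients.\<close>

lemma Vec_Vec:
  "Vec v * Vec w + Vec w * Vec v = (\<Sum>i\<in>M. \<Sum>j\<in>M. fe i * fe j * fL (v i * w j - w j * v i))"
proof -
  have "Vec v * Vec w = (\<Sum>i\<in>M. \<Sum>j\<in>M. fe i * fe j * fL (v i * w j))"
    by (simp add: Vec_def sum_distrib_left sum_distrib_right mult.assoc fL_fe_left fL_mult)
      (subst sum.swap, simp)
  moreover have "Vec w * Vec v = (\<Sum>i\<in>M. \<Sum>j\<in>M. fe j * fe i * fL (w j * v i))"
    by (simp add: Vec_def sum_distrib_left sum_distrib_right mult.assoc fL_fe_left fL_mult)
  moreover have "\<dots> = - (\<Sum>i\<in>M. \<Sum>j\<in>M. fe i * fe j * fL (w j * v i))"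
    by (simp add: sum_negf[symmetric]) (intro sum.cong refl, subst fe_anti, simp)
  ultimately show ?thesis
    by (simp add: fL_diff algebra_simps sum_subtractf)
qed

text \<open>The term h stands on the diagonal, where \<open>fe i * fe i = 0\<close> kills
  it.\<close>

lemma Vec_Vec_W:
  assumes "\<And>i j. i \<in> M \<Longrightarrow> j \<in> M \<Longrightarrow> v i * w j - w j * v i = - A i j - (if i = j then h else 0)"
  shows "Vec v * Vec w + Vec w * Vec v = - (W + W)"
  unfolding Vec_Vec W2 sum_negf[symmetric]
  by (intro sum.cong refl) (simp add: assms fL_diff fL_minus)

lemma Vec_sq:
  assumes "\<And>i j. i \<in> M \<Longrightarrow> j \<in> M \<Longrightarrow> v i * v j - v j * v i = - A i j"
  shows "Vec v * Vec v = - W"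
  by (rule calg_double_cancel) (use Vec_Vec_W[of v v 0] assms in \<open>simp\<close>)

lemma Vec_sq_0:
  assumes "\<And>i j. i \<in> M \<Longrightarrow> j \<in> M \<Longrightarrow> v i * v j = v j * v i"
  shows "Vec v * Vec v = 0"
  by (rule calg_double_cancel) (use Vec_Vec[of v v] assms in \<open>simp\<close>)

lemma fL_Vec:
  assumes "\<And>i. i \<in> M \<Longrightarrow> w * v i - v i * w = - A j i - (if i = j then h else 0)" "j \<in> M"
  shows "fL w * Vec v = Vec v * fL w - Eta j - fe j * fL h"
proof -
  have *: "fL (w * v i) = fL (v i) * fL w - fL (A j i) - (if i = j then fL h else 0)" if "i \<in> M" for i
  proof -
    have "w * v i = v i * w - A j i - (if i = j then h else 0)"
      using assms(1)[OF that] by (simp add: algebra_simps)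
    then have "fL (w * v i) = fL (v i * w - A j i - (if i = j then h else 0))" by (rule arg_cong)
    then show ?thesis by (simp add: fL_diff fL_mult if_zero_simps)
  qed
  have "fL w * Vec v = (\<Sum>i\<in>M. fe i * fL (w * v i))"
    by (simp add: Vec_def sum_distrib_left mult.assoc fL_fe_left fL_mult)
  also have "\<dots> = (\<Sum>i\<in>M. fe i * fL (v i) * fL w - fe i * fL (A j i) - (if i = j then fe i * fL h else 0))"
    by (intro sum.cong refl) (simp add: * algebra_simps)
  finally show ?thesis using fin assms(2)
    by (simp add: Vec_def Eta_def sum_distrib_right sum_subtractf)
qed

lemma fi_W:
  assumes "i \<in> M"
  shows "fi i * W = W * fi i + Eta i"
proof (rule calg_double_cancel)
  have *: "fi i * (fe j * fe l * fL (A j l)) = fe j * fe l * fL (A j l) * fi i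
      + ((if i = j then fe l * fL (A j l) else 0) - (if i = l then fe j * fL (A j l) else 0))" for j l
    by (simp add: mult.assoc fL_fi fi_fe_left) (auto simp: algebra_simps fL_fi)
  have "fi i * (W + W) = (\<Sum>j\<in>M. \<Sum>l\<in>M. fe j * fe l * fL (A j l) * fi i
      + ((if i = j then fe l * fL (A j l) else 0) - (if i = l then fe j * fL (A j l) else 0)))"
    by (simp only: W2 sum_distrib_left *)
  also have "\<dots> = (W + W) * fi i + (\<Sum>j\<in>M. \<Sum>l\<in>M. if i = j then fe l * fL (A j l) else 0)
      - (\<Sum>j\<in>M. \<Sum>l\<in>M. if i = l then fe j * fL (A j l) else 0)"
    by (simp only: W2 sum_distrib_right sum.distrib sum_subtractf add_diff_eq)
  also have "\<dots> = (W + W) * fi i + (\<Sum>l\<in>M. fe l * fL (A i l)) - (\<Sum>j\<in>M. fe j * fL (A j i))"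
    using assms fin by (simp add: sum_if_out)
  also have "(\<Sum>j\<in>M. fe j * fL (A j i)) = - Eta i"
    unfolding Eta_def sum_negf[symmetric]
    by (intro sum.cong refl) (subst skewA[OF assms], simp_all add: fL_minus)
  finally show "fi i * W + fi i * W = W * fi i + Eta i + (W * fi i + Eta i)"
    by (simp add: algebra_simps Eta_def)
qed

end

context so_alg begin

text \<open>By \<open>fi_W\<close> this says that \<open>W\<close> commutes with
  \<open>fL (A i s)\<close> plus \<open>fe i * fi s - fe s * fi i\<close>, that is, \<open>W\<close>
  is invariant under the diagonal action on the exterior algebra and the coefficients.\<close>

lemma fL_A_W:
  assumes "i \<in> M" "s \<in> M"
  shows "fL (A i s) * W = W * fL (A i s) + fe s * Eta i - fe i * Eta s"
proof (rule calg_double_cancel)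
  have br: "fL (A i s) * fL (A j l) = fL (A j l) * fL (A i s) + (if s = j then fL (A i l) else 0)
     - (if i = j then fL (A s l) else 0) + (if s = l then fL (A j i) else 0) - (if i = l then fL (A j s) else 0)"
    if "j \<in> M" "l \<in> M" for j l
    using arg_cong[OF brA[OF assms that], of fL]
    by (simp add: fL_add fL_diff fL_mult if_zero_simps algebra_simps)
  have *: "fL (A i s) * (fe j * fe l * fL (A j l)) = fe j * fe l * fL (A j l) * fL (A i s)
      + (if s = j then fe j * (fe l * fL (A i l)) else 0) - (if i = j then fe j * (fe l * fL (A s l)) else 0)
      + (if s = l then fe j * (fe l * fL (A j i)) else 0) - (if i = l then fe j * (fe l * fL (A j s)) else 0)"
    if "j \<in> M" "l \<in> M" for j l
    using br[OF that] by (simp add: mult.assoc fL_fe_left) (simp add: algebra_simps if_zero_simps)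
  have "fL (A i s) * (W + W) = (\<Sum>j\<in>M. \<Sum>l\<in>M. fe j * fe l * fL (A j l) * fL (A i s)
      + (if s = j then fe j * (fe l * fL (A i l)) else 0) - (if i = j then fe j * (fe l * fL (A s l)) else 0)
      + (if s = l then fe j * (fe l * fL (A j i)) else 0) - (if i = l then fe j * (fe l * fL (A j s)) else 0))"
    unfolding W2 sum_distrib_left by (intro sum.cong refl *)
  also have "\<dots> = (W + W) * fL (A i s) + fe s * Eta i - fe i * Eta s
      + (\<Sum>j\<in>M. fe j * (fe s * fL (A j i))) - (\<Sum>j\<in>M. fe j * (fe i * fL (A j s)))"
    using assms fin
    by (simp add: W2 sum_distrib_right sum.distrib sum_subtractf sum_if_out Eta_def sum_distrib_left)
  also have "(\<Sum>j\<in>M. fe j * (fe s * fL (A j i))) = fe s * Eta i"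
    unfolding Eta_def sum_distrib_left
    by (intro sum.cong refl) (subst skewA[OF assms(1)], simp_all add: fL_minus, subst fe_fe_left, simp)
  also have "(\<Sum>j\<in>M. fe j * (fe i * fL (A j s))) = fe i * Eta s"
    unfolding Eta_def sum_distrib_left
    by (intro sum.cong refl) (subst skewA[OF assms(2)], simp_all add: fL_minus, subst fe_fe_left, simp)
  finally show "fL (A i s) * W + fL (A i s) * W = (W * fL (A i s) + fe s * Eta i - fe i * Eta s) +
     (W * fL (A i s) + fe s * Eta i - fe i * Eta s)"
    by (simp add: algebra_simps)
qed

lemma fe_W_left: "fe k * (W * x) = W * (fe k * x)"
  by (simp add: fe_W flip: mult.assoc)

lemma sum_fe_Eta: "(\<Sum>s\<in>M. fe s * Eta s) = W + W"
  by (simp add: W2 Eta_def sum_distrib_left mult.assoc)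

lemma Eta_fe: "Eta i * fe j = - (fe j * Eta i)"
  unfolding Eta_def sum_distrib_left sum_distrib_right sum_negf[symmetric]
  by (intro sum.cong refl) (simp add: mult.assoc fL_fe fe_fe_left[of _ j])

lemma sum_Eta_fe: "(\<Sum>s\<in>M. Eta s * fe s) = - (W + W)"
  by (simp add: Eta_fe sum_negf sum_fe_Eta)

text \<open>The row \<open>A i\<close> violates \<open>vfam\<close> in the commutators with those
  \<open>A j l\<close> that contain the index i; hence, in contrast to \<open>Vec_W\<close>, a
  correction remains.\<close>

lemma Eta_W:
  assumes "i \<in> M"
  shows "Eta i * W = W * Eta i + fe i * (W + W)"
proof -
  have "Eta i * W = (\<Sum>s\<in>M. fe s * (W * fL (A i s) + fe s * Eta i - fe i * Eta s))"
    unfolding Eta_def sum_distrib_right using assms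
    by (intro sum.cong refl) (simp add: mult.assoc fL_A_W Eta_def)
  also have "\<dots> = (\<Sum>s\<in>M. W * (fe s * fL (A i s)) + fe i * (fe s * Eta s))"
    by (intro sum.cong refl) (simp add: algebra_simps fe_fe_left[of _ i] fe_W_left)
  finally show ?thesis
    by (simp add: sum.distrib Eta_def[of i] sum_fe_Eta flip: sum_distrib_left)
qed

lemma Eta_as_Vec: "Eta i = Vec (A i)"
  by (simp add: Eta_def Vec_def)

lemma Eta_sq:
  assumes "i \<in> M"
  shows "Eta i * Eta i + Eta i * Eta i = fe i * Eta i + fe i * Eta i - (W + W)"
proof -
  have *: "fe l * fe s * fL (A i l * A i s - A i s * A i l) =
      (if i = l then fe i * (fe s * fL (A i s)) else 0) - fe l * fe s * fL (A l s)
      + (if i = s then fe i * (fe l * fL (A i l)) else 0)" if "l \<in> M" "s \<in> M" for l s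
  proof -
    have "fL (A i l * A i s - A i s * A i l) =
      (if i = l then fL (A i s) else 0) - fL (A l s) - (if i = s then fL (A i l) else 0)"
      unfolding brA[OF assms that(1) assms that(2)] using assms
      by (auto simp: fL_add fL_diff fL_mult)
    then show ?thesis
      using fe_fe_left[of l i "fL (A i l)"] by (auto simp: mult.assoc right_diff_distrib)
  qed
  have "Eta i * Eta i + Eta i * Eta i = (\<Sum>l\<in>M. \<Sum>s\<in>M.
      (if i = l then fe i * (fe s * fL (A i s)) else 0) - fe l * fe s * fL (A l s)
      + (if i = s then fe i * (fe l * fL (A i l)) else 0))"
    unfolding Eta_as_Vec Vec_Vec by (intro sum.cong refl *)
  also have "\<dots> = fe i * Eta i - (W + W) + fe i * Eta i"
    using assms fin
    by (simp add: sum.distrib sum_subtractf sum_if_out W2 Eta_def sum_distrib_left)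
  finally show ?thesis by simp
qed

text \<open>Summing \<open>Eta_sq\<close> over s gives twice \<open>W + W\<close> from the terms
  \<open>fe s * Eta s\<close>, and \<open>card M\<close> copies of \<open>- (W + W)\<close>.\<close>

lemma sum_Eta_Eta: "(\<Sum>s\<in>M. Eta s * Eta s) = sc (2 - of_nat (card M)) W"
proof (rule calg_double_cancel)
  have "(\<Sum>s\<in>M. Eta s * Eta s + Eta s * Eta s) = (\<Sum>s\<in>M. fe s * Eta s + fe s * Eta s - (W + W))"
    by (intro sum.cong refl Eta_sq)
  then show "(\<Sum>s\<in>M. Eta s * Eta s) + (\<Sum>s\<in>M. Eta s * Eta s) =
      sc (2 - of_nat (card M)) W + sc (2 - of_nat (card M)) W"
    by (simp add: sum.distrib sum_subtractf sum_fe_Eta sum_const_sc sc_left sc_right del: sum_constant)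
qed

lemma Eta_Vec:
  assumes "vfam v" "i \<in> M"
  shows "Eta i * Vec v = fe i * Vec v - Vec v * Eta i"
proof -
  have *: "fe l * fe s * fL (A i l * v s - v s * A i l) = (if i = s then fe i * (fe l * fL (v l)) else 0)"
    if "l \<in> M" "s \<in> M" for l s
    using assms that fe_fe_left[of l i "fL (v l)"]
    by (auto simp: vfam_def fL_diff if_zero_simps mult.assoc)
  have "Eta i * Vec v + Vec v * Eta i = (\<Sum>l\<in>M. \<Sum>s\<in>M. if i = s then fe i * (fe l * fL (v l)) else 0)"
    unfolding Eta_as_Vec Vec_Vec by (intro sum.cong refl *)
  also have "\<dots> = fe i * Vec v"
    using assms fin by (simp add: sum_if_out Vec_def sum_distrib_left)
  finally show ?thesis by (simp add: algebra_simps)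
qed

lemma fi_Vec:
  assumes "i \<in> M"
  shows "fi i * Vec v = fL (v i) - Vec v * fi i"
proof -
  have "fi i * Vec v = (\<Sum>j\<in>M. (if i = j then fL (v j) else 0) - fe j * fL (v j) * fi i)"
    unfolding Vec_def sum_distrib_left
    by (intro sum.cong refl) (simp add: fi_fe_left mult.assoc fL_fi)
  then show ?thesis using assms fin
    by (simp add: sum_subtractf sum_distrib_right Vec_def)
qed

lemma fe_Vec: "fe i * Vec v = - (Vec v * fe i)"
  unfolding Vec_def sum_distrib_left sum_distrib_right sum_negf[symmetric]
  by (intro sum.cong refl) (simp add: mult.assoc fL_fe fe_fe_left[of _ i])

text \<open>The first and second derivative of the \<open>k\<close>-th power, at \<open>W\<close>; truncated subtraction is harmless in the exponents.\<close>

definition Psi :: "nat \<Rightarrow> 'a fop" where "Psi k = sc (of_nat k) (W ^ (k - 1))"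
definition Chi :: "nat \<Rightarrow> 'a fop" where "Chi k = sc (of_nat k * (of_nat k - 1)) (W ^ (k - 2))"

lemma Psi_0 [simp]: "Psi 0 = 0" by (simp add: Psi_def)
lemma Chi_0 [simp]: "Chi 0 = 0" by (simp add: Chi_def)

lemma W_Psi: "W * Psi k = sc (of_nat k) (W ^ k)"
  by (cases k) (simp_all add: Psi_def sc_mult)

lemma Psi_Suc: "Psi (Suc k) = W ^ k + W * Psi k"
  unfolding W_Psi by (simp add: Psi_def sc_left)

lemma W_Chi: "W * Chi k = sc (of_nat k - 1) (Psi k)"
  by (cases "k < 2"; cases k) (auto simp: Psi_def Chi_def sc_mult sc_sc mult.commute Suc_diff_Suc
     numeral_2_eq_2 less_Suc_eq simp flip: power_Suc)

lemma Chi_Suc: "Chi (Suc k) = Psi k + Psi k + W * Chi k"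
  unfolding W_Chi by (simp add: Psi_def Chi_def sc_left sc_sc distrib_right mult.commute algebra_simps)

lemma pow_comm: "T * W = W * T \<Longrightarrow> T * W ^ k = W ^ k * T"
  by (rule power_commuting_commutes[symmetric]) simp

lemma Psi_comm: "T * W = W * T \<Longrightarrow> T * Psi k = Psi k * T"
  by (simp add: Psi_def sc_mult pow_comm)

lemma W_fe_left: "W * (fe k * x) = fe k * (W * x)"
  by (simp add: fe_W flip: mult.assoc)

lemma W_Vec_left: "vfam v \<Longrightarrow> W * (Vec v * x) = Vec v * (W * x)"
  by (simp add: Vec_W flip: mult.assoc)

text \<open>The commutator of \<open>fL (v i)\<close> with \<open>W\<close> is
  \<open>fe i * Vec v\<close>, which commutes with \<open>W\<close> again. So the commutator with a
  power contains the derivative \<open>Psi k\<close>, and in \<open>fL_Psi\<close> the second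
  derivative appears likewise.\<close>

lemma fL_pow:
  assumes "vfam v" "i \<in> M"
  shows "fL (v i) * W ^ k = W ^ k * fL (v i) + fe i * (Vec v * Psi k)"
proof (induct k)
  case (Suc k)
  have c: "W * (fe i * (Vec v * Psi k)) = fe i * (Vec v * (W * Psi k))"
    by (simp add: W_fe_left W_Vec_left[OF assms(1)])
  have "fL (v i) * W ^ Suc k = W * (fL (v i) * W ^ k) + fe i * (Vec v * W ^ k)"
    by (simp add: fL_W[OF assms] algebra_simps flip: mult.assoc)
  also have "\<dots> = W ^ Suc k * fL (v i) + fe i * (Vec v * (W ^ k + W * Psi k))"
    by (simp add: Suc c algebra_simps)
  finally show ?case by (simp only: Psi_Suc)
qed simp

lemma fL_Psi:
  assumes "vfam v" "i \<in> M"
  shows "fL (v i) * Psi k = Psi k * fL (v i) + fe i * (Vec v * Chi k)"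
proof (induct k)
  case (Suc k)
  have c: "W * (fe i * (Vec v * Chi k)) = fe i * (Vec v * (W * Chi k))"
    by (simp add: W_fe_left W_Vec_left[OF assms(1)])
  have "fL (v i) * Psi (Suc k) = fL (v i) * W ^ k + (fL (v i) * W) * Psi k"
    by (simp add: Psi_Suc algebra_simps)
  also have "\<dots> = W ^ k * fL (v i) + fe i * (Vec v * Psi k) + W * (fL (v i) * Psi k) + fe i * (Vec v * Psi k)"
    by (simp add: fL_W[OF assms] fL_pow[OF assms] algebra_simps)
  also have "\<dots> = Psi (Suc k) * fL (v i) + fe i * (Vec v * (Psi k + Psi k + W * Chi k))"
    by (simp add: Suc c Psi_Suc algebra_simps)
  finally show ?case by (simp only: Chi_Suc)
qed simp

text \<open>Here the commutator \<open>Eta i\<close> does not commute with \<open>W\<close>. Moving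
  it to the front past j factors \<open>W\<close> costs j times the correction of
  \<open>Eta_W\<close>, and summing over j < k gives the last term.\<close>

lemma fi_pow:
  assumes "i \<in> M"
  shows "fi i * W ^ k = W ^ k * fi i + Eta i * Psi k - sc (of_nat k - 1) (fe i * Psi k)"
proof (induct k)
  case (Suc k)
  have p: "Psi (Suc k) = W ^ k + W * Psi k" by (rule Psi_Suc)
  have q: "W * Psi k = sc (of_nat k) (W ^ k)" by (rule W_Psi)
  have c: "W * (Eta i * Psi k) = Eta i * (W * Psi k) - fe i * ((W + W) * Psi k)"
    using Eta_W[OF assms] by (simp add: algebra_simps flip: mult.assoc)
  have d: "W * (fe i * Psi k) = fe i * (W * Psi k)"
    by (simp add: fe_W flip: mult.assoc)
  have "fi i * W ^ Suc k = W * (fi i * W ^ k) + Eta i * W ^ k"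
    by (simp add: fi_W[OF assms] algebra_simps flip: mult.assoc)
  also have "\<dots> = W ^ Suc k * fi i + Eta i * (W ^ k + W * Psi k) - fe i * ((W + W) * Psi k)
       - sc (of_nat k - 1) (fe i * (W * Psi k))"
    by (simp add: Suc distrib_left right_diff_distrib c d sc_mult mult.assoc)
  also have "\<dots> = W ^ Suc k * fi i + Eta i * (W ^ k + W * Psi k)
       - sc (of_nat k) (fe i * (W ^ k + W * Psi k))"
    unfolding distrib_right q
    by (simp add: algebra_simps sc_mult sc_left sc_right sc_sc)
  finally show ?case by (simp add: p)
qed simp

text \<open>The degree operator of the exterior algebra. A relation
  \<open>Num * q = q * Num + sc d q\<close> says that q raises degrees by d.\<close>

definition Num :: "'a fop" where "Num = (\<Sum>j\<in>M. fe j * fi j)"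

lemma Num_fe: "i \<in> M \<Longrightarrow> Num * fe i = fe i * Num + fe i"
proof -
  assume i: "i \<in> M"
  have "Num * fe i = (\<Sum>j\<in>M. fe i * (fe j * fi j) + (if i = j then fe j else 0))"
    unfolding Num_def sum_distrib_right
    by (intro sum.cong refl) (auto simp: mult.assoc fi_fe algebra_simps fe_fe_left[of _ i])
  then show ?thesis using i fin by (simp add: sum.distrib Num_def sum_distrib_left)
qed

lemma Num_fL: "Num * fL c = fL c * Num"
  unfolding Num_def sum_distrib_left sum_distrib_right
  by (intro sum.cong refl) (simp add: mult.assoc fL_fe_left fL_fi)

lemma Num_Vec: "Num * Vec v = Vec v * Num + Vec v"
proof -
  have "Num * Vec v = (\<Sum>i\<in>M. (fe i * Num + fe i) * fL (v i))"
    unfolding Vec_def sum_distrib_left by (intro sum.cong refl) (simp add: Num_fe flip: mult.assoc)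
  then show ?thesis
    by (simp add: Vec_def algebra_simps sum.distrib sum_distrib_right Num_fL)
qed

lemma Num_W: "Num * W = W * Num + (W + W)"
proof (rule calg_double_cancel)
  have "Num * (fe i * fe j * fL (A i j)) = fe i * fe j * fL (A i j) * Num + fe i * fe j * fL (A i j) + fe i * fe j * fL (A i j)"
    if "i \<in> M" "j \<in> M" for i j
  proof -
    have "Num * (fe i * fe j * fL (A i j)) = (Num * fe i) * fe j * fL (A i j)" by (simp add: mult.assoc)
    also have "\<dots> = fe i * (Num * fe j) * fL (A i j) + fe i * fe j * fL (A i j)"
      using that by (simp add: Num_fe algebra_simps)
    finally show ?thesis using that by (simp add: Num_fe Num_fL algebra_simps)
  qed
  then have "Num * (W + W) = (W + W) * Num + (W + W) + (W + W)"
    by (simp add: W2 sum_distrib_left sum_distrib_right sum.distrib cong: sum.cong)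
  then show "Num * W + Num * W = W * Num + (W + W) + (W * Num + (W + W))"
    by (simp add: algebra_simps)
qed

lemma Num_pow: "Num * W ^ k = W ^ k * Num + sc (2 * of_nat k) (W ^ k)"
proof (induct k)
  case (Suc k)
  have "Num * W ^ Suc k = W * (Num * W ^ k) + (W + W) * W ^ k"
    by (simp add: Num_W algebra_simps flip: mult.assoc)
  also have "\<dots> = W ^ Suc k * Num + sc (2 * of_nat k) (W ^ Suc k) + (W + W) * W ^ k"
    by (simp add: Suc algebra_simps sc_mult)
  finally show ?case by (simp add: algebra_simps sc_left)
qed simp

lemma Num_Psi: "Num * Psi k = Psi k * Num + sc (2 * of_nat k - 2) (Psi k)"
  by (cases k) (simp_all add: Psi_def sc_mult Num_pow sc_right sc_sc mult.commute)

end

text \<open>\<open>X\<close>, \<open>a\<close>, \<open>H\<close> abstract \<open>elemX n\<close>, \<open>skew (n - 1)\<close>, \<open>elemH n\<close> over the index set \<open>{1..n - 2}\<close>.\<close>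

locale key_alg = so_alg A M for A :: "nat \<Rightarrow> nat \<Rightarrow> 'a::calg" and M +
  fixes X a :: "nat \<Rightarrow> 'a" and H :: 'a and G :: "nat set"
  assumes finG: "finite G" and MG: "M \<subseteq> G"
    and vX: "vfam X" and va: "vfam a"
    and XX: "i \<in> M \<Longrightarrow> j \<in> M \<Longrightarrow> X i * X j = X j * X i"
    and Xa: "i \<in> M \<Longrightarrow> j \<in> M \<Longrightarrow> X i * a j - a j * X i = - A i j - (if i = j then H else 0)"
    and aa: "i \<in> M \<Longrightarrow> j \<in> M \<Longrightarrow> a i * a j - a j * a i = - A i j"
    and HX: "i \<in> M \<Longrightarrow> H * X i = X i * H + X i"
    and Ha: "i \<in> M \<Longrightarrow> H * a i = a i * H + X i - a i"
    and HA: "i \<in> M \<Longrightarrow> j \<in> M \<Longrightarrow> H * A i j = A i j * H"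
begin

abbreviation B where "B \<equiv> fB G"
abbreviation x where "x \<equiv> Vec X"
abbreviation al where "al \<equiv> Vec a"
abbreviation m :: complex where "m \<equiv> of_nat (card M)"
abbreviation (input) kk :: "nat \<Rightarrow> complex" where "kk \<equiv> of_nat"
abbreviation ph where "ph k \<equiv> W ^ k"

lemma fB_fe: "i \<in> M \<Longrightarrow> B (fe i * p) q = B p (fi i * q)"
  using fB_fe_left[OF finG] MG by auto

lemma fB_fi: "i \<in> M \<Longrightarrow> B (fi i * p) q = B p (fe i * q)"
  using fB_fi_left'[OF finG] MG by auto

lemmas fB_lin = fB_add_left fB_add_right fB_diff_left fB_diff_right fB_minus_left fB_minus_right
  fB_sc_left fB_sc_right

lemma fB_Vec_left: "B (Vec v * p) q = (\<Sum>i\<in>M. v i * B (fe i * p) q)"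
  unfolding Vec_def sum_distrib_right fB_sum_left
  by (intro sum.cong refl) (simp add: mult.assoc fB_L_left flip: fL_fe_left)

text \<open>In the second argument a coefficient cannot be pulled out in front; it stays in the
  middle and is handed over to p. Moving it to the left through p is what produces the correction
  terms of the lemmas below.\<close>

lemma fB_Vec_right: "B p (Vec v * q) = (\<Sum>i\<in>M. B (p * fL (v i)) (fe i * q))"
  unfolding Vec_def sum_distrib_right fB_sum_right
  by (intro sum.cong refl) (simp add: mult.assoc fB_L_mid fL_fe_left)

text \<open>The sum over j of \<open>fi j * fe j\<close> is \<open>card M\<close> minus the degree
  operator, and q applied to \<open>vac\<close> has degree d. \<open>fB_Num_left\<close> is the
  variant for a known degree of the first argument.\<close>

lemma fB_Num_right:
  assumes "Num * q = q * Num + sc d q"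
  shows "(\<Sum>j\<in>M. B (fe j * p) (fe j * q)) = sc (m - d) (B p q)"
proof -
  have "(\<Sum>j\<in>M. B (fe j * p) (fe j * q)) = (\<Sum>j\<in>M. B p q - B p (fe j * fi j * q))"
    by (intro sum.cong refl) (simp add: fB_fe fi_fe_left fB_lin mult.assoc)
  also have "\<dots> = sc m (B p q) - B p (Num * q)"
    by (simp add: sum_subtractf sum_const_sc Num_def sum_distrib_right fB_sum_right del: sum_constant)
  also have "B p (Num * q) = sc d (B p q)"
    unfolding assms by (simp add: Num_def sum_distrib_left fB_lin fB_sum_right flip: mult.assoc)
  finally show ?thesis by (simp add: sc_left)
qed

lemma fB_Num_left:
  assumes "Num * p = p * Num + sc d p"
  shows "(\<Sum>j\<in>M. B (fe j * p) (fe j * q)) = sc (m - d) (B p q)"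
proof -
  have *: "B (fi j * (fe j * p)) q = B p q - B (fe j * fi j * p) q" for j
    by (simp add: fi_fe_left fB_lin mult.assoc)
  have "(\<Sum>j\<in>M. B (fe j * p) (fe j * q)) = (\<Sum>j\<in>M. B p q - B (fe j * fi j * p) q)"
    by (intro sum.cong refl) (simp add: fB_fi[symmetric] *)
  also have "\<dots> = sc m (B p q) - B (Num * p) q"
    by (simp add: sum_subtractf sum_const_sc Num_def sum_distrib_right fB_sum_left del: sum_constant)
  also have "B (Num * p) q = sc d (B p q)"
    unfolding assms by (simp add: Num_def sum_distrib_left fB_lin fB_sum_left flip: mult.assoc)
  finally show ?thesis by (simp add: sc_left)
qed

lemma Num_Vec_mult: "Num * p = p * Num + sc d p \<Longrightarrow> Num * (Vec v * p) = Vec v * p * Num + sc (d + 1) (Vec v * p)"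
proof -
  assume *: "Num * p = p * Num + sc d p"
  have "Num * (Vec v * p) = Vec v * (Num * p) + Vec v * p"
    by (simp add: Num_Vec algebra_simps flip: mult.assoc)
  then show ?thesis by (simp add: * algebra_simps sc_mult sc_left)
qed

lemma Num_fe_mult: "i \<in> M \<Longrightarrow> Num * p = p * Num + sc d p \<Longrightarrow> Num * (fe i * p) = fe i * p * Num + sc (d + 1) (fe i * p)"
proof -
  assume i: "i \<in> M" and *: "Num * p = p * Num + sc d p"
  have "Num * (fe i * p) = fe i * (Num * p) + fe i * p"
    using i by (simp add: Num_fe algebra_simps flip: mult.assoc)
  then show ?thesis by (simp add: * algebra_simps sc_mult sc_left)
qed

lemma Num_fi: "i \<in> M \<Longrightarrow> Num * fi i = fi i * Num - fi i"
proof -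
  assume i: "i \<in> M"
  have *: "fe j * (fi j * fi i) = fi i * (fe j * fi j) - (if i = j then fi j else (0 :: 'a fop))" for j
  proof -
    have e: "fe j * (fi j * fi i) = fe j * - (fi i * (fi j :: 'a fop))" by (subst fi_anti) (rule refl)
    show ?thesis unfolding e by (simp add: fi_fe_left)
  qed
  have "Num * fi i = (\<Sum>j\<in>M. fi i * (fe j * fi j) - (if i = j then fi j else 0))"
    unfolding Num_def sum_distrib_right by (intro sum.cong refl) (simp add: mult.assoc *)
  then show ?thesis using i fin by (simp add: sum_subtractf Num_def sum_distrib_left)
qed

lemma Num_fi_mult: "i \<in> M \<Longrightarrow> Num * p = p * Num + sc d p \<Longrightarrow> Num * (fi i * p) = fi i * p * Num + sc (d - 1) (fi i * p)"
proof -
  assume i: "i \<in> M" and *: "Num * p = p * Num + sc d p"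
  have "Num * (fi i * p) = fi i * (Num * p) - fi i * p"
    using i by (simp add: Num_fi algebra_simps flip: mult.assoc)
  then show ?thesis by (simp add: * algebra_simps sc_mult sc_left)
qed

lemma Vec_fe_left: "Vec v * (fe i * p) = - (fe i * (Vec v * p))"
  by (simp add: fe_Vec flip: mult.assoc)

text \<open>The null vectors commute. Therefore a correction that contains x behind
  \<open>fe i\<close> disappears as soon as it is multiplied by \<open>X i\<close> and summed over
  i, see \<open>sumX_zero\<close> and \<open>sum_X_drop\<close>.\<close>

lemma xx: "x * x = 0"
  by (rule Vec_sq_0) (simp add: XX)

lemma x_fe_x: "x * (fe i * (x * p)) = 0"
proof -
  have "x * fe i * x = - (fe i * (x * x))" by (simp add: fe_Vec mult.assoc flip: mult.assoc)
  then show ?thesis by (simp add: xx flip: mult.assoc)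
qed

lemma x_x: "x * (x * p) = 0"
  by (simp add: xx flip: mult.assoc)

lemma al_al: "al * al = - W"
  by (rule Vec_sq) (simp add: aa)

lemma x_al: "x * al + al * x = - (W + W)"
  by (rule Vec_Vec_W[of X a H]) (simp add: Xa)

lemma al_x_left: "al * (x * p) = - (W * p) - W * p - x * (al * p)"
  using arg_cong[OF x_al, of "\<lambda>t. t * p"] by (simp add: algebra_simps mult.assoc)

lemma H_W: "fL H * W = W * fL H"
  by (rule fL_W_comm) (simp add: HA)

lemma sumX_zero: "(\<Sum>i\<in>M. X i * B (fe i * (x * p)) q) = 0"
  by (simp add: x_x flip: fB_Vec_left)

lemma X_al: "j \<in> M \<Longrightarrow> fL (X j) * al = al * fL (X j) - Eta j - fe j * fL H"
  by (rule fL_Vec) (simp_all add: Xa)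

lemma a_al: "j \<in> M \<Longrightarrow> fL (a j) * al = al * fL (a j) - Eta j"
  using fL_Vec[of "a j" a j 0] by (simp add: aa)

lemma ph_X: "i \<in> M \<Longrightarrow> ph k * fL (X i) = fL (X i) * ph k - fe i * (x * Psi k)"
  by (simp add: fL_pow[OF vX])

lemma ph_H: "ph k * fL H = fL H * ph k"
  by (rule pow_comm[symmetric, OF H_W])

lemma al_ph_X: "j \<in> M \<Longrightarrow> al * ph k * fL (X j) = fL (X j) * (al * ph k) + Eta j * ph k + fe j * (fL H * ph k)
    + fe j * (al * (x * Psi k))"
proof -
  assume j: "j \<in> M"
  have "fL (X j) * (al * ph k) = (al * fL (X j) - Eta j - fe j * fL H) * ph k"
    using X_al[OF j] by (simp flip: mult.assoc)
  also have "\<dots> = al * (ph k * fL (X j) + fe j * (x * Psi k)) - Eta j * ph k - fe j * (fL H * ph k)"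
    by (simp add: algebra_simps fL_pow[OF vX j])
  finally show ?thesis by (simp add: algebra_simps Vec_fe_left)
qed

lemma al_Psi_X: "j \<in> M \<Longrightarrow> al * Psi k * fL (X j) = fL (X j) * (al * Psi k) + Eta j * Psi k + fe j * (fL H * Psi k)
    + fe j * (al * (x * Chi k))"
proof -
  assume j: "j \<in> M"
  have "fL (X j) * (al * Psi k) = (al * fL (X j) - Eta j - fe j * fL H) * Psi k"
    using X_al[OF j] by (simp flip: mult.assoc)
  also have "\<dots> = al * (Psi k * fL (X j) + fe j * (x * Chi k)) - Eta j * Psi k - fe j * (fL H * Psi k)"
    by (simp add: algebra_simps fL_Psi[OF vX j])
  finally show ?thesis by (simp add: algebra_simps Vec_fe_left)
qed

lemma sumX_fe_x: "(\<Sum>i\<in>M. X i * B (fe i * (fe j * (x * p))) q) = 0"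
  by (simp add: x_fe_x flip: fB_Vec_left)

text \<open>\<open>fi_pow\<close> solved for the term with \<open>Eta i\<close>: one of the
  contractions acts on \<open>vac\<close> and vanishes, the other can pass to the other argument of
  the pairing.\<close>

lemma Eta_Psi: "i \<in> M \<Longrightarrow> Eta i * Psi k = fi i * ph k - ph k * fi i + sc (of_nat k - 1) (fe i * Psi k)"
  by (simp add: fi_pow)

lemma fi_ph_zero: "B p (q * (ph k * fi i)) = 0" "B (q * (ph k * fi i)) p = 0"
   "B p (ph k * fi i) = 0" "B (ph k * fi i) p = 0"
  by (simp_all flip: mult.assoc)


section \<open>The pairings that occur in the recursion\<close>

definition c where "c k = B (ph k) (ph k)"
text \<open>\<open>P k i + S k i\<close> is the commutator of \<open>a i\<close> with
  \<open>c k\<close> (\<open>a_c\<close>), split according to the argument of the pairing in which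
  \<open>a i\<close> meets the power of \<open>W\<close>.\<close>

definition P where "P k i = B (fe i * (al * Psi k)) (ph k)"
definition S where "S k i = B (ph k) (fe i * (al * Psi k))"
definition Y where "Y k i = B (fe i * Psi k) (al * Psi k)"
text \<open>The second commutators are differences of \<open>V\<close> and \<open>U\<close>, see
  \<open>a_P\<close> and \<open>a_S\<close>.\<close>

definition V where "V k i j = B (fe i * (al * Psi k)) (fe j * (al * Psi k))"
definition U where "U k i j = B (ph k) (fe j * (fi i * ph k))"
text \<open>Up to scalar factors the coefficient of \<open>fe q * fe p\<close> in the next power of
  the full \<open>W\<close>, see \<open>Q_R\<close> and \<open>Pf2_K\<close>.\<close>

definition R where "R k = fL H * ph k - sc (of_nat k) (ph k) - x * (al * Psi k)"

lemma Num_x_Psi: "Num * (Vec v * Psi k) = Vec v * Psi k * Num + sc (2 * of_nat k - 1) (Vec v * Psi k)"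
  using Num_Vec_mult[OF Num_Psi, of v k] by simp

lemma Num_fe_Psi: "i \<in> M \<Longrightarrow> Num * (fe i * Psi k) = fe i * Psi k * Num + sc (2 * of_nat k - 1) (fe i * Psi k)"
  using Num_fe_mult[OF _ Num_Psi, of i k] by simp

lemma Num_fi_ph: "i \<in> M \<Longrightarrow> Num * (fi i * ph k) = fi i * ph k * Num + sc (2 * of_nat k - 1) (fi i * ph k)"
  using Num_fi_mult[OF _ Num_pow, of i k] by simp

lemma fB_ph_fL_X: "i \<in> M \<Longrightarrow> B (ph k) (fL (X i) * q) = X i * B (ph k) q - B (fe i * (x * Psi k)) q"
  by (simp add: ph_X fB_lin fB_L_left flip: fB_L_mid)

lemma sum_X_drop:
  "(\<Sum>i\<in>M. X i * (f i - B (fe i * (x * p)) q)) = (\<Sum>i\<in>M. X i * f i)"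
  "(\<Sum>i\<in>M. X i * (f i + sc d (B (fe i * (x * p)) q))) = (\<Sum>i\<in>M. X i * f i)"
  using sumX_zero[of p q]
  by (simp_all add: algebra_simps sum_subtractf sum.distrib sc_mult flip: sc_sum)

lemma B_x_x:
  "B (x * ph k) (x * ph k) = (\<Sum>i\<in>M. X i * (X i * c k)) - (\<Sum>i\<in>M. \<Sum>j\<in>M. X i * (X j * U k i j))"
proof -
  have *: "B (fe i * ph k) (x * ph k) =
     (X i * c k - (\<Sum>j\<in>M. X j * U k i j) + sc (m - (2 * of_nat k - 1)) (B (fe i * (x * Psi k)) (ph k))
       - B (fe i * (x * Psi k)) (ph k))" if i: "i \<in> M" for i
  proof -
    have "B (fe i * ph k) (x * ph k) = B (ph k) (fL (X i) * ph k) - B (ph k) (x * (fi i * ph k))"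
      using i by (simp add: fB_fe fi_Vec fB_lin algebra_simps flip: mult.assoc)
    also have "B (ph k) (fL (X i) * ph k) = X i * c k - B (fe i * (x * Psi k)) (ph k)"
      using fB_ph_fL_X[OF i] by (simp add: c_def)
    also have "B (ph k) (x * (fi i * ph k)) = (\<Sum>j\<in>M. X j * U k i j - B (fe j * (x * Psi k)) (fe j * (fi i * ph k)))"
      unfolding fB_Vec_right
      by (intro sum.cong refl) (simp add: fB_L_mid fB_ph_fL_X U_def)
    also have "\<dots> = (\<Sum>j\<in>M. X j * U k i j) - sc (m - (2 * of_nat k - 1)) (B (x * Psi k) (fi i * ph k))"
      by (simp add: sum_subtractf fB_Num_left[OF Num_x_Psi])
    also have "B (x * Psi k) (fi i * ph k) = B (fe i * (x * Psi k)) (ph k)"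
      using i by (simp add: fB_fe)
    finally show ?thesis by simp
  qed
  have "B (x * ph k) (x * ph k) = (\<Sum>i\<in>M. X i * B (fe i * ph k) (x * ph k))"
    by (rule fB_Vec_left)
  also have "\<dots> = (\<Sum>i\<in>M. X i * (X i * c k - (\<Sum>j\<in>M. X j * U k i j)))"
    by (simp only: * sum_X_drop cong: sum.cong)
  finally show ?thesis by (simp add: algebra_simps sum_subtractf sum_distrib_left)
qed

lemma c_H: "H * c k = c k * H"
proof -
  have "H * c k = B (ph k * fL H) (ph k)" by (simp only: c_def ph_H fB_L_left)
  also have "\<dots> = B (ph k) (ph k * fL H)" by (subst fB_L_mid) (simp only: ph_H)
  also have "\<dots> = c k * H" by (simp only: c_def fB_L_right)
  finally show ?thesis .
qed

lemma B_R_ph: "B (R k) (ph k) = H * c k - sc (of_nat k) (c k) - (\<Sum>i\<in>M. X i * P k i)"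
  by (simp add: R_def fB_lin fB_Vec_left P_def c_def fB_L_left)

lemma sum_Eta_fi_ph:
  "(\<Sum>j\<in>M. B (Eta j * ph k) (fe j * ph k)) = sc ((m - 2 * of_nat k) * of_nat k) (c k)"
proof -
  have "B (Eta j * ph k) (fe j * ph k) = - B (Eta j * (Eta j * Psi k)) (ph k)
      + sc (of_nat k - 1) (B (Eta j * (fe j * Psi k)) (ph k))" if j: "j \<in> M" for j
  proof -
    \<comment> \<open>The two anticommute because the diagonal entry \<open>A j j\<close> is
      0.\<close>
    have "fi j * Eta j = - (Eta j * fi j)"
      using fi_Vec[OF j, of "A j"] j by (simp add: Eta_as_Vec)
    then have "fi j * (Eta j * ph k) = - (Eta j * (fi j * ph k))"
      by (simp flip: mult.assoc)
    then show ?thesis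
      using j by (simp add: fB_fi[symmetric] fi_pow fB_lin distrib_left right_diff_distrib fi_ph_zero sc_mult)
  qed
  then have "(\<Sum>j\<in>M. B (Eta j * ph k) (fe j * ph k)) =
      - B ((\<Sum>j\<in>M. Eta j * Eta j) * Psi k) (ph k) + sc (of_nat k - 1) (B ((\<Sum>j\<in>M. Eta j * fe j) * Psi k) (ph k))"
    by (simp add: sum.distrib sum_subtractf sum_distrib_right fB_sum_left sc_sum mult.assoc cong: sum.cong)
  also have "\<dots> = - sc ((2 - m) * of_nat k) (c k) - sc ((of_nat k - 1) * of_nat k) (c k)
     - sc ((of_nat k - 1) * of_nat k) (c k)"
    by (simp add: sum_Eta_Eta sum_Eta_fe sc_mult W_Psi fB_lin c_def left_diff_distrib sc_sc sc_right)
  also have "\<dots> = sc ((m - 2 * of_nat k) * of_nat k) (c k)"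
    unfolding sc_minus_left[symmetric] sc_diff_left[symmetric]
    by (rule arg_cong2[of _ _ _ _ sc]) (simp_all add: algebra_simps)
  finally show ?thesis .
qed

lemma B_al_x:
  "B (al * ph k) (x * ph k) = (\<Sum>i\<in>M. X i * B (al * ph k) (fe i * ph k)) + sc (m - 2 * of_nat k) (B (R k) (ph k))"
proof -
  \<comment> \<open>The corrections \<open>fL H * ph k\<close> and \<open>al * (x * Psi k)\<close>
    of \<open>al_ph_X\<close> combine to \<open>R k\<close> minus k times
    \<open>ph k\<close>.\<close>
  have *: "B (al * ph k * fL (X j)) (fe j * ph k) = X j * B (al * ph k) (fe j * ph k) + B (Eta j * ph k) (fe j * ph k)
      + B (fe j * (R k - sc (of_nat k) (ph k))) (fe j * ph k)" if j: "j \<in> M" for j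
    unfolding al_ph_X[OF j, of k]
    by (simp add: al_x_left W_Psi R_def fB_lin fB_L_left algebra_simps sc_mult)
  have "B (al * ph k) (x * ph k) = (\<Sum>j\<in>M. B (al * ph k * fL (X j)) (fe j * ph k))"
    by (rule fB_Vec_right)
  also have "\<dots> = (\<Sum>i\<in>M. X i * B (al * ph k) (fe i * ph k)) + sc ((m - 2 * of_nat k) * of_nat k) (c k)
     + sc (m - 2 * of_nat k) (B (R k - sc (of_nat k) (ph k)) (ph k))"
    by (simp add: * sum.distrib sum_Eta_fi_ph fB_Num_right[OF Num_pow] cong: sum.cong)
  also have "\<dots> = (\<Sum>i\<in>M. X i * B (al * ph k) (fe i * ph k)) + sc (m - 2 * of_nat k) (B (R k) (ph k))"
    by (simp add: fB_lin sc_right sc_sc c_def)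
  finally show ?thesis .
qed

lemma R_right: "R k = ph k * fL H - sc (of_nat k) (ph k) - x * (al * Psi k)"
  by (simp add: R_def ph_H)

lemma B_ph_x_al:
  "B (ph k) (x * (al * Psi k)) = (\<Sum>i\<in>M. X i * S k i) - sc (m - (2 * of_nat k - 1)) (\<Sum>i\<in>M. X i * Y k i)"
proof -
  have "B (ph k) (x * (al * Psi k)) = (\<Sum>j\<in>M. X j * S k j - B (fe j * (x * Psi k)) (fe j * (al * Psi k)))"
    unfolding fB_Vec_right
    by (intro sum.cong refl) (simp add: fB_L_mid fB_ph_fL_X S_def)
  also have "\<dots> = (\<Sum>i\<in>M. X i * S k i) - sc (m - (2 * of_nat k - 1)) (B (x * Psi k) (al * Psi k))"
    by (simp add: sum_subtractf fB_Num_left[OF Num_x_Psi])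
  also have "B (x * Psi k) (al * Psi k) = (\<Sum>i\<in>M. X i * Y k i)"
    by (simp add: fB_Vec_left Y_def)
  finally show ?thesis .
qed

lemma fi_fe_fi: "fi j * (fe i * (fi j * p)) = (if i = j then fi j * p else (0 :: 'a fop))"
proof -
  have "fi j * fi j = (0 :: 'a fop)" by (rule calg_eq_minus) (rule fi_anti)
  then have "fi j * (fi j * p) = 0" by (simp flip: mult.assoc)
  then show ?thesis by (simp add: fi_fe_left)
qed

lemma sum_fe_fi_S:
  assumes "i \<in> M"
  shows "(\<Sum>j\<in>M. B (fe i * (fi j * ph k)) (fe j * (al * Psi k))) = S k i"
proof -
  have "(\<Sum>j\<in>M. B (fe i * (fi j * ph k)) (fe j * (al * Psi k))) =
     (\<Sum>j\<in>M. if i = j then B (fi j * ph k) (al * Psi k) else 0)"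
    by (intro sum.cong refl) (simp add: fB_fi[symmetric] fi_fe_fi)
  also have "\<dots> = S k i"
    using assms fin by (simp add: fB_fi S_def)
  finally show ?thesis .
qed

text \<open>The last sum is left as it is: it contains x, and in \<open>B_R_R\<close> it vanishes
  after multiplication by \<open>X i\<close> and summation over i.\<close>

lemma B_fe_al_x:
  assumes i: "i \<in> M"
  shows "B (fe i * (al * Psi k)) (x * (al * Psi k)) = (\<Sum>j\<in>M. X j * V k i j) + S k i
    + sc (m - (2 * of_nat k - 1)) (sc (of_nat k - 1) (Y k i) - H * Y k i)
    - (\<Sum>j\<in>M. B (fe i * (fe j * (x * (al * Chi k)))) (fe j * (al * Psi k)))"
proof -
  let ?q = "\<lambda>j. fe j * (al * Psi k)"
  have *: "B (fe i * (al * Psi k) * fL (X j)) (?q j) = X j * V k i j + B (fe i * (fi j * ph k)) (?q j)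
     + sc (of_nat k - 1) (B (fe j * (fe i * Psi k)) (?q j)) - H * B (fe j * (fe i * Psi k)) (?q j)
     - B (fe i * (fe j * (x * (al * Chi k)))) (?q j)" if j: "j \<in> M" for j
  proof -
    have e: "fe i * (al * Psi k) * fL (X j) = fL (X j) * (fe i * (al * Psi k))
      + fe i * (fi j * ph k) - (fe i * ph k) * fi j + sc (of_nat k - 1) (fe j * (fe i * Psi k))
      - fL H * (fe j * (fe i * Psi k)) - fe i * (fe j * (x * (al * Chi k)))"
      unfolding mult.assoc[of "fe i"] al_Psi_X[OF j, of k] Eta_Psi[OF j, of k]
      using fe_fe_left[of i j "Psi k"] fe_fe_left[of i j "fL H * Psi k"]
      by (simp add: mult.assoc al_x_left W_Chi algebra_simps sc_mult fL_fe_left sc_minus_right)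
    show ?thesis unfolding e
      by (simp add: fB_lin fB_L_left V_def)
  qed
  have "B (fe i * (al * Psi k)) (x * (al * Psi k)) = (\<Sum>j\<in>M. B (fe i * (al * Psi k) * fL (X j)) (?q j))"
    by (rule fB_Vec_right)
  also have "\<dots> = (\<Sum>j\<in>M. X j * V k i j + B (fe i * (fi j * ph k)) (?q j)
     + sc (of_nat k - 1) (B (fe j * (fe i * Psi k)) (?q j)) - H * B (fe j * (fe i * Psi k)) (?q j)
     - B (fe i * (fe j * (x * (al * Chi k)))) (?q j))"
    by (intro sum.cong refl *)
  also have "\<dots> = (\<Sum>j\<in>M. X j * V k i j) + S k i
     + sc (of_nat k - 1) (\<Sum>j\<in>M. B (fe j * (fe i * Psi k)) (?q j)) - H * (\<Sum>j\<in>M. B (fe j * (fe i * Psi k)) (?q j))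
     - (\<Sum>j\<in>M. B (fe i * (fe j * (x * (al * Chi k)))) (?q j))"
    by (simp only: sum.distrib sum_subtractf sum_fe_fi_S[OF i] sc_sum sum_distrib_left)
  also have "(\<Sum>j\<in>M. B (fe j * (fe i * Psi k)) (?q j)) = sc (m - (2 * of_nat k - 1)) (Y k i)"
    by (simp add: fB_Num_left[OF Num_fe_Psi[OF i]] Y_def)
  finally show ?thesis
    by (simp add: sc_right sc_sc sc_mult mult.commute)
qed

lemma H_X_sum: "H * (\<Sum>i\<in>M. X i * f i) = (\<Sum>i\<in>M. X i * (H * f i)) + (\<Sum>i\<in>M. X i * f i)"
  unfolding sum_distrib_left sum.distrib[symmetric]
  by (intro sum.cong refl) (simp add: HX algebra_simps flip: mult.assoc)

lemma H_P:
  assumes i: "i \<in> M"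
  shows "P k i * H = H * P k i + P k i - B (fe i * (x * Psi k)) (ph k)"
proof -
  have Hal: "fL H * al = al * fL H + x - al"
    unfolding Vec_def sum_distrib_left sum_distrib_right sum.distrib[symmetric] sum_subtractf[symmetric]
    by (intro sum.cong refl)
      (simp add: mult.assoc fL_fe_left Ha fL_add fL_diff distrib_left right_diff_distrib flip: fL_mult)
  have "H * P k i = B (fe i * (fL H * al) * Psi k) (ph k)"
    unfolding P_def fB_L_left[symmetric] by (simp add: fL_fe_left mult.assoc)
  also have "\<dots> = B (fe i * (al * Psi k) * fL H) (ph k) + B (fe i * (x * Psi k)) (ph k) - P k i"
    unfolding Hal by (simp add: algebra_simps fB_lin P_def Psi_comm[OF H_W])
  also have "B (fe i * (al * Psi k) * fL H) (ph k) = P k i * H"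
    by (simp only: fB_L_mid ph_H[symmetric] fB_L_right P_def)
  finally show ?thesis by (simp add: algebra_simps)
qed

lemma B_R_R:
  "B (R k) (R k) = H * (c k * H) - sc (of_nat k) (H * c k) - sc (of_nat k) (c k * H) + sc (of_nat k * of_nat k) (c k)
    - (\<Sum>i\<in>M. X i * (H * (P k i + S k i))) - sc (1 - of_nat k) (\<Sum>i\<in>M. X i * (P k i + S k i))
    + (\<Sum>i\<in>M. \<Sum>j\<in>M. X i * (X j * V k i j)) + (\<Sum>i\<in>M. X i * S k i)"
proof -
  \<comment> \<open>The factor that \<open>fB_Num_left\<close> produces in degree
    \<open>2 * k - 1\<close>.\<close>
  define s where "s = m - (2 * of_nat k - 1)"
  define SS SHS SP SHP SY SHY XV where
    "SS = (\<Sum>i\<in>M. X i * S k i)" and "SHS = (\<Sum>i\<in>M. X i * (H * S k i))" and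
    "SP = (\<Sum>i\<in>M. X i * P k i)" and "SHP = (\<Sum>i\<in>M. X i * (H * P k i))" and
    "SY = (\<Sum>i\<in>M. X i * Y k i)" and "SHY = (\<Sum>i\<in>M. X i * (H * Y k i))" and
    "XV = (\<Sum>i\<in>M. \<Sum>j\<in>M. X i * (X j * V k i j))"
  have HS: "H * SS = SHS + SS" and HY: "H * SY = SHY + SY"
    unfolding SS_def SHS_def SY_def SHY_def by (rule H_X_sum)+
  have PH: "(\<Sum>i\<in>M. X i * (P k i * H)) = SHP + SP"
    unfolding SHP_def SP_def sum.distrib[symmetric] distrib_left[symmetric]
    by (simp only: H_P sum_X_drop cong: sum.cong)
  have phR: "B (ph k) (R k) = c k * H - sc (of_nat k) (c k) - SS + sc s SY"
    by (simp add: R_right fB_lin fB_L_right B_ph_x_al c_def SS_def SY_def s_def)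
  have xR: "B (x * (al * Psi k)) (R k) = SHP + SP - sc (of_nat k) SP - XV - SS - sc s (sc (of_nat k - 1) SY - SHY)"
  proof -
    have *: "B (fe i * (al * Psi k)) (R k) = (P k i * H - sc (of_nat k) (P k i) - (\<Sum>j\<in>M. X j * V k i j) - S k i
        - sc s (sc (of_nat k - 1) (Y k i) - H * Y k i))
        + (\<Sum>j\<in>M. B (fe i * (fe j * (x * (al * Chi k)))) (fe j * (al * Psi k)))" if "i \<in> M" for i
      by (simp add: R_right fB_lin fB_L_right B_fe_al_x[OF that] P_def s_def)
    have z: "(\<Sum>i\<in>M. X i * (\<Sum>j\<in>M. B (fe i * (fe j * (x * (al * Chi k)))) (fe j * (al * Psi k)))) = 0"
      unfolding sum_distrib_left
        sum.swap[of "\<lambda>i j. X i * B (fe i * (fe j * (x * (al * Chi k)))) (fe j * (al * Psi k))" M M]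
      by (simp only: sumX_fe_x sum.neutral_const)
    have "B (x * (al * Psi k)) (R k) = (\<Sum>i\<in>M. X i * B (fe i * (al * Psi k)) (R k))"
      by (rule fB_Vec_left)
    also have "\<dots> = (\<Sum>i\<in>M. X i * (P k i * H)) - sc (of_nat k) SP - XV - SS - sc s (sc (of_nat k - 1) SY - SHY)"
      by (simp add: * distrib_left right_diff_distrib sum.distrib sum_subtractf z[unfolded sum_distrib_left] SP_def SS_def XV_def SY_def SHY_def
           sc_mult sc_right sc_sum sum_distrib_left cong: sum.cong)
    finally show ?thesis by (simp add: PH)
  qed
  have "B (R k) (R k) = H * B (ph k) (R k) - sc (of_nat k) (B (ph k) (R k)) - B (x * (al * Psi k)) (R k)"
    by (subst (1) R_def) (simp add: fB_lin fB_L_left)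
  \<comment> \<open>The sums with \<open>Y\<close> from \<open>phR\<close> and from
    \<open>xR\<close> cancel here; moving H past \<open>X i\<close> in \<open>HY\<close> supplies
    the missing unit.\<close>
  also have "\<dots> = H * (c k * H) - sc (of_nat k) (H * c k) - sc (of_nat k) (c k * H) + sc (of_nat k * of_nat k) (c k)
     - (SHP + SHS) - sc (1 - of_nat k) (SP + SS) + XV + SS"
    unfolding phR xR
    by (simp add: right_diff_distrib distrib_left sc_mult HS HY sc_right sc_sc sc_left)
      (simp add: algebra_simps sc_left sc_right)
  finally show ?thesis
    by (simp add: SS_def SHS_def SP_def SHP_def XV_def distrib_left sum.distrib)
qed

lemma a_c: "i \<in> M \<Longrightarrow> a i * c k - c k * a i = P k i + S k i"
proof -
  assume i: "i \<in> M"
  have e: "fL (a i) * ph k = ph k * fL (a i) + fe i * (al * Psi k)" by (rule fL_pow[OF va i])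
  have "a i * c k = B (ph k * fL (a i)) (ph k) + P k i"
    unfolding c_def P_def fB_L_left[symmetric] e fB_lin by (rule refl)
  also have "B (ph k * fL (a i)) (ph k) = c k * a i + S k i"
    unfolding fB_L_mid e fB_lin fB_L_right c_def S_def by (rule refl)
  finally show ?thesis by simp
qed

text \<open>The relation \<open>al * al = - W\<close> turns the second derivative into a multiple of
  the first, and this multiple is exactly the one that \<open>Eta_Psi\<close> removes. Only
  contractions remain.\<close>

lemma a_al_Psi: "i \<in> M \<Longrightarrow> fL (a i) * (al * Psi k) = al * Psi k * fL (a i) - fi i * ph k + ph k * fi i"
proof -
  assume i: "i \<in> M"
  have "fL (a i) * (al * Psi k) = al * (fL (a i) * Psi k) - Eta i * Psi k"
    using a_al[OF i] by (simp add: left_diff_distrib flip: mult.assoc)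
  also have "al * (fL (a i) * Psi k) = al * Psi k * fL (a i) - fe i * ((al * al) * Chi k)"
    by (simp add: fL_Psi[OF va i] distrib_left Vec_fe_left mult.assoc)
  finally show ?thesis
    by (simp add: al_al W_Chi Eta_Psi[OF i] mult.assoc sc_mult)
qed

lemma a_P: "i \<in> M \<Longrightarrow> j \<in> M \<Longrightarrow> a i * P k j - P k j * a i = V k j i - U k j i"
proof -
  assume i: "i \<in> M" and j: "j \<in> M"
  have e: "fL (a i) * ph k = ph k * fL (a i) + fe i * (al * Psi k)" by (rule fL_pow[OF va i])
  have "a i * P k j = B (fe j * (fL (a i) * (al * Psi k))) (ph k)"
    unfolding P_def fB_L_left[symmetric] fL_fe_left by (rule refl)
  also have "\<dots> = B (fe j * (al * Psi k) * fL (a i)) (ph k) - B (fe j * (fi i * ph k)) (ph k)"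
    unfolding a_al_Psi[OF i] by (simp add: distrib_left right_diff_distrib fB_lin fi_ph_zero mult.assoc)
  also have "B (fe j * (al * Psi k) * fL (a i)) (ph k) = P k j * a i + V k j i"
    unfolding fB_L_mid e fB_lin fB_L_right P_def V_def by (rule refl)
  also have "B (fe j * (fi i * ph k)) (ph k) = U k j i"
    unfolding U_def by (simp add: fB_fe[OF j] fB_fi[OF i])
  finally show ?thesis by simp
qed

lemma a_S: "i \<in> M \<Longrightarrow> j \<in> M \<Longrightarrow> a i * S k j - S k j * a i = V k i j - U k i j"
proof -
  assume i: "i \<in> M" and j: "j \<in> M"
  have e: "fL (a i) * ph k = ph k * fL (a i) + fe i * (al * Psi k)" by (rule fL_pow[OF va i])
  have "a i * S k j = B (ph k * fL (a i)) (fe j * (al * Psi k)) + V k i j"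
    unfolding S_def fB_L_left[symmetric] e fB_lin V_def by (rule refl)
  also have "B (ph k * fL (a i)) (fe j * (al * Psi k)) = B (ph k) (fe j * (fL (a i) * (al * Psi k)))"
    unfolding fB_L_mid fL_fe_left by (rule refl)
  also have "\<dots> = B (ph k) (fe j * (al * Psi k) * fL (a i)) - U k i j"
    unfolding a_al_Psi[OF i] U_def by (simp add: distrib_left right_diff_distrib fB_lin fi_ph_zero mult.assoc)
  also have "B (ph k) (fe j * (al * Psi k) * fL (a i)) = S k j * a i"
    unfolding fB_L_right S_def by (rule refl)
  finally show ?thesis by simp
qed


text \<open>By \<open>Om_vfam\<close> this sum is what the commutator with \<Omega> contributes to
  the recursion. On \<open>P\<close> the row \<open>A i\<close> acts as \<open>Eta i\<close>; on
  \<open>S\<close> its entries first have to cross \<open>ph k\<close>.\<close>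

lemma sum_A_comm:
  assumes i: "i \<in> M"
  shows "(\<Sum>l\<in>M. A i l * (P k l + S k l)) = sc (of_nat k) (P k i + S k i) + sc (m - 2 * of_nat k) (S k i)
     - B (al * (fi i * ph k)) (ph k) - B (ph k) (al * (fi i * ph k))"
proof -
  have eta: "Eta i * (al * Psi k) = sc (of_nat k) (fe i * (al * Psi k)) - al * (fi i * ph k) + al * (ph k * fi i)"
  proof -
    have "Eta i * (al * Psi k) = fe i * (al * Psi k) - al * (Eta i * Psi k)"
      using Eta_Vec[OF va i] by (simp add: left_diff_distrib flip: mult.assoc)
    then show ?thesis
      by (simp add: Eta_Psi[OF i] right_diff_distrib distrib_left sc_mult Vec_fe_left sc_left sc_right)
  qed
  have "(\<Sum>l\<in>M. A i l * P k l) = B (Eta i * (al * Psi k)) (ph k)"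
    unfolding Eta_as_Vec fB_Vec_left P_def by (rule refl)
  then have 1: "(\<Sum>l\<in>M. A i l * P k l) = sc (of_nat k) (P k i) - B (al * (fi i * ph k)) (ph k)"
    unfolding eta by (simp add: fB_lin P_def fi_ph_zero)
  \<comment> \<open>The invariance of \<open>W\<close> under the diagonal action, passed on to its
    powers.\<close>
  have A: "fL (A i l) * ph k = ph k * fL (A i l) + (ph k * (fe i * fi l - fe l * fi i) - (fe i * fi l - fe l * fi i) * ph k)"
    if l: "l \<in> M" for l
  proof -
    have "(fL (A i l) + (fe i * fi l - fe l * fi i)) * W = W * (fL (A i l) + (fe i * fi l - fe l * fi i))"
      by (simp add: fL_A_W[OF i l] algebra_simps fi_W i l fe_W_left)
    then have "(fL (A i l) + (fe i * fi l - fe l * fi i)) * ph k = ph k * (fL (A i l) + (fe i * fi l - fe l * fi i))"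
      by (rule pow_comm)
    then show ?thesis by (simp add: algebra_simps)
  qed
  have "A i l * S k l = B (ph k * fL (A i l)) (fe l * (al * Psi k)) - B (fe i * (fi l * ph k)) (fe l * (al * Psi k))
     + B (fe l * (fi i * ph k)) (fe l * (al * Psi k))" if l: "l \<in> M" for l
  proof -
    have z: "B (ph k * (fe i * fi l)) q = 0" for i l q
      by (simp flip: mult.assoc)
    show ?thesis
      unfolding S_def fB_L_left[symmetric] A[OF l]
      by (simp add: fB_lin right_diff_distrib left_diff_distrib mult.assoc z)
  qed
  then have "(\<Sum>l\<in>M. A i l * S k l) = B (ph k) (Eta i * (al * Psi k)) - S k i
     + sc (m - (2 * of_nat k - 1)) (B (fi i * ph k) (al * Psi k))"
    unfolding Eta_as_Vec fB_Vec_right[of _ "A i"]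
    by (simp add: sum.distrib sum_subtractf sum_fe_fi_S[OF i] fB_Num_left[OF Num_fi_ph[OF i]] cong: sum.cong)
  also have "B (fi i * ph k) (al * Psi k) = S k i"
    by (simp add: fB_fi[OF i] S_def)
  finally have 2: "(\<Sum>l\<in>M. A i l * S k l) = sc (of_nat k) (S k i) - B (ph k) (al * (fi i * ph k)) - S k i
     + sc (m - (2 * of_nat k - 1)) (S k i)"
    unfolding eta by (simp add: fB_lin S_def fi_ph_zero)
  show ?thesis
    by (simp add: distrib_left sum.distrib 1 2 sc_left sc_right algebra_simps)
qed

lemma B_fe_al: "i \<in> M \<Longrightarrow> B (fe i * ph k) (al * ph k) = c k * a i + S k i - B (ph k) (al * (fi i * ph k))"
proof -
  assume i: "i \<in> M"
  have "B (fe i * ph k) (al * ph k) = B (ph k) (fL (a i) * ph k) - B (ph k) (al * (fi i * ph k))"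
    using i by (simp add: fB_fe fi_Vec fB_lin left_diff_distrib flip: mult.assoc)
  also have "B (ph k) (fL (a i) * ph k) = c k * a i + S k i"
    by (simp only: fL_pow[OF va i] fB_lin fB_L_right c_def S_def)
  finally show ?thesis .
qed

lemma B_al_fe: "i \<in> M \<Longrightarrow> B (al * ph k) (fe i * ph k) = a i * c k - B (al * (fi i * ph k)) (ph k)"
proof -
  assume i: "i \<in> M"
  have "B (al * ph k) (fe i * ph k) = B (fL (a i) * ph k) (ph k) - B (al * (fi i * ph k)) (ph k)"
    using i by (simp add: fB_fi[symmetric] fi_Vec fB_lin left_diff_distrib flip: mult.assoc)
  then show ?thesis by (simp add: fB_L_left c_def)
qed

text \<open>By \<open>Pf2_K_key\<close> the left side measures the growth of the squared Pfaffians
  when two indices are added; the right side consists of terms of the recursion. The pairings with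
  \<open>al * (fi i * ph k)\<close>, which have no counterpart there, are eliminated by means of
  \<open>sum_A_comm\<close>.\<close>

lemma key_identity:
  "B (x * ph k) (al * ph k) + B (al * ph k) (x * ph k) - B (x * ph k) (x * ph k) - B (R k) (R k) =
     sc m (H * c k) - H * (H * c k) + sc (of_nat k * of_nat k - m * of_nat k) (c k)
     - (\<Sum>i\<in>M. X i * (X i * c k)) + (\<Sum>i\<in>M. X i * (H * (P k i + S k i)))
     + sc 2 (\<Sum>i\<in>M. X i * (c k * a i)) + sc (2 - m) (\<Sum>i\<in>M. X i * (P k i + S k i))
     + (\<Sum>i\<in>M. X i * (\<Sum>l\<in>M. A i l * (P k l + S k l)))
     - (\<Sum>i\<in>M. \<Sum>j\<in>M. X i * (X j * (V k i j - U k i j)))"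
proof -
  define SS SP SE SA SC where
    "SS = (\<Sum>i\<in>M. X i * S k i)" and
    "SP = (\<Sum>i\<in>M. X i * P k i)" and
    "SE = (\<Sum>i\<in>M. X i * (B (al * (fi i * ph k)) (ph k) + B (ph k) (al * (fi i * ph k))))" and
    "SA = (\<Sum>i\<in>M. X i * (\<Sum>l\<in>M. A i l * (P k l + S k l)))" and
    "SC = (\<Sum>i\<in>M. X i * (c k * a i))"
  have SPS: "(\<Sum>i\<in>M. X i * (P k i + S k i)) = SP + SS"
    by (simp add: SP_def SS_def distrib_left sum.distrib)
  have SA: "SA = sc (of_nat k) (SP + SS) + sc (m - 2 * of_nat k) SS - SE"
    unfolding SA_def
    by (simp only: sum_A_comm cong: sum.cong)
      (simp add: SP_def SS_def SE_def distrib_left right_diff_distrib sum.distrib sum_subtractf sc_mult sc_sum sc_right)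
  have *: "B (fe i * ph k) (al * ph k) + B (al * ph k) (fe i * ph k) =
      sc 2 (c k * a i) + P k i + sc 2 (S k i) - (B (al * (fi i * ph k)) (ph k) + B (ph k) (al * (fi i * ph k)))"
    if i: "i \<in> M" for i
    using a_c[OF i, of k] by (simp add: B_fe_al[OF i] B_al_fe[OF i] sc_2 algebra_simps)
  have "B (x * ph k) (al * ph k) + (\<Sum>i\<in>M. X i * B (al * ph k) (fe i * ph k))
     = (\<Sum>i\<in>M. X i * (sc 2 (c k * a i) + P k i + sc 2 (S k i) -
          (B (al * (fi i * ph k)) (ph k) + B (ph k) (al * (fi i * ph k)))))"
    unfolding fB_Vec_left[of X] sum.distrib[symmetric] distrib_left[symmetric] by (intro sum.cong refl) (simp only: *)
  also have "\<dots> = sc 2 SC + SP + sc 2 SS - SE"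
    by (simp add: SC_def SP_def SS_def SE_def distrib_left right_diff_distrib sum.distrib sum_subtractf
      sc_mult sc_sum)
  finally have 1: "B (x * ph k) (al * ph k) + B (al * ph k) (x * ph k) = sc 2 SC + SP + sc 2 SS - SE
     + sc (m - 2 * of_nat k) (H * c k - sc (of_nat k) (c k) - SP)"
    by (simp add: B_al_x B_R_ph SP_def flip: add.assoc)
  have 2: "(\<Sum>i\<in>M. \<Sum>j\<in>M. X i * (X j * (V k i j - U k i j))) =
     (\<Sum>i\<in>M. \<Sum>j\<in>M. X i * (X j * V k i j)) - (\<Sum>i\<in>M. \<Sum>j\<in>M. X i * (X j * U k i j))"
    by (simp add: right_diff_distrib sum_subtractf)
  have tw: "sc (2 * d) y = sc d y + sc d y" for d and y :: 'a
    by (simp only: mult_2 sc_add_left)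
  have kk: "sc (of_nat k * of_nat k) (c k) = sc (of_nat k) (sc (of_nat k) (c k))"
      "sc (m * of_nat k) (c k) = sc m (sc (of_nat k) (c k))"
    by (simp_all add: sc_sc)
  show ?thesis
    unfolding 1 B_x_x B_R_R 2 SPS SA_def[symmetric] SC_def[symmetric] SS_def[symmetric] SA c_H[symmetric]
      sc_left sc_right tw kk
    by (simp add: algebra_simps)
qed


end

section \<open>The Pfaffian formula and its recursion\<close>

definition nul :: "'a::ring_1 fop \<Rightarrow> bool" where "nul y \<longleftrightarrow> fop_app y vac = (\<lambda>I. 0)"

lemma nul_mult: "nul y \<Longrightarrow> nul (g * y)"
  by (simp add: nul_def fop_app_0)

lemma nul_fi: "nul (g * fi r)" "nul (fi r)"
  using fi_vac[of g r] fi_vac[of 1 r] by (simp_all add: nul_def)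

lemma nul_lin: "nul x \<Longrightarrow> nul y \<Longrightarrow> nul (x + y)" "nul x \<Longrightarrow> nul y \<Longrightarrow> nul (x - y)" "nul x \<Longrightarrow> nul (- x)"
  by (auto simp: nul_def fun_eq_iff)

lemma fB_nul: "nul y \<Longrightarrow> fB G f y = 0" "nul y \<Longrightarrow> fB G y f = 0"
  by (simp_all add: nul_def fB_def)

text \<open>\<open>nul (fi r * f)\<close> says that f applied to \<open>vac\<close> does not involve
  the index r. Vectors with and without r are orthogonal, and \<open>fe r\<close> preserves the
  pairing of those without.\<close>

lemma fB_fe_nul:
  assumes "finite G" "r \<in> G" "nul (fi r * f)"
  shows "fB G f (fe r * g) = 0" "fB G (fe r * g) f = 0" "fB G (fe r * f) (fe r * g) = fB G f g"
proof -
  show "fB G f (fe r * g) = 0" "fB G (fe r * g) f = 0"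
    using assms by (simp_all add: fB_fe_left fB_nul flip: fB_fi_left')
  have "fB G (fe r * f) (fe r * g) = fB G (fi r * (fe r * f)) g"
    using assms by (simp add: fB_fi_left')
  also have "\<dots> = fB G f g"
    using assms(3) by (simp add: fi_fe_left fB_diff_left fB_nul nul_mult)
  finally show "fB G (fe r * f) (fe r * g) = fB G f g" .
qed

definition supp_card :: "nat set \<Rightarrow> nat \<Rightarrow> (nat set \<Rightarrow> 'a::ring_1) \<Rightarrow> bool" where
  "supp_card M k v \<longleftrightarrow> (\<forall>I. v I \<noteq> 0 \<longrightarrow> finite I \<and> I \<subseteq> M \<and> card I = k)"

definition raises :: "nat set \<Rightarrow> nat \<Rightarrow> 'a::ring_1 fop \<Rightarrow> bool" where
  "raises M d T \<longleftrightarrow> (\<forall>v k. supp_card M k v \<longrightarrow> supp_card M (k + d) (fop_app T v))"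

lemma raises_fe: "i \<in> M \<Longrightarrow> raises M 1 (fe i)"
  unfolding raises_def supp_card_def app_fe
proof (intro allI impI)
  fix v :: "nat set \<Rightarrow> 'a" and k I
  assume i: "i \<in> M" and v: "\<forall>I. v I \<noteq> 0 \<longrightarrow> finite I \<and> I \<subseteq> M \<and> card I = k"
    and nz: "(if i \<in> I then sg i I * v (I - {i}) else 0) \<noteq> 0"
  then have "i \<in> I" "v (I - {i}) \<noteq> 0" by (auto split: if_splits)
  with v have "finite (I - {i})" "I - {i} \<subseteq> M" "card (I - {i}) = k" by blast+
  with i \<open>i \<in> I\<close> show "finite I \<and> I \<subseteq> M \<and> card I = k + 1"
    using card_Suc_Diff1[of I i] by auto
qed

lemma raises_fL: "raises M 0 (fL a)"
  unfolding raises_def supp_card_def by (auto dest: mult_not_zero)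

lemma raises_mult: "raises M d S \<Longrightarrow> raises M e T \<Longrightarrow> raises M (e + d) (S * T)"
  unfolding raises_def by (simp add: add.assoc[symmetric])

lemma raises_add: "raises M d S \<Longrightarrow> raises M d T \<Longrightarrow> raises M d (S + T)"
  unfolding raises_def supp_card_def
proof (intro allI impI)
  fix v k I
  assume S: "\<forall>v k. (\<forall>I. v I \<noteq> 0 \<longrightarrow> finite I \<and> I \<subseteq> M \<and> card I = k) \<longrightarrow>
      (\<forall>I. fop_app S v I \<noteq> 0 \<longrightarrow> finite I \<and> I \<subseteq> M \<and> card I = k + d)"
    and T: "\<forall>v k. (\<forall>I. v I \<noteq> 0 \<longrightarrow> finite I \<and> I \<subseteq> M \<and> card I = k) \<longrightarrow>
      (\<forall>I. fop_app T v I \<noteq> 0 \<longrightarrow> finite I \<and> I \<subseteq> M \<and> card I = k + d)"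
    and v: "\<forall>I. v I \<noteq> 0 \<longrightarrow> finite I \<and> I \<subseteq> M \<and> card I = k"
    and nz: "fop_app (S + T) v I \<noteq> 0"
  from nz have "fop_app S v I \<noteq> 0 \<or> fop_app T v I \<noteq> 0" by auto
  then show "finite I \<and> I \<subseteq> M \<and> card I = k + d"
    using S[rule_format, OF v[rule_format]] T[rule_format, OF v[rule_format]] by blast
qed

lemma raises_0: "raises M d 0"
  unfolding raises_def supp_card_def by simp

lemma raises_sum: "(\<And>i. i \<in> S \<Longrightarrow> raises M d (f i)) \<Longrightarrow> raises M d (sum f S)"
  by (induct S rule: infinite_finite_induct) (auto simp: raises_0 raises_add)

context so_alg begin

lemma raises_W: "raises M 2 W"
proof -
  have "raises M 2 (fe i * fe j * fL a)" if "i \<in> M" "j \<in> M" for i j and a :: 'a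
    using raises_mult[OF raises_mult[OF raises_fe[OF that(1)] raises_fe[OF that(2)]] raises_fL[of M a]] by (simp add: numeral_2_eq_2)
  then have "raises M 2 (\<Sum>i\<in>M. \<Sum>j\<in>M. fe i * fe j * fL (A i j))"
    by (intro raises_sum)
  then show ?thesis
    using raises_mult[OF raises_fL[of M "cs (1/2) :: 'a"]] by (simp add: W_def)
qed

text \<open>\<open>W\<close> raises the degree by 2, and there are no sets of more than
  \<open>card M\<close> indices. This ends the telescoping in \<open>C_elem_step\<close>.\<close>

lemma W_pow_zero: "card M < 2 * k \<Longrightarrow> fB G (W ^ k) (W ^ k) = 0"
proof -
  assume k: "card M < 2 * k"
  have "supp_card M 0 (vac :: nat set \<Rightarrow> 'a)" by (simp add: supp_card_def vac_def)
  then have "supp_card M (2 * k) (fop_app (W ^ k) vac)"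
  proof (induct k)
    case (Suc k)
    then show ?case
      using raises_W unfolding raises_def by (simp add: numeral_2_eq_2)
  qed simp
  then have "fop_app (W ^ k) vac I = 0" for I
    using k card_mono[OF fin, of I] unfolding supp_card_def by (cases "fop_app (W ^ k) vac I = 0") auto
  then show ?thesis by (simp add: fB_def)
qed

definition Pf2 :: "nat set \<Rightarrow> nat \<Rightarrow> 'a" where
  "Pf2 G k = fB G (W ^ k) (W ^ k)"

lemma A_Pf2:
  assumes G: "finite G" "M \<subseteq> G" and i: "i \<in> M" and l: "l \<in> M"
  shows "A i l * Pf2 G k = Pf2 G k * A i l"
proof -
  let ?D = "fe i * fi l - fe l * fi i :: 'a fop"
  have "(fL (A i l) + ?D) * W = W * (fL (A i l) + ?D)"
    by (simp add: fL_A_W[OF i l] algebra_simps fi_W i l fe_W_left)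
  then have "(fL (A i l) + ?D) * W ^ k = W ^ k * (fL (A i l) + ?D)"
    by (rule pow_comm)
  then have c: "fL (A i l) * W ^ k = W ^ k * fL (A i l) + W ^ k * ?D - ?D * W ^ k"
    by (simp only: distrib_left distrib_right) (simp add: algebra_simps)
  have z: "fB G (W ^ k * ?D) q = 0" "fB G q (W ^ k * ?D) = 0" for q
    unfolding right_diff_distrib fB_diff_left fB_diff_right mult.assoc[symmetric] by simp_all
  have adj: "fB G (fe i * (fi l * p)) q = fB G p (fe l * (fi i * q))" if "i \<in> M" "l \<in> M" for i l p q
    using G that by (simp add: fB_fe_left fB_fi_left' subset_iff)
  have skew: "fB G (?D * p) q = - fB G p (?D * q)" for p q
    using i l by (simp add: left_diff_distrib fB_diff_left fB_diff_right mult.assoc adj)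
  have c1: "fB G (fL (A i l) * W ^ k) q = fB G (W ^ k * fL (A i l)) q - fB G (?D * W ^ k) q"
    and c2: "fB G q (fL (A i l) * W ^ k) = fB G q (W ^ k * fL (A i l)) - fB G q (?D * W ^ k)" for q
    by (simp_all only: c fB_add_left fB_diff_left fB_add_right fB_diff_right z) simp_all
  have "A i l * Pf2 G k = fB G (W ^ k * fL (A i l)) (W ^ k) - fB G (?D * W ^ k) (W ^ k)"
    by (simp only: Pf2_def c1 flip: fB_L_left)
  also have "\<dots> = fB G (W ^ k) (fL (A i l) * W ^ k) + fB G (W ^ k) (?D * W ^ k)"
    by (simp only: skew fB_L_mid) simp
  also have "\<dots> = Pf2 G k * A i l"
    by (simp only: c2 Pf2_def fB_L_right) simp
  finally show ?thesis .
qed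

lemma vfam_commutator:
  assumes v: "vfam v" and c: "\<And>i l. i \<in> M \<Longrightarrow> l \<in> M \<Longrightarrow> A i l * c = c * A i l"
  shows "vfam (\<lambda>i. v i * c - c * v i)"
  unfolding vfam_def
proof (intro ballI)
  fix j l i assume *: "j \<in> M" "l \<in> M" "i \<in> M"
  have e: "A j l * v i = v i * A j l + ((if l = i then v j else 0) - (if j = i then v l else 0))"
    using vfamD[OF v *] by simp
  have "A j l * (v i * c - c * v i) - (v i * c - c * v i) * A j l
      = (A j l * v i) * c - c * (A j l * v i) - (v i * A j l) * c + c * (v i * A j l)"
  proof -
    have "A j l * c = c * A j l" by (rule c[OF *(1,2)])
    moreover from this have "A j l * (c * y) = c * (A j l * y)" for y by (simp flip: mult.assoc)
    ultimately show ?thesis by (simp add: algebra_simps)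
  qed
  also have "\<dots> = (if l = i then v j * c - c * v j else 0) - (if j = i then v l * c - c * v l else 0)"
    unfolding e by (auto simp: algebra_simps)
  finally show "A j l * (v i * c - c * v i) - (v i * c - c * v i) * A j l
      = (if l = i then v j * c - c * v j else 0) - (if j = i then v l * c - c * v l else 0)" .
qed

lemma vfam_lin:
  assumes "vfam v" "vfam w"
  shows "vfam (\<lambda>i. v i + sc c (w i))"
  unfolding vfam_def
proof (intro ballI)
  fix j l i assume *: "j \<in> M" "l \<in> M" "i \<in> M"
  have "A j l * (v i + sc c (w i)) - (v i + sc c (w i)) * A j l
      = (A j l * v i - v i * A j l) + sc c (A j l * w i - w i * A j l)"
    by (simp add: algebra_simps sc_mult sc_right)
  also have "\<dots> = ((if l = i then v j else 0) - (if j = i then v l else 0))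
      + sc c ((if l = i then w j else 0) - (if j = i then w l else 0))"
    using assms * unfolding vfam_def by simp
  finally show "A j l * (v i + sc c (w i)) - (v i + sc c (w i)) * A j l
      = (if l = i then v j + sc c (w j) else 0) - (if j = i then v l + sc c (w l) else 0)"
    by (simp add: sc_right)
qed

definition Om :: 'a where "Om = (\<Sum>j\<in>M. \<Sum>i\<in>{i \<in> M. i < j}. A j i ^ 2)"

lemma Om_double: "Om + Om = (\<Sum>j\<in>M. \<Sum>i\<in>M. A j i * A j i)"
proof -
  have "Om = (\<Sum>j\<in>M. \<Sum>i\<in>M. if i < j then A j i * A j i else 0)"
    unfolding Om_def power2_eq_square using fin by (intro sum.cong refl sum.inter_filter) auto
  moreover have "(\<Sum>j\<in>M. \<Sum>i\<in>M. if i < j then A j i * A j i else 0) = (\<Sum>j\<in>M. \<Sum>i\<in>M. if j < i then A j i * A j i else 0)"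
    unfolding sum.swap[of "\<lambda>j i. if i < j then A j i * A j i else 0" M M]
  proof (intro sum.cong refl)
    fix i j assume "i \<in> M" "j \<in> M"
    from skewA[OF this] show "(if i < j then A j i * A j i else 0) = (if i < j then A i j * A i j else 0)"
      by simp
  qed
  ultimately have "Om + Om = (\<Sum>j\<in>M. \<Sum>i\<in>M. (if i < j then A j i * A j i else 0) + (if j < i then A j i * A j i else 0))"
    by (simp add: sum.distrib)
  also have "\<dots> = (\<Sum>j\<in>M. \<Sum>i\<in>M. A j i * A j i)"
  proof (intro sum.cong refl)
    fix j i assume "j \<in> M" "i \<in> M"
    then show "(if i < j then A j i * A j i else 0) + (if j < i then A j i * A j i else 0) = A j i * A j i"
      by (cases i j rule: linorder_cases) auto
  qed
  finally show ?thesis .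
qed

text \<open>Commuting a sum of squares with \<open>v s\<close> leaves anticommutators of
  \<open>A s l\<close> and \<open>v l\<close>. Ordering each of them costs one \<open>v s\<close>,
  except for l = s, where \<open>A s s\<close> is 0; hence the factor
  \<open>card M - 1\<close>.\<close>

lemma Om_vfam:
  assumes v: "vfam v" and s: "s \<in> M"
  shows "Om * v s - v s * Om = sc (of_nat (card M) - 1) (v s) - sc 2 (\<Sum>l\<in>M. A s l * v l)"
proof (rule calg_double_cancel)
  have vA: "v l * A s l = A s l * v l - v s + (if s = l then v l else 0)" if "l \<in> M" for l
    using vfamD[OF v s that that] by simp
  have *: "A j l * A j l * v s - v s * (A j l * A j l) =
      (if l = s then A j l * v j + v j * A j l else 0) - (if j = s then A j l * v l + v l * A j l else 0)"
    if "j \<in> M" "l \<in> M" for j l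
  proof -
    have e: "A j l * v s = v s * A j l + ((if l = s then v j else 0) - (if j = s then v l else 0))"
      using vfamD[OF v that s] by simp
    have "A j l * A j l * v s - v s * (A j l * A j l) = A j l * (A j l * v s) - v s * A j l * A j l"
      by (simp add: mult.assoc)
    also have "\<dots> = (A j l * v s) * A j l + A j l * ((if l = s then v j else 0) - (if j = s then v l else 0)) - v s * A j l * A j l"
      by (subst e) (simp add: algebra_simps)
    also have "\<dots> = ((if l = s then v j else 0) - (if j = s then v l else 0)) * A j l
        + A j l * ((if l = s then v j else 0) - (if j = s then v l else 0))"
      unfolding e by (simp add: algebra_simps)
    finally show ?thesis by (auto simp: algebra_simps)
  qed
  have "(Om + Om) * v s - v s * (Om + Om) =
      (\<Sum>j\<in>M. \<Sum>l\<in>M. (if l = s then A j l * v j + v j * A j l else 0) - (if j = s then A j l * v l + v l * A j l else 0))"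
    unfolding Om_double sum_distrib_left sum_distrib_right sum_subtractf[symmetric]
    by (intro sum.cong refl *)
  also have "\<dots> = (\<Sum>j\<in>M. A j s * v j + v j * A j s) - (\<Sum>l\<in>M. A s l * v l + v l * A s l)"
    using s fin by (simp add: sum_subtractf sum_if_out)
  also have "(\<Sum>j\<in>M. A j s * v j + v j * A j s) = - (\<Sum>l\<in>M. A s l * v l + v l * A s l)"
    unfolding sum_negf[symmetric] by (intro sum.cong refl) (simp add: skewA[OF s])
  also have "(\<Sum>l\<in>M. A s l * v l + v l * A s l) = sc 2 (\<Sum>l\<in>M. A s l * v l) - sc (of_nat (card M) - 1) (v s)"
    using s fin by (simp add: vA sum.distrib sum_subtractf sum_const_sc sc_left del: sum_constant cong: sum.cong)
  finally show "Om * v s - v s * Om + (Om * v s - v s * Om) =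
      sc (of_nat (card M) - 1) (v s) - sc 2 (\<Sum>l\<in>M. A s l * v l) +
      (sc (of_nat (card M) - 1) (v s) - sc 2 (\<Sum>l\<in>M. A s l * v l))"
    by (simp add: algebra_simps)
qed


end

text \<open>The telescoping in \<open>C_elem_step\<close> asks for the two rules
  \<open>dcoef_shift\<close> and \<open>dcoef_step\<close>; this product satisfies them. For
  \<open>k = n div 2\<close> it is empty.\<close>

definition dcoef :: "nat \<Rightarrow> nat \<Rightarrow> complex \<Rightarrow> complex" where
  "dcoef n k u = (\<Prod>j\<in>{k+1..n div 2}. u\<^sup>2 - (of_nat n / 2 - of_nat j)\<^sup>2)"

lemma dcoef_shift: "dcoef (n + 2) (k + 1) u = dcoef n k u"
proof -
  have "dcoef n k u = (\<Prod>j\<in>{k+2..(n + 2) div 2}. u\<^sup>2 - (of_nat n / 2 - of_nat (j - 1))\<^sup>2)"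
    unfolding dcoef_def by (rule prod.reindex_bij_witness[of _ "\<lambda>j. j - 1" "\<lambda>j. j + 1"]) auto
  also have "\<dots> = dcoef (n + 2) (k + 1) u"
    unfolding dcoef_def by (rule prod.cong) (auto simp: of_nat_diff add_divide_distrib algebra_simps)
  finally show ?thesis by simp
qed

lemma dcoef_step:
  assumes "k \<le> n div 2"
  shows "dcoef (n + 2) k u = (u\<^sup>2 - (of_nat n / 2 - of_nat k)\<^sup>2) * dcoef n k u"
proof -
  have "{k+1..(n + 2) div 2} = insert (k+1) {k+1+1..(n + 2) div 2}" using assms by auto
  then have "dcoef (n + 2) k u = (u\<^sup>2 - (of_nat (n + 2) / 2 - of_nat (k + 1))\<^sup>2) * dcoef (n + 2) (k + 1) u"
    unfolding dcoef_def by simp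
  then show ?thesis unfolding dcoef_shift by (simp add: add_divide_distrib)
qed

text \<open>With the usual normalization of the Pfaffian, every component of \<open>W ^ k\<close> on
  \<open>vac\<close> carries a factor k!, which \<open>(fact k)\<^sup>2\<close> removes from the
  pairing. No order of the elements of K enters, in contrast to the recursion.\<close>

definition C_elem :: "nat set \<Rightarrow> (nat \<Rightarrow> nat \<Rightarrow> 'a::calg) \<Rightarrow> nat set \<Rightarrow> complex \<Rightarrow> 'a" where
  "C_elem G A K u = (\<Sum>k\<le>card K div 2. sc (dcoef (card K) k u / (fact k)\<^sup>2) (so_alg.Pf2 A K G k))"

lemma (in so_alg) A_C_elem:
  "finite G \<Longrightarrow> M \<subseteq> G \<Longrightarrow> i \<in> M \<Longrightarrow> l \<in> M \<Longrightarrow> A i l * C_elem G A M u = C_elem G A M u * A i l"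
  unfolding C_elem_def sum_distrib_left sum_distrib_right
  by (intro sum.cong refl) (simp add: sc_mult A_Pf2)

text \<open>The indices p and q take the places of n - 1 and n. They may be any two indices in
  either order, so that pairs can later be removed in the order that the Borel subalgebra
  dictates.\<close>

locale so_pair =
  fixes A :: "nat \<Rightarrow> nat \<Rightarrow> 'a::calg" and M :: "nat set" and p q :: nat and G :: "nat set"
  assumes so_K: "so_alg A (insert p (insert q M))"
    and pq: "p \<noteq> q" "p \<notin> M" "q \<notin> M"
    and G: "finite G" "insert p (insert q M) \<subseteq> G"
begin

sublocale K: so_alg A "insert p (insert q M)" by (rule so_K)

sublocale M: so_alg A M
proof
  show "finite M" using K.fin by simp
  show "A j i = - A i j" if "i \<in> M" "j \<in> M" for i j using K.skewA that by blast
qed (use K.brA in blast)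

abbreviation X where "X i \<equiv> A p i + sc \<i> (A q i)"
abbreviation H where "H \<equiv> sc \<i> (A q p)"

lemma ii: "sc \<i> (sc \<i> y) = - y"
  by (simp add: sc_sc sc_minus_left)

lemma pi: "i \<in> M \<Longrightarrow> (p = i) = False" "i \<in> M \<Longrightarrow> (i = p) = False" "i \<in> M \<Longrightarrow> (q = i) = False" "i \<in> M \<Longrightarrow> (i = q) = False"
   "(p = q) = False" "(q = p) = False"
  using pq by auto

lemma vfam_p: "M.vfam (A p)" and vfam_q: "M.vfam (A q)"
  unfolding M.vfam_def by (auto simp: K.brA pi)

lemma vfam_X: "M.vfam X"
  by (rule M.vfam_lin vfam_p vfam_q)+

lemma aa: "i \<in> M \<Longrightarrow> j \<in> M \<Longrightarrow> A p i * A p j - A p j * A p i = - A i j"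
  by (subst K.brA) (auto simp: pi)

lemma bb: "i \<in> M \<Longrightarrow> j \<in> M \<Longrightarrow> A q i * A q j - A q j * A q i = - A i j"
  by (subst K.brA) (auto simp: pi)

lemma ba: "i \<in> M \<Longrightarrow> j \<in> M \<Longrightarrow> A q i * A p j - A p j * A q i = - (if i = j then A q p else 0)"
  using K.skewA[of q p] by (subst K.brA) (auto simp: pi)

lemma Xa: "i \<in> M \<Longrightarrow> j \<in> M \<Longrightarrow> X i * A p j - A p j * X i = - A i j - (if i = j then H else 0)"
proof -
  assume ij: "i \<in> M" "j \<in> M"
  have "X i * A p j - A p j * X i = (A p i * A p j - A p j * A p i) + sc \<i> (A q i * A p j - A p j * A q i)"
    by (simp add: algebra_simps sc_mult sc_right)
  then show ?thesis by (simp add: aa ba ij sc_minus_right)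
qed

lemma XX: "i \<in> M \<Longrightarrow> j \<in> M \<Longrightarrow> X i * X j = X j * X i"
proof -
  assume ij: "i \<in> M" "j \<in> M"
  have "X i * X j - X j * X i = (A p i * A p j - A p j * A p i) - (A q i * A q j - A q j * A q i)
     + sc \<i> (A q i * A p j - A p j * A q i) - sc \<i> (A q j * A p i - A p i * A q j)"
    by (simp add: algebra_simps sc_mult sc_right ii)
  also have "\<dots> = 0" using ij by (simp add: aa bb ba)
  finally show ?thesis by simp
qed

lemma Hp: "i \<in> M \<Longrightarrow> A q p * A p i - A p i * A q p = A q i"
  by (subst K.brA) (auto simp: pi)

lemma Hq: "i \<in> M \<Longrightarrow> A q p * A q i - A q i * A q p = - A p i"
  by (subst K.brA) (auto simp: pi)

lemma HX: "i \<in> M \<Longrightarrow> H * X i = X i * H + X i"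
proof -
  assume i: "i \<in> M"
  have "H * X i - X i * H = sc \<i> (A q p * A p i - A p i * A q p) - (A q p * A q i - A q i * A q p)"
    by (simp add: algebra_simps sc_mult sc_right ii)
  then show ?thesis by (simp add: Hp Hq i algebra_simps)
qed

lemma Ha: "i \<in> M \<Longrightarrow> H * A p i = A p i * H + X i - A p i"
  using Hp[of i] by (simp add: algebra_simps sc_mult flip: sc_add_right)

lemma A_qp_M: "i \<in> M \<Longrightarrow> j \<in> M \<Longrightarrow> A q p * A i j = A i j * A q p"
  using K.brA[of q p i j] by (auto simp: pi)

sublocale key_alg A M X "A p" H G
proof
  show "finite G" "M \<subseteq> G" using G by auto
  show "M.vfam X" "M.vfam (A p)" by (rule vfam_X vfam_p)+
  fix i j assume ij: "i \<in> M" "j \<in> M"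
  show "X i * X j = X j * X i" using ij by (rule XX)
  show "X i * A p j - A p j * X i = - A i j - (if i = j then H else 0)" using ij by (rule Xa)
  show "A p i * A p j - A p j * A p i = - A i j" using ij by (rule aa)
  show "H * A i j = A i j * H" by (simp add: sc_mult A_qp_M ij)
next
  fix i assume "i \<in> M"
  then show "H * X i = X i * H + X i" "H * A p i = A p i * H + X i - A p i" by (rule HX Ha)+
qed


abbreviation be where "be \<equiv> M.Vec (A q)"
text \<open>\<open>th\<close> is the part of the full \<open>W\<close> that involves p or q, and
  \<open>ta\<close> is half of its square, see \<open>th_th\<close>.\<close>

definition th where "th = fe p * al + fe q * be + fe q * (fe p * fL (A q p))"
definition ta where "ta = fe q * (fe p * (al * be))"

lemma K_W: "K.W = M.W + th"
proof (rule calg_double_cancel)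
  let ?f = "\<lambda>i j. fe i * fe j * fL (A i j)"
  have sym: "?f i j = ?f j i" if "i \<in> insert p (insert q M)" "j \<in> insert p (insert q M)" for i j
    by (subst K.skewA[OF that], subst fe_anti) (simp add: fL_minus)
  have "K.W + K.W = ?f p p + ?f p q + (\<Sum>j\<in>M. ?f p j) + (?f q p + ?f q q + (\<Sum>j\<in>M. ?f q j))
      + (\<Sum>i\<in>M. ?f i p + ?f i q + (\<Sum>j\<in>M. ?f i j))"
    unfolding K.W2 using M.fin pq by (simp add: algebra_simps)
  also have "(\<Sum>i\<in>M. ?f i p + ?f i q + (\<Sum>j\<in>M. ?f i j)) = (\<Sum>j\<in>M. ?f p j) + (\<Sum>j\<in>M. ?f q j) + (M.W + M.W)"
    unfolding M.W2 sum.distrib[symmetric]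
    by (intro sum.cong refl arg_cong2[of _ _ _ _ "(+)"] sym) auto
  also have "?f p q = ?f q p" by (rule sym) auto
  also have "(\<Sum>j\<in>M. ?f p j) = fe p * al"
    by (simp add: M.Vec_def sum_distrib_left mult.assoc)
  also have "(\<Sum>j\<in>M. ?f q j) = fe q * be"
    by (simp add: M.Vec_def sum_distrib_left mult.assoc)
  finally show "K.W + K.W = (M.W + th) + (M.W + th)"
    by (simp add: th_def algebra_simps)
qed

text \<open>The commutators of the two rows form a diagonal matrix, which
  \<open>fe i * fe i = 0\<close> makes invisible.\<close>

lemma be_al: "be * al = - (al * be)"
proof -
  have "al * be + be * al = (\<Sum>i\<in>M. \<Sum>j\<in>M. 0)"
    unfolding M.Vec_Vec
  proof (intro sum.cong refl)
    fix i j assume ij: "i \<in> M" "j \<in> M"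
    have "A p i * A q j - A q j * A p i = (if j = i then A q p else 0)"
      using arg_cong[OF ba[OF ij(2,1)], of uminus] by simp
    then show "fe i * fe j * fL (A p i * A q j - A q j * A p i) = 0"
      by simp
  qed
  then show ?thesis by (simp add: eq_neg_iff_add_eq_0 add.commute)
qed

lemma D_W: "fL (A q p) * M.W = M.W * fL (A q p)"
  by (rule M.fL_W_comm) (simp add: A_qp_M)

lemma Vec_W_left: "M.vfam v \<Longrightarrow> M.Vec v * (M.W * y) = M.W * (M.Vec v * y)"
  by (simp add: M.Vec_W flip: mult.assoc)

lemma th_W: "th * M.W = M.W * th"
  by (simp add: th_def distrib_left distrib_right mult.assoc M.Vec_W vfam_p vfam_q D_W M.fe_W_left)

lemma ta_W: "ta * M.W = M.W * ta"
  by (simp add: ta_def mult.assoc M.Vec_W vfam_p vfam_q M.fe_W_left Vec_W_left)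

lemma th_th: "th * th = ta + ta"
  by (simp add: th_def ta_def distrib_left distrib_right mult.assoc Vec_fe_left fL_fe_left be_al)
    (simp add: fe_fe_left[of p q])

lemma th_ta: "th * ta = 0"
  by (simp add: th_def ta_def distrib_left distrib_right mult.assoc Vec_fe_left fL_fe_left)

text \<open>The Taylor expansion of the k-th power at \<open>M.W\<close>, valid because
  \<open>th\<close> commutes with \<open>M.W\<close>; it stops after the second order because
  \<open>th * ta = 0\<close>.\<close>

lemma K_pow: "K.W ^ k = M.W ^ k + th * M.Psi k + ta * M.Chi k"
proof (induct k)
  case (Suc k)
  have c: "M.W * (th * y) = th * (M.W * y)" "M.W * (ta * y) = ta * (M.W * y)" for y
    by (simp_all add: th_W ta_W flip: mult.assoc)
  have "K.W ^ Suc k = (M.W + th) * (M.W ^ k + th * M.Psi k + ta * M.Chi k)"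
    by (simp only: power_Suc Suc) (simp only: K_W)
  also have "\<dots> = M.W ^ Suc k + th * (M.W ^ k + M.W * M.Psi k) + (th * th) * M.Psi k + ta * (M.W * M.Chi k)
      + (th * ta) * M.Chi k"
    by (simp add: distrib_left distrib_right mult.assoc c)
  also have "\<dots> = M.W ^ Suc k + th * M.Psi (Suc k) + ta * M.Chi (Suc k)"
    by (simp add: M.Psi_Suc M.Chi_Suc th_th th_ta algebra_simps)
  finally show ?case .
qed simp

lemma fi_out_Vec: "r \<notin> M \<Longrightarrow> fi r * (M.Vec v * y) = - (M.Vec v * (fi r * y))"
proof -
  assume r: "r \<notin> M"
  have "fi r * M.Vec v = - (M.Vec v * fi r)"
    unfolding M.Vec_def sum_distrib_left sum_distrib_right sum_negf[symmetric]
    using r by (intro sum.cong refl) (auto simp: fi_fe_left mult.assoc fL_fi)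
  then show ?thesis by (simp flip: mult.assoc)
qed

lemma fi_out_W: "r \<notin> M \<Longrightarrow> fi r * M.W = M.W * fi r"
proof (rule calg_double_cancel)
  assume r: "r \<notin> M"
  have "fi r * (M.W + M.W) = (M.W + M.W) * fi r"
    unfolding M.W2 sum_distrib_left sum_distrib_right
    using r by (intro sum.cong refl) (auto simp: fi_fe_left mult.assoc fL_fi)
  then show "fi r * M.W + fi r * M.W = M.W * fi r + M.W * fi r" by (simp add: algebra_simps)
qed

lemma nul_W: "r \<notin> M \<Longrightarrow> nul (fi r * M.W ^ k)"
  by (simp add: M.pow_comm[OF fi_out_W] nul_fi)

lemma nul_Psi: "r \<notin> M \<Longrightarrow> nul (fi r * M.Psi k)"
  by (simp add: M.Psi_comm[OF fi_out_W] nul_fi)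

lemma nul_Vec: "r \<notin> M \<Longrightarrow> nul (fi r * y) \<Longrightarrow> nul (fi r * (M.Vec v * y))"
  by (simp add: fi_out_Vec nul_lin nul_mult)

lemma nul_fL: "nul (fi r * y) \<Longrightarrow> nul (fi r * (fL b * y))"
  by (simp add: nul_mult flip: fL_fi_left)

lemma nul_fe: "r \<noteq> s \<Longrightarrow> nul (fi r * y) \<Longrightarrow> nul (fi r * (fe s * y))"
  by (simp add: fi_fe_left nul_lin nul_mult)

definition Q where "Q k = fL (A q p) * M.W ^ k + al * (be * M.Psi k)"

text \<open>The components of the power with neither p nor q, with p alone, with q alone and with
  both are orthogonal, so the pairing splits into four pairings over M.\<close>

lemma Pf2_K:
  "K.Pf2 G (Suc k) = M.Pf2 G (Suc k) + sc ((of_nat (Suc k))\<^sup>2)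
     (B (al * M.W ^ k) (al * M.W ^ k) + B (be * M.W ^ k) (be * M.W ^ k) + B (Q k) (Q k))"
proof -
  let ?s = "of_nat (Suc k) :: complex"
  have c: "M.Chi (Suc k) = sc ?s (M.Psi k)"
    by (simp add: M.Chi_def M.Psi_def sc_sc)
  have K: "K.W ^ Suc k = M.W ^ Suc k + sc ?s (fe p * (al * M.W ^ k) + fe q * (be * M.W ^ k) + fe q * (fe p * Q k))"
    unfolding K_pow c by (simp add: M.Psi_def[of "Suc k"] th_def ta_def Q_def distrib_right distrib_left mult.assoc sc_mult sc_right)
  have pG: "p \<in> G" "q \<in> G" using G by auto
  have nQ: "nul (fi r * Q k)" if "r \<notin> M" for r
    unfolding Q_def distrib_left using that by (intro nul_lin nul_fL nul_W nul_Vec nul_Psi)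
  note n = nul_W[OF pq(2)] nul_W[OF pq(3)] nul_Vec[OF pq(2) nul_W[OF pq(2)]] nul_Vec[OF pq(3) nul_W[OF pq(3)]]
    nQ[OF pq(2)] nQ[OF pq(3)]
  note n2 = nul_fe[OF pq(1)[symmetric] nul_Vec[OF pq(3) nul_W[OF pq(3)]]] nul_fe[OF pq(1)[symmetric] nQ[OF pq(3)]]
  note fpq = fB_fe_nul[OF G(1) pG(1)] fB_fe_nul[OF G(1) pG(2)]
  show ?thesis
    unfolding K.Pf2_def M.Pf2_def K
    by (simp only: fB_lin sc_right fpq n n2 sc_sc add_0_left add_0_right sc_0_right power2_eq_square)
qed

text \<open>The definition of \<open>X i\<close> solved for the second row, so that only
  \<open>x\<close> and \<open>al\<close> remain.\<close>

lemma be_al_x: "be = sc (- \<i>) (x - al)"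
  unfolding M.Vec_def sum_subtractf[symmetric] sc_sum
  by (intro sum.cong refl) (simp add: fL_add fL_sc sc_mult sc_right sc_sc sc_minus_left algebra_simps)

lemma Q_R: "Q k = sc (- \<i>) (R k)"
proof -
  have "al * (be * M.Psi k) = sc (- \<i>) (al * (x * M.Psi k) - (al * al) * M.Psi k)"
    unfolding be_al_x by (simp add: sc_mult algebra_simps)
  also have "\<dots> = sc (- \<i>) (- sc (of_nat k) (M.W ^ k) - x * (al * M.Psi k))"
    unfolding al_al al_x_left by (simp add: M.W_Psi)
  finally show ?thesis
    by (simp add: Q_def R_def fL_sc sc_mult sc_right sc_sc sc_minus_left algebra_simps)
qed

text \<open>Expressing \<open>be\<close> through \<open>x\<close> and \<open>al\<close> gives the
  pairing of \<open>be\<close> with itself a minus sign, and the pairing of \<open>al\<close> with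
  itself cancels.\<close>

lemma Pf2_K_key:
  "K.Pf2 G (Suc k) = M.Pf2 G (Suc k) + sc ((of_nat (Suc k))\<^sup>2)
     (B (x * M.W ^ k) (al * M.W ^ k) + B (al * M.W ^ k) (x * M.W ^ k) - B (x * M.W ^ k) (x * M.W ^ k) - B (R k) (R k))"
proof -
  have ne: "B (sc (- \<i>) y) (sc (- \<i>) z) = - B y z" for y z
    by (simp only: fB_sc_left fB_sc_right sc_sc) (simp add: sc_minus_left)
  have be: "be * M.W ^ k = sc (- \<i>) (x * M.W ^ k - al * M.W ^ k)"
    unfolding be_al_x by (simp add: sc_mult algebra_simps)
  have "B (al * M.W ^ k) (al * M.W ^ k) + B (be * M.W ^ k) (be * M.W ^ k) + B (Q k) (Q k) =
     B (x * M.W ^ k) (al * M.W ^ k) + B (al * M.W ^ k) (x * M.W ^ k) - B (x * M.W ^ k) (x * M.W ^ k) - B (R k) (R k)"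
    unfolding be Q_R ne by (simp add: fB_diff_left fB_diff_right algebra_simps)
  then show ?thesis unfolding Pf2_K by simp
qed


text \<open>The right-hand side of the recursion in any algebra with these relations. With
  \<open>card M\<close> equal to n - 2, its constants (n - 2)/2 and (n - 5)/2 become
  \<open>card M / 2\<close> and \<open>(card M - 3) / 2\<close>.\<close>

definition step :: "complex \<Rightarrow> 'a \<Rightarrow> 'a" where
  "step u c' =
     - (((H - cs (of_nat (card M) / 2)) ^ 2 - cs (u\<^sup>2) + (\<Sum>i\<in>M. X i ^ 2)) * c')
     + (\<Sum>i\<in>M. X i * (H - cs ((of_nat (card M) - 3) / 2)) * (A p i * c' - c' * A p i))
     + cs 2 * (\<Sum>i\<in>M. X i * c' * A p i)
     - cs (1 / 2) * (\<Sum>i\<in>M. X i * (M.Om * (A p i * c' - c' * A p i) - (A p i * c' - c' * A p i) * M.Om))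
     - cs (1 / 2) * (\<Sum>i\<in>M. \<Sum>j\<in>M. X i * X j *
         (A p i * (A p j * c' - c' * A p j) - (A p j * c' - c' * A p j) * A p i))"

lemma sc_cs: "cs d * y = sc d y" by (simp add: sc_def)

lemma step_add: "step u (c1 + c2) = step u c1 + step u c2"
  unfolding step_def by (simp add: algebra_simps sum.distrib sum_subtractf sum_negf)

lemma step_sc: "step u (sc d c') = sc d (step u c')"
proof -
  define v o' w where "v i = A p i * c' - c' * A p i" and "o' i = M.Om * v i - v i * M.Om"
    and "w i j = A p i * v j - v j * A p i" for i j
  have e: "T * sc d y - sc d y * T = sc d (T * y - y * T)" for T y :: 'a
    by (simp add: sc_mult sc_right)
  show ?thesis
    unfolding step_def e sc_cs unfolding v_def[symmetric] unfolding o'_def[symmetric] w_def[symmetric]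
    by (simp add: sc_mult sc_right sc_sc sc_sum mult.commute)
qed

lemma step_0: "step u 0 = 0"
  by (simp add: step_def)

lemma step_sum: "step u (\<Sum>k\<in>T. f k) = (\<Sum>k\<in>T. step u (f k))"
  by (induct T rule: infinite_finite_induct) (simp_all add: step_0 step_add)

lemma step_Pf2:
  "step u (M.Pf2 G k) = sc (u\<^sup>2 - (of_nat (card M) / 2 - of_nat k)\<^sup>2) (M.Pf2 G k)
     + (B (x * M.W ^ k) (al * M.W ^ k) + B (al * M.W ^ k) (x * M.W ^ k) - B (x * M.W ^ k) (x * M.W ^ k) - B (R k) (R k))"
proof -
  define v where "v i = P k i + S k i" for i
  have MG': "finite G" "M \<subseteq> G" using G by auto
  have c: "M.Pf2 G k = c k" by (simp add: M.Pf2_def c_def)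
  have comm: "A i l * c k = c k * A i l" if "i \<in> M" "l \<in> M" for i l
    using M.A_Pf2[OF MG' that, of k] by (simp add: c)
  have v: "A p i * c k - c k * A p i = v i" if "i \<in> M" for i
    using a_c[OF that, of k] by (simp add: v_def)
  have vf: "M.vfam v"
    using M.vfam_commutator[OF vfam_p comm] v unfolding M.vfam_def by simp
  have Om: "M.Om * v i - v i * M.Om = sc (m - 1) (v i) - sc 2 (\<Sum>l\<in>M. A i l * v l)" if "i \<in> M" for i
    by (rule M.Om_vfam[OF vf that])
  \<comment> \<open>The second commutator is \<open>V - U\<close> plus its transpose. As the
    \<open>X i\<close> commute, both have the same sum against \<open>X i * X j\<close>, which makes
    up for the factor 1/2 in the recursion.\<close>
  have aa: "A p i * v j - v j * A p i = (V k j i - U k j i) + (V k i j - U k i j)" if "i \<in> M" "j \<in> M" for i j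
  proof -
    have "A p i * v j - v j * A p i = (A p i * P k j - P k j * A p i) + (A p i * S k j - S k j * A p i)"
      by (simp add: v_def algebra_simps)
    then show ?thesis by (simp only: a_P[OF that] a_S[OF that])
  qed
  define XV where "XV = (\<Sum>i\<in>M. \<Sum>j\<in>M. X i * (X j * (V k i j - U k i j)))"
  have XV': "(\<Sum>i\<in>M. \<Sum>j\<in>M. X i * (X j * (V k j i - U k j i))) = XV"
    unfolding XV_def
    by (subst sum.swap) (intro sum.cong refl, simp add: XX flip: mult.assoc)
  define XA Xv XHv Xca XXc where
    "XA = (\<Sum>i\<in>M. X i * (\<Sum>l\<in>M. A i l * v l))" and "Xv = (\<Sum>i\<in>M. X i * v i)" and
    "XHv = (\<Sum>i\<in>M. X i * (H * v i))" and "Xca = (\<Sum>i\<in>M. X i * (c k * A p i))" and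
    "XXc = (\<Sum>i\<in>M. X i * (X i * c k))"
  have h: "sc (1/2) (y + y) = y" for y :: 'a
    by (simp add: sc_def cs_half_double)
  have 4: "(\<Sum>i\<in>M. X i * (M.Om * (A p i * c k - c k * A p i) - (A p i * c k - c k * A p i) * M.Om))
     = sc (m - 1) Xv - sc 2 XA"
    unfolding Xv_def XA_def sc_sum sum_subtractf[symmetric]
    by (intro sum.cong refl) (simp add: v Om right_diff_distrib sc_mult)
  have 5: "(\<Sum>i\<in>M. \<Sum>j\<in>M. X i * X j *
         (A p i * (A p j * c k - c k * A p j) - (A p j * c k - c k * A p j) * A p i)) = XV + XV"
  proof -
    have dist: "y * z * (s + t) = y * (z * s) + y * (z * t)" for y z s t :: 'a
      by (simp add: algebra_simps)
    have "(\<Sum>i\<in>M. \<Sum>j\<in>M. X i * X j *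
         (A p i * (A p j * c k - c k * A p j) - (A p j * c k - c k * A p j) * A p i)) =
       (\<Sum>i\<in>M. \<Sum>j\<in>M. X i * (X j * (V k j i - U k j i)) + X i * (X j * (V k i j - U k i j)))"
      by (intro sum.cong refl) (simp only: v aa dist)
    then show ?thesis by (simp only: sum.distrib XV' XV_def[symmetric])
  qed
  have 2: "(\<Sum>i\<in>M. X i * (H - cs ((m - 3) / 2)) * (A p i * c k - c k * A p i)) = XHv - sc ((m - 3) / 2) Xv"
    unfolding XHv_def Xv_def sc_sum sum_subtractf[symmetric]
  proof (intro sum.cong refl)
    have dist: "y * (t - cs d) * z = y * (t * z) - sc d (y * z)" for y z t :: 'a and d
      by (simp add: left_diff_distrib right_diff_distrib mult.assoc sc_cs sc_mult)
    fix i assume "i \<in> M"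
    then show "X i * (H - cs ((m - 3) / 2)) * (A p i * c k - c k * A p i) = X i * (H * v i) - sc ((m - 3) / 2) (X i * v i)"
      by (simp only: v dist)
  qed
  have 3: "(\<Sum>i\<in>M. X i * c k * A p i) = Xca"
    unfolding Xca_def by (simp add: mult.assoc)
  have 1: "((H - cs (m / 2)) ^ 2 - cs (u\<^sup>2) + (\<Sum>i\<in>M. X i ^ 2)) * c k
     = H * (H * c k) - sc (m / 2) (H * c k) - sc (m / 2) (H * c k) + sc (m / 2 * (m / 2)) (c k) - sc (u\<^sup>2) (c k) + XXc"
  proof -
    have dist: "((t - cs d) ^ 2 - cs e + s) * z = t * (t * z) - sc d (t * z) - sc d (t * z) + sc (d * d) z - sc e z + s * z"
      for t s z :: 'a and d e
      by (simp add: power2_eq_square left_diff_distrib right_diff_distrib distrib_right mult.assoc sc_cs sc_mult sc_right sc_sc)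
    show ?thesis
      unfolding dist XXc_def sum_distrib_right by (simp add: power2_eq_square mult.assoc)
  qed
  have d: "sc (1/2) (sc d y) = sc (d / 2) y" for d and y :: 'a
    by (simp add: sc_sc)
  \<comment> \<open>One half of the coefficient comes from the shift of H, the other from the
    commutator with \<Omega>: (m - 3)/2 + (m - 1)/2 = m - 2.\<close>
  have f1: "sc (2 - m) Xv = - sc ((m - 3) / 2) Xv - sc ((m - 1) / 2) Xv"
    unfolding sc_minus_left[symmetric] sc_diff_left[symmetric]
    by (rule arg_cong2[of _ _ _ _ sc]) (simp_all add: field_simps)
  have f2: "sc m (H * c k) = sc (m / 2) (H * c k) + sc (m / 2) (H * c k)"
    unfolding sc_add_left[symmetric] by (rule arg_cong2[of _ _ _ _ sc]) simp_all
  have f3: "sc (u\<^sup>2 - (m / 2 - of_nat k)\<^sup>2) (c k) =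
      sc (u\<^sup>2) (c k) - sc (m / 2 * (m / 2)) (c k) - sc (of_nat k * of_nat k - m * of_nat k) (c k)"
    unfolding sc_diff_left[symmetric]
    by (rule arg_cong2[of _ _ _ _ sc]) (simp_all add: field_simps power2_eq_square)
  show ?thesis
    unfolding key_identity c step_def 1 2 3 4 5 sc_cs
    unfolding v_def[symmetric] XA_def[symmetric] Xv_def[symmetric] XHv_def[symmetric] Xca_def[symmetric] XXc_def[symmetric]
      XV_def[symmetric] h sc_diff_right d f1 f2 f3
    by (simp add: algebra_simps)
qed


theorem C_elem_step: "C_elem G A (insert p (insert q M)) u = step u (C_elem G A M u)"
proof -
  let ?n = "card M" and ?K = "insert p (insert q M)"
  let ?key = "\<lambda>k. B (x * M.W ^ k) (al * M.W ^ k) + B (al * M.W ^ k) (x * M.W ^ k) - B (x * M.W ^ k) (x * M.W ^ k) - B (R k) (R k)"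
  have cK: "card ?K = ?n + 2" using pq M.fin by simp
  let ?t = "\<lambda>k. sc (dcoef (?n + 2) k u / (fact k)\<^sup>2) (M.Pf2 G k)"
  have key: "sc (dcoef ?n k u / (fact k)\<^sup>2) (?key k) =
      sc (dcoef (?n + 2) (Suc k) u / (fact (Suc k))\<^sup>2) (K.Pf2 G (Suc k)) - ?t (Suc k)" for k
  proof -
    have "dcoef (?n + 2) (Suc k) u / (fact (Suc k))\<^sup>2 * (of_nat (Suc k))\<^sup>2 = dcoef ?n k u / (fact k)\<^sup>2"
      using dcoef_shift[of ?n k u] by (simp add: power_mult_distrib del: of_nat_Suc)
    then show ?thesis
      unfolding Pf2_K_key by (simp only: sc_add_right sc_sc) simp
  qed
  have diag: "sc (dcoef ?n k u / (fact k)\<^sup>2) (sc (u\<^sup>2 - (of_nat ?n / 2 - of_nat k)\<^sup>2) (M.Pf2 G k)) = ?t k"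
    if "k \<le> ?n div 2" for k
    using dcoef_step[OF that, of u] by (simp add: sc_sc mult.commute)
  have top: "M.Pf2 G (Suc (?n div 2)) = 0"
    unfolding M.Pf2_def by (rule M.W_pow_zero) simp
  have "step u (C_elem G A M u) = (\<Sum>k\<le>?n div 2. ?t k
     + (sc (dcoef (?n + 2) (Suc k) u / (fact (Suc k))\<^sup>2) (K.Pf2 G (Suc k)) - ?t (Suc k)))"
    unfolding C_elem_def step_sum step_sc step_Pf2 sc_add_right key by (intro sum.cong refl) (simp add: diag)
  \<comment> \<open>The terms \<open>?t\<close> telescope to the one for k = 0, which is also the
    summand k = 0 of the new formula; the remaining summands come from \<open>key\<close>, shifted
    by one.\<close>
  also have "\<dots> = (\<Sum>k\<le>?n div 2. ?t k - ?t (Suc k))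
      + (\<Sum>k\<le>?n div 2. sc (dcoef (?n + 2) (Suc k) u / (fact (Suc k))\<^sup>2) (K.Pf2 G (Suc k)))"
    by (simp only: sum.distrib[symmetric]) (simp add: algebra_simps)
  also have "(\<Sum>k\<le>?n div 2. ?t k - ?t (Suc k)) = ?t 0 - ?t (Suc (?n div 2))"
    by (rule sum_telescope)
  also have "?t (Suc (?n div 2)) = 0" unfolding top by simp
  also have "?t 0 = sc (dcoef (?n + 2) 0 u / (fact 0)\<^sup>2) (K.Pf2 G 0)"
    by (simp add: M.Pf2_def K.Pf2_def)
  also have "sc (dcoef (?n + 2) 0 u / (fact 0)\<^sup>2) (K.Pf2 G 0) - 0 +
      (\<Sum>k\<le>?n div 2. sc (dcoef (?n + 2) (Suc k) u / (fact (Suc k))\<^sup>2) (K.Pf2 G (Suc k))) = C_elem G A ?K u"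
    unfolding C_elem_def cK by (simp add: sum.atMost_Suc_shift del: sum.atMost_Suc)
  finally show ?thesis by simp
qed

end

section \<open>Universal enveloping algebras\<close>

lemma poly_mapping_single_induct [case_names single add]:
  assumes "\<And>k v. P (Poly_Mapping.single k v)" "\<And>f g. P f \<Longrightarrow> P g \<Longrightarrow> P (f + g)"
  shows "P (f :: 'a \<Rightarrow>\<^sub>0 'b::comm_monoid_add)"
proof (induct "card (Poly_Mapping.keys f)" arbitrary: f)
  case 0
  then have "f = Poly_Mapping.single undefined 0" by simp
  then show ?case using assms(1) by metis
next
  case (Suc n)
  then obtain k where k: "k \<in> Poly_Mapping.keys f" by fastforce
  define g where "g = Poly_Mapping.update k 0 f"
  have f: "f = Poly_Mapping.single k (Poly_Mapping.lookup f k) + g"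
    unfolding g_def by (rule poly_mapping_eqI) (simp add: lookup_add lookup_single lookup_update when_def)
  have "Poly_Mapping.keys g = Poly_Mapping.keys f - {k}"
    unfolding g_def by (auto simp: in_keys_iff lookup_update split: if_splits)
  then have "card (Poly_Mapping.keys g) = n" using Suc.hyps(2) k by simp
  then have "P g" using Suc.hyps(1) by blast
  then show ?case using assms f by metis
qed

lemma list_plus [simp]: "(0 :: 'a list) = []" "(v :: 'a list) + w = v @ w"
  by (simp_all add: zero_list_def plus_list_def)

definition ev :: "(complex \<Rightarrow> 'r::ring_1) \<Rightarrow> ('a \<Rightarrow> 'r) \<Rightarrow> ('a list \<Rightarrow>\<^sub>0 complex) \<Rightarrow> 'r" where
  "ev \<kappa> \<phi> f = (\<Sum>w\<in>Poly_Mapping.keys f. \<kappa> (Poly_Mapping.lookup f w) * prod_list (map \<phi> w))"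

text \<open>Besides the algebras of class \<open>calg\<close>, the complex numbers and the free
  algebras occur as targets of evaluations; hence the embedding of the scalars is a
  parameter.\<close>

locale scalar_hom =
  fixes \<kappa> :: "complex \<Rightarrow> 'r::ring_1"
  assumes k_add: "\<kappa> (c + d) = \<kappa> c + \<kappa> d" and k_mult: "\<kappa> (c * d) = \<kappa> c * \<kappa> d"
    and k_1: "\<kappa> 1 = 1" and k_comm: "\<kappa> c * x = x * \<kappa> c"
begin

lemma k_0: "\<kappa> 0 = 0" using k_add[of 0 0] by simp

lemma ev_superset:
  assumes "finite T" "Poly_Mapping.keys f \<subseteq> T"
  shows "ev \<kappa> \<phi> f = (\<Sum>w\<in>T. \<kappa> (Poly_Mapping.lookup f w) * prod_list (map \<phi> w))"
  unfolding ev_def using assms by (intro sum.mono_neutral_left) (auto simp: k_0 in_keys_iff)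

lemma ev_add: "ev \<kappa> \<phi> (f + g) = ev \<kappa> \<phi> f + ev \<kappa> \<phi> g"
proof -
  let ?T = "Poly_Mapping.keys f \<union> Poly_Mapping.keys g"
  have "finite ?T" by simp
  then show ?thesis
    using keys_add[of f g]
    by (simp add: ev_superset[of ?T] k_add lookup_add algebra_simps sum.distrib)
qed

lemma ev_0: "ev \<kappa> \<phi> 0 = 0" by (simp add: ev_def)

lemma ev_minus: "ev \<kappa> \<phi> (- f) = - ev \<kappa> \<phi> f"
  using ev_add[of \<phi> f "- f"] by (simp add: ev_0 eq_neg_iff_add_eq_0 add.commute)

lemma ev_diff: "ev \<kappa> \<phi> (f - g) = ev \<kappa> \<phi> f - ev \<kappa> \<phi> g"
  using ev_add[of \<phi> f "- g"] by (simp add: ev_minus)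

lemma ev_single: "ev \<kappa> \<phi> (Poly_Mapping.single w c) = \<kappa> c * prod_list (map \<phi> w)"
  by (simp add: ev_def k_0)

lemma ev_mult: "ev \<kappa> \<phi> (f * g) = ev \<kappa> \<phi> f * ev \<kappa> \<phi> g"
proof (induct f rule: poly_mapping_single_induct)
  case (single k v)
  show ?case
  proof (induct g rule: poly_mapping_single_induct)
    case (single l w)
    have "\<kappa> v * \<kappa> w * (prod_list (map \<phi> k) * prod_list (map \<phi> l)) =
      \<kappa> v * (\<kappa> w * prod_list (map \<phi> k)) * prod_list (map \<phi> l)" by (simp add: mult.assoc)
    also have "\<dots> = \<kappa> v * prod_list (map \<phi> k) * (\<kappa> w * prod_list (map \<phi> l))"
      unfolding k_comm[of w "prod_list (map \<phi> k)"] by (simp add: mult.assoc)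
    finally show ?case by (simp add: mult_single ev_single k_mult)
  qed (simp add: ev_add algebra_simps)
qed (simp add: ev_add algebra_simps)

lemma ev_1: "ev \<kappa> \<phi> 1 = 1"
  using ev_single[of \<phi> "[]" 1] by (simp add: k_1 flip: single_one)

lemma ev_letter: "ev \<kappa> \<phi> (letter x) = \<phi> x"
  by (simp add: letter_def ev_single k_1)

lemma ev_scalar: "ev \<kappa> \<phi> (scalar c) = \<kappa> c"
  by (simp add: scalar_def ev_single)

end

lemma scalar_comm: "scalar c * f = f * scalar c"
  by (induct f rule: poly_mapping_single_induct)
    (simp_all add: scalar_def mult_single algebra_simps)

interpretation scalar: scalar_hom scalar
proof
  show "scalar (c + d) = scalar c + scalar d" for c d by (simp add: scalar_def single_add)
  show "scalar (c * d) = scalar c * scalar d" for c d by (simp add: scalar_def mult_single)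
  show "scalar 1 = 1" by (simp add: scalar_def flip: single_one)
  show "scalar c * x = x * scalar c" for c x by (rule scalar_comm)
qed

interpretation id_complex: scalar_hom "id :: complex \<Rightarrow> complex"
  by standard simp_all

lemma free_alg_simps [simp]:
  "carrier (free_alg S) = {f. Poly_Mapping.keys f \<subseteq> lists S}"
  "mult (free_alg S) = (*)" "one (free_alg S) = 1" "zero (free_alg S) = 0" "add (free_alg S) = (+)"
  by (simp_all add: free_alg_def)

lemma keys_mult_lists:
  "Poly_Mapping.keys f \<subseteq> lists S \<Longrightarrow> Poly_Mapping.keys g \<subseteq> lists S \<Longrightarrow> Poly_Mapping.keys (f * g) \<subseteq> lists S"
  using keys_mult[of f g] by fastforce

lemma keys_add_lists:
  "Poly_Mapping.keys f \<subseteq> lists S \<Longrightarrow> Poly_Mapping.keys g \<subseteq> lists S \<Longrightarrow> Poly_Mapping.keys (f + g) \<subseteq> lists S"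
  using keys_add[of f g] by blast

lemma keys_diff_lists:
  "Poly_Mapping.keys f \<subseteq> lists S \<Longrightarrow> Poly_Mapping.keys g \<subseteq> lists S \<Longrightarrow> Poly_Mapping.keys (f - g) \<subseteq> lists S"
  using keys_diff[of f g] by blast

lemma keys_letter: "x \<in> S \<Longrightarrow> Poly_Mapping.keys (letter x) \<subseteq> lists S"
  by (simp add: letter_def)

lemma keys_scalar: "Poly_Mapping.keys (scalar c) \<subseteq> lists S"
  by (simp add: scalar_def)

lemma ring_free_alg: "ring (free_alg S)"
proof (rule ringI)
  show "abelian_group (free_alg S)"
  proof (rule abelian_groupI)
    fix x assume "x \<in> carrier (free_alg S)"
    then show "\<exists>y\<in>carrier (free_alg S). y \<oplus>\<^bsub>free_alg S\<^esub> x = \<zero>\<^bsub>free_alg S\<^esub>"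
      by (intro bexI[of _ "- x"]) auto
  qed (auto simp: keys_add_lists add_ac)
  show "Group.monoid (free_alg S)"
    by (rule monoidI) (auto simp: keys_mult_lists mult.assoc)
qed (simp_all add: algebra_simps)

lemma free_alg_minus [simp]: "f \<in> carrier (free_alg S) \<Longrightarrow> g \<in> carrier (free_alg S) \<Longrightarrow> f \<ominus>\<^bsub>free_alg S\<^esub> g = f - g"
proof -
  assume f: "f \<in> carrier (free_alg S)" and g: "g \<in> carrier (free_alg S)"
  interpret ring "free_alg S" by (rule ring_free_alg)
  have "\<ominus>\<^bsub>free_alg S\<^esub> g = - g" by (rule minus_equality) (use g in auto)
  then show ?thesis by (simp add: a_minus_def)
qed

section \<open>The defining ideal and calculation in the enveloping algebra\<close>

lemma lie_subalgebraD:
  assumes "lie_subalgebra g"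
  shows "x \<in> g \<Longrightarrow> y \<in> g \<Longrightarrow> x + y \<in> g" "x \<in> g \<Longrightarrow> smat c x \<in> g" "x \<in> g \<Longrightarrow> y \<in> g \<Longrightarrow> lie x y \<in> g" "0 \<in> g"
    "x \<in> g \<Longrightarrow> - x \<in> g" "x \<in> g \<Longrightarrow> y \<in> g \<Longrightarrow> x - y \<in> g"
  using assms
  by (auto simp: lie_subalgebra_def cmat.subspace_add cmat.subspace_scale cmat.subspace_0 cmat.subspace_neg cmat.subspace_diff)

lemma uea_relations_carrier:
  assumes "lie_subalgebra g"
  shows "uea_relations g \<subseteq> carrier (free_alg g)"
proof
  fix r assume "r \<in> uea_relations g"
  then consider (add) x y where "x \<in> g" "y \<in> g" "r = letter (x + y) - letter x - letter y"
    | (scale) c x where "x \<in> g" "r = letter (smat c x) - scalar c * letter x"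
    | (lie) x y where "x \<in> g" "y \<in> g" "r = letter x * letter y - letter y * letter x - letter (lie x y)"
    unfolding uea_relations_def by blast
  then have "Poly_Mapping.keys r \<subseteq> lists g"
  proof cases
    case add
    then show ?thesis using lie_subalgebraD(1)[OF assms]
      by (simp only:) (intro keys_diff_lists keys_letter)
  next
    case scale
    then show ?thesis using lie_subalgebraD(2)[OF assms]
      by (simp only:) (intro keys_diff_lists keys_mult_lists keys_letter keys_scalar)
  next
    case lie
    then show ?thesis using lie_subalgebraD(3)[OF assms]
      by (simp only:) (intro keys_diff_lists keys_mult_lists keys_letter)
  qed
  then show "r \<in> carrier (free_alg g)" by simp
qed

lemma ideal_uea:
  assumes "lie_subalgebra g"
  shows "ideal (uea_ideal g) (free_alg g)"
  unfolding uea_ideal_def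
  by (intro ring.genideal_ideal ring_free_alg uea_relations_carrier assms)

text \<open>The elements of the free algebra with property P form an ideal; zero and negatives are
  obtained by multiplying with 0 and with \<open>scalar (-1)\<close>.\<close>

lemma uea_ideal_induct [consumes 2, case_names rel add left right]:
  assumes g: "lie_subalgebra g" and f: "f \<in> uea_ideal g"
    and rel: "\<And>r. r \<in> uea_relations g \<Longrightarrow> P r"
    and add: "\<And>a b. P a \<Longrightarrow> P b \<Longrightarrow> P (a + b)"
    and left: "\<And>a b. a \<in> carrier (free_alg g) \<Longrightarrow> P b \<Longrightarrow> P (a * b)"
    and right: "\<And>a b. a \<in> carrier (free_alg g) \<Longrightarrow> P b \<Longrightarrow> P (b * a)"
  shows "P f"
proof -
  interpret ring "free_alg g" by (rule ring_free_alg)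
  let ?J = "{f \<in> carrier (free_alg g). P f}"
  have x: "0 \<in> g" using lie_subalgebraD[OF g] by blast
  have P0: "P 0"
  proof -
    have "letter (0 + 0) - letter 0 - letter 0 \<in> uea_relations g"
      unfolding uea_relations_def using x by blast
    from left[of 0, OF _ rel[OF this]] show "P 0" by simp
  qed
  have Pm: "P (- a)" if "P a" for a
  proof -
    have "scalar (-1) + scalar 1 = (0 :: cmat list \<Rightarrow>\<^sub>0 complex)"
      unfolding scalar.k_add[symmetric] by (simp add: scalar.k_0)
    then have "scalar (-1) = (-1 :: cmat list \<Rightarrow>\<^sub>0 complex)"
      unfolding scalar.k_1 by (simp only: eq_neg_iff_add_eq_0)
    then show ?thesis using left[of "scalar (-1)", OF _ that] keys_scalar[of "-1" g] by simp
  qed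
  have "ideal ?J (free_alg g)"
  proof (rule idealI[OF ring_free_alg])
    show "subgroup ?J (add_monoid (free_alg g))"
    proof
      fix y assume y: "y \<in> ?J"
      have "inv\<^bsub>add_monoid (free_alg g)\<^esub> y = - y"
        unfolding a_inv_def[symmetric] by (rule minus_equality) (use y in auto)
      then show "inv\<^bsub>add_monoid (free_alg g)\<^esub> y \<in> ?J" using y Pm by auto
    qed (auto simp: P0 add keys_add_lists)
  qed (use left right in \<open>auto simp: keys_mult_lists\<close>)
  moreover have "uea_relations g \<subseteq> ?J"
    using uea_relations_carrier[OF g] rel by auto
  ultimately have "uea_ideal g \<subseteq> ?J"
    unfolding uea_ideal_def by (rule genideal_minimal)
  then show ?thesis using f by blast
qed


definition uea_class :: "cmat set \<Rightarrow> (cmat list \<Rightarrow>\<^sub>0 complex) \<Rightarrow> uea_elem" where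
  "uea_class g f = uea_ideal g +>\<^bsub>free_alg g\<^esub> f"

lemma uea_emb_uea_class: "uea_emb g x = uea_class g (letter x)"
  by (simp add: uea_emb_def uea_class_def)

lemma uea_const_uea_class: "uea_const g c = uea_class g (scalar c)"
  by (simp add: uea_const_def uea_class_def)

abbreviation fcar :: "cmat set \<Rightarrow> (cmat list \<Rightarrow>\<^sub>0 complex) set" where
  "fcar g \<equiv> carrier (free_alg g)"

lemma fcar_intros:
  "f \<in> fcar g \<Longrightarrow> f' \<in> fcar g \<Longrightarrow> f * f' \<in> fcar g"
  "f \<in> fcar g \<Longrightarrow> f' \<in> fcar g \<Longrightarrow> f + f' \<in> fcar g"
  "f \<in> fcar g \<Longrightarrow> f' \<in> fcar g \<Longrightarrow> f - f' \<in> fcar g"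
  "f \<in> fcar g \<Longrightarrow> - f \<in> fcar g"
  "1 \<in> fcar g" "0 \<in> fcar g" "scalar c \<in> fcar g"
  "x \<in> g \<Longrightarrow> letter x \<in> fcar g"
  by (simp_all add: keys_mult_lists keys_add_lists keys_diff_lists keys_scalar keys_letter)

context
  fixes g assumes g: "lie_subalgebra g"
begin

interpretation I: ideal "uea_ideal g" "free_alg g" by (rule ideal_uea[OF g])

lemma ring_uea: "ring (uea g)"
  unfolding uea_def by (rule I.quotient_is_ring)

lemma uea_class_hom: "uea_class g \<in> ring_hom (free_alg g) (uea g)"
  using I.rcos_ring_hom unfolding uea_def uea_class_def[abs_def] .

lemma uea_class_simps:
  "f \<in> fcar g \<Longrightarrow> uea_class g f \<in> carrier (uea g)"
  "f \<in> fcar g \<Longrightarrow> f' \<in> fcar g \<Longrightarrow> uea_class g (f * f') = uea_class g f \<otimes>\<^bsub>uea g\<^esub> uea_class g f'"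
  "f \<in> fcar g \<Longrightarrow> f' \<in> fcar g \<Longrightarrow> uea_class g (f + f') = uea_class g f \<oplus>\<^bsub>uea g\<^esub> uea_class g f'"
  "uea_class g 1 = \<one>\<^bsub>uea g\<^esub>"
  using ring_hom_closed[OF uea_class_hom] ring_hom_mult[OF uea_class_hom, of f f'] ring_hom_add[OF uea_class_hom, of f f'] ring_hom_one[OF uea_class_hom]
  by simp_all

lemma uea_class_0: "uea_class g 0 = \<zero>\<^bsub>uea g\<^esub>"
  using ring_hom_zero[OF uea_class_hom ring_free_alg ring_uea] by simp

lemma uea_class_minus: "f \<in> fcar g \<Longrightarrow> uea_class g (- f) = \<ominus>\<^bsub>uea g\<^esub> uea_class g f"
proof -
  assume f: "f \<in> fcar g"
  interpret ring "uea g" by (rule ring_uea)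
  have "uea_class g (- f) \<oplus>\<^bsub>uea g\<^esub> uea_class g f = \<zero>\<^bsub>uea g\<^esub>"
    using uea_class_simps(3)[of "- f" f] f by (simp add: uea_class_0)
  then have "\<ominus>\<^bsub>uea g\<^esub> uea_class g f = uea_class g (- f)"
    using f by (intro minus_equality uea_class_simps fcar_intros) auto
  then show ?thesis by simp
qed

lemma uea_class_eq_iff: "f \<in> fcar g \<Longrightarrow> f' \<in> fcar g \<Longrightarrow> uea_class g f = uea_class g f' \<longleftrightarrow> f - f' \<in> uea_ideal g"
  using I.quotient_eq_iff_same_a_r_cos[OF ideal_uea[OF g], of f f'] by (simp add: uea_class_def)

lemma uea_cases: "y \<in> carrier (uea g) \<Longrightarrow> (\<And>f. f \<in> fcar g \<Longrightarrow> y = uea_class g f \<Longrightarrow> P) \<Longrightarrow> P"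
  unfolding uea_def FactRing_def A_RCOSETS_def' uea_class_def by auto

lemma uea_class_self: "f \<in> fcar g \<Longrightarrow> f \<in> uea_class g f"
  unfolding uea_class_def by (rule I.a_rcos_self)

lemma in_uea_class: "f \<in> fcar g \<Longrightarrow> f' \<in> uea_class g f \<Longrightarrow> f' \<in> fcar g \<and> uea_class g f' = uea_class g f"
  unfolding uea_class_def
  using abelian_subgroup.a_repr_independence'[OF I.abelian_subgroup_axioms, of f' f] I.a_elemrcos_carrier[of f f']
  by simp

lemma uea_class_eqI: "f - f' \<in> uea_ideal g \<Longrightarrow> f \<in> fcar g \<Longrightarrow> f' \<in> fcar g \<Longrightarrow> uea_class g f = uea_class g f'"
  using uea_class_eq_iff by blast

lemma uea_emb_add: "x \<in> g \<Longrightarrow> y \<in> g \<Longrightarrow> uea_emb g (x + y) = uea_emb g x \<oplus>\<^bsub>uea g\<^esub> uea_emb g y"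
proof -
  assume xy: "x \<in> g" "y \<in> g"
  have "letter (x + y) - letter x - letter y \<in> uea_ideal g"
    unfolding uea_ideal_def using xy
    by (intro subsetD[OF I.genideal_self[OF uea_relations_carrier[OF g]]]) (auto simp: uea_relations_def)
  then have "uea_class g (letter (x + y)) = uea_class g (letter x + letter y)"
    unfolding diff_diff_eq using xy by (rule_tac uea_class_eqI) (assumption, (intro fcar_intros lie_subalgebraD[OF g]; assumption)+)
  then show ?thesis using xy by (simp add: uea_emb_uea_class uea_class_simps fcar_intros del: free_alg_simps)
qed

lemma uea_emb_smat: "x \<in> g \<Longrightarrow> uea_emb g (smat c x) = uea_const g c \<otimes>\<^bsub>uea g\<^esub> uea_emb g x"
proof -
  assume x: "x \<in> g"
  have "letter (smat c x) - scalar c * letter x \<in> uea_ideal g"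
    unfolding uea_ideal_def using x
    by (intro subsetD[OF I.genideal_self[OF uea_relations_carrier[OF g]]]) (auto simp: uea_relations_def)
  then have "uea_class g (letter (smat c x)) = uea_class g (scalar c * letter x)"
    using x by (rule_tac uea_class_eqI) (assumption, (intro fcar_intros lie_subalgebraD[OF g]; assumption)+)
  then show ?thesis using x by (simp add: uea_emb_uea_class uea_const_uea_class uea_class_simps fcar_intros del: free_alg_simps)
qed

lemma uea_emb_lie: "x \<in> g \<Longrightarrow> y \<in> g \<Longrightarrow>
  (uea_emb g x \<otimes>\<^bsub>uea g\<^esub> uea_emb g y) = (uea_emb g y \<otimes>\<^bsub>uea g\<^esub> uea_emb g x) \<oplus>\<^bsub>uea g\<^esub> uea_emb g (lie x y)"
proof -
  assume xy: "x \<in> g" "y \<in> g"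
  have "letter x * letter y - letter y * letter x - letter (lie x y) \<in> uea_ideal g"
    unfolding uea_ideal_def using xy
    by (intro subsetD[OF I.genideal_self[OF uea_relations_carrier[OF g]]]) (unfold uea_relations_def, blast)
  then have "uea_class g (letter x * letter y) = uea_class g (letter y * letter x + letter (lie x y))"
    unfolding diff_diff_eq using xy by (rule_tac uea_class_eqI) (assumption, (intro fcar_intros lie_subalgebraD[OF g]; assumption)+)
  then show ?thesis using xy
    by (simp add: uea_emb_uea_class uea_class_simps fcar_intros lie_subalgebraD[OF g] del: free_alg_simps)
qed

lemma uea_emb_closed: "x \<in> g \<Longrightarrow> uea_emb g x \<in> carrier (uea g)"
  by (simp add: uea_emb_uea_class uea_class_simps fcar_intros del: free_alg_simps)

lemma uea_const_closed: "uea_const g c \<in> carrier (uea g)"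
  by (simp add: uea_const_uea_class uea_class_simps fcar_intros del: free_alg_simps)

lemma uea_const_simps:
  "uea_const g (c + d) = uea_const g c \<oplus>\<^bsub>uea g\<^esub> uea_const g d"
  "uea_const g (c * d) = uea_const g c \<otimes>\<^bsub>uea g\<^esub> uea_const g d"
  "uea_const g 1 = \<one>\<^bsub>uea g\<^esub>" "uea_const g 0 = \<zero>\<^bsub>uea g\<^esub>"
  by (simp_all add: uea_const_uea_class scalar.k_add scalar.k_mult scalar.k_1 scalar.k_0 uea_class_simps uea_class_0 fcar_intros del: free_alg_simps)

lemma uea_const_comm:
  "y \<in> carrier (uea g) \<Longrightarrow> uea_const g c \<otimes>\<^bsub>uea g\<^esub> y = y \<otimes>\<^bsub>uea g\<^esub> uea_const g c"
  by (erule uea_cases) (simp add: uea_const_uea_class scalar_comm fcar_intros flip: uea_class_simps(2) del: free_alg_simps)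

end

text \<open>The universal property of U(g), phrased for representatives in the free algebra.\<close>

lemma ev_uea_ideal:
  assumes g: "lie_subalgebra g" and k: "scalar_hom \<kappa>"
    and add: "\<And>x y. x \<in> g \<Longrightarrow> y \<in> g \<Longrightarrow> \<phi> (x + y) = \<phi> x + \<phi> y"
    and smat: "\<And>c x. x \<in> g \<Longrightarrow> \<phi> (smat c x) = \<kappa> c * \<phi> x"
    and lie: "\<And>x y. x \<in> g \<Longrightarrow> y \<in> g \<Longrightarrow> \<phi> x * \<phi> y - \<phi> y * \<phi> x = \<phi> (lie x y)"
    and f: "f \<in> uea_ideal g"
  shows "ev \<kappa> \<phi> f = 0"
  using g f
proof (induct rule: uea_ideal_induct)
  case (rel r)
  interpret scalar_hom \<kappa> by (rule k)
  from rel show ?case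
    unfolding uea_relations_def
    by (auto simp: ev_diff ev_mult ev_letter ev_scalar add smat lie)
qed (simp_all add: scalar_hom.ev_add[OF k] scalar_hom.ev_mult[OF k])

text \<open>The counit of U(g). It shows that U(g) is not the zero ring, as the class axiom
  \<open>0 \<noteq> 1\<close> demands of the product ring, and it supplies values for
  \<open>lift\<close>.\<close>

definition aug :: "uea_elem \<Rightarrow> complex" where
  "aug y = ev id (\<lambda>_. 0) (SOME f. f \<in> y)"

lemma aug_uea_class:
  assumes g: "lie_subalgebra g" and f: "f \<in> fcar g"
  shows "aug (uea_class g f) = ev id (\<lambda>_. 0) f"
proof -
  have "(SOME f'. f' \<in> uea_class g f) \<in> uea_class g f" using uea_class_self[OF g f] by (rule someI)
  with in_uea_class[OF g f] have *: "(SOME f'. f' \<in> uea_class g f) \<in> fcar g" "uea_class g (SOME f'. f' \<in> uea_class g f) = uea_class g f" by blast+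
  then have "(SOME f'. f' \<in> uea_class g f) - f \<in> uea_ideal g" using uea_class_eq_iff[OF g * (1) f] by blast
  then have "ev id (\<lambda>_. 0) ((SOME f'. f' \<in> uea_class g f) - f) = 0"
    by (intro ev_uea_ideal[OF g]) (simp_all add: id_complex.scalar_hom_axioms)
  then show ?thesis by (simp add: aug_def id_complex.ev_diff)
qed

text \<open>The smaller ideal lies in the larger one, so adding the larger ideal to a coset of the
  smaller yields a single coset.\<close>

lemma uea_incl_uea_class:
  assumes g: "lie_subalgebra g" and g': "lie_subalgebra g'" and sub: "g \<subseteq> g'" and f: "f \<in> fcar g"
  shows "uea_incl g g' (uea_class g f) = uea_class g' f"
proof -
  interpret I: ideal "uea_ideal g" "free_alg g" by (rule ideal_uea[OF g])
  interpret I': ideal "uea_ideal g'" "free_alg g'" by (rule ideal_uea[OF g'])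
  have addI: "a + b \<in> uea_ideal g'" if "a \<in> uea_ideal g'" "b \<in> uea_ideal g'" for a b
    using subgroup.m_closed[OF I'.a_subgroup that] by simp
  have fsub: "fcar g \<subseteq> fcar g'" using sub lists_mono[OF sub] by auto
  have sub': "uea_ideal g \<subseteq> uea_ideal g'"
  proof
    fix f assume "f \<in> uea_ideal g"
    with g show "f \<in> uea_ideal g'"
    proof (induct rule: uea_ideal_induct)
      case (rel r)
      have "r \<in> uea_relations g'" using rel sub unfolding uea_relations_def by blast
      then show ?case unfolding uea_ideal_def
        using I'.genideal_self[OF uea_relations_carrier[OF g']] by blast
    next
      case (add a b) then show ?case by (rule addI)
    next
      case (left a b)
      then have "a \<in> fcar g'" using fsub by blast
      with left(2) show ?case using I'.I_l_closed[of b a] by simp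
    next
      case (right a b)
      then have "a \<in> fcar g'" using fsub by blast
      with right(2) show ?case using I'.I_r_closed[of b a] by simp
    qed
  qed
  have z: "0 \<in> uea_ideal g" using subgroup.one_closed[OF I.a_subgroup] by simp
  show ?thesis
    unfolding uea_incl_def uea_class_def set_add_def' a_r_coset_def'
  proof (rule equalityI; rule subsetI)
    fix y assume "y \<in> (\<Union>h\<in>uea_ideal g'. \<Union>k\<in>(\<Union>h\<in>uea_ideal g. {h \<oplus>\<^bsub>free_alg g\<^esub> f}). {h \<oplus>\<^bsub>free_alg g'\<^esub> k})"
    then obtain h h' where "h \<in> uea_ideal g'" "h' \<in> uea_ideal g" "y = h + h' + f" by (auto simp: add.assoc)
    then show "y \<in> (\<Union>h\<in>uea_ideal g'. {h \<oplus>\<^bsub>free_alg g'\<^esub> f})" using sub' addI[of h h'] by auto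
  next
    fix y assume "y \<in> (\<Union>h\<in>uea_ideal g'. {h \<oplus>\<^bsub>free_alg g'\<^esub> f})"
    then obtain h where h: "h \<in> uea_ideal g'" "y = h + f" by auto
    have "f \<in> {0 \<oplus>\<^bsub>free_alg g\<^esub> f}" by simp
    with z have f1: "f \<in> (\<Union>h\<in>uea_ideal g. {h \<oplus>\<^bsub>free_alg g\<^esub> f})" by (rule UN_I)
    show "y \<in> (\<Union>h\<in>uea_ideal g'. \<Union>k\<in>(\<Union>h\<in>uea_ideal g. {h \<oplus>\<^bsub>free_alg g\<^esub> f}). {h \<oplus>\<^bsub>free_alg g'\<^esub> k})"
      by (rule UN_I[OF h(1)], rule UN_I[OF f1]) (simp add: h(2))
  qed
qed


text \<open>
  The enveloping algebras are rings with a carrier. Their product over all Lie algebras is a ring on a whole type, so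
  that the identities above apply to it; \<open>component x g\<close> recovers the element of \<open>U(g)\<close>.
\<close>

typedef lie_alg = "{g. lie_subalgebra g}"
proof
  have "lie 0 0 = 0" by (simp add: lie_def)
  then show "{0} \<in> {g. lie_subalgebra g}"
    by (simp add: lie_subalgebra_def cmat.subspace_single_0)
qed

typedef uprod = "{x :: lie_alg \<Rightarrow> uea_elem. \<forall>g. x g \<in> carrier (uea (Rep_lie_alg g))}"
  by (rule exI[of _ "\<lambda>g. \<one>\<^bsub>uea (Rep_lie_alg g)\<^esub>"])
    (use Rep_lie_alg in \<open>auto intro!: ring.ring_simprules ring_uea\<close>)

setup_lifting type_definition_uprod

lemma Rep_lie: "lie_subalgebra (Rep_lie_alg g)"
  using Rep_lie_alg[of g] by simp

lemma ring_uea_Rep: "ring (uea (Rep_lie_alg g))"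
  by (rule ring_uea[OF Rep_lie])

lemma one_neq_zero_uea:
  assumes g: "lie_subalgebra g"
  shows "\<one>\<^bsub>uea g\<^esub> \<noteq> \<zero>\<^bsub>uea g\<^esub>"
proof
  assume "\<one>\<^bsub>uea g\<^esub> = \<zero>\<^bsub>uea g\<^esub>"
  then have "aug (uea_class g 1) = aug (uea_class g 0)" by (simp add: uea_class_simps[OF g] uea_class_0[OF g])
  then show False
    by (simp add: aug_uea_class[OF g] fcar_intros id_complex.ev_1 id_complex.ev_0 del: free_alg_simps)
qed

instantiation uprod :: calg
begin
lift_definition zero_uprod :: uprod is "\<lambda>g. \<zero>\<^bsub>uea (Rep_lie_alg g)\<^esub>"
  by (intro ring.ring_simprules ring_uea_Rep)
lift_definition one_uprod :: uprod is "\<lambda>g. \<one>\<^bsub>uea (Rep_lie_alg g)\<^esub>"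
  by (intro ring.ring_simprules ring_uea_Rep)
lift_definition plus_uprod :: "uprod \<Rightarrow> uprod \<Rightarrow> uprod" is "\<lambda>x y g. x g \<oplus>\<^bsub>uea (Rep_lie_alg g)\<^esub> y g"
  by (auto intro!: ring.ring_simprules ring_uea_Rep)
lift_definition minus_uprod :: "uprod \<Rightarrow> uprod \<Rightarrow> uprod" is "\<lambda>x y g. x g \<ominus>\<^bsub>uea (Rep_lie_alg g)\<^esub> y g"
  by (auto intro!: ring.ring_simprules ring_uea_Rep)
lift_definition uminus_uprod :: "uprod \<Rightarrow> uprod" is "\<lambda>x g. \<ominus>\<^bsub>uea (Rep_lie_alg g)\<^esub> x g"
  by (auto intro!: ring.ring_simprules ring_uea_Rep)
lift_definition times_uprod :: "uprod \<Rightarrow> uprod \<Rightarrow> uprod" is "\<lambda>x y g. x g \<otimes>\<^bsub>uea (Rep_lie_alg g)\<^esub> y g"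
  by (auto intro!: ring.ring_simprules ring_uea_Rep)
lift_definition cs_uprod :: "complex \<Rightarrow> uprod" is "\<lambda>c g. uea_const (Rep_lie_alg g) c"
  by (rule uea_const_closed[OF Rep_lie])
instance
proof
  fix x y z :: uprod and c d :: complex
  show "x + y + z = x + (y + z)" by transfer (rule ext, simp add: ring.ring_simprules[OF ring_uea_Rep])
  show "x + y = y + x" by transfer (rule ext, simp add: ring.ring_simprules[OF ring_uea_Rep])
  show "0 + x = x" by transfer (rule ext, simp add: ring.ring_simprules[OF ring_uea_Rep])
  show "- x + x = 0" by transfer (rule ext, simp add: ring.ring_simprules[OF ring_uea_Rep])
  show "x - y = x + - y" by transfer (rule ext, simp add: a_minus_def)
  show "x * y * z = x * (y * z)" by transfer (rule ext, simp add: ring.ring_simprules[OF ring_uea_Rep])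
  show "1 * x = x" by transfer (rule ext, simp add: ring.ring_simprules[OF ring_uea_Rep])
  show "x * 1 = x" by transfer (rule ext, simp add: monoid.r_one[OF ring.is_monoid[OF ring_uea_Rep]])
  show "(x + y) * z = x * z + y * z" by transfer (rule ext, simp add: ring.ring_simprules[OF ring_uea_Rep])
  show "x * (y + z) = x * y + x * z" by transfer (rule ext, simp add: ring.ring_simprules[OF ring_uea_Rep])
  show "(0::uprod) \<noteq> 1"
    by transfer (metis one_neq_zero_uea Rep_lie)
  show "cs (c + d) = (cs c + cs d :: uprod)" by transfer (simp add: uea_const_simps[OF Rep_lie])
  show "cs (c * d) = (cs c * cs d :: uprod)" by transfer (simp add: uea_const_simps[OF Rep_lie])
  show "cs 1 = (1 :: uprod)" by transfer (simp add: uea_const_simps[OF Rep_lie])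
  show "cs c * x = x * cs c" by transfer (simp add: uea_const_comm[OF Rep_lie])
qed
end

definition component :: "uprod \<Rightarrow> cmat set \<Rightarrow> uea_elem" where
  "component x g = Rep_uprod x (Abs_lie_alg g)"

context
  fixes g assumes g: "lie_subalgebra g"
begin

lemma Rep_Abs: "Rep_lie_alg (Abs_lie_alg g) = g"
  using g by (simp add: Abs_lie_alg_inverse)

lemma component_simps:
  "component (x + y) g = component x g \<oplus>\<^bsub>uea g\<^esub> component y g"
  "component (x - y) g = component x g \<ominus>\<^bsub>uea g\<^esub> component y g"
  "component (x * y) g = component x g \<otimes>\<^bsub>uea g\<^esub> component y g"
  "component (- x) g = \<ominus>\<^bsub>uea g\<^esub> component x g"
  "component 0 g = \<zero>\<^bsub>uea g\<^esub>" "component 1 g = \<one>\<^bsub>uea g\<^esub>" "component (cs c) g = uea_const g c"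
  unfolding component_def
  by (simp_all add: plus_uprod.rep_eq minus_uprod.rep_eq times_uprod.rep_eq uminus_uprod.rep_eq zero_uprod.rep_eq
      one_uprod.rep_eq cs_uprod.rep_eq Rep_Abs)

lemma component_closed [simp]: "component x g \<in> carrier (uea g)"
proof -
  have "Rep_uprod x (Abs_lie_alg g) \<in> carrier (uea (Rep_lie_alg (Abs_lie_alg g)))"
    using Rep_uprod[of x] by blast
  then show ?thesis unfolding component_def by (simp only: Rep_Abs)
qed

lemma component_pow: "component (x ^ k) g = component x g [^]\<^bsub>uea g\<^esub> k"
proof -
  interpret ring "uea g" by (rule ring_uea[OF g])
  show ?thesis by (induct k) (simp_all add: component_simps power_Suc2 del: power_Suc)
qed

lemma component_sum: "finite S \<Longrightarrow> component (sum f S) g = (\<Oplus>\<^bsub>uea g\<^esub>i\<in>S. component (f i) g)"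
proof -
  interpret ring "uea g" by (rule ring_uea[OF g])
  show "finite S \<Longrightarrow> ?thesis" by (induct S rule: finite_induct) (simp_all add: component_simps)
qed

end

section \<open>Matrices supported in a square of side n\<close>

definition box :: "nat \<Rightarrow> cmat set" where
  "box n = {A. \<forall>i j. A i j \<noteq> 0 \<longrightarrow> i \<in> {1..n} \<and> j \<in> {1..n}}"

lemma box_D: "A \<in> box n \<Longrightarrow> i \<notin> {1..n} \<or> j \<notin> {1..n} \<Longrightarrow> A i j = 0"
  unfolding box_def by blast

lemma so_box: "so n \<subseteq> box n"
  unfolding so_def box_def by blast

lemma subspace_box: "cmat.subspace (box n)"
proof -
  have iff: "A \<in> box n \<longleftrightarrow> (\<forall>i j. i \<notin> {1..n} \<or> j \<notin> {1..n} \<longrightarrow> A i j = 0)" for A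
    unfolding box_def by blast
  show ?thesis unfolding cmat.subspace_def by (simp add: smat_def iff del: atLeastAtMost_iff)
qed

text \<open>\<open>Sum_any\<close> returns 0 when infinitely many terms are nonzero, so
  \<open>mmul\<close> is an honest sum under bounded support only. Linearity, associativity and the
  Jacobi identity are therefore stated on \<open>box n\<close>.\<close>

lemma mmul_box:
  assumes "A \<in> box n \<or> B \<in> box n"
  shows "mmul A B i j = (\<Sum>k\<in>{1..n}. A i k * B k j)"
  unfolding mmul_def
proof (rule Sum_any.expand_superset)
  show "{k. A i k * B k j \<noteq> 0} \<subseteq> {1..n}"
    using assms by (auto simp: box_def)
qed simp

lemma mmul_box_closed: "A \<in> box n \<Longrightarrow> B \<in> box n \<Longrightarrow> mmul A B \<in> box n"
proof -
  assume A: "A \<in> box n" and B: "B \<in> box n"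
  have "mmul A B i j = 0" if "i \<notin> {1..n} \<or> j \<notin> {1..n}" for i j
    unfolding mmul_box[OF disjI1[OF A]] using that box_D[OF A] box_D[OF B] by (intro sum.neutral) auto
  then show ?thesis unfolding box_def by blast
qed

lemma mmul_lin:
  assumes "A \<in> box n" "B \<in> box n" "C \<in> box n"
  shows "mmul (A + B) C = mmul A C + mmul B C" "mmul C (A + B) = mmul C A + mmul C B"
    "mmul (A - B) C = mmul A C - mmul B C" "mmul C (A - B) = mmul C A - mmul C B"
    "mmul (smat c A) C = smat c (mmul A C)" "mmul C (smat c A) = smat c (mmul C A)"
  by (auto simp: fun_eq_iff mmul_box[OF disjI2[OF assms(3)]] mmul_box[OF disjI1[OF assms(3)]] smat_def
     sum.distrib sum_subtractf sum_distrib_left algebra_simps)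

lemma mmul_assoc:
  assumes "A \<in> box n" "B \<in> box n" "C \<in> box n"
  shows "mmul (mmul A B) C = mmul A (mmul B C)"
proof (intro ext)
  fix i j
  have "mmul (mmul A B) C i j = (\<Sum>k\<in>{1..n}. \<Sum>l\<in>{1..n}. A i l * B l k * C k j)"
    by (simp add: mmul_box[OF disjI2[OF assms(3)]] mmul_box[OF disjI1[OF assms(1)]] sum_distrib_right)
  also have "\<dots> = (\<Sum>l\<in>{1..n}. \<Sum>k\<in>{1..n}. A i l * B l k * C k j)" by (rule sum.swap)
  also have "\<dots> = mmul A (mmul B C) i j"
    by (simp add: mmul_box[OF disjI2[OF assms(3)]] mmul_box[OF disjI1[OF assms(1)]] sum_distrib_left mult.assoc)
  finally show "mmul (mmul A B) C i j = mmul A (mmul B C) i j" .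
qed

lemma lie_box:
  assumes "A \<in> box n" "B \<in> box n" "C \<in> box n"
  shows "lie (A + B) C = lie A C + lie B C" "lie C (A + B) = lie C A + lie C B"
    "lie (smat c A) C = smat c (lie A C)" "lie C (smat c A) = smat c (lie C A)"
    "lie A (lie B C) + lie B (lie C A) + lie C (lie A B) = 0" "lie A B \<in> box n"
proof -
  note cl = mmul_box_closed[OF assms(1,2)] mmul_box_closed[OF assms(2,1)] cmat.subspace_diff[OF subspace_box[of n]]
  show "lie (A + B) C = lie A C + lie B C" "lie C (A + B) = lie C A + lie C B"
    "lie (smat c A) C = smat c (lie A C)" "lie C (smat c A) = smat c (lie C A)"
    by (simp_all add: lie_def mmul_lin[OF assms] cmat.scale_right_diff_distrib)
  show "lie A B \<in> box n" by (simp add: lie_def cl)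
  have d: "mmul X (Y - Z) = mmul X Y - mmul X Z" "mmul (Y - Z) X = mmul Y X - mmul Z X"
    if "X \<in> box n" "Y \<in> box n" "Z \<in> box n" for X Y Z
    using mmul_lin[OF that(2,3,1)] by simp_all
  have e: "lie X (lie Y Z) = mmul X (mmul Y Z) - mmul X (mmul Z Y) - mmul Y (mmul Z X) + mmul Z (mmul Y X)"
    if "X \<in> box n" "Y \<in> box n" "Z \<in> box n" for X Y Z
    unfolding lie_def d(1)[OF that(1) mmul_box_closed[OF that(2,3)] mmul_box_closed[OF that(3,2)]]
      d(2)[OF that(1) mmul_box_closed[OF that(2,3)] mmul_box_closed[OF that(3,2)]]
      mmul_assoc[OF that(2,3,1)] mmul_assoc[OF that(3,2,1)] by simp
  show "lie A (lie B C) + lie B (lie C A) + lie C (lie A B) = 0"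
    unfolding e[OF assms] e[OF assms(2,3,1)] e[OF assms(3,1,2)]
    by (simp only: fun_eq_iff plus_fun_apply minus_apply zero_fun_apply) simp
qed

lemma lie_anti: "lie B A = - lie A B" "lie A A = 0"
  by (simp_all add: lie_def)

lemma so_skewD: "A \<in> so n \<Longrightarrow> A j i = - A i j"
  unfolding so_def by blast

lemma so_iff: "A \<in> so n \<longleftrightarrow> A \<in> box n \<and> (\<forall>i j. A j i = - A i j)"
  unfolding so_def box_def by blast

lemma lie_subalgebra_so: "lie_subalgebra (so n)"
  unfolding lie_subalgebra_def
proof (intro conjI ballI)
  show "cmat.subspace (so n)"
  proof (rule cmat.subspaceI)
    show "0 \<in> so n" by (simp add: so_def)
    show "x + y \<in> so n" if "x \<in> so n" "y \<in> so n" for x y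
      unfolding so_iff
    proof (intro conjI allI)
      show "x + y \<in> box n" using that so_box cmat.subspace_add[OF subspace_box] by blast
      show "(x + y) j i = - (x + y) i j" for i j
        using so_skewD[OF that(1), of j i] so_skewD[OF that(2), of j i] by simp
    qed
    show "smat c x \<in> so n" if "x \<in> so n" for c x
      unfolding so_iff
    proof (intro conjI allI)
      show "smat c x \<in> box n" using that so_box cmat.subspace_scale[OF subspace_box] by blast
      show "smat c x j i = - smat c x i j" for i j
        using so_skewD[OF that, of j i] by (simp add: smat_def)
    qed
  qed
  fix x y assume xy: "x \<in> so n" "y \<in> so n"
  then have b: "x \<in> box n" "y \<in> box n" using so_box by blast+
  have "lie x y j i = - lie x y i j" for i j
  proof -
    have "mmul x y j i = mmul y x i j"
      unfolding mmul_box[OF disjI1[OF b(1)]] mmul_box[OF disjI1[OF b(2)]]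
      by (intro sum.cong refl) (simp add: so_skewD[OF xy(1), of _ j] so_skewD[OF xy(2), of i])
    moreover have "mmul y x j i = mmul x y i j"
      unfolding mmul_box[OF disjI1[OF b(1)]] mmul_box[OF disjI1[OF b(2)]]
      by (intro sum.cong refl) (simp add: so_skewD[OF xy(2), of _ j] so_skewD[OF xy(1), of i])
    ultimately show ?thesis by (simp add: lie_def)
  qed
  then show "lie x y \<in> so n" unfolding so_iff using lie_box(6)[OF b b(1)] by blast
qed

lemma munit_box: "i \<in> {1..n} \<Longrightarrow> j \<in> {1..n} \<Longrightarrow> munit i j \<in> box n"
  by (auto simp: box_def munit_def)

lemma mmul_munit: "mmul (munit i j) (munit k l) = (if j = k then munit i l else 0)"
proof (intro ext)
  fix r s
  have "mmul (munit i j) (munit k l) r s = Sum_any (\<lambda>t. (if r = i \<and> j = k \<and> s = l then 1 else 0) when t = j)"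
    unfolding mmul_def by (rule arg_cong[of _ _ Sum_any]) (auto simp: munit_def fun_eq_iff when_def)
  then show "mmul (munit i j) (munit k l) r s = (if j = k then munit i l else 0) r s"
    by (auto simp: munit_def)
qed

lemma skew_so: "i \<in> {1..n} \<Longrightarrow> j \<in> {1..n} \<Longrightarrow> skew i j \<in> so n"
proof -
  assume "i \<in> {1..n}" "j \<in> {1..n}"
  then have "skew i j \<in> box n"
    unfolding skew_def using cmat.subspace_diff[OF subspace_box munit_box munit_box] by blast
  moreover have "skew i j s r = - skew i j r s" for r s
    unfolding skew_def munit_def minus_apply conj_commute[of "s = i"] conj_commute[of "s = j"] by simp
  ultimately show ?thesis unfolding so_iff by blast
qed

lemma skew_anti: "skew j i = smat (-1) (skew i j)"
  by (auto simp: skew_def smat_def fun_eq_iff)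

lemma lie_skew:
  assumes "i \<in> {1..n}" "j \<in> {1..n}" "k \<in> {1..n}" "l \<in> {1..n}"
  shows "lie (skew i j) (skew k l) = (if j = k then skew i l else 0) - (if i = k then skew j l else 0)
        + (if j = l then skew k i else 0) - (if i = l then skew k j else 0)"
proof -
  have d: "mmul (munit a b - munit b a) (munit c e - munit e c) =
      (if b = c then munit a e else 0) - (if b = e then munit a c else 0)
      - (if a = c then munit b e else 0) + (if a = e then munit b c else 0)"
    if "a \<in> {1..n}" "b \<in> {1..n}" "c \<in> {1..n}" "e \<in> {1..n}" for a b c e
  proof -
    note m = munit_box[of _ n] that cmat.subspace_diff[OF subspace_box[of n]]
    show ?thesis
      by (subst mmul_lin(3)[of _ n]) (simp_all only: m mmul_lin(4)[of _ n] mmul_munit, simp)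
  qed
  show ?thesis
    unfolding lie_def skew_def d[OF assms] d[OF assms(3,4,1,2)] by auto
qed


lemma lie_subalgebra_so_mono: "m \<le> n \<Longrightarrow> so m \<subseteq> so n"
proof -
  assume "m \<le> n"
  then have "{1..m} \<subseteq> {1..n}" by auto
  then show ?thesis unfolding so_def by blast
qed

lemma uea_gen_induct [consumes 2, case_names const emb add mult]:
  assumes g: "lie_subalgebra g" and y: "y \<in> carrier (uea g)"
    and const: "\<And>c. P (uea_const g c)"
    and emb: "\<And>x. x \<in> g \<Longrightarrow> P (uea_emb g x)"
    and add: "\<And>a b. a \<in> carrier (uea g) \<Longrightarrow> b \<in> carrier (uea g) \<Longrightarrow> P a \<Longrightarrow> P b \<Longrightarrow> P (a \<oplus>\<^bsub>uea g\<^esub> b)"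
    and mult: "\<And>a b. a \<in> carrier (uea g) \<Longrightarrow> b \<in> carrier (uea g) \<Longrightarrow> P a \<Longrightarrow> P b \<Longrightarrow> P (a \<otimes>\<^bsub>uea g\<^esub> b)"
  shows "P y"
proof -
  have word: "P (uea_class g (Poly_Mapping.single w 1)) \<and> Poly_Mapping.single w 1 \<in> fcar g" if "w \<in> lists g" for w
    using that
  proof (induct w)
    case Nil
    then show ?case using const[of 1] by (simp add: uea_const_uea_class scalar_def)
  next
    case (Cons x w)
    have e: "Poly_Mapping.single (x # w) 1 = letter x * Poly_Mapping.single w (1 :: complex)"
      by (simp add: letter_def mult_single)
    have fx: "letter x \<in> fcar g" and fw: "Poly_Mapping.single w 1 \<in> fcar g"
      using Cons by (auto intro!: fcar_intros simp del: free_alg_simps)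
    show ?case
      unfolding e uea_class_simps(2)[OF g fx fw]
    proof
      show "P (uea_class g (letter x) \<otimes>\<^bsub>uea g\<^esub> uea_class g (Poly_Mapping.single w 1))"
        using Cons uea_class_simps(1)[OF g fx] uea_class_simps(1)[OF g fw] emb[of x] by (intro mult) (auto simp: uea_emb_uea_class)
      show "letter x * Poly_Mapping.single w 1 \<in> fcar g" using fx fw by (rule fcar_intros)
    qed
  qed
  have sing: "P (uea_class g (Poly_Mapping.single w c)) \<and> Poly_Mapping.single w c \<in> fcar g" if w: "w \<in> lists g" for w c
  proof -
    have e: "Poly_Mapping.single w c = scalar c * Poly_Mapping.single w 1" by (simp add: scalar_def mult_single)
    have fw: "Poly_Mapping.single w 1 \<in> fcar g" using word[OF w] by blast
    show ?thesis
      unfolding e uea_class_simps(2)[OF g fcar_intros(7) fw]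
      using const[of c] word[OF w] uea_class_simps(1)[OF g fcar_intros(7)] uea_class_simps(1)[OF g fw] fcar_intros(1)[OF fcar_intros(7) fw]
      by (auto intro!: mult simp: uea_const_uea_class simp del: free_alg_simps)
  qed
  obtain f where f: "f \<in> fcar g" "y = uea_class g f" using uea_cases[OF g y] by blast
  have fin: "P (uea_class g (\<Sum>w\<in>W. Poly_Mapping.single w (Poly_Mapping.lookup f w))) \<and>
      (\<Sum>w\<in>W. Poly_Mapping.single w (Poly_Mapping.lookup f w)) \<in> fcar g" if "finite W" "W \<subseteq> lists g" for W
    using that
  proof (induct W rule: finite_induct)
    case empty
    then show ?case using const[of 0] by (simp add: uea_const_uea_class scalar_def fcar_intros)
  next
    case (insert w W)
    let ?a = "Poly_Mapping.single w (Poly_Mapping.lookup f w)" and ?b = "\<Sum>w\<in>W. Poly_Mapping.single w (Poly_Mapping.lookup f w)"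
    have a: "P (uea_class g ?a)" "?a \<in> fcar g" and b: "P (uea_class g ?b)" "?b \<in> fcar g" using insert sing by auto
    have "P (uea_class g (?a + ?b)) \<and> ?a + ?b \<in> fcar g"
      unfolding uea_class_simps(3)[OF g a(2) b(2)]
      using a b fcar_intros(2)[OF a(2) b(2)] uea_class_simps(1)[OF g a(2)] uea_class_simps(1)[OF g b(2)] add by blast
    then show ?case using insert by simp
  qed
  have "f = (\<Sum>w\<in>Poly_Mapping.keys f. Poly_Mapping.single w (Poly_Mapping.lookup f w))"
    by (rule poly_mapping_eqI) (simp add: lookup_sum lookup_single when_def in_keys_iff)
  then show ?thesis using fin[of "Poly_Mapping.keys f"] f by auto
qed

text \<open>The augmentation makes \<open>lift g\<close> multiplicative also in the components that do not contain \<open>g\<close>.\<close>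

definition lift :: "cmat set \<Rightarrow> uea_elem \<Rightarrow> uprod" where
  "lift g y = Abs_uprod (\<lambda>h. if g \<subseteq> Rep_lie_alg h then uea_incl g (Rep_lie_alg h) y else uea_const (Rep_lie_alg h) (aug y))"

context
  fixes g assumes g: "lie_subalgebra g"
begin

lemma uea_incl_simps:
  assumes h: "lie_subalgebra h" and sub: "g \<subseteq> h"
  shows "y \<in> carrier (uea g) \<Longrightarrow> uea_incl g h y \<in> carrier (uea h)"
    "y \<in> carrier (uea g) \<Longrightarrow> z \<in> carrier (uea g) \<Longrightarrow> uea_incl g h (y \<otimes>\<^bsub>uea g\<^esub> z) = uea_incl g h y \<otimes>\<^bsub>uea h\<^esub> uea_incl g h z"
    "y \<in> carrier (uea g) \<Longrightarrow> z \<in> carrier (uea g) \<Longrightarrow> uea_incl g h (y \<oplus>\<^bsub>uea g\<^esub> z) = uea_incl g h y \<oplus>\<^bsub>uea h\<^esub> uea_incl g h z"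
    "uea_incl g h (uea_const g c) = uea_const h c"
    "x \<in> g \<Longrightarrow> uea_incl g h (uea_emb g x) = uea_emb h x"
proof -
  have fsub: "f \<in> fcar h" if "f \<in> fcar g" for f using that lists_mono[OF sub] by auto
  note q = uea_incl_uea_class[OF g h sub]
  show "y \<in> carrier (uea g) \<Longrightarrow> uea_incl g h y \<in> carrier (uea h)"
    by (erule uea_cases[OF g]) (simp add: q fsub uea_class_simps(1)[OF h] del: free_alg_simps)
  show "y \<in> carrier (uea g) \<Longrightarrow> z \<in> carrier (uea g) \<Longrightarrow> uea_incl g h (y \<otimes>\<^bsub>uea g\<^esub> z) = uea_incl g h y \<otimes>\<^bsub>uea h\<^esub> uea_incl g h z"
    by (erule uea_cases[OF g], erule uea_cases[OF g])
      (simp add: q fsub fcar_intros uea_class_simps(2)[OF h] uea_class_simps(2)[OF g, symmetric] del: free_alg_simps)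
  show "y \<in> carrier (uea g) \<Longrightarrow> z \<in> carrier (uea g) \<Longrightarrow> uea_incl g h (y \<oplus>\<^bsub>uea g\<^esub> z) = uea_incl g h y \<oplus>\<^bsub>uea h\<^esub> uea_incl g h z"
    by (erule uea_cases[OF g], erule uea_cases[OF g])
      (simp add: q fsub fcar_intros uea_class_simps(3)[OF h] uea_class_simps(3)[OF g, symmetric] del: free_alg_simps)
  show "uea_incl g h (uea_const g c) = uea_const h c"
    by (simp add: uea_const_uea_class q fcar_intros del: free_alg_simps)
  show "x \<in> g \<Longrightarrow> uea_incl g h (uea_emb g x) = uea_emb h x"
    by (simp add: uea_emb_uea_class q fcar_intros del: free_alg_simps)
qed

lemma uea_incl_self: "y \<in> carrier (uea g) \<Longrightarrow> uea_incl g g y = y"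
  by (erule uea_cases[OF g]) (simp add: uea_incl_uea_class[OF g g] del: free_alg_simps)

lemma aug_simps:
  "y \<in> carrier (uea g) \<Longrightarrow> z \<in> carrier (uea g) \<Longrightarrow> aug (y \<otimes>\<^bsub>uea g\<^esub> z) = aug y * aug z"
  "y \<in> carrier (uea g) \<Longrightarrow> z \<in> carrier (uea g) \<Longrightarrow> aug (y \<oplus>\<^bsub>uea g\<^esub> z) = aug y + aug z"
  "aug (uea_const g c) = c"
proof -
  show "y \<in> carrier (uea g) \<Longrightarrow> z \<in> carrier (uea g) \<Longrightarrow> aug (y \<otimes>\<^bsub>uea g\<^esub> z) = aug y * aug z"
    by (erule uea_cases[OF g], erule uea_cases[OF g])
      (simp add: aug_uea_class[OF g] fcar_intros id_complex.ev_mult uea_class_simps(2)[OF g, symmetric] del: free_alg_simps)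
  show "y \<in> carrier (uea g) \<Longrightarrow> z \<in> carrier (uea g) \<Longrightarrow> aug (y \<oplus>\<^bsub>uea g\<^esub> z) = aug y + aug z"
    by (erule uea_cases[OF g], erule uea_cases[OF g])
      (simp add: aug_uea_class[OF g] fcar_intros id_complex.ev_add uea_class_simps(3)[OF g, symmetric] del: free_alg_simps)
  show "aug (uea_const g c) = c"
    by (simp add: uea_const_uea_class aug_uea_class[OF g] fcar_intros id_complex.ev_scalar del: free_alg_simps)
qed

lemma Rep_lift: "y \<in> carrier (uea g) \<Longrightarrow> Rep_uprod (lift g y) =
    (\<lambda>h. if g \<subseteq> Rep_lie_alg h then uea_incl g (Rep_lie_alg h) y else uea_const (Rep_lie_alg h) (aug y))"
  unfolding lift_def
  by (rule Abs_uprod_inverse) (auto simp: uea_incl_simps[OF Rep_lie] uea_const_closed[OF Rep_lie])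

lemma lift_mult: "y \<in> carrier (uea g) \<Longrightarrow> z \<in> carrier (uea g) \<Longrightarrow> lift g (y \<otimes>\<^bsub>uea g\<^esub> z) = lift g y * lift g z"
  and lift_add: "y \<in> carrier (uea g) \<Longrightarrow> z \<in> carrier (uea g) \<Longrightarrow> lift g (y \<oplus>\<^bsub>uea g\<^esub> z) = lift g y + lift g z"
  and lift_const: "lift g (uea_const g c) = cs c"
proof -
  interpret ring "uea g" by (rule ring_uea[OF g])
  show "y \<in> carrier (uea g) \<Longrightarrow> z \<in> carrier (uea g) \<Longrightarrow> lift g (y \<otimes>\<^bsub>uea g\<^esub> z) = lift g y * lift g z"
    by (rule Rep_uprod_inject[THEN iffD1])
      (auto simp: Rep_lift times_uprod.rep_eq uea_incl_simps[OF Rep_lie] aug_simps uea_const_simps[OF Rep_lie] fun_eq_iff)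
  show "y \<in> carrier (uea g) \<Longrightarrow> z \<in> carrier (uea g) \<Longrightarrow> lift g (y \<oplus>\<^bsub>uea g\<^esub> z) = lift g y + lift g z"
    by (rule Rep_uprod_inject[THEN iffD1])
      (auto simp: Rep_lift plus_uprod.rep_eq uea_incl_simps[OF Rep_lie] aug_simps uea_const_simps[OF Rep_lie] fun_eq_iff)
  show "lift g (uea_const g c) = cs c"
    by (rule Rep_uprod_inject[THEN iffD1])
      (auto simp: Rep_lift uea_const_closed[OF g] cs_uprod.rep_eq uea_incl_simps[OF Rep_lie] aug_simps fun_eq_iff)
qed

lemma component_lift: "lie_subalgebra h \<Longrightarrow> g \<subseteq> h \<Longrightarrow> y \<in> carrier (uea g) \<Longrightarrow> component (lift g y) h = uea_incl g h y"
  unfolding component_def by (simp add: Rep_lift Abs_lie_alg_inverse)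

end

section \<open>Transport of the Pfaffian formula along homomorphisms\<close>

definition calg_hom :: "('a::calg \<Rightarrow> 'b::calg) \<Rightarrow> bool" where
  "calg_hom f \<longleftrightarrow> (\<forall>x y. f (x + y) = f x + f y) \<and> (\<forall>x y. f (x * y) = f x * f y) \<and> (\<forall>c. f (cs c) = cs c)"

lemma calg_hom_lift: "lie_subalgebra g \<Longrightarrow> calg_hom (\<lambda>x. lift g (component x g))"
  by (simp add: calg_hom_def component_simps lift_add lift_mult lift_const)

text \<open>T is S with its coefficients mapped by f. This is a relation and not a map, since f is
  not assumed to be onto or injective and so a general S has no natural image.\<close>

definition frel :: "('a::calg \<Rightarrow> 'b::calg) \<Rightarrow> 'a fop \<Rightarrow> 'b fop \<Rightarrow> bool" where
  "frel f S T \<longleftrightarrow> (\<forall>v. fop_app T (\<lambda>I. f (v I)) = (\<lambda>I. f (fop_app S v I)))"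

context
  fixes f :: "'a::calg \<Rightarrow> 'b::calg"
  assumes f: "calg_hom f"
begin

lemma hom_simps: "f (x + y) = f x + f y" "f (x * y) = f x * f y" "f (cs c) = cs c" "f 0 = 0" "f 1 = 1"
  "f (- x) = - f x"
proof -
  show a: "f (x + y) = f x + f y" "f (x * y) = f x * f y" and c: "f (cs c) = cs c" for x y c using f by (simp_all add: calg_hom_def)
  show "f 0 = 0" using c[of 0] by simp
  then show "f (- x) = - f x" using a(1)[of x "- x"] by (simp add: eq_neg_iff_add_eq_0 add.commute)
  show "f 1 = 1" using c[of 1] by simp
qed

lemma hom_sc: "f (sc c x) = sc c (f x)"
  by (simp add: sc_def hom_simps)

lemma hom_sum: "f (sum h S) = (\<Sum>i\<in>S. f (h i))"
  by (induct S rule: infinite_finite_induct) (simp_all add: hom_simps)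

lemma hom_sg: "f (sg i I) = sg i I"
proof -
  have "f ((- 1) ^ k) = (- 1) ^ k" for k by (induct k) (simp_all add: hom_simps)
  then show ?thesis by (simp add: sg_def)
qed

lemma frel_fe: "frel f (fe i) (fe i)"
  by (simp add: frel_def app_fe fun_eq_iff hom_simps hom_sg)

lemma frel_fL: "frel f (fL a) (fL (f a))"
  by (simp add: frel_def fun_eq_iff hom_simps)

lemma frel_mult: "frel f S T \<Longrightarrow> frel f S' T' \<Longrightarrow> frel f (S * S') (T * T')"
  by (simp add: frel_def)

lemma frel_sum: "(\<And>i. i \<in> Q \<Longrightarrow> frel f (S i) (T i)) \<Longrightarrow> frel f (sum S Q) (sum T Q)"
  by (induct Q rule: infinite_finite_induct) (auto intro: simp: frel_def fun_eq_iff hom_simps)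

lemma frel_pow: "frel f S T \<Longrightarrow> frel f (S ^ k) (T ^ k)"
  by (induct k) (auto intro: frel_mult simp: frel_def)

lemma frel_fB: "frel f S T \<Longrightarrow> frel f S' T' \<Longrightarrow> f (fB G S S') = fB G T T'"
proof -
  assume *: "frel f S T" "frel f S' T'"
  have v: "(\<lambda>I. f (vac I)) = vac" by (auto simp: vac_def hom_simps)
  have "fop_app T vac = (\<lambda>I. f (fop_app S vac I))" "fop_app T' vac = (\<lambda>I. f (fop_app S' vac I))"
    using * unfolding frel_def by (metis v)+
  then show ?thesis by (simp add: fB_def hom_sum hom_simps)
qed

lemma hom_C_elem:
  assumes A: "so_alg A M" and A': "so_alg A' M" and AA': "\<And>i j. i \<in> M \<Longrightarrow> j \<in> M \<Longrightarrow> f (A i j) = A' i j"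
  shows "f (C_elem G A M u) = C_elem G A' M u"
proof -
  have e: "frel f (fe i * fe j * fL (A i j)) (fe i * fe j * fL (A' i j))" if "i \<in> M" "j \<in> M" for i j
    unfolding AA'[OF that, symmetric] by (intro frel_mult frel_fe frel_fL)
  have c: "frel f (cs c) (cs c)" for c
    using frel_fL[of "cs c"] by (simp add: hom_simps)
  have "frel f (so_alg.W A M) (so_alg.W A' M)"
    unfolding so_alg.W_def[OF A] so_alg.W_def[OF A'] by (intro frel_mult[OF c] frel_sum e)
  then have "f (so_alg.Pf2 A M G k) = so_alg.Pf2 A' M G k" for k
    unfolding so_alg.Pf2_def[OF A] so_alg.Pf2_def[OF A'] by (intro frel_fB frel_pow)
  then show ?thesis by (simp add: C_elem_def hom_sum hom_sc)
qed

end

section \<open>Identification of \<open>Cn\<close> with the Pfaffian formula\<close>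

definition A_so :: "nat \<Rightarrow> nat \<Rightarrow> nat \<Rightarrow> uprod" where
  "A_so n i j = lift (so n) (uea_emb (so n) (skew i j))"

lemma lift_emb_lin:
  assumes g: "lie_subalgebra g"
  shows "x \<in> g \<Longrightarrow> y \<in> g \<Longrightarrow> lift g (uea_emb g (x + y)) = lift g (uea_emb g x) + lift g (uea_emb g y)"
    "x \<in> g \<Longrightarrow> lift g (uea_emb g (smat c x)) = sc c (lift g (uea_emb g x))"
    "x \<in> g \<Longrightarrow> y \<in> g \<Longrightarrow> lift g (uea_emb g x) * lift g (uea_emb g y) =
       lift g (uea_emb g y) * lift g (uea_emb g x) + lift g (uea_emb g (lie x y))"
    "lift g (uea_emb g 0) = 0"
    "x \<in> g \<Longrightarrow> y \<in> g \<Longrightarrow> lift g (uea_emb g (x - y)) = lift g (uea_emb g x) - lift g (uea_emb g y)"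
proof -
  interpret ring "uea g" by (rule ring_uea[OF g])
  show add: "lift g (uea_emb g (x + y)) = lift g (uea_emb g x) + lift g (uea_emb g y)" if "x \<in> g" "y \<in> g" for x y
    using that by (simp add: uea_emb_add[OF g] lift_add[OF g] uea_emb_closed[OF g])
  show smat: "lift g (uea_emb g (smat c x)) = sc c (lift g (uea_emb g x))" if "x \<in> g" for c x
    using that by (simp add: uea_emb_smat[OF g] lift_mult[OF g] lift_const[OF g] uea_emb_closed[OF g] uea_const_closed[OF g] sc_def)
  show "x \<in> g \<Longrightarrow> y \<in> g \<Longrightarrow> lift g (uea_emb g x) * lift g (uea_emb g y) =
       lift g (uea_emb g y) * lift g (uea_emb g x) + lift g (uea_emb g (lie x y))"
    using uea_emb_lie[OF g, of x y]
    by (simp add: lift_mult[OF g, symmetric] lift_add[OF g, symmetric] uea_emb_closed[OF g] lie_subalgebraD[OF g])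
  have z: "0 \<in> g" using lie_subalgebraD[OF g] by blast
  then show "lift g (uea_emb g 0) = 0" using smat[OF z, of 0] by (simp add: smat_def zero_fun_def)
  show "lift g (uea_emb g (x - y)) = lift g (uea_emb g x) - lift g (uea_emb g y)" if "x \<in> g" "y \<in> g"
    using add[of "x - y" y] that lie_subalgebraD(6)[OF g] by (simp add: algebra_simps)
qed

lemma so_alg_A_so:
  assumes "M \<subseteq> {1..n}"
  shows "so_alg (A_so n) M"
proof
  note L = lift_emb_lin[OF lie_subalgebra_so[of n]]
  have s: "skew i j \<in> so n" if "i \<in> M" "j \<in> M" for i j
    using skew_so that assms by blast
  show "finite M" using assms finite_subset by blast
  fix i j assume i: "i \<in> M" and j: "j \<in> M"
  show "A_so n j i = - A_so n i j"
    unfolding A_so_def skew_anti[of j i] L(2)[OF s[OF i j]] by (simp add: sc_minus_left)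
  fix k l assume k: "k \<in> M" and l: "l \<in> M"
  have z: "0 \<in> so n" using lie_subalgebraD[OF lie_subalgebra_so] by blast
  have e: "lift (so n) (uea_emb (so n) (if P then x else 0)) = (if P then lift (so n) (uea_emb (so n) x) else 0)" for P x
    using L(4) by simp
  have c: "(if P then x else 0) \<in> so n" if "x \<in> so n" for P x using that z by simp
  have "A_so n i j * A_so n k l - A_so n k l * A_so n i j = lift (so n) (uea_emb (so n) (lie (skew i j) (skew k l)))"
    unfolding A_so_def L(3)[OF s[OF i j] s[OF k l]] by simp
  also have "lie (skew i j) (skew k l) = (if j = k then skew i l else 0) - (if i = k then skew j l else 0)
        + (if j = l then skew k i else 0) - (if i = l then skew k j else 0)"
    using i j k l assms by (intro lie_skew[of _ n]) auto
  also have "lift (so n) (uea_emb (so n) \<dots>) = (if j = k then A_so n i l else 0) - (if i = k then A_so n j l else 0)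
        + (if j = l then A_so n k i else 0) - (if i = l then A_so n k j else 0)"
    unfolding A_so_def
    by (simp only: L(1,5) c s i j k l lie_subalgebraD[OF lie_subalgebra_so] e)
  finally show "A_so n i j * A_so n k l - A_so n k l * A_so n i j = (if j = k then A_so n i l else 0) - (if i = k then A_so n j l else 0)
        + (if j = l then A_so n k i else 0) - (if i = l then A_so n k j else 0)" .
qed

lemma component_A_so: "i \<in> {1..n} \<Longrightarrow> j \<in> {1..n} \<Longrightarrow> component (A_so n i j) (so n) = uea_emb (so n) (skew i j)"
  unfolding A_so_def
  by (simp add: component_lift[OF lie_subalgebra_so lie_subalgebra_so] uea_emb_closed[OF lie_subalgebra_so] skew_so
      uea_incl_self[OF lie_subalgebra_so] del: atLeastAtMost_iff)

lemma component_sc: "lie_subalgebra g \<Longrightarrow> component (sc c x) g = uea_const g c \<otimes>\<^bsub>uea g\<^esub> component x g"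
  by (simp add: sc_def component_simps)

text \<open>In general \<open>A_so m\<close> and \<open>A_so n\<close> are different in the product
  ring, although they agree in the component of \<open>so n\<close>. Taking the component at
  \<open>so n\<close> and lifting it back is an endomorphism that sends the former to the
  latter.\<close>

lemma C_elem_incl:
  assumes "m \<le> n"
  shows "component (C_elem G (A_so n) {1..m} u) (so n) = uea_incl (so m) (so n) (component (C_elem G (A_so m) {1..m} u) (so m))"
proof -
  let ?g = "so m" and ?h = "so n"
  have sub: "?g \<subseteq> ?h" using lie_subalgebra_so_mono[OF assms] .
  note g = lie_subalgebra_so[of m] and h = lie_subalgebra_so[of n]
  have mn: "{1..m} \<subseteq> {1..n}" using assms by auto
  note A = so_alg_A_so[of "{1..m}" m] so_alg_A_so[OF mn]
  let ?f = "\<lambda>x. lift ?g (component x ?g)" and ?f' = "\<lambda>x. lift ?h (component x ?h)"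
  have em: "uea_emb ?g (skew i j) \<in> carrier (uea ?g)" if "i \<in> {1..m}" "j \<in> {1..m}" for i j
    using uea_emb_closed[OF g skew_so[OF that]] .
  have 1: "?f (C_elem G (A_so m) {1..m} u) = C_elem G (A_so m) {1..m} u"
  proof (rule hom_C_elem[OF calg_hom_lift[OF g] A(1) A(1)])
    fix i j assume ij: "i \<in> {1..m}" "j \<in> {1..m}"
    show "lift ?g (component (A_so m i j) ?g) = A_so m i j"
      by (simp only: component_A_so[OF ij]) (simp only: A_so_def)
  qed simp_all
  have 2: "?f' (C_elem G (A_so m) {1..m} u) = C_elem G (A_so n) {1..m} u"
  proof (rule hom_C_elem[OF calg_hom_lift[OF h] A(1) A(2)])
    fix i j assume ij: "i \<in> {1..m}" "j \<in> {1..m}"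
    show "lift ?h (component (A_so m i j) ?h) = A_so n i j"
      unfolding A_so_def component_lift[OF g h sub em[OF ij]] uea_incl_simps(5)[OF g h sub skew_so[OF ij]] by (rule refl)
  qed simp
  have "component (C_elem G (A_so n) {1..m} u) ?h = component (?f' (C_elem G (A_so m) {1..m} u)) ?h"
    by (simp only: 2)
  also have "\<dots> = component (C_elem G (A_so m) {1..m} u) ?h"
    by (simp add: component_lift[OF h h] uea_incl_self[OF h] component_closed[OF h])
  also have "\<dots> = component (?f (C_elem G (A_so m) {1..m} u)) ?h"
    by (simp only: 1)
  also have "\<dots> = uea_incl ?g ?h (component (C_elem G (A_so m) {1..m} u) ?g)"
    by (rule component_lift[OF g h sub component_closed[OF g]])
  finally show ?thesis .
qed

lemma elem_so:
  assumes "2 \<le> n"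
  shows "elemH n \<in> so n" "i \<in> {1..n-2} \<Longrightarrow> elemX n i \<in> so n" 
proof -
  note D = lie_subalgebraD[OF lie_subalgebra_so[of n]]
  show "elemH n \<in> so n" unfolding elemH_def using assms by (intro D skew_so) auto
  show "elemX n i \<in> so n" if "i \<in> {1..n-2}" unfolding elemX_def using assms that by (intro D skew_so) auto
qed

text \<open>With p = n - 1 and q = n, the abstract \<open>X i\<close>, \<open>H\<close> and
  \<open>M.Om\<close> of \<open>so_pair\<close> become \<open>elemX\<close>, \<open>elemH\<close>
  and \<open>Omega\<close>.\<close>

lemma component_C_elem_step:
  assumes G: "finite G" "{1..n} \<subseteq> G" and n: "2 \<le> n"
  shows "component (C_elem G (A_so n) {1..n} u) (so n) = C_step n u (component (C_elem G (A_so n) {1..n-2} u) (so n))"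
proof -
  let ?g = "so n" let ?A = "A_so n" let ?R = "uea ?g" let ?M = "{1..n-2}"
  note g = lie_subalgebra_so[of n]
  have K: "insert (n-1) (insert n ?M) = {1..n}" using n by auto
  interpret so_pair ?A ?M "n-1" n G
    unfolding so_pair_def K using G n by (auto intro!: so_alg_A_so)
  interpret R: ring ?R by (rule ring_uea[OF g])
  let ?c = "C_elem G ?A ?M u"
  have r: "n - 1 \<in> {1..n}" "n \<in> {1..n}" using n by auto
  have rM: "i \<in> {1..n}" if "i \<in> ?M" for i using that by auto
  have aH: "component H ?g = uea_emb ?g (elemH n)"
    unfolding elemH_def component_sc[OF g] component_A_so[OF r(2,1)] uea_emb_smat[OF g skew_so[OF r(2,1)]] by (rule refl)
  have aA: "component (?A (n-1) i) ?g = uea_emb ?g (skew (n-1) i)" if "i \<in> ?M" for i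
    using r rM[OF that] by (intro component_A_so) auto
  have aX: "component (X i) ?g = uea_emb ?g (elemX n i)" if i: "i \<in> ?M" for i
    unfolding elemX_def component_simps(1)[OF g] component_sc[OF g] aA[OF i] component_A_so[OF r(2) rM[OF i]]
      uea_emb_add[OF g skew_so[OF r(1) rM[OF i]] lie_subalgebraD(2)[OF g skew_so[OF r(2) rM[OF i]]]]
      uea_emb_smat[OF g skew_so[OF r(2) rM[OF i]]] by (rule refl)
  have aOm: "component M.Om ?g = Omega n (n-2)"
  proof -
    have ij: "j \<in> {1..n}" "i \<in> {1..n}" if "j \<in> ?M" "i \<in> {1..<j}" for i j using that by auto
    have "M.Om = (\<Sum>j\<in>?M. \<Sum>i\<in>{1..<j}. ?A j i ^ 2)"
      unfolding M.Om_def by (intro sum.cong refl) auto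
    then have "component M.Om ?g = (\<Oplus>\<^bsub>?R\<^esub>j\<in>?M. \<Oplus>\<^bsub>?R\<^esub>i\<in>{1..<j}. component (?A j i) ?g [^]\<^bsub>?R\<^esub> (2::nat))"
      by (simp add: component_sum[OF g] component_pow[OF g])
    also have "\<dots> = Omega n (n-2)"
      unfolding Omega_def Let_def
    proof (rule R.finsum_cong')
      show "(\<lambda>j. \<Oplus>\<^bsub>?R\<^esub>i\<in>{1..<j}. uea_emb ?g (skew j i) [^]\<^bsub>?R\<^esub> (2::nat)) \<in> ?M \<rightarrow> carrier ?R"
        using ij by (intro Pi_I R.finsum_closed R.nat_pow_closed uea_emb_closed[OF g] skew_so)
      fix j assume j: "j \<in> ?M"
      show "(\<Oplus>\<^bsub>?R\<^esub>i\<in>{1..<j}. component (?A j i) ?g [^]\<^bsub>?R\<^esub> (2::nat)) = (\<Oplus>\<^bsub>?R\<^esub>i\<in>{1..<j}. uea_emb ?g (skew j i) [^]\<^bsub>?R\<^esub> (2::nat))"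
      proof (rule R.finsum_cong')
        show "(\<lambda>i. uea_emb ?g (skew j i) [^]\<^bsub>?R\<^esub> (2::nat)) \<in> {1..<j} \<rightarrow> carrier ?R"
          using ij[OF j] by (intro Pi_I R.nat_pow_closed uea_emb_closed[OF g] skew_so)
        show "component (?A j i) ?g [^]\<^bsub>?R\<^esub> (2::nat) = uea_emb ?g (skew j i) [^]\<^bsub>?R\<^esub> (2::nat)" if "i \<in> {1..<j}" for i
          unfolding component_A_so[OF ij[OF j that]] by (rule refl)
      qed simp
    qed simp
    finally show ?thesis .
  qed
  have com: "component (a * b - b * a) ?g = commutator ?R (component a ?g) (component b ?g)" for a b
    by (simp add: component_simps[OF g] commutator_def)
  have fs: "component (\<Sum>i\<in>?M. f i) ?g = (\<Oplus>\<^bsub>?R\<^esub>i\<in>?M. F i)" if f: "\<And>i. i \<in> ?M \<Longrightarrow> component (f i) ?g = F i" for f F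
  proof -
    have "F i \<in> carrier ?R" if "i \<in> ?M" for i using f[OF that] component_closed[OF g, of "f i"] by simp
    then show ?thesis unfolding component_sum[OF g finite_atLeastAtMost] by (intro R.finsum_cong') (use f in auto)
  qed
  have k: "of_nat (card ?M) / 2 = (of_nat n - 2) / (2 :: complex)" "(of_nat (card ?M) - 3) / 2 = (of_nat n - 5) / (2 :: complex)"
    using n by (simp_all add: of_nat_diff)
  have "C_elem G ?A {1..n} u = step u ?c" using C_elem_step[of u] unfolding K .
  then have "component (C_elem G ?A {1..n} u) ?g = component (step u ?c) ?g" by simp
  also have "\<dots> = C_step n u (component ?c ?g)"
    unfolding C_step_def Let_def step_def k component_simps(1,2,3,4)[OF g] component_simps(7)[OF g] component_pow[OF g] aH
  proof (intro arg_cong2[of _ _ _ _ "add ?R"] arg_cong2[of _ _ _ _ "mult ?R"] arg_cong2[of _ _ _ _ "a_minus ?R"]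
      arg_cong[of _ _ "a_inv ?R"] refl)
    show "component (\<Sum>i\<in>?M. X i ^ 2) ?g = (\<Oplus>\<^bsub>?R\<^esub>i\<in>?M. uea_emb ?g (elemX n i) [^]\<^bsub>?R\<^esub> (2::nat))"
      by (rule fs) (simp only: component_pow[OF g] aX)
    show "component (\<Sum>i\<in>?M. X i * (H - cs ((of_nat n - 5) / 2)) * (?A (n-1) i * ?c - ?c * ?A (n-1) i)) ?g =
       (\<Oplus>\<^bsub>?R\<^esub>i\<in>?M. uea_emb ?g (elemX n i) \<otimes>\<^bsub>?R\<^esub> (uea_emb ?g (elemH n) \<ominus>\<^bsub>?R\<^esub> uea_const ?g ((of_nat n - 5) / 2))
          \<otimes>\<^bsub>?R\<^esub> commutator ?R (uea_emb ?g (skew (n-1) i)) (component ?c ?g))"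
      by (rule fs) (simp only: component_simps(3)[OF g] commutator_def aX aA component_simps(2)[OF g] component_simps(7)[OF g] aH)
    show "component (\<Sum>i\<in>?M. X i * ?c * ?A (n-1) i) ?g =
       (\<Oplus>\<^bsub>?R\<^esub>i\<in>?M. uea_emb ?g (elemX n i) \<otimes>\<^bsub>?R\<^esub> component ?c ?g \<otimes>\<^bsub>?R\<^esub> uea_emb ?g (skew (n-1) i))"
      by (rule fs) (simp only: component_simps(3)[OF g] aX aA)
    show "component (\<Sum>i\<in>?M. X i * (M.Om * (?A (n-1) i * ?c - ?c * ?A (n-1) i) - (?A (n-1) i * ?c - ?c * ?A (n-1) i) * M.Om)) ?g =
       (\<Oplus>\<^bsub>?R\<^esub>i\<in>?M. uea_emb ?g (elemX n i) \<otimes>\<^bsub>?R\<^esub> commutator ?R (Omega n (n-2)) (commutator ?R (uea_emb ?g (skew (n-1) i)) (component ?c ?g)))"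
      by (rule fs) (simp only: component_simps(3)[OF g] com aX aA aOm)
    show "component (\<Sum>i\<in>?M. \<Sum>j\<in>?M. X i * X j * (?A (n-1) i * (?A (n-1) j * ?c - ?c * ?A (n-1) j) - (?A (n-1) j * ?c - ?c * ?A (n-1) j) * ?A (n-1) i)) ?g =
       (\<Oplus>\<^bsub>?R\<^esub>i\<in>?M. \<Oplus>\<^bsub>?R\<^esub>j\<in>?M. uea_emb ?g (elemX n i) \<otimes>\<^bsub>?R\<^esub> uea_emb ?g (elemX n j) \<otimes>\<^bsub>?R\<^esub>
          commutator ?R (uea_emb ?g (skew (n-1) i)) (commutator ?R (uea_emb ?g (skew (n-1) j)) (component ?c ?g)))"
      by (rule fs, rule fs) (simp only: component_simps(3)[OF g] com aX aA)
  qed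
  finally show ?thesis .
qed

lemma C_elem_small: "finite G \<Longrightarrow> {1..n} \<subseteq> G \<Longrightarrow> n < 2 \<Longrightarrow> C_elem G (A_so n) {1..n} u = 1"
proof -
  assume G: "finite G" "{1..n} \<subseteq> G" and n: "n < 2"
  then have "n div 2 = 0" by simp
  then show ?thesis
    using G by (simp add: C_elem_def so_alg.Pf2_def[OF so_alg_A_so] fB_1 dcoef_def)
qed

text \<open>G stays fixed in the induction, because \<open>C_elem_step\<close> forms the pairings
  for n - 2 and for n indices over the same set.\<close>

lemma Cn_eq_C_elem:
  assumes "finite G" "{1..n} \<subseteq> G"
  shows "Cn n u = component (C_elem G (A_so n) {1..n} u) (so n)"
  using assms
proof (induct n u rule: Cn.induct)
  case (1 u)
  then have "C_elem G (A_so 0) {1..0} u = 1" by (intro C_elem_small) auto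
  then show ?case by (simp only: component_simps[OF lie_subalgebra_so] Cn.simps)
next
  case (2 u)
  then have "C_elem G (A_so (Suc 0)) {1..Suc 0} u = 1" by (intro C_elem_small) auto
  then show ?case by (simp only: component_simps[OF lie_subalgebra_so] Cn.simps)
next
  case (3 m u)
  have "{1..m} \<subseteq> G" using 3(3) by auto
  then have m: "Cn m u = component (C_elem G (A_so m) {1..m} u) (so m)" by (rule 3(1)[OF 3(2)])
  have e: "Suc (Suc m) - 2 = m" by simp
  show ?case
    unfolding Cn.simps m
    by (subst component_C_elem_step[OF 3(2,3)]) (simp, simp only: e C_elem_incl[of m "Suc (Suc m)"])
qed

text \<open>The sum runs over ordered pairs and so counts each entry twice; hence the division by
  2.\<close>

lemma so_sum_skew:
  assumes "x \<in> so n"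
  shows "x = (\<Sum>i\<in>{1..n}. \<Sum>j\<in>{1..n}. smat (x i j / 2) (skew i j))"
proof (intro ext)
  fix r s
  have b: "x \<in> box n" using assms so_box by blast
  have sa: "(\<Sum>i\<in>S. f i) r s = (\<Sum>i\<in>S. f i r s)" for f :: "nat \<Rightarrow> cmat" and S
    by (induct S rule: infinite_finite_induct) auto
  have e: "smat (x i j / 2) (skew i j) r s = (if i = r then if j = s then x r s / 2 else 0 else 0)
      - (if i = s then if j = r then x s r / 2 else 0 else 0)" for i j
    by (auto simp: smat_def skew_def munit_def)
  have o: "(\<Sum>i\<in>{1..n}. if i = r then c else 0) = (if r \<in> {1..n} then c else 0)" for r and c :: complex
    by simp
  have "(\<Sum>i\<in>{1..n}. \<Sum>j\<in>{1..n}. smat (x i j / 2) (skew i j)) r s =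
     (if r \<in> {1..n} \<and> s \<in> {1..n} then x r s / 2 - x s r / 2 else 0)"
    unfolding sa e sum_subtractf by (simp add: sum_if_out[where 'a = complex] del: atLeastAtMost_iff)
  also have "\<dots> = x r s"
    using so_skewD[OF assms, of s r] box_D[OF b, of r s] by auto
  finally show "x r s = (\<Sum>i\<in>{1..n}. \<Sum>j\<in>{1..n}. smat (x i j / 2) (skew i j)) r s" by simp
qed

theorem Cn_central: "Cn n u \<in> ring_center (uea (so n))"
proof -
  let ?g = "so n" let ?R = "uea ?g"
  note g = lie_subalgebra_so[of n]
  interpret R: ring ?R by (rule ring_uea[OF g])
  have z: "Cn n u = component (C_elem {1..n} (A_so n) {1..n} u) ?g" by (rule Cn_eq_C_elem) auto
  let ?z = "Cn n u"
  have zc: "?z \<in> carrier ?R" unfolding z by (rule component_closed[OF g])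
  interpret so_alg "A_so n" "{1..n}" by (rule so_alg_A_so) simp
  have sk: "?z \<otimes>\<^bsub>?R\<^esub> uea_emb ?g (skew i j) = uea_emb ?g (skew i j) \<otimes>\<^bsub>?R\<^esub> ?z" if "i \<in> {1..n}" "j \<in> {1..n}" for i j
    using A_C_elem[of "{1..n}" i j u] that
    by (simp add: z component_A_so[OF that, symmetric] component_simps(3)[OF g, symmetric] del: atLeastAtMost_iff)
  define S where "S = {x \<in> ?g. ?z \<otimes>\<^bsub>?R\<^esub> uea_emb ?g x = uea_emb ?g x \<otimes>\<^bsub>?R\<^esub> ?z}"
  have S: "cmat.subspace S"
  proof (rule cmat.subspaceI)
    have sm: "smat c x \<in> S" if x: "x \<in> S" for c x
    proof -
      have xg: "x \<in> ?g" and xz: "?z \<otimes>\<^bsub>?R\<^esub> uea_emb ?g x = uea_emb ?g x \<otimes>\<^bsub>?R\<^esub> ?z" using x by (auto simp: S_def)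
      note cl = uea_emb_closed[OF g xg] uea_const_closed[OF g, of c] zc
      have "?z \<otimes>\<^bsub>?R\<^esub> (uea_const ?g c \<otimes>\<^bsub>?R\<^esub> uea_emb ?g x) = (uea_const ?g c \<otimes>\<^bsub>?R\<^esub> uea_emb ?g x) \<otimes>\<^bsub>?R\<^esub> ?z"
        using cl xz uea_const_comm[OF g zc, of c] by (metis R.m_assoc)
      then show ?thesis using xg by (simp add: S_def uea_emb_smat[OF g] lie_subalgebraD[OF g])
    qed
    show "x + y \<in> S" if "x \<in> S" "y \<in> S" for x y
      using that by (auto simp: S_def uea_emb_add[OF g] lie_subalgebraD[OF g] R.r_distr R.l_distr zc uea_emb_closed[OF g])
    show "smat c x \<in> S" if "x \<in> S" for c x using sm[OF that] .
    have z0: "0 \<in> ?g" using lie_subalgebraD[OF g] by blast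
    have "uea_emb ?g 0 = \<zero>\<^bsub>?R\<^esub>"
      using uea_emb_smat[OF g z0, of 0] uea_const_simps[OF g] uea_emb_closed[OF g z0] by (simp add: smat_def zero_fun_def)
    then show "0 \<in> S" using zc z0 by (simp add: S_def)
  qed
  have gS: "x \<in> S" if "x \<in> ?g" for x
  proof -
    have "(\<Sum>i\<in>{1..n}. \<Sum>j\<in>{1..n}. smat (x i j / 2) (skew i j)) \<in> S"
      using sk skew_so by (intro cmat.subspace_sum[OF S] cmat.subspace_scale[OF S]) (auto simp: S_def simp del: atLeastAtMost_iff)
    then show ?thesis using so_sum_skew[OF that] by simp
  qed
  have "?z \<otimes>\<^bsub>?R\<^esub> a = a \<otimes>\<^bsub>?R\<^esub> ?z" if a: "a \<in> carrier ?R" for a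
    using g a
  proof (induct rule: uea_gen_induct)
    case (const c) show ?case using uea_const_comm[OF g zc] by simp
  next
    case (emb x) then show ?case using gS by (auto simp: S_def)
  next
    case (add a b) then show ?case using zc by (simp add: R.r_distr R.l_distr)
  next
    case (mult a b) then show ?case using zc by (metis R.m_assoc)
  qed
  then show ?thesis using zc by (simp add: ring_center_def)
qed

section \<open>Straightening of words and uniqueness of the projection\<close>

fun first_descent :: "nat list \<Rightarrow> (nat list \<times> nat \<times> nat \<times> nat list) option" where
  "first_descent (x # y # c) = (if y < x then Some ([], x, y, c)
     else map_option (\<lambda>(a, x', y', c'). (x # a, x', y', c')) (first_descent (y # c)))"
| "first_descent _ = None"

lemma first_descent_Some: "first_descent w = Some (a, x, y, c) \<Longrightarrow> w = a @ x # y # c \<and> y < x"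
  by (induct w arbitrary: a rule: first_descent.induct) (auto split: if_splits)

text \<open>A known descent bounds the position of the first one. In \<open>confluence_desc\<close>
  this excludes a first descent to the right of the given pair.\<close>

lemma first_descent_first:
  "y < x \<Longrightarrow> \<exists>a' x' y' c'. first_descent (a @ x # y # c) = Some (a', x', y', c') \<and> length a' \<le> length a"
proof (induct a)
  case (Cons z a)
  then obtain a' x' y' c' where *: "first_descent (a @ x # y # c) = Some (a', x', y', c')" "length a' \<le> length a" by blast
  show ?case
  proof (cases a)
    case Nil
    then show ?thesis using Cons(2) by auto
  next
    case (Cons z' a2)
    then show ?thesis using * by auto
  qed
qed simp

text \<open>Each letter counts as often as there are letters from it to the end of the word, so
  moving the larger of two neighbours to the right lowers the weight. Together with the length it is
  the termination measure of \<open>\<sigma>\<close>.\<close>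

fun word_weight :: "nat list \<Rightarrow> nat" where
  "word_weight [] = 0"
| "word_weight (x # w) = x * (length w + 1) + word_weight w"

lemma word_weight_swap: "y < x \<Longrightarrow> word_weight (a @ y # x # c) < word_weight (a @ x # y # c)"
  by (induct a) (auto simp: algebra_simps)

text \<open>
  \<open>\<sigma>\<close> straightens words over \<open>{..<D}\<close>, \<open>s\<close> being the structure constants, and applies \<open>\<tau>\<close> to the sorted ones. By confluence, the
  straightening of an arbitrary pair of neighbours, not just of the first descent, does not change the value.
\<close>

locale pbw =
  fixes D :: nat and s :: "nat \<Rightarrow> nat \<Rightarrow> nat \<Rightarrow> complex" and \<tau> :: "nat list \<Rightarrow> 'v::calg"
  assumes s_anti: "s j i k = - s i j k"
    and s_jac: "(\<Sum>k<D. s y z k * s x k l + s z x k * s y k l + s x y k * s z k l) = 0"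
begin

function \<sigma> :: "nat list \<Rightarrow> 'v" where
  "\<sigma> w = (case first_descent w of None \<Rightarrow> \<tau> w
     | Some (a, x, y, c) \<Rightarrow> \<sigma> (a @ y # x # c) + (\<Sum>k<D. sc (s x y k) (\<sigma> (a @ k # c))))"
  by pat_completeness auto
termination
  by (relation "inv_image (less_than <*lex*> less_than) (\<lambda>w. (length w, word_weight w))")
    (auto dest!: first_descent_Some simp: word_weight_swap)

declare \<sigma>.simps [simp del]

definition S where "S x y a c = (\<Sum>k<D. sc (s x y k) (\<sigma> (a @ k # c)))"

lemma \<sigma>_Some: "first_descent w = Some (a, x, y, c) \<Longrightarrow> \<sigma> w = \<sigma> (a @ y # x # c) + S x y a c"
  by (subst \<sigma>.simps) (simp add: S_def)

lemma S_anti: "S y x a c = - S x y a c"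
  unfolding S_def sum_negf[symmetric] by (intro sum.cong refl) (simp add: s_anti[of x] sc_minus_left)

lemma s_diag: "s x x k = 0"
  using s_anti[of x x k] by simp

lemma swap_if_descent:
  assumes Q: "\<And>x y. y < x \<Longrightarrow> \<sigma> (a @ x # y # c) = \<sigma> (a @ y # x # c) + S x y a c"
  shows "\<sigma> (a @ x # y # c) = \<sigma> (a @ y # x # c) + S x y a c"
proof (cases x y rule: linorder_cases)
  case less
  then show ?thesis using Q[of x y] S_anti[of x y] by simp
next
  case equal
  then show ?thesis by (simp add: S_def s_diag)
next
  case greater
  then show ?thesis by (rule Q)
qed

text \<open>The two sides collect the brackets from the two ways of sorting u, x, y. Moving the
  letter left over past each bracket turns the difference into the Jacobi sum.\<close>

lemma jacobi_S:
  assumes G: "\<And>x y. \<sigma> (a @ x # y # c) = \<sigma> (a @ y # x # c) + S x y a c"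
  shows "S u y (a @ [x]) c + S x y a (u # c) + S u x a (y # c) = S u y a (x # c) + S u x (a @ [y]) c + S x y (a @ [u]) c"
proof -
  let ?t = "\<lambda>l. \<sigma> (a @ l # c)"
  have *: "S p q (a @ [r]) c - S p q a (r # c) = (\<Sum>k<D. \<Sum>l<D. sc (s p q k * s r k l) (?t l))" for p q r
    unfolding S_def sum_subtractf[symmetric]
    by (intro sum.cong refl) (simp add: G[of r] S_def sc_right sc_sum sc_sc)
  have "(S u y (a @ [x]) c - S u y a (x # c)) - (S x y (a @ [u]) c - S x y a (u # c)) - (S u x (a @ [y]) c - S u x a (y # c))
    = (\<Sum>k<D. \<Sum>l<D. sc (s u y k * s x k l) (?t l) - sc (s x y k * s u k l) (?t l) - sc (s u x k * s y k l) (?t l))"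
    unfolding * sum_subtractf by simp
  also have "\<dots> = (\<Sum>l<D. \<Sum>k<D. sc (s u y k * s x k l + s y x k * s u k l + s x u k * s y k l) (?t l))"
    by (subst sum.swap) (intro sum.cong refl, simp add: sc_left s_anti[of x y] s_anti[of u x])
  also have "\<dots> = (\<Sum>l<D. sc (\<Sum>k<D. s u y k * s x k l + s y x k * s u k l + s x u k * s y k l) (?t l))"
  proof (intro sum.cong refl)
    fix l
    have "(\<Sum>k\<in>K. sc (f k) t) = sc (\<Sum>k\<in>K. f k) t" if "finite K" for f :: "nat \<Rightarrow> complex" and t :: 'v and K
      using that by (induct K rule: finite_induct) (simp_all add: sc_left)
    then show "(\<Sum>k<D. sc (s u y k * s x k l + s y x k * s u k l + s x u k * s y k l) (?t l)) =
      sc (\<Sum>k<D. s u y k * s x k l + s y x k * s u k l + s x u k * s y k l) (?t l)" by simp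
  qed
  also have "\<dots> = 0" by (simp only: s_jac sc_0_left sum.neutral_const)
  finally show ?thesis by (simp add: algebra_simps)
qed

text \<open>Two pairs that do not overlap can be straightened in either order: the terms in which
  both are replaced by brackets agree.\<close>

lemma swap_S:
  assumes G: "\<And>k. \<sigma> (a @ k # d @ x # y # c) = \<sigma> (a @ k # d @ y # x # c) + S x y (a @ k # d) c"
    and G': "\<And>k. \<sigma> (a @ u # v # d @ k # c) = \<sigma> (a @ v # u # d @ k # c) + S u v a (d @ k # c)"
  shows "S x y (a @ v # u # d) c + S u v a (d @ x # y # c) = S u v a (d @ y # x # c) + S x y (a @ u # v # d) c"
proof -
  have "S u v a (d @ x # y # c) - S u v a (d @ y # x # c) = (\<Sum>k<D. \<Sum>l<D. sc (s u v k * s x y l) (\<sigma> (a @ k # d @ l # c)))"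
    unfolding S_def sum_subtractf[symmetric]
    by (intro sum.cong refl) (simp add: G S_def sc_right sc_sum sc_sc)
  also have "\<dots> = (\<Sum>l<D. \<Sum>k<D. sc (s u v k * s x y l) (\<sigma> (a @ k # d @ l # c)))" by (rule sum.swap)
  also have "\<dots> = S x y (a @ u # v # d) c - S x y (a @ v # u # d) c"
    unfolding S_def sum_subtractf[symmetric]
    by (intro sum.cong refl) (simp add: G' S_def sc_right sc_sum sc_sc mult.commute)
  finally show ?thesis by (simp add: algebra_simps)
qed

text \<open>The diamond lemma. As \<open>\<sigma>\<close> is defined by the first descent, that
  descent is compared with the given one: they coincide, overlap in one letter or are disjoint, and
  all words reached after one step are smaller in the order of the induction.\<close>

lemma confluence_desc:
  "y < x \<Longrightarrow> \<sigma> (a @ x # y # c) = \<sigma> (a @ y # x # c) + S x y a c"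
proof (induct "(length (a @ x # y # c), word_weight (a @ x # y # c))" arbitrary: a x y c
    rule: wf_induct_rule[OF wf_lex_prod[OF wf_less_than wf_less_than]])
  case (1 a x y c)
  let ?w = "a @ x # y # c"
  have IH: "\<sigma> (a' @ x' # y' # c') = \<sigma> (a' @ y' # x' # c') + S x' y' a' c'"
    if "y' < x'" "length (a' @ x' # y' # c') < length ?w \<or>
      length (a' @ x' # y' # c') = length ?w \<and> word_weight (a' @ x' # y' # c') < word_weight ?w" for a' x' y' c'
    by (rule 1(1)) (use that in auto)
  have G: "\<sigma> (a' @ x' # y' # c') = \<sigma> (a' @ y' # x' # c') + S x' y' a' c'"
    if "length (a' @ x' # y' # c') < length ?w" for a' x' y' c'
    by (rule swap_if_descent, rule IH) (use that in auto)
  obtain a1 u v c1 where sp: "first_descent ?w = Some (a1, u, v, c1)" and le: "length a1 \<le> length a"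
    using first_descent_first[OF 1(2), of a c] by blast
  have w: "?w = a1 @ u # v # c1" and uv: "v < u" using first_descent_Some[OF sp] by auto
  have \<sigma>w: "\<sigma> ?w = \<sigma> (a1 @ v # u # c1) + S u v a1 c1" by (rule \<sigma>_Some[OF sp])
  from w obtain us where us: "a = a1 @ us \<and> us @ x # y # c = u # v # c1"
    using le by (auto simp: append_eq_append_conv2)
  consider "us = []" | "us = [u]" "v = x" "c1 = y # c" | d where "us = u # v # d" "c1 = d @ x # y # c"
    using us by (cases us; cases "tl us") auto
  then show ?case
  proof cases
    case 1
    then show ?thesis using us \<sigma>w by simp
  next
    case 2
    have a: "a = a1 @ [u]" using us 2 by simp
    have L: "word_weight (a1 @ x # u # y # c) < word_weight ?w" "word_weight (a1 @ u # y # x # c) < word_weight ?w"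
      using word_weight_swap[of x u a1 "y # c"] word_weight_swap[OF 1(2), of "a1 @ [u]" c] uv 2 a by auto
    have "word_weight (a1 @ x # y # u # c) < word_weight (a1 @ x # u # y # c)"
      using word_weight_swap[of y u "a1 @ [x]" c] uv 2 1(2) by simp
    moreover have "word_weight (a1 @ y # u # x # c) < word_weight (a1 @ u # y # x # c)"
      using word_weight_swap[of y u a1 "x # c"] uv 2 1(2) by simp
    ultimately have L2: "word_weight (a1 @ x # y # u # c) < word_weight ?w" "word_weight (a1 @ y # u # x # c) < word_weight ?w" using L by auto
    have e1: "\<sigma> (a1 @ x # u # y # c) = \<sigma> (a1 @ x # y # u # c) + S u y (a1 @ [x]) c"
      using IH[of y u "a1 @ [x]" c] L uv 2 1(2) a by simp
    have e2: "\<sigma> (a1 @ x # y # u # c) = \<sigma> (a1 @ y # x # u # c) + S x y a1 (u # c)"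
      using IH[of y x a1 "u # c"] L2 1(2) a by simp
    have e3: "\<sigma> (a1 @ u # y # x # c) = \<sigma> (a1 @ y # u # x # c) + S u y a1 (x # c)"
      using IH[of y u a1 "x # c"] L uv 2 1(2) a by simp
    have e4: "\<sigma> (a1 @ y # u # x # c) = \<sigma> (a1 @ y # x # u # c) + S u x (a1 @ [y]) c"
      using IH[of x u "a1 @ [y]" c] L2 uv 2 a by simp
    have J: "S u y (a1 @ [x]) c + S x y a1 (u # c) + S u x a1 (y # c) = S u y a1 (x # c) + S u x (a1 @ [y]) c + S x y (a1 @ [u]) c"
      by (rule jacobi_S) (rule G, simp add: a)
    show ?thesis
      using \<sigma>w J unfolding a 2 append_assoc append.simps e1 e2 e3 e4 by (simp add: algebra_simps)
  next
    case 3
    have a: "a = a1 @ u # v # d" using us 3 by simp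
    have L: "word_weight (a1 @ v # u # d @ x # y # c) < word_weight ?w" "word_weight (a1 @ u # v # d @ y # x # c) < word_weight ?w"
      using word_weight_swap[OF uv, of a1 "d @ x # y # c"] word_weight_swap[OF 1(2), of "a1 @ u # v # d" c] a by auto
    have e1: "\<sigma> (a1 @ v # u # d @ x # y # c) = \<sigma> (a1 @ v # u # d @ y # x # c) + S x y (a1 @ v # u # d) c"
      using IH[of y x "a1 @ v # u # d" c] L 1(2) a by simp
    have e2: "\<sigma> (a1 @ u # v # d @ y # x # c) = \<sigma> (a1 @ v # u # d @ y # x # c) + S u v a1 (d @ y # x # c)"
      using IH[of v u a1 "d @ y # x # c"] L uv a by simp
    have "S x y (a1 @ v # u # d) c + S u v a1 (d @ x # y # c) = S u v a1 (d @ y # x # c) + S x y (a1 @ u # v # d) c"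
    proof (rule swap_S)
      show "\<sigma> (a1 @ k # d @ x # y # c) = \<sigma> (a1 @ k # d @ y # x # c) + S x y (a1 @ k # d) c" for k
        using G[of "a1 @ k # d" x y c] a by simp
      show "\<sigma> (a1 @ u # v # d @ k # c) = \<sigma> (a1 @ v # u # d @ k # c) + S u v a1 (d @ k # c)" for k
        using G[of a1 u v "d @ k # c"] a by simp
    qed
    then show ?thesis
      using \<sigma>w unfolding a 3 append_assoc append.simps e1 e2 by (simp add: algebra_simps)
  qed
qed

lemma confluence: "\<sigma> (a @ x # y # c) = \<sigma> (a @ y # x # c) + S x y a c"
  by (rule swap_if_descent) (rule confluence_desc)

end

section \<open>Triangular decompositions and adapted bases\<close>

lemma independent_Un_direct:
  assumes A: "cmat.independent A" "finite A" and B: "cmat.independent B" "finite B"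
    and AB: "cmat.span A \<inter> cmat.span B \<subseteq> {0}"
  shows "cmat.independent (A \<union> B)" "A \<inter> B = {}"
proof -
  show disj: "A \<inter> B = {}"
  proof (rule ccontr)
    assume "A \<inter> B \<noteq> {}"
    then obtain x where "x \<in> A" "x \<in> B" by blast
    then have "x \<in> cmat.span A \<inter> cmat.span B" by (simp add: cmat.span_base)
    then have "x = 0" using AB by blast
    then show False using \<open>x \<in> A\<close> A cmat.dependent_zero by blast
  qed
  have fAB: "finite (A \<union> B)" using A B by simp
  have "u v = 0" if s: "(\<Sum>v\<in>A \<union> B. smat (u v) v) = 0" and v: "v \<in> A \<union> B" for u v
  proof -
    have "(\<Sum>v\<in>A. smat (u v) v) + (\<Sum>v\<in>B. smat (u v) v) = 0"
      using s sum.union_disjoint[OF A(2) B(2) disj] by metis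
    then have e: "(\<Sum>v\<in>A. smat (u v) v) = - (\<Sum>v\<in>B. smat (u v) v)"
      by (simp only: eq_neg_iff_add_eq_0)
    have a: "(\<Sum>v\<in>A. smat (u v) v) \<in> cmat.span A" by (intro cmat.span_sum cmat.span_scale cmat.span_base)
    have b: "(\<Sum>v\<in>B. smat (u v) v) \<in> cmat.span B" by (intro cmat.span_sum cmat.span_scale cmat.span_base)
    have "(\<Sum>v\<in>A. smat (u v) v) \<in> cmat.span B" unfolding e using b by (rule cmat.span_neg)
    then have zA: "(\<Sum>v\<in>A. smat (u v) v) = 0" using a AB by blast
    then have zB: "(\<Sum>v\<in>B. smat (u v) v) = 0" using e by simp
    show ?thesis
      using v A(1) B(1) zA zB unfolding cmat.dependent_finite[OF A(2)] cmat.dependent_finite[OF B(2)] by blast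
  qed
  then show "cmat.independent (A \<union> B)" unfolding cmat.dependent_finite[OF fAB] by blast
qed

lemma finite_basis_box:
  assumes V: "cmat.subspace V" "V \<subseteq> box n"
  obtains B where "finite B" "cmat.independent B" "cmat.span B = V"
proof -
  let ?E = "(\<lambda>(i, j). munit i j) ` ({1..n} \<times> {1..n})"
  have "box n \<subseteq> cmat.span ?E"
  proof
    fix x assume x: "x \<in> box n"
    have sa: "(\<Sum>i\<in>S. f i) r s = (\<Sum>i\<in>S. f i r s)" for f :: "nat \<Rightarrow> cmat" and S r s
      by (induct S rule: infinite_finite_induct) auto
    have e: "smat (x i j) (munit i j) r s = (if i = r then if j = s then x r s else 0 else 0)" for i j r s
      by (auto simp: smat_def munit_def)
    have "(\<Sum>i\<in>{1..n}. \<Sum>j\<in>{1..n}. smat (x i j) (munit i j)) r s = x r s" for r s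
      unfolding sa e using box_D[OF x, of r s]
      by (simp add: sum_if_out[where 'a = complex] del: atLeastAtMost_iff)
    then have "x = (\<Sum>i\<in>{1..n}. \<Sum>j\<in>{1..n}. smat (x i j) (munit i j))" by (intro ext) simp
    also have "\<dots> \<in> cmat.span ?E"
      by (intro cmat.span_sum cmat.span_scale cmat.span_base) auto
    finally show "x \<in> cmat.span ?E" .
  qed
  then have VE: "V \<subseteq> cmat.span ?E" using V by blast
  obtain B where B: "B \<subseteq> V" "cmat.independent B" "V \<subseteq> cmat.span B"
    using cmat.maximal_independent_subset[of V] by metis
  have "finite B"
    using cmat.independent_span_bound[of ?E B] B VE by auto
  moreover have "cmat.span B = V"
    using B V(1) cmat.span_minimal[OF B(1) V(1)] by blast
  ultimately show ?thesis using that B(2) by blast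
qed

text \<open>
  With a basis of \<open>g\<close> listing \<open>N\<close>, \<open>h\<close> and \<open>Nb\<close> in this order, straightening keeps an initial letter from \<open>N\<close> in \<open>N\<close> and a final
  letter from \<open>Nb\<close> in \<open>Nb\<close>. Hence the functional that is the identity on words over \<open>h\<close> and 0 on other sorted words kills
  \<open>N U(g) + U(g) Nb\<close>.
\<close>

locale triangular =
  fixes g N h Nb :: "cmat set" and n :: nat
  assumes g: "lie_subalgebra g" and gbox: "g \<subseteq> box n"
    and N: "lie_subalgebra N" and h: "lie_subalgebra h" and Nb: "lie_subalgebra Nb"
    and gsum: "g = N + h + Nb"
    and direct: "\<And>x y z. x \<in> N \<Longrightarrow> y \<in> h \<Longrightarrow> z \<in> Nb \<Longrightarrow> x + y + z = 0 \<Longrightarrow> x = 0 \<and> y = 0 \<and> z = 0"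
    and abel: "\<And>x y. x \<in> h \<Longrightarrow> y \<in> h \<Longrightarrow> lie x y = 0"
begin

lemma zero_in: "0 \<in> N" "0 \<in> h" "0 \<in> Nb" "0 \<in> g"
  using lie_subalgebraD[OF N] lie_subalgebraD[OF h] lie_subalgebraD[OF Nb] lie_subalgebraD[OF g] by blast+

lemma parts_subset: "N \<subseteq> g" "h \<subseteq> g" "Nb \<subseteq> g"
proof -
  have "x + y + z \<in> g" if "x \<in> N" "y \<in> h" "z \<in> Nb" for x y z
    using that unfolding gsum by (auto intro: set_plus_intro)
  from this[of _ 0 0] this[of 0 _ 0] this[of 0 0] show "N \<subseteq> g" "h \<subseteq> g" "Nb \<subseteq> g"
    using zero_in by auto
qed

lemma subspaces: "cmat.subspace N" "cmat.subspace h" "cmat.subspace Nb" "cmat.subspace g"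
  using N h Nb g unfolding lie_subalgebra_def by blast+

lemma bases_exist: "\<exists>lN lh lb. distinct (lN @ lh @ lb) \<and> cmat.independent (set (lN @ lh @ lb)) \<and>
   cmat.span (set lN) = N \<and> cmat.span (set lh) = h \<and> cmat.span (set lb) = Nb"
proof -
  obtain BN where BN: "finite BN" "cmat.independent BN" "cmat.span BN = N"
    using finite_basis_box[of N n] subspaces parts_subset gbox by (metis subset_trans)
  obtain Bh where Bh: "finite Bh" "cmat.independent Bh" "cmat.span Bh = h"
    using finite_basis_box[of h n] subspaces parts_subset gbox by (metis subset_trans)
  obtain Bb where Bb: "finite Bb" "cmat.independent Bb" "cmat.span Bb = Nb"
    using finite_basis_box[of Nb n] subspaces parts_subset gbox by (metis subset_trans)
  have "cmat.span BN \<inter> cmat.span Bh \<subseteq> {0}"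
  proof
    fix x assume x: "x \<in> cmat.span BN \<inter> cmat.span Bh"
    then have "- x \<in> h" using Bh lie_subalgebraD[OF h] by auto
    then show "x \<in> {0}" using direct[of x "- x" 0] x BN zero_in by auto
  qed
  note NH = independent_Un_direct[OF BN(2,1) Bh(2,1) this]
  have sp: "cmat.span (BN \<union> Bh) = {x + y | x y. x \<in> N \<and> y \<in> h}"
    unfolding cmat.span_Un BN(3) Bh(3) by blast
  have "cmat.span (BN \<union> Bh) \<inter> cmat.span Bb \<subseteq> {0}"
  proof
    fix x assume x: "x \<in> cmat.span (BN \<union> Bh) \<inter> cmat.span Bb"
    then obtain y z where yz: "x = y + z" "y \<in> N" "z \<in> h" unfolding sp by blast
    have "- x \<in> Nb" using x Bb lie_subalgebraD[OF Nb] by auto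
    then show "x \<in> {0}" using direct[of y z "- x"] yz by auto
  qed
  note NHB = independent_Un_direct[OF NH(1) _ Bb(2,1) this]
  obtain lN lh lb where l: "set lN = BN" "distinct lN" "set lh = Bh" "distinct lh" "set lb = Bb" "distinct lb"
    using finite_distinct_list BN(1) Bh(1) Bb(1) by metis
  have "distinct (lN @ lh @ lb)" using l NH(2) NHB(2) BN(1) Bh(1) by auto
  moreover have "cmat.independent (set (lN @ lh @ lb))" using l NHB(1) BN(1) Bh(1) by (simp add: Un_assoc)
  ultimately show ?thesis using l BN Bh Bb by blast
qed

definition bases :: "cmat list \<times> cmat list \<times> cmat list" where
  "bases = (SOME (lN, lh, lb). distinct (lN @ lh @ lb) \<and> cmat.independent (set (lN @ lh @ lb)) \<and>
     cmat.span (set lN) = N \<and> cmat.span (set lh) = h \<and> cmat.span (set lb) = Nb)"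

definition lN where "lN = fst bases"
definition lh where "lh = fst (snd bases)"
definition lb where "lb = snd (snd bases)"

lemma bases: "distinct (lN @ lh @ lb)" "cmat.independent (set (lN @ lh @ lb))"
   "cmat.span (set lN) = N" "cmat.span (set lh) = h" "cmat.span (set lb) = Nb"
proof -
  have "case bases of (p, q, r) \<Rightarrow> distinct (p @ q @ r) \<and> cmat.independent (set (p @ q @ r)) \<and>
     cmat.span (set p) = N \<and> cmat.span (set q) = h \<and> cmat.span (set r) = Nb"
    unfolding bases_def by (rule someI_ex) (use bases_exist in auto)
  then show "distinct (lN @ lh @ lb)" "cmat.independent (set (lN @ lh @ lb))"
    "cmat.span (set lN) = N" "cmat.span (set lh) = h" "cmat.span (set lb) = Nb"
    by (simp_all add: lN_def lh_def lb_def case_prod_beta)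
qed

abbreviation bl where "bl \<equiv> lN @ lh @ lb"
definition n1 where "n1 = length lN"
definition n2 where "n2 = n1 + length lh"
definition D where "D = length bl"
definition b :: "nat \<Rightarrow> cmat" where "b i = bl ! i"

lemma b_mem: "i < n1 \<Longrightarrow> b i \<in> N" "n1 \<le> i \<Longrightarrow> i < n2 \<Longrightarrow> b i \<in> h" "n2 \<le> i \<Longrightarrow> i < D \<Longrightarrow> b i \<in> Nb"
proof -
  show "b i \<in> N" if "i < n1"
  proof -
    have "b i \<in> cmat.span (set lN)"
      using that by (intro cmat.span_base) (simp add: b_def n1_def nth_append)
    then show ?thesis by (simp only: bases(3))
  qed
  show "b i \<in> h" if "n1 \<le> i" "i < n2"
  proof -
    have "b i \<in> cmat.span (set lh)"
      using that less_diff_conv2[of "length lN" i "length lh"]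
      by (intro cmat.span_base) (simp add: b_def n1_def n2_def nth_append add.commute)
    then show ?thesis by (simp only: bases(4))
  qed
  show "b i \<in> Nb" if "n2 \<le> i" "i < D"
  proof -
    have "b i \<in> cmat.span (set lb)"
      using that by (intro cmat.span_base) (auto simp: b_def n1_def n2_def D_def nth_append)
    then show ?thesis by (simp only: bases(5))
  qed
qed

lemma b_g: "i < D \<Longrightarrow> b i \<in> g"
  using b_mem[of i] parts_subset by (meson not_le subsetD)

definition coef :: "cmat \<Rightarrow> nat \<Rightarrow> complex" where
  "coef x i = (if i < D then cmat.representation (set bl) x (b i) else 0)"

lemma span_g: "cmat.span (set bl) = g"
proof -
  have "cmat.span (set bl) = {x + y | x y. x \<in> N \<and> y \<in> {x + y | x y. x \<in> h \<and> y \<in> Nb}}"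
    by (simp add: cmat.span_Un bases)
  also have "\<dots> = N + h + Nb"
    unfolding add.assoc by (auto simp: set_plus_def)
  finally show ?thesis by (simp add: gsum)
qed

lemma coef_add: "x \<in> g \<Longrightarrow> y \<in> g \<Longrightarrow> coef (x + y) i = coef x i + coef y i"
  by (simp add: coef_def cmat.representation_add[OF bases(2)] span_g del: set_append)

lemma coef_smat: "x \<in> g \<Longrightarrow> coef (smat c x) i = c * coef x i"
  by (simp add: coef_def cmat.representation_scale[OF bases(2)] span_g del: set_append)

lemma coef_sum: "(\<And>i. i \<in> I \<Longrightarrow> f i \<in> g) \<Longrightarrow> coef (sum f I) k = (\<Sum>i\<in>I. coef (f i) k)"
proof (induct I rule: infinite_finite_induct)
  case (insert i I)
  then have "sum f I \<in> g" "f i \<in> g" by (auto intro!: cmat.subspace_sum[OF subspaces(4)])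
  with insert show ?case by (simp only: sum.insert[OF insert(1,2)] coef_add) auto
qed (simp_all add: coef_def cmat.representation_zero)

lemma expand: "x \<in> g \<Longrightarrow> x = (\<Sum>i<D. smat (coef x i) (b i))"
proof -
  assume "x \<in> g"
  then have "x = (\<Sum>v\<in>set bl. smat (cmat.representation (set bl) x v) v)"
    using cmat.sum_representation_eq[OF bases(2), of x "set bl"] span_g by simp
  also have "\<dots> = (\<Sum>i<D. smat (cmat.representation (set bl) x (b i)) (b i))"
    unfolding b_def D_def by (rule sum.reindex_bij_betw[symmetric]) (rule bij_betw_nth[OF bases(1)], simp_all)
  finally show ?thesis by (simp add: coef_def)
qed

lemma b_index: "i < D \<Longrightarrow> b i \<in> set lN \<Longrightarrow> i < n1" "i < D \<Longrightarrow> b i \<in> set lh \<Longrightarrow> n1 \<le> i \<and> i < n2" "i < D \<Longrightarrow> b i \<in> set lb \<Longrightarrow> n2 \<le> i"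
  using bases(1) by (auto simp: b_def n1_def n2_def D_def nth_append disjoint_iff dest: nth_mem split: if_splits)

lemma coef_sub:
  assumes "set l \<subseteq> set bl" "x \<in> cmat.span (set l)" "coef x i \<noteq> 0"
  shows "i < D \<and> b i \<in> set l"
proof -
  have "cmat.representation (set bl) x = cmat.representation (set l) x"
    by (rule cmat.representation_extend[OF bases(2) assms(2,1)])
  then show ?thesis
    using assms(3) cmat.representation_ne_zero[of "set l" x "b i"] by (auto simp: coef_def split: if_splits)
qed

lemma coef_N: "x \<in> N \<Longrightarrow> coef x i \<noteq> 0 \<Longrightarrow> i < n1"
  using coef_sub[of lN x i] b_index(1) bases(3) by auto

lemma coef_h: "x \<in> h \<Longrightarrow> coef x i \<noteq> 0 \<Longrightarrow> n1 \<le> i \<and> i < n2"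
  using coef_sub[of lh x i] b_index(2) bases(4) by auto

lemma coef_Nb: "x \<in> Nb \<Longrightarrow> coef x i \<noteq> 0 \<Longrightarrow> n2 \<le> i \<and> i < D"
  using coef_sub[of lb x i] b_index(3) bases(5) by auto

text \<open>Letters that do not belong to the basis get bracket 0, because the locale
  \<open>pbw\<close> asks for antisymmetry and the Jacobi identity on all natural numbers.\<close>

definition s :: "nat \<Rightarrow> nat \<Rightarrow> nat \<Rightarrow> complex" where
  "s i j k = (if i < D \<and> j < D then coef (lie (b i) (b j)) k else 0)"

lemma lie_g: "x \<in> g \<Longrightarrow> y \<in> g \<Longrightarrow> lie x y \<in> g" using lie_subalgebraD[OF g] by blast

lemma coef_lie:
  assumes x: "x \<in> g" and y: "y \<in> g"
  shows "coef (lie x y) k = (\<Sum>i<D. \<Sum>j<D. coef x i * coef y j * s i j k)"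
proof -
  have lie_sum1: "lie (\<Sum>i<m. smat (c i) (b i)) z = (\<Sum>i<m. smat (c i) (lie (b i) z))" if "m \<le> D" "z \<in> g" for m c z
    using that
  proof (induct m)
    case 0
    show ?case using lie_box(3)[of 0 n z 0 0] gbox zero_in(4) \<open>z \<in> g\<close> by (auto simp: smat_def zero_fun_def lie_def mmul_def)
  next
    case (Suc m)
    have a: "(\<Sum>i<m. smat (c i) (b i)) \<in> g"
      using Suc b_g by (intro cmat.subspace_sum[OF subspaces(4)] cmat.subspace_scale[OF subspaces(4)]) auto
    have bm: "b m \<in> g" using Suc b_g by auto
    have sm: "smat (c m) (b m) \<in> g" using bm cmat.subspace_scale[OF subspaces(4)] by blast
    have "lie ((\<Sum>i<m. smat (c i) (b i)) + smat (c m) (b m)) z = lie (\<Sum>i<m. smat (c i) (b i)) z + lie (smat (c m) (b m)) z"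
      using a sm Suc(3) gbox by (intro lie_box(1)[of _ n]) auto
    also have "lie (smat (c m) (b m)) z = smat (c m) (lie (b m) z)"
      using bm Suc(3) gbox by (intro lie_box(3)[of _ n z z]) auto
    also have "lie (\<Sum>i<m. smat (c i) (b i)) z = (\<Sum>i<m. smat (c i) (lie (b i) z))"
      using Suc by auto
    finally show ?case by (simp only: sum.lessThan_Suc)
  qed
  have l: "lie x y = (\<Sum>i<D. smat (coef x i) (lie (b i) y))"
    using lie_sum1[of D y "coef x"] expand[OF x] y by simp
  have "lie (b i) y = (\<Sum>j<D. smat (coef y j) (lie (b i) (b j)))" if "i < D" for i
  proof -
    have "lie (b i) y = - lie y (b i)" by (rule lie_anti)
    also have "lie y (b i) = (\<Sum>j<D. smat (coef y j) (lie (b j) (b i)))"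
      using lie_sum1[of D "b i" "coef y"] expand[OF y] b_g[OF that] by simp
    also have "- \<dots> = (\<Sum>j<D. smat (coef y j) (lie (b i) (b j)))"
      unfolding sum_negf[symmetric] by (intro sum.cong refl) (subst lie_anti(1), simp)
    finally show ?thesis .
  qed
  then have ly: "lie x y = (\<Sum>i<D. smat (coef x i) (\<Sum>j<D. smat (coef y j) (lie (b i) (b j))))"
    unfolding l by (intro sum.cong refl) auto
  have in1: "lie (b i) (b j) \<in> g" if "i < D" "j < D" for i j
    using that by (intro lie_g b_g)
  have in2: "smat (coef y j) (lie (b i) (b j)) \<in> g" if "i < D" "j < D" for i j
    using lie_subalgebraD(2)[OF g in1[OF that]] .
  have in3: "(\<Sum>j<D. smat (coef y j) (lie (b i) (b j))) \<in> g" if "i < D" for i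
    using in2[OF that] by (intro cmat.subspace_sum[OF subspaces(4)]) auto
  have c1: "coef (\<Sum>j<D. smat (coef y j) (lie (b i) (b j))) k = (\<Sum>j<D. coef y j * s i j k)" if i: "i < D" for i
  proof -
    have "coef (\<Sum>j<D. smat (coef y j) (lie (b i) (b j))) k = (\<Sum>j<D. coef (smat (coef y j) (lie (b i) (b j))) k)"
      using in2[OF i] by (intro coef_sum) auto
    also have "\<dots> = (\<Sum>j<D. coef y j * s i j k)"
      by (intro sum.cong refl) (simp add: coef_smat in1 i s_def)
    finally show ?thesis .
  qed
  have "coef (lie x y) k = (\<Sum>i<D. coef (smat (coef x i) (\<Sum>j<D. smat (coef y j) (lie (b i) (b j)))) k)"
    unfolding ly using lie_subalgebraD(2)[OF g in3] by (intro coef_sum) auto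
  also have "\<dots> = (\<Sum>i<D. coef x i * (\<Sum>j<D. coef y j * s i j k))"
    by (intro sum.cong refl) (simp add: coef_smat in3 c1)
  finally show ?thesis by (simp add: sum_distrib_left mult.assoc)
qed

lemma coef_b: "i < D \<Longrightarrow> coef (b i) j = (if j = i then 1 else 0)"
proof -
  assume i: "i < D"
  have bi: "b i \<in> set bl" using i by (simp add: b_def D_def nth_mem del: set_append)
  have "b j = b i \<longleftrightarrow> j = i" if "j < D" for j
    using that i bases(1) nth_eq_iff_index_eq[of bl j i] by (simp add: b_def D_def)
  then show ?thesis
    using i cmat.representation_basis[OF bases(2) bi] by (auto simp: coef_def)
qed

definition t :: "nat \<Rightarrow> uprod" where "t i = lift h (uea_emb h (b i))"

definition \<tau> :: "nat list \<Rightarrow> uprod" where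
  "\<tau> w = (if set w \<subseteq> {n1..<n2} then prod_list (map t w) else 0)"

lemma s_jac0: "(\<Sum>k<D. s y z k * s x k l + s z x k * s y k l + s x y k * s z k l) = 0"
proof (cases "x < D \<and> y < D \<and> z < D")
  case True
  note bg = b_g[of x] b_g[of y] b_g[of z]
  have e: "coef (lie (b p) (lie (b q) (b r))) l = (\<Sum>k<D. s q r k * s p k l)" if "p < D" "q < D" "r < D" for p q r
  proof -
    have "coef (lie (b p) (lie (b q) (b r))) l = (\<Sum>i<D. \<Sum>j<D. coef (b p) i * coef (lie (b q) (b r)) j * s i j l)"
      using that by (intro coef_lie lie_g b_g)
    also have "\<dots> = (\<Sum>i<D. if i = p then \<Sum>j<D. s q r j * s p j l else 0)"
      using that by (intro sum.cong refl) (simp add: coef_b s_def)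
    finally show ?thesis using that by simp
  qed
  have J: "lie (b x) (lie (b y) (b z)) + lie (b y) (lie (b z) (b x)) + lie (b z) (lie (b x) (b y)) = 0"
    using True bg gbox by (intro lie_box(5)[of _ n]) auto
  have m: "lie (b p) (lie (b q) (b r)) \<in> g" if "p < D" "q < D" "r < D" for p q r
    using that by (intro lie_g b_g)
  have "coef 0 l = coef (lie (b x) (lie (b y) (b z))) l + coef (lie (b y) (lie (b z) (b x))) l + coef (lie (b z) (lie (b x) (b y))) l"
    unfolding J[symmetric] using True lie_subalgebraD(1)[OF g m m] by (simp only: coef_add m)
  moreover have "coef 0 l = 0" by (simp add: coef_def cmat.representation_zero)
  ultimately show ?thesis using True by (simp add: e sum.distrib)
next
  case False
  then show ?thesis by (auto intro!: sum.neutral simp: s_def)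
qed

lemma s_anti0: "s j i k = - s i j k"
proof (cases "i < D \<and> j < D")
  case True
  have "lie (b j) (b i) = smat (-1) (lie (b i) (b j))"
    unfolding lie_anti(1)[of "b j"] by (simp add: smat_def fun_eq_iff)
  then have "coef (lie (b j) (b i)) k = coef (smat (-1) (lie (b i) (b j))) k" by (rule arg_cong)
  also have "\<dots> = - 1 * coef (lie (b i) (b j)) k"
    using True by (intro coef_smat lie_g b_g) auto
  finally show ?thesis using True unfolding s_def by simp
qed (auto simp: s_def)

sublocale pbw D s \<tau>
  by standard (rule s_anti0, rule s_jac0)

lemma s_N: "i < n1 \<Longrightarrow> j < n1 \<Longrightarrow> s i j k \<noteq> 0 \<Longrightarrow> k < n1"
proof -
  assume i: "i < n1" and j: "j < n1" and nz: "s i j k \<noteq> 0"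
  have "coef (lie (b i) (b j)) k \<noteq> 0" using nz by (simp add: s_def split: if_splits)
  then show ?thesis by (rule coef_N[OF lie_subalgebraD(3)[OF N b_mem(1)[OF i] b_mem(1)[OF j]]])
qed

lemma s_Nb: "n2 \<le> i \<Longrightarrow> n2 \<le> j \<Longrightarrow> s i j k \<noteq> 0 \<Longrightarrow> n2 \<le> k"
proof -
  assume i: "n2 \<le> i" and j: "n2 \<le> j" and nz: "s i j k \<noteq> 0"
  have D: "i < D" "j < D" and "coef (lie (b i) (b j)) k \<noteq> 0" using nz by (auto simp: s_def split: if_splits)
  then show ?thesis using coef_Nb[OF lie_subalgebraD(3)[OF Nb b_mem(3)[OF i D(1)] b_mem(3)[OF j D(2)]]] by blast
qed

lemma s_h: "n1 \<le> i \<Longrightarrow> i < n2 \<Longrightarrow> n1 \<le> j \<Longrightarrow> j < n2 \<Longrightarrow> s i j k = 0"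
proof -
  assume i: "n1 \<le> i" "i < n2" and j: "n1 \<le> j" "j < n2"
  have "lie (b i) (b j) = 0" by (rule abel[OF b_mem(2)[OF i] b_mem(2)[OF j]])
  then show ?thesis by (simp add: s_def coef_def cmat.representation_zero)
qed

text \<open>Induction along the recursion of \<open>\<sigma>\<close>, freed of the equations from
  its case distinction.\<close>

lemma \<sigma>_induct [case_names step]:
  assumes "\<And>w. (\<And>a x y c. first_descent w = Some (a, x, y, c) \<Longrightarrow> P (a @ y # x # c)) \<Longrightarrow>
      (\<And>a x y c k. first_descent w = Some (a, x, y, c) \<Longrightarrow> k < D \<Longrightarrow> P (a @ k # c)) \<Longrightarrow> P w"
  shows "P w"
proof (induct w rule: \<sigma>.induct)
  case (1 w)
  show ?case
  proof (rule assms)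
    fix a x y c assume s: "first_descent w = Some (a, x, y, c)"
    show "P (a @ y # x # c)" by (rule 1(1)[OF s refl refl refl])
  next
    fix a x y c k assume s: "first_descent w = Some (a, x, y, c)" and k: "k < D"
    show "P (a @ k # c)" by (rule 1(2)[OF s refl refl refl]) (use k in simp)
  qed
qed

text \<open>A step at the front exchanges or brackets two letters from N, as the second one is even
  smaller than the first; a step elsewhere keeps the first letter. So every sorted word that is
  reached has a letter outside h.\<close>

lemma \<sigma>_first: "w \<noteq> [] \<Longrightarrow> hd w < n1 \<Longrightarrow> \<sigma> w = 0"
proof (induct w rule: \<sigma>_induct)
  case (step w)
  show ?case
  proof (cases "first_descent w")
    case None
    have "\<not> set w \<subseteq> {n1..<n2}"
    proof
      assume "set w \<subseteq> {n1..<n2}"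
      then have "hd w \<in> {n1..<n2}" using hd_in_set[OF step(3)] by blast
      then show False using step(4) by simp
    qed
    then show ?thesis using None by (subst \<sigma>.simps) (simp add: \<tau>_def)
  next
    case (Some r)
    obtain a x y c where r: "r = (a, x, y, c)" by (cases r)
    have w: "w = a @ x # y # c" "y < x" using first_descent_Some Some r by auto
    have a: "hd (a @ y # x # c) < n1" using step(4) w by (cases a) auto
    have z: "\<sigma> (a @ y # x # c) = 0"
      using step(1)[OF Some[unfolded r]] a by simp
    have "sc (s x y k) (\<sigma> (a @ k # c)) = 0" if "k \<in> {..<D}" for k
    proof (cases "s x y k = 0")
      case False
      have "hd (a @ k # c) < n1"
      proof (cases a)
        case Nil
        then have "x < n1" "y < n1" using step(4) w by auto
        then show ?thesis using s_N[OF _ _ False] Nil by auto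
      qed (use step(4) w in auto)
      then have "\<sigma> (a @ k # c) = 0"
        using step(2)[OF Some[unfolded r]] that by simp
      then show ?thesis by simp
    qed simp
    then show ?thesis using \<sigma>_Some[of w a x y c] Some r z by (simp add: S_def)
  qed
qed

lemma \<sigma>_last: "w \<noteq> [] \<Longrightarrow> n2 \<le> last w \<Longrightarrow> \<sigma> w = 0"
proof (induct w rule: \<sigma>_induct)
  case (step w)
  show ?case
  proof (cases "first_descent w")
    case None
    have "\<not> set w \<subseteq> {n1..<n2}"
    proof
      assume "set w \<subseteq> {n1..<n2}"
      then have "last w \<in> {n1..<n2}" using last_in_set[OF step(3)] by blast
      then show False using step(4) by simp
    qed
    then show ?thesis using None by (subst \<sigma>.simps) (simp add: \<tau>_def)
  next
    case (Some r)
    obtain a x y c where r: "r = (a, x, y, c)" by (cases r)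
    have w: "w = a @ x # y # c" "y < x" using first_descent_Some Some r by auto
    have a: "n2 \<le> last (a @ y # x # c)" using step(4) w by (cases c) auto
    have z: "\<sigma> (a @ y # x # c) = 0"
      using step(1)[OF Some[unfolded r]] a by simp
    have "sc (s x y k) (\<sigma> (a @ k # c)) = 0" if "k \<in> {..<D}" for k
    proof (cases "s x y k = 0")
      case False
      have "n2 \<le> last (a @ k # c)"
      proof (cases c)
        case Nil
        then have "n2 \<le> x" "n2 \<le> y" using step(4) w by auto
        then show ?thesis using s_Nb[OF _ _ False] Nil by auto
      qed (use step(4) w in auto)
      then have "\<sigma> (a @ k # c) = 0"
        using step(2)[OF Some[unfolded r]] that by simp
      then show ?thesis by simp
    qed simp
    then show ?thesis using \<sigma>_Some[of w a x y c] Some r z by (simp add: S_def)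
  qed
qed

lemma t_comm: "n1 \<le> i \<Longrightarrow> i < n2 \<Longrightarrow> n1 \<le> j \<Longrightarrow> j < n2 \<Longrightarrow> t i * t j = t j * t i"
  unfolding t_def
  using lift_emb_lin(3)[OF h b_mem(2) b_mem(2), of i j] abel[OF b_mem(2) b_mem(2), of i j] lift_emb_lin(4)[OF h] by simp

text \<open>Brackets within h vanish, so straightening only permutes the letters, and their images
  in U(h) commute.\<close>

lemma \<sigma>_h: "set w \<subseteq> {n1..<n2} \<Longrightarrow> \<sigma> w = prod_list (map t w)"
proof (induct w rule: \<sigma>_induct)
  case (step w)
  show ?case
  proof (cases "first_descent w")
    case None
    then show ?thesis using step(3) by (subst \<sigma>.simps) (simp add: \<tau>_def)
  next
    case (Some r)
    obtain a x y c where r: "r = (a, x, y, c)" by (cases r)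
    have w: "w = a @ x # y # c" "y < x" using first_descent_Some Some r by auto
    have xy: "n1 \<le> x" "x < n2" "n1 \<le> y" "y < n2" using step(3) w by auto
    have "\<sigma> w = \<sigma> (a @ y # x # c)"
      using \<sigma>_Some[of w a x y c] Some r s_h[OF xy] by (simp add: S_def)
    also have "\<dots> = prod_list (map t (a @ y # x # c))"
      using step(3) w by (intro step(1)[OF Some[unfolded r]]) auto
    also have "\<dots> = prod_list (map t w)"
      using w t_comm[OF xy] by (simp add: mult.assoc[symmetric])
    finally show ?thesis .
  qed
qed

end

lemma scalar_hom_cs: "scalar_hom (cs :: complex \<Rightarrow> 'a::calg)"
  by standard (rule cs_add cs_mult cs_1 cs_comm)+

interpretation cs: scalar_hom "cs :: complex \<Rightarrow> 'a::calg"
  by (rule scalar_hom_cs)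

lemma fcar_induct [consumes 1, case_names zero single add]:
  assumes f: "f \<in> fcar g" and 0: "P 0" and single: "\<And>w c. w \<in> lists g \<Longrightarrow> P (Poly_Mapping.single w c)"
    and add: "\<And>a b. a \<in> fcar g \<Longrightarrow> b \<in> fcar g \<Longrightarrow> P a \<Longrightarrow> P b \<Longrightarrow> P (a + b)"
  shows "P f"
proof -
  have "P (\<Sum>w\<in>T. Poly_Mapping.single w (Poly_Mapping.lookup f w)) \<and> (\<Sum>w\<in>T. Poly_Mapping.single w (Poly_Mapping.lookup f w)) \<in> fcar g"
    if "finite T" "T \<subseteq> Poly_Mapping.keys f" for T
    using that
  proof (induct T rule: finite_induct)
    case empty
    show ?case using 0 by simp
  next
    case (insert w T)
    have w: "w \<in> lists g" using insert(4) f by auto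
    then have s: "Poly_Mapping.single w (Poly_Mapping.lookup f w) \<in> fcar g" by simp
    show ?case
      unfolding sum.insert[OF insert(1,2)]
      using insert(3,4) s single[OF w, of "Poly_Mapping.lookup f w"] by (intro conjI add fcar_intros) auto
  qed
  then have "P (\<Sum>w\<in>Poly_Mapping.keys f. Poly_Mapping.single w (Poly_Mapping.lookup f w))"
    using finite_keys[of f] by blast
  moreover have "(\<Sum>w\<in>Poly_Mapping.keys f. Poly_Mapping.single w (Poly_Mapping.lookup f w)) = f"
    by (rule poly_mapping_eqI) (simp add: lookup_sum lookup_single when_def in_keys_iff sum.delta)
  ultimately show ?thesis by (rule back_subst)
qed

context triangular
begin

section \<open>A projection onto U(h)\<close>

definition L :: "(nat list \<Rightarrow>\<^sub>0 complex) \<Rightarrow> uprod" where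
  "L f = (\<Sum>w\<in>Poly_Mapping.keys f. sc (Poly_Mapping.lookup f w) (\<sigma> w))"

lemma L_superset:
  assumes "finite T" "Poly_Mapping.keys f \<subseteq> T"
  shows "L f = (\<Sum>w\<in>T. sc (Poly_Mapping.lookup f w) (\<sigma> w))"
  unfolding L_def using assms by (intro sum.mono_neutral_left) (auto simp: in_keys_iff)

lemma L_add: "L (f + f') = L f + L f'"
proof -
  let ?T = "Poly_Mapping.keys f \<union> Poly_Mapping.keys f'"
  have "finite ?T" by simp
  then show ?thesis
    using keys_add[of f f']
    by (simp add: L_superset[of ?T] lookup_add sc_left sum.distrib)
qed

lemma L_0: "L 0 = 0" by (simp add: L_def)

lemma L_minus: "L (- f) = - L f"
  using L_add[of f "- f"] by (simp add: L_0 eq_neg_iff_add_eq_0 add.commute)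

lemma L_diff: "L (f - f') = L f - L f'"
  using L_add[of f "- f'"] by (simp add: L_minus)

lemma L_sum: "L (sum F T) = (\<Sum>i\<in>T. L (F i))"
  by (induct T rule: infinite_finite_induct) (simp_all add: L_0 L_add)

lemma L_single: "L (Poly_Mapping.single w c) = sc c (\<sigma> w)"
  by (simp add: L_def)

definition K :: "nat \<Rightarrow> nat \<Rightarrow> nat list \<Rightarrow>\<^sub>0 complex" where
  "K x y = Poly_Mapping.single [x, y] 1 - Poly_Mapping.single [y, x] 1 - (\<Sum>k<D. Poly_Mapping.single [k] (s x y k))"

text \<open>Here confluence enters: L kills the relator of two letters in every context, not only at
  the first descent.\<close>

lemma L_K: "L (a * K x y * c) = 0"
proof (induct a rule: poly_mapping_single_induct)
  case (single a p)
  show ?case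
  proof (induct c rule: poly_mapping_single_induct)
    case (single c q)
    have "L (Poly_Mapping.single a p * K x y * Poly_Mapping.single c q) =
       sc (p * q) (\<sigma> (a @ x # y # c)) - sc (p * q) (\<sigma> (a @ y # x # c)) - (\<Sum>k<D. sc (p * q) (sc (s x y k) (\<sigma> (a @ k # c))))"
      unfolding K_def
      by (simp add: right_diff_distrib left_diff_distrib sum_distrib_left sum_distrib_right mult_single L_diff L_sum L_single sc_sc mult.assoc, simp add: mult.commute mult.left_commute)
    also have "\<dots> = sc (p * q) (\<sigma> (a @ x # y # c) - \<sigma> (a @ y # x # c) - S x y a c)"
      by (simp add: S_def sc_diff_right sc_sum)
    also have "\<dots> = 0" unfolding confluence[of a x y c] by simp
    finally show ?case .
  qed (simp add: distrib_left L_add)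
qed (simp add: distrib_right L_add)

text \<open>\<open>ev scalar \<phi>\<close> passes from words over the whole of g to words over the
  basis letters.\<close>

definition \<phi> :: "cmat \<Rightarrow> nat list \<Rightarrow>\<^sub>0 complex" where
  "\<phi> x = (\<Sum>i<D. Poly_Mapping.single [i] (coef x i))"

lemma \<phi>_add: "x \<in> g \<Longrightarrow> y \<in> g \<Longrightarrow> \<phi> (x + y) = \<phi> x + \<phi> y"
  by (simp add: \<phi>_def coef_add single_add sum.distrib)

lemma \<phi>_smat: "x \<in> g \<Longrightarrow> \<phi> (smat c x) = scalar c * \<phi> x"
  by (simp add: \<phi>_def coef_smat scalar_def sum_distrib_left mult_single)

lemma single_sum: "Poly_Mapping.single k (sum F T) = (\<Sum>i\<in>T. Poly_Mapping.single k (F i))"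
  by (induct T rule: infinite_finite_induct) (simp_all add: single_add)

lemma \<phi>_lie:
  assumes x: "x \<in> g" and y: "y \<in> g"
  shows "\<phi> x * \<phi> y - \<phi> y * \<phi> x - \<phi> (lie x y) = (\<Sum>i<D. \<Sum>j<D. scalar (coef x i * coef y j) * K i j)"
proof -
  have "\<phi> (lie x y) = (\<Sum>k<D. \<Sum>i<D. \<Sum>j<D. Poly_Mapping.single [k] (coef x i * coef y j * s i j k))"
    unfolding \<phi>_def by (intro sum.cong refl) (simp add: coef_lie[OF x y] single_sum)
  also have "\<dots> = (\<Sum>i<D. \<Sum>k<D. \<Sum>j<D. Poly_Mapping.single [k] (coef x i * coef y j * s i j k))"
    by (rule sum.swap)
  also have "\<dots> = (\<Sum>i<D. \<Sum>j<D. \<Sum>k<D. Poly_Mapping.single [k] (coef x i * coef y j * s i j k))"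
    by (intro sum.cong refl sum.swap)
  finally have 1: "\<phi> (lie x y) = (\<Sum>i<D. \<Sum>j<D. \<Sum>k<D. Poly_Mapping.single [k] (coef x i * coef y j * s i j k))" .
  have 2: "\<phi> x * \<phi> y = (\<Sum>i<D. \<Sum>j<D. Poly_Mapping.single [i, j] (coef x i * coef y j))"
    by (simp add: \<phi>_def sum_product mult_single)
  have "\<phi> y * \<phi> x = (\<Sum>j<D. \<Sum>i<D. Poly_Mapping.single [j, i] (coef x i * coef y j))"
    by (simp add: \<phi>_def sum_product mult_single mult.commute)
  also have "\<dots> = (\<Sum>i<D. \<Sum>j<D. Poly_Mapping.single [j, i] (coef x i * coef y j))" by (rule sum.swap)
  finally have 3: "\<phi> y * \<phi> x = (\<Sum>i<D. \<Sum>j<D. Poly_Mapping.single [j, i] (coef x i * coef y j))" .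
  show ?thesis
    unfolding 1 2 3 K_def sum_subtractf[symmetric]
    by (intro sum.cong refl) (simp add: right_diff_distrib scalar_def mult_single sum_distrib_left)
qed

text \<open>The linear relations become trivial in basis coordinates, and the bracket relations
  become combinations of the relators \<open>K i j\<close>. The contexts a and c let the claim pass
  to products.\<close>

lemma L_ideal:
  assumes "f \<in> uea_ideal g"
  shows "L (a * ev scalar \<phi> f * c) = 0"
  using g assms
proof (induct arbitrary: a c rule: uea_ideal_induct)
  case (rel r)
  then consider (add) x y where "x \<in> g" "y \<in> g" "r = letter (x + y) - letter x - letter y"
    | (scale) k x where "x \<in> g" "r = letter (smat k x) - scalar k * letter x"
    | (lie) x y where "x \<in> g" "y \<in> g" "r = letter x * letter y - letter y * letter x - letter (lie x y)"
    unfolding uea_relations_def by blast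
  then show ?case
  proof cases
    case add
    then have "ev scalar \<phi> r = 0" by (simp add: scalar.ev_diff scalar.ev_letter \<phi>_add)
    then show ?thesis by (simp add: L_0)
  next
    case scale
    then have "ev scalar \<phi> r = 0"
      by (simp add: scalar.ev_diff scalar.ev_letter scalar.ev_mult scalar.ev_scalar \<phi>_smat)
    then show ?thesis by (simp add: L_0)
  next
    case lie
    then have "ev scalar \<phi> r = (\<Sum>i<D. \<Sum>j<D. scalar (coef x i * coef y j) * K i j)"
      by (simp only: scalar.ev_diff scalar.ev_letter scalar.ev_mult \<phi>_lie)
    then have "L (a * ev scalar \<phi> r * c) = (\<Sum>i<D. \<Sum>j<D. L ((a * scalar (coef x i * coef y j)) * K i j * c))"
      by (simp only: sum_distrib_left sum_distrib_right L_sum mult.assoc)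
    then show ?thesis by (simp add: L_K)
  qed
next
  case (add p q)
  then show ?case by (simp add: scalar.ev_add distrib_left distrib_right L_add)
next
  case (left p q)
  have "L ((a * ev scalar \<phi> p) * ev scalar \<phi> q * c) = 0" by (rule left)
  then show ?case by (simp only: scalar.ev_mult mult.assoc)
next
  case (right p q)
  have "L (a * ev scalar \<phi> q * (ev scalar \<phi> p * c)) = 0" by (rule right)
  then show ?case by (simp only: scalar.ev_mult mult.assoc)
qed

lemma L_first: "i < n1 \<Longrightarrow> L (Poly_Mapping.single [i] p * f) = 0"
  by (induct f rule: poly_mapping_single_induct) (simp_all add: mult_single L_single \<sigma>_first distrib_left L_add)

lemma L_last: "n2 \<le> i \<Longrightarrow> L (f * Poly_Mapping.single [i] p) = 0"
  by (induct f rule: poly_mapping_single_induct) (simp_all add: mult_single L_single \<sigma>_last distrib_right L_add)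

lemma L_\<phi>_N: "x \<in> N \<Longrightarrow> L (\<phi> x * f) = 0"
proof -
  assume x: "x \<in> N"
  have "L (Poly_Mapping.single [i] (coef x i) * f) = 0" for i
    using coef_N[OF x, of i] L_first[of i "coef x i" f] by (cases "coef x i = 0") (auto simp: L_0)
  then show ?thesis by (simp add: \<phi>_def sum_distrib_right L_sum)
qed

lemma L_\<phi>_Nb: "x \<in> Nb \<Longrightarrow> L (f * \<phi> x) = 0"
proof -
  assume x: "x \<in> Nb"
  have "L (f * Poly_Mapping.single [i] (coef x i)) = 0" for i
    using coef_Nb[OF x, of i] L_last[of i f "coef x i"] by (cases "coef x i = 0") (auto simp: L_0)
  then show ?thesis by (simp add: \<phi>_def sum_distrib_left L_sum)
qed

lemma L_h_word:
  assumes "Poly_Mapping.keys f \<subseteq> lists {n1..<n2}"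
  shows "L f = ev cs t f"
  unfolding L_def ev_def using assms by (intro sum.cong refl) (auto simp: \<sigma>_h sc_def in_lists_conv_set subset_iff)

lemma keys_\<phi>_h: "x \<in> h \<Longrightarrow> Poly_Mapping.keys (\<phi> x) \<subseteq> lists {n1..<n2}"
proof -
  assume x: "x \<in> h"
  have "Poly_Mapping.keys (\<Sum>i\<in>T. Poly_Mapping.single [i] (coef x i)) \<subseteq> lists {n1..<n2}" for T
  proof (induct T rule: infinite_finite_induct)
    case (insert i T)
    have "Poly_Mapping.keys (Poly_Mapping.single [i] (coef x i)) \<subseteq> lists {n1..<n2}"
      using coef_h[OF x, of i] by (cases "coef x i = 0") auto
    with insert show ?case by (simp only: sum.insert[OF insert(1,2)] keys_add_lists)
  qed simp_all
  then show ?thesis unfolding \<phi>_def .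
qed

lemma keys_ev_\<phi>_h: "f \<in> fcar h \<Longrightarrow> Poly_Mapping.keys (ev scalar \<phi> f) \<subseteq> lists {n1..<n2}"
proof (induct rule: fcar_induct)
  case (single w c)
  then have "Poly_Mapping.keys (prod_list (map \<phi> w)) \<subseteq> lists {n1..<n2}"
    by (induct w) (simp_all add: keys_mult_lists keys_\<phi>_h)
  then show ?case by (simp add: scalar.ev_single keys_mult_lists keys_scalar)
qed (simp_all add: scalar.ev_0 scalar.ev_add keys_add_lists)

lemma smat_zero: "smat 0 x = 0"
  by (simp add: smat_def zero_fun_def)

lemma coef_b_h: "x \<in> h \<Longrightarrow> smat (coef x i) (b i) \<in> h"
proof (cases "coef x i = 0")
  case True
  then show ?thesis using zero_in(2) by (simp only: smat_zero)
next
  case False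
  assume x: "x \<in> h"
  show ?thesis using coef_h[OF x False] by (intro lie_subalgebraD(2)[OF h] b_mem(2)) auto
qed

lemma lift_coef_b: "x \<in> h \<Longrightarrow> lift h (uea_emb h (smat (coef x i) (b i))) = cs (coef x i) * t i"
proof (cases "coef x i = 0")
  case True
  then show ?thesis using lift_emb_lin(4)[OF h] by (simp only: smat_zero cs_0 mult_zero_left)
next
  case False
  assume x: "x \<in> h"
  have "b i \<in> h" using coef_h[OF x False] by (intro b_mem(2)) auto
  then show ?thesis using lift_emb_lin(2)[OF h] by (simp add: t_def sc_def)
qed

lemma ev_t_\<phi>: "x \<in> h \<Longrightarrow> ev cs t (\<phi> x) = lift h (uea_emb h x)"
proof -
  assume x: "x \<in> h"
  have "lift h (uea_emb h (\<Sum>i<m. smat (coef x i) (b i))) = (\<Sum>i<m. cs (coef x i) * t i)" for m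
  proof (induct m)
    case 0
    show ?case using lift_emb_lin(4)[OF h] by (simp only: lessThan_0 sum.empty)
  next
    case (Suc m)
    have m: "(\<Sum>i<m. smat (coef x i) (b i)) \<in> h"
      using coef_b_h[OF x] by (intro cmat.subspace_sum[OF subspaces(2)])
    show ?case
      unfolding sum.lessThan_Suc lift_emb_lin(1)[OF h m coef_b_h[OF x]] Suc lift_coef_b[OF x] by (rule refl)
  qed
  from this[of D] have "lift h (uea_emb h x) = (\<Sum>i<D. cs (coef x i) * t i)"
    using expand[of x] x parts_subset by auto
  moreover have "ev cs t (\<Sum>i<m. Poly_Mapping.single [i] (coef x i)) = (\<Sum>i<m. cs (coef x i) * t i)" for m
    by (induct m) (simp_all add: cs.ev_0 cs.ev_add cs.ev_single)
  ultimately show ?thesis unfolding \<phi>_def by simp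
qed

lemma lift_ev: "f \<in> fcar h \<Longrightarrow> ev cs (\<lambda>x. lift h (uea_emb h x)) f = lift h (uea_class h f)"
proof (induct rule: fcar_induct)
  case zero
  then show ?case using lift_const[OF h, of 0] by (simp add: cs.ev_0 uea_class_0[OF h] uea_const_simps[OF h])
next
  case (single w c)
  have p: "lift h (uea_class h (Poly_Mapping.single w 1)) = prod_list (map (\<lambda>x. lift h (uea_emb h x)) w)"
    using single
  proof (induct w)
    case Nil
    show ?case using lift_const[OF h, of 1] by (simp add: uea_const_uea_class scalar_def)
  next
    case (Cons x w)
    have "Poly_Mapping.single (x # w) 1 = letter x * Poly_Mapping.single w 1"
      by (simp add: letter_def mult_single)
    moreover have "letter x \<in> fcar h" "Poly_Mapping.single w 1 \<in> fcar h" using Cons by (auto intro!: keys_letter)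
    ultimately show ?case using Cons by (simp add: uea_class_simps[OF h] lift_mult[OF h] uea_emb_uea_class del: free_alg_simps)
  qed
  have "Poly_Mapping.single w c = scalar c * Poly_Mapping.single w 1" by (simp add: scalar_def mult_single)
  moreover have "scalar c \<in> fcar h" "Poly_Mapping.single w 1 \<in> fcar h" using single by (auto intro!: keys_scalar)
  ultimately show ?case using p
    by (simp add: uea_class_simps[OF h] lift_mult[OF h] cs.ev_mult cs.ev_scalar uea_const_uea_class[symmetric] lift_const[OF h] uea_const_closed[OF h] cs.ev_single del: free_alg_simps)
next
  case (add a b)
  then show ?case by (simp add: cs.ev_add uea_class_simps[OF h] lift_add[OF h] del: free_alg_simps)
qed

lemma ev_ev: "f \<in> fcar h \<Longrightarrow> ev cs t (ev scalar \<phi> f) = ev cs (\<lambda>x. lift h (uea_emb h x)) f"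
proof (induct rule: fcar_induct)
  case (single w c)
  then have "ev cs t (prod_list (map \<phi> w)) = prod_list (map (\<lambda>x. lift h (uea_emb h x)) w)"
    by (induct w) (simp_all add: cs.ev_1 cs.ev_mult ev_t_\<phi>)
  then show ?case by (simp add: scalar.ev_single cs.ev_single cs.ev_mult cs.ev_scalar)
qed (simp_all add: scalar.ev_0 cs.ev_0 scalar.ev_add cs.ev_add)

text \<open>By \<open>\<Psi>_ideal\<close> this is a function on U(g). It is \<open>lift h\<close>
  on U(h) (\<open>\<Psi>_h\<close>) and can be evaluated to 0 on the complement
  (\<open>hc_complement_\<Psi>\<close>), which proves uniqueness of the projection.\<close>

definition \<Psi> :: "(cmat list \<Rightarrow>\<^sub>0 complex) \<Rightarrow> uprod" where
  "\<Psi> f = L (ev scalar \<phi> f)"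

lemma \<Psi>_h: "f \<in> fcar h \<Longrightarrow> \<Psi> f = lift h (uea_class h f)"
  unfolding \<Psi>_def L_h_word[OF keys_ev_\<phi>_h] ev_ev lift_ev by (rule refl)

lemma \<Psi>_ideal: "f \<in> uea_ideal g \<Longrightarrow> \<Psi> f = 0"
  using L_ideal[of f 1 1] by (simp add: \<Psi>_def)

lemma \<Psi>_add: "\<Psi> (f + f') = \<Psi> f + \<Psi> f'" and \<Psi>_diff: "\<Psi> (f - f') = \<Psi> f - \<Psi> f'" and \<Psi>_minus: "\<Psi> (- f) = - \<Psi> f"
  and \<Psi>_0: "\<Psi> 0 = 0"
  by (simp_all add: \<Psi>_def scalar.ev_add L_add scalar.ev_diff L_diff scalar.ev_minus L_minus scalar.ev_0 L_0)

lemma hc_generate: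
  assumes "z \<in> generate (add_monoid (uea g)) Z"
    and Z: "\<And>y. y \<in> Z \<Longrightarrow> \<exists>f\<in>fcar g. y = uea_class g f \<and> \<Psi> f = 0"
  shows "\<exists>f\<in>fcar g. z = uea_class g f \<and> \<Psi> f = 0"
  using assms(1)
proof induct
  case one
  show ?case by (rule bexI[of _ 0]) (simp_all add: uea_class_0[OF g] \<Psi>_0)
next
  case (incl y)
  then show ?case by (rule Z)
next
  case (inv y)
  then obtain f where f: "f \<in> fcar g" "y = uea_class g f" "\<Psi> f = 0" using Z by blast
  show ?case
    by (rule bexI[of _ "- f"]) (use f fcar_intros(4) in \<open>simp_all add: uea_class_minus[OF g] a_inv_def \<Psi>_minus del: free_alg_simps\<close>)
next
  case (eng y y')
  then obtain f f' where f: "f \<in> fcar g" "y = uea_class g f" "\<Psi> f = 0" "f' \<in> fcar g" "y' = uea_class g f'" "\<Psi> f' = 0" by blast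
  show ?case
    by (rule bexI[of _ "f + f'"]) (use f fcar_intros(2) in \<open>simp_all add: uea_class_simps[OF g] \<Psi>_add del: free_alg_simps\<close>)
qed

text \<open>Representatives are chosen that keep the letter from N in front or the letter from Nb at
  the end, where \<open>L_\<phi>_N\<close> and \<open>L_\<phi>_Nb\<close> apply.\<close>

lemma hc_complement_\<Psi>:
  assumes "z \<in> hc_complement g N Nb"
  shows "\<exists>f\<in>fcar g. z = uea_class g f \<and> \<Psi> f = 0"
proof -
  obtain z1 z2 where z: "z = z1 \<oplus>\<^bsub>uea g\<^esub> z2"
    and z1: "z1 \<in> generate (add_monoid (uea g)) {uea_emb g x \<otimes>\<^bsub>uea g\<^esub> a | x a. x \<in> N \<and> a \<in> carrier (uea g)}"
    and z2: "z2 \<in> generate (add_monoid (uea g)) {a \<otimes>\<^bsub>uea g\<^esub> uea_emb g y | a y. a \<in> carrier (uea g) \<and> y \<in> Nb}"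
    using assms unfolding hc_complement_def set_add_def' by blast
  have "\<exists>f\<in>fcar g. z1 = uea_class g f \<and> \<Psi> f = 0"
  proof (rule hc_generate[OF z1])
    fix y assume "y \<in> {uea_emb g x \<otimes>\<^bsub>uea g\<^esub> a | x a. x \<in> N \<and> a \<in> carrier (uea g)}"
    then obtain x a where y: "y = uea_emb g x \<otimes>\<^bsub>uea g\<^esub> a" "x \<in> N" "a \<in> carrier (uea g)" by blast
    obtain f where f: "f \<in> fcar g" "a = uea_class g f" using uea_cases[OF g y(3)] by blast
    have l: "letter x \<in> fcar g" using y(2) parts_subset by (intro fcar_intros) blast
    show "\<exists>f\<in>fcar g. y = uea_class g f \<and> \<Psi> f = 0"
      by (rule bexI[of _ "letter x * f"])
        (use y f l L_\<phi>_N in \<open>simp_all add: uea_class_simps[OF g] uea_emb_uea_class fcar_intros \<Psi>_def scalar.ev_mult scalar.ev_letter del: free_alg_simps\<close>)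
  qed
  moreover have "\<exists>f\<in>fcar g. z2 = uea_class g f \<and> \<Psi> f = 0"
  proof (rule hc_generate[OF z2])
    fix y assume "y \<in> {a \<otimes>\<^bsub>uea g\<^esub> uea_emb g y | a y. a \<in> carrier (uea g) \<and> y \<in> Nb}"
    then obtain x a where y: "y = a \<otimes>\<^bsub>uea g\<^esub> uea_emb g x" "x \<in> Nb" "a \<in> carrier (uea g)" by blast
    obtain f where f: "f \<in> fcar g" "a = uea_class g f" using uea_cases[OF g y(3)] by blast
    have l: "letter x \<in> fcar g" using y(2) parts_subset by (intro fcar_intros) blast
    show "\<exists>f\<in>fcar g. y = uea_class g f \<and> \<Psi> f = 0"
      by (rule bexI[of _ "f * letter x"])
        (use y f l L_\<phi>_Nb in \<open>simp_all add: uea_class_simps[OF g] uea_emb_uea_class fcar_intros \<Psi>_def scalar.ev_mult scalar.ev_letter del: free_alg_simps\<close>)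
  qed
  ultimately obtain f f' where f: "f \<in> fcar g" "z1 = uea_class g f" "\<Psi> f = 0" "f' \<in> fcar g" "z2 = uea_class g f'" "\<Psi> f' = 0" by blast
  show ?thesis
    by (rule bexI[of _ "f + f'"]) (use z f fcar_intros(2) in \<open>simp_all add: uea_class_simps[OF g] \<Psi>_add del: free_alg_simps\<close>)
qed

theorem hc_unique:
  assumes p: "p \<in> carrier (uea h)" "p' \<in> carrier (uea h)"
    and q: "q \<in> hc_complement g N Nb" "q' \<in> hc_complement g N Nb"
    and e: "uea_incl h g p \<oplus>\<^bsub>uea g\<^esub> q = uea_incl h g p' \<oplus>\<^bsub>uea g\<^esub> q'"
  shows "p = p'"
proof -
  obtain f where f: "f \<in> fcar h" "p = uea_class h f" using uea_cases[OF h p(1)] by blast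
  obtain f' where f': "f' \<in> fcar h" "p' = uea_class h f'" using uea_cases[OF h p(2)] by blast
  obtain r where r: "r \<in> fcar g" "q = uea_class g r" "\<Psi> r = 0" using hc_complement_\<Psi>[OF q(1)] by blast
  obtain r' where r': "r' \<in> fcar g" "q' = uea_class g r'" "\<Psi> r' = 0" using hc_complement_\<Psi>[OF q(2)] by blast
  have "fcar h \<subseteq> fcar g" using parts_subset(2) lists_mono[OF parts_subset(2)] by auto
  then have fg: "f \<in> fcar g" "f' \<in> fcar g" using f f' by blast+
  have "uea_class g (f + r) = uea_class g (f' + r')"
    using e f f' r r' fg by (simp add: uea_incl_uea_class[OF h g parts_subset(2)] uea_class_simps[OF g] del: free_alg_simps)
  then have "(f + r) - (f' + r') \<in> uea_ideal g"
    using uea_class_eq_iff[OF g fcar_intros(2)[OF fg(1) r(1)] fcar_intros(2)[OF fg(2) r'(1)]] by blast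
  from \<Psi>_ideal[OF this] have "\<Psi> f = \<Psi> f'" using r r' by (simp add: \<Psi>_add \<Psi>_diff)
  then have "lift h p = lift h p'" using f f' by (simp add: \<Psi>_h del: free_alg_simps)
  then have "component (lift h p) h = component (lift h p') h" by simp
  then show ?thesis using p by (simp add: component_lift[OF h h] uea_incl_self[OF h])
qed

end

section \<open>Root vectors\<close>

text \<open>The bivector of v and w, under the identification of so_n with the exterior square of
  the space of columns; Z acts on it by the Leibniz rule (\<open>lie_sk\<close>).\<close>

definition sk :: "(nat \<Rightarrow> complex) \<Rightarrow> (nat \<Rightarrow> complex) \<Rightarrow> cmat" where
  "sk v w = (\<lambda>a b. v a * w b - v b * w a)"

definition vs :: "nat \<Rightarrow> (nat \<Rightarrow> complex) set" where
  "vs n = {v. \<forall>a. v a \<noteq> 0 \<longrightarrow> a \<in> {1..n}}"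

text \<open>The symmetric bilinear form that so_n preserves. It involves no conjugation, so that
  there are nonzero null vectors.\<close>

definition ip :: "nat \<Rightarrow> (nat \<Rightarrow> complex) \<Rightarrow> (nat \<Rightarrow> complex) \<Rightarrow> complex" where
  "ip n v w = (\<Sum>a\<in>{1..n}. v a * w a)"

definition act :: "nat \<Rightarrow> cmat \<Rightarrow> (nat \<Rightarrow> complex) \<Rightarrow> nat \<Rightarrow> complex" where
  "act n Z v = (\<lambda>a. \<Sum>b\<in>{1..n}. Z a b * v b)"

definition unitv :: "nat \<Rightarrow> nat \<Rightarrow> complex" where
  "unitv i = (\<lambda>a. if a = i then 1 else 0)"

lemma skew_sk: "skew j i = sk (unitv j) (unitv i)"
  by (auto simp: skew_def munit_def sk_def unitv_def fun_eq_iff)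

lemma unitv_vs: "i \<in> {1..n} \<Longrightarrow> unitv i \<in> vs n"
  by (simp add: unitv_def vs_def)

lemma sk_so: "v \<in> vs n \<Longrightarrow> w \<in> vs n \<Longrightarrow> sk v w \<in> so n"
proof -
  assume v: "v \<in> vs n" and w: "w \<in> vs n"
  have z: "v a = 0" "w a = 0" if "a \<notin> {1..n}" for a using v w that unfolding vs_def by blast+
  have "sk v w i j \<noteq> 0 \<longrightarrow> i \<in> {1..n} \<and> j \<in> {1..n}" for i j
    using z[of i] z[of j] unfolding sk_def by fastforce
  then show ?thesis unfolding so_def by (simp add: sk_def)
qed

lemma sk_anti: "sk w v = smat (-1) (sk v w)"
  by (simp add: sk_def smat_def fun_eq_iff)

lemma lie_sk:
  assumes Z: "Z \<in> so n" and v: "v \<in> vs n" and w: "w \<in> vs n"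
  shows "lie Z (sk v w) = sk (act n Z v) w + sk v (act n Z w)"
proof (intro ext)
  fix a b
  have box: "Z \<in> box n" "sk v w \<in> box n" using Z sk_so[OF v w] so_box by auto
  have 1: "mmul Z (sk v w) a b = act n Z v a * w b - v b * act n Z w a"
    unfolding mmul_box[OF disjI1[OF box(1)]] act_def sk_def
    by (simp add: right_diff_distrib sum_subtractf sum_distrib_left sum_distrib_right mult_ac)
  have "mmul (sk v w) Z a b = (\<Sum>k\<in>{1..n}. - (sk v w a k * Z b k))"
    unfolding mmul_box[OF disjI1[OF box(2)]] by (intro sum.cong refl) (subst so_skewD[OF Z], simp)
  also have "\<dots> = - (v a * act n Z w b - act n Z v b * w a)"
    unfolding act_def sk_def sum_negf
    by (simp add: left_diff_distrib right_diff_distrib sum_subtractf sum_distrib_left sum_distrib_right mult_ac)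
  finally have 2: "mmul (sk v w) Z a b = - (v a * act n Z w b - act n Z v b * w a)" .
  have "lie Z (sk v w) a b = mmul Z (sk v w) a b - mmul (sk v w) Z a b"
    by (simp add: lie_def)
  then show "lie Z (sk v w) a b = (sk (act n Z v) w + sk v (act n Z w)) a b"
    unfolding 1 2 by (simp add: sk_def algebra_simps)
qed

lemma act_sk: "act n (sk a b) v = (\<lambda>i. a i * ip n b v - b i * ip n a v)"
  by (simp add: act_def sk_def ip_def left_diff_distrib right_diff_distrib sum_subtractf sum_distrib_left mult_ac fun_eq_iff)

lemma act_lin: "act n (smat c Z) v = (\<lambda>i. c * act n Z v i)" "act n (Z + Z') v = (\<lambda>i. act n Z v i + act n Z' v i)"
  by (simp_all add: act_def smat_def sum_distrib_left algebra_simps sum.distrib fun_eq_iff)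

lemma lie_sk_sk:
  assumes "a \<in> vs n" "b \<in> vs n" "c \<in> vs n" "d \<in> vs n"
  shows "lie (sk a b) (sk c d) = smat (ip n b c) (sk a d) - smat (ip n a c) (sk b d)
     + smat (ip n b d) (sk c a) - smat (ip n a d) (sk c b)"
  unfolding lie_sk[OF sk_so[OF assms(1,2)] assms(3,4)] act_sk
  by (simp add: fun_eq_iff sk_def smat_def algebra_simps)

text \<open>
  The null vectors: \<open>nu n x\<close> for \<open>x = k\<close> and \<open>x = - k\<close> with \<open>k \<ge> 1\<close> are $e_{n+1-2k}\pm\sqrt{-1}\,e_{n+2-2k}$, so that \<open>k = 1\<close>
  belongs to \<open>H\<close> and \<open>k = i + 1\<close> to $T_i$; \<open>nu n 0\<close> is $e_1$, which is left over for odd \<open>n\<close>.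
\<close>

definition nu :: "nat \<Rightarrow> int \<Rightarrow> nat \<Rightarrow> complex" where
  "nu n x a = (if x = 0 then (if a = 1 then 1 else 0)
     else if a = n + 1 - 2 * nat \<bar>x\<bar> then 1
     else if a = n + 2 - 2 * nat \<bar>x\<bar> then (if x > 0 then \<i> else - \<i>) else 0)"

definition idx :: "nat \<Rightarrow> int set" where
  "idx n = {x. 2 * nat \<bar>x\<bar> \<le> n \<and> (x = 0 \<longrightarrow> odd n)}"

lemma idx_uminus: "x \<in> idx n \<Longrightarrow> - x \<in> idx n"
  by (simp add: idx_def)

lemma finite_idx: "finite (idx n)"
proof (rule finite_subset)
  show "idx n \<subseteq> {- int n..int n}" by (auto simp: idx_def)
qed simp

lemma nu_vs: "x \<in> idx n \<Longrightarrow> nu n x \<in> vs n"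
proof -
  assume x: "x \<in> idx n"
  have "1 \<le> a \<and> a \<le> n" if "nu n x a \<noteq> 0" for a
  proof (cases "x = 0")
    case True
    then show ?thesis using that x by (auto simp: nu_def idx_def split: if_splits elim: oddE)
  next
    case False
    then have "nat \<bar>x\<bar> \<ge> 1" "2 * nat \<bar>x\<bar> \<le> n" using x by (simp_all add: idx_def)
    moreover have "a = n + 1 - 2 * nat \<bar>x\<bar> \<or> a = n + 2 - 2 * nat \<bar>x\<bar>"
      using that False by (simp add: nu_def split: if_splits)
    ultimately show ?thesis by arith
  qed
  then show ?thesis by (simp add: vs_def)
qed

lemma sum_nu:
  assumes x: "x \<in> idx n" and x0: "x \<noteq> 0"
  shows "(\<Sum>a\<in>{1..n}. nu n x a * f a) = f (n + 1 - 2 * nat \<bar>x\<bar>) + (if x > 0 then \<i> else - \<i>) * f (n + 2 - 2 * nat \<bar>x\<bar>)"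
proof -
  have *: "nat \<bar>x\<bar> \<ge> 1" "2 * nat \<bar>x\<bar> \<le> n" using x x0 by (auto simp: idx_def)
  let ?p = "n + 1 - 2 * nat \<bar>x\<bar>" and ?q = "n + 2 - 2 * nat \<bar>x\<bar>"
  have pq: "?p \<noteq> ?q" "?p \<in> {1..n}" "?q \<in> {1..n}" using * by auto
  have "(\<Sum>a\<in>{1..n}. nu n x a * f a) = (\<Sum>a\<in>{?p, ?q}. nu n x a * f a)"
    using pq x0 by (intro sum.mono_neutral_right) (auto simp: nu_def)
  also have "\<dots> = f ?p + (if x > 0 then \<i> else - \<i>) * f ?q"
    using pq x0 by (simp add: nu_def)
  finally show ?thesis .
qed

text \<open>The \<open>nu n x\<close> form a hyperbolic basis: each of them pairs only with the one
  of opposite sign.\<close>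

lemma ip_nu:
  assumes x: "x \<in> idx n" and y: "y \<in> idx n"
  shows "ip n (nu n x) (nu n y) = (if y = - x then (if x = 0 then 1 else 2) else 0)"
proof -
  have main: "ip n (nu n x) (nu n y) = (if y = - x then 2 else 0)" if x: "x \<in> idx n" "x \<noteq> 0" and y: "y \<in> idx n" for x y
  proof -
    have *: "nat \<bar>x\<bar> \<ge> 1" "2 * nat \<bar>x\<bar> \<le> n" using x by (auto simp: idx_def)
    have e: "ip n (nu n x) (nu n y) = nu n y (n + 1 - 2 * nat \<bar>x\<bar>) + (if x > 0 then \<i> else - \<i>) * nu n y (n + 2 - 2 * nat \<bar>x\<bar>)"
      unfolding ip_def sum_nu[OF x] by (rule refl)
    show ?thesis
    proof (cases "y = 0")
      case True
      then have "odd n" using y by (simp add: idx_def)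
      moreover have "n + 1 - 2 * m \<noteq> 1 \<and> n + 2 - 2 * m \<noteq> 1" if "odd n" "2 * m \<le> n" for m
        using that by presburger
      ultimately have "n + 1 - 2 * nat \<bar>x\<bar> \<noteq> 1" "n + 2 - 2 * nat \<bar>x\<bar> \<noteq> 1" using *(2) by blast+
      then show ?thesis unfolding e using True x by (simp add: nu_def)
    next
      case False
      have **: "nat \<bar>y\<bar> \<ge> 1" "2 * nat \<bar>y\<bar> \<le> n" using y False by (auto simp: idx_def)
      have 1: "n + 1 - 2 * nat \<bar>x\<bar> = n + 1 - 2 * nat \<bar>y\<bar> \<longleftrightarrow> \<bar>x\<bar> = \<bar>y\<bar>"
        "n + 2 - 2 * nat \<bar>x\<bar> = n + 2 - 2 * nat \<bar>y\<bar> \<longleftrightarrow> \<bar>x\<bar> = \<bar>y\<bar>"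
        using * ** by arith+
      \<comment> \<open>The two numbers have different parity.\<close>
      have 2: "n + 1 - 2 * l \<noteq> n + 2 - 2 * m" if "2 * l \<le> n" "2 * m \<le> n" for l m
        using that by presburger
      note 1 = 1 2[OF *(2) **(2)] 2[OF **(2) *(2), symmetric]
      show ?thesis unfolding e nu_def using 1 False x(2) by (auto simp: abs_if split: if_splits)
    qed
  qed
  show ?thesis
  proof (cases "x = 0")
    case False
    then show ?thesis using main[OF x False y] by simp
  next
    case x0: True
    show ?thesis
    proof (cases "y = 0")
      case True
      have "n \<ge> 1" using x x0 by (auto simp: idx_def elim: oddE)
      then have "(\<Sum>a\<in>{1..n}. if a = 1 then 1 else (0::complex)) = 1" by simp
      moreover have "ip n (nu n 0) (nu n 0) = (\<Sum>a\<in>{1..n}. if a = 1 then 1 else 0)"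
        unfolding ip_def by (intro sum.cong refl) (simp add: nu_def)
      ultimately show ?thesis using x0 True by simp
    next
      case False
      have "ip n (nu n x) (nu n y) = ip n (nu n y) (nu n x)" by (simp add: ip_def mult.commute)
      then show ?thesis using main[OF y False x] x0 False by auto
    qed
  qed
qed

text \<open>The vector whose weight is the sum of the weights of \<open>nu n x\<close> and
  \<open>nu n y\<close> (\<open>lie_torus_R\<close>). It is a root vector unless x = y or x = - y;
  for y = - x it lies in the Cartan subalgebra.\<close>

definition R :: "nat \<Rightarrow> int \<Rightarrow> int \<Rightarrow> cmat" where
  "R n x y = sk (nu n x) (nu n y)"

text \<open>As \<open>elemT n 0\<close> is \<open>elemH n\<close>, this joins H and the T_i to one
  family, numbered like the null vectors \<open>nu\<close>.\<close>

definition torus :: "nat \<Rightarrow> nat \<Rightarrow> cmat" where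
  "torus n k = elemT n (k - 1)"

text \<open>The weight of \<open>nu n x\<close>, evaluated at \<open>torus n k\<close>, see
  \<open>act_torus\<close>.\<close>

definition sign_weight :: "int \<Rightarrow> nat \<Rightarrow> complex" where
  "sign_weight x k = (if x = int k then 1 else if x = - int k then - 1 else 0)"

lemma R_so: "x \<in> idx n \<Longrightarrow> y \<in> idx n \<Longrightarrow> R n x y \<in> so n"
  unfolding R_def by (intro sk_so nu_vs)

lemma R_anti: "R n y x = smat (-1) (R n x y)"
  unfolding R_def by (rule sk_anti)

lemma R_self: "R n x x = 0"
  by (simp add: R_def sk_def fun_eq_iff)

lemma idx_pos: "1 \<le> k \<Longrightarrow> k \<le> n div 2 \<Longrightarrow> int k \<in> idx n"
  by (auto simp: idx_def)

lemma idx_abs: "x \<in> idx n \<Longrightarrow> x \<noteq> 0 \<Longrightarrow> nat \<bar>x\<bar> \<in> {1..n div 2}"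
  by (auto simp: idx_def)

lemma torus_R: "1 \<le> k \<Longrightarrow> k \<le> n div 2 \<Longrightarrow> torus n k = smat (1/2) (R n (int k) (- int k))"
proof -
  assume k: "1 \<le> k" "k \<le> n div 2"
  have e: "n - 2 * (k - 1) = n + 2 - 2 * k" "n - 1 - 2 * (k - 1) = n + 1 - 2 * k" using k by arith+
  have "n + 1 - 2 * k \<noteq> n + 2 - 2 * k" using k by arith
  then show ?thesis using k
    unfolding torus_def elemT_def e R_def skew_sk
    by (auto simp: fun_eq_iff sk_def smat_def nu_def unitv_def)
qed

lemma act_torus:
  assumes k: "1 \<le> k" "k \<le> n div 2" and x: "x \<in> idx n"
  shows "act n (torus n k) (nu n x) = (\<lambda>i. sign_weight x k * nu n x i)"
proof -
  note kk = idx_pos[OF k]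
  have "act n (torus n k) (nu n x) = (\<lambda>i. 1/2 * (nu n (int k) i * ip n (nu n (- int k)) (nu n x) - nu n (- int k) i * ip n (nu n (int k)) (nu n x)))"
    unfolding torus_R[OF k] R_def act_lin(1) act_sk by (rule refl)
  also have "\<dots> = (\<lambda>i. sign_weight x k * nu n x i)"
    unfolding ip_nu[OF idx_uminus[OF kk] x] ip_nu[OF kk x] using k by (auto simp: sign_weight_def fun_eq_iff)
  finally show ?thesis .
qed

lemma torus_so: "1 \<le> k \<Longrightarrow> k \<le> n div 2 \<Longrightarrow> torus n k \<in> so n"
  unfolding torus_R by (intro lie_subalgebraD(2)[OF lie_subalgebra_so] R_so idx_uminus idx_pos)

lemma lie_torus_R:
  assumes k: "1 \<le> k" "k \<le> n div 2" and x: "x \<in> idx n" and y: "y \<in> idx n"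
  shows "lie (torus n k) (R n x y) = smat (sign_weight x k + sign_weight y k) (R n x y)"
  unfolding R_def lie_sk[OF torus_so[OF k] nu_vs[OF x] nu_vs[OF y]] act_torus[OF k x] act_torus[OF k y]
  by (simp add: fun_eq_iff sk_def smat_def algebra_simps)

lemma unitv_nu:
  assumes a: "a \<in> {1..n}"
  obtains x c d where "x \<in> idx n" "unitv a = (\<lambda>i. c * nu n x i + d * nu n (- x) i)"
proof (cases "odd n \<and> a = 1")
  case True
  show ?thesis
    by (rule that[of 0 1 0]) (use True in \<open>auto simp: idx_def unitv_def nu_def fun_eq_iff\<close>)
next
  case False
  \<comment> \<open>The pair with number k consists of n + 1 - 2 * k and n + 2 - 2 * k; this k is
    the one whose pair contains a.\<close>
  define k where "k = (n + 2 - a) div 2"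
  have k: "1 \<le> k" "k \<le> n div 2" using a False unfolding k_def atLeastAtMost_iff by presburger+
  have ne: "n + 1 - 2 * k \<noteq> n + 2 - 2 * k" using k by arith
  consider "a = n + 1 - 2 * k" | "a = n + 2 - 2 * k" using a unfolding k_def by fastforce
  then show ?thesis
  proof cases
    case 1
    show ?thesis
      by (rule that[of "int k" "1/2" "1/2"]) (use k 1 ne in \<open>auto simp: idx_pos unitv_def nu_def fun_eq_iff\<close>)
  next
    case 2
    show ?thesis
      by (rule that[of "int k" "-\<i>/2" "\<i>/2"]) (use k 2 ne in \<open>auto simp: idx_pos unitv_def nu_def fun_eq_iff\<close>)
  qed
qed

lemma so_span_R: "so n \<subseteq> cmat.span ((\<lambda>(x, y). R n x y) ` (idx n \<times> idx n))"
proof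
  fix Z assume Z: "Z \<in> so n"
  let ?S = "cmat.span ((\<lambda>(x, y). R n x y) ` (idx n \<times> idx n))"
  have RS: "sk (nu n x) (nu n y) \<in> ?S" if "x \<in> idx n" "y \<in> idx n" for x y
    using that by (intro cmat.span_base) (auto simp: R_def)
  have lin: "sk (\<lambda>i. c * v i + d * v' i) w \<in> ?S" if "sk v w \<in> ?S" "sk v' w \<in> ?S" for c d v v' w
  proof -
    have "sk (\<lambda>i. c * v i + d * v' i) w = smat c (sk v w) + smat d (sk v' w)"
      by (simp add: fun_eq_iff sk_def smat_def algebra_simps)
    then show ?thesis using cmat.span_add[OF cmat.span_scale[OF that(1)] cmat.span_scale[OF that(2)]] by simp
  qed
  have S1: "sk (unitv a) (nu n y) \<in> ?S" if a: "a \<in> {1..n}" and y: "y \<in> idx n" for a y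
  proof -
    obtain x c d where x: "x \<in> idx n" "unitv a = (\<lambda>i. c * nu n x i + d * nu n (- x) i)" using unitv_nu[OF a] .
    show ?thesis unfolding x(2) by (intro lin RS x idx_uminus y)
  qed
  have S2: "sk (unitv a) (unitv b) \<in> ?S" if a: "a \<in> {1..n}" and b: "b \<in> {1..n}" for a b
  proof -
    obtain x c d where x: "x \<in> idx n" "unitv b = (\<lambda>i. c * nu n x i + d * nu n (- x) i)" using unitv_nu[OF b] .
    have sw: "sk w v \<in> ?S" if "sk v w \<in> ?S" for v w
      unfolding sk_anti[of w v] using that by (rule cmat.span_scale)
    have "sk (unitv b) (unitv a) \<in> ?S" unfolding x(2) by (intro lin sw[OF S1[OF a]] x idx_uminus)
    then show ?thesis by (rule sw)
  qed
  have "(\<Sum>i\<in>{1..n}. \<Sum>j\<in>{1..n}. smat (Z i j / 2) (skew i j)) \<in> ?S"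
    unfolding skew_sk by (intro cmat.span_sum cmat.span_scale S2)
  then show "Z \<in> ?S" using so_sum_skew[OF Z] by simp
qed

lemma lie_sum_right:
  assumes "Y \<in> box n" "\<And>i. i \<in> I \<Longrightarrow> z i \<in> box n"
  shows "lie Y (\<Sum>i\<in>I. smat (c i) (z i)) = (\<Sum>i\<in>I. smat (c i) (lie Y (z i)))"
  using assms(2)
proof (induct I rule: infinite_finite_induct)
  case (insert i I)
  have a: "(\<Sum>i\<in>I. smat (c i) (z i)) \<in> box n"
    using insert by (intro cmat.subspace_sum[OF subspace_box] cmat.subspace_scale[OF subspace_box]) auto
  have b: "smat (c i) (z i) \<in> box n" using insert by (intro cmat.subspace_scale[OF subspace_box]) auto
  have "lie Y (smat (c i) (z i) + (\<Sum>i\<in>I. smat (c i) (z i))) = lie Y (smat (c i) (z i)) + lie Y (\<Sum>i\<in>I. smat (c i) (z i))"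
    by (rule lie_box(2)[OF b a assms(1)])
  also have "lie Y (smat (c i) (z i)) = smat (c i) (lie Y (z i))"
    using insert by (intro lie_box(4)[of _ n "z i" Y]) (auto intro: assms)
  also have "lie Y (\<Sum>i\<in>I. smat (c i) (z i)) = (\<Sum>i\<in>I. smat (c i) (lie Y (z i)))"
    using insert by auto
  finally show ?case unfolding sum.insert[OF insert(1,2)] .
qed (simp_all only: sum.infinite sum.empty, (simp add: lie_def mmul_def zero_fun_def fun_eq_iff)+)

text \<open>Applying \<open>T k - \<beta>\<close>, where \<open>\<beta>\<close> is the weight of one summand, removes that summand.\<close>

lemma weight_span:
  assumes "finite I" and T: "\<And>k. k \<in> Ks \<Longrightarrow> T k \<in> box n" and z: "\<And>i. i \<in> I \<Longrightarrow> z i \<in> box n"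
    and w: "\<And>i k. i \<in> I \<Longrightarrow> k \<in> Ks \<Longrightarrow> lie (T k) (z i) = smat (\<beta> i k) (z i)"
    and Z: "Z = (\<Sum>i\<in>I. smat (c i) (z i))" and \<alpha>: "\<And>k. k \<in> Ks \<Longrightarrow> lie (T k) Z = smat (\<alpha> k) Z"
  shows "Z \<in> cmat.span (z ` {i \<in> I. \<forall>k\<in>Ks. \<beta> i k = \<alpha> k})"
  using assms(1) z w Z \<alpha>
proof (induct I arbitrary: Z c rule: finite_induct)
  case empty
  then show ?case by (simp only: sum.empty cmat.span_zero)
next
  case (insert i I)
  let ?S = "cmat.span (z ` {j \<in> insert i I. \<forall>k\<in>Ks. \<beta> j k = \<alpha> k})"
  have mono: "cmat.span (z ` {i \<in> I. \<forall>k\<in>Ks. \<beta> i k = \<alpha> k}) \<subseteq> ?S"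
    by (intro cmat.span_mono) auto
  let ?Y = "\<Sum>j\<in>I. smat (c j) (z j)"
  have Zs: "Z = smat (c i) (z i) + ?Y" using insert(6) unfolding sum.insert[OF insert(1,2)] .
  have zb: "z j \<in> box n" if "j \<in> I" for j using insert(4) that by blast
  have zi: "z i \<in> box n" using insert(4) by blast
  have Yb: "?Y \<in> box n" using zb by (intro cmat.subspace_sum[OF subspace_box] cmat.subspace_scale[OF subspace_box])
  have TY: "lie (T k) ?Y = (\<Sum>j\<in>I. smat (c j * \<beta> j k) (z j))" if k: "k \<in> Ks" for k
  proof -
    have "lie (T k) ?Y = (\<Sum>j\<in>I. smat (c j) (lie (T k) (z j)))"
      by (rule lie_sum_right[OF T[OF k] zb])
    also have "\<dots> = (\<Sum>j\<in>I. smat (c j * \<beta> j k) (z j))"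
      by (intro sum.cong refl) (simp add: insert(5) k)
    finally show ?thesis .
  qed
  have TZ: "lie (T k) Z = smat (c i * \<beta> i k) (z i) + (\<Sum>j\<in>I. smat (c j * \<beta> j k) (z j))" if k: "k \<in> Ks" for k
  proof -
    have "lie (T k) Z = lie (T k) (smat (c i) (z i)) + lie (T k) ?Y"
      unfolding Zs by (rule lie_box(2)[OF cmat.subspace_scale[OF subspace_box zi] Yb T[OF k]])
    also have "lie (T k) (smat (c i) (z i)) = smat (c i * \<beta> i k) (z i)"
      using lie_box(4)[OF zi zi T[OF k]] insert(5) k by simp
    finally show ?thesis unfolding TY[OF k] .
  qed
  show ?case
  proof (cases "\<forall>k\<in>Ks. \<beta> i k = \<alpha> k")
    case True
    have "?Y \<in> cmat.span (z ` {i \<in> I. \<forall>k\<in>Ks. \<beta> i k = \<alpha> k})"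
    proof (rule insert(3)[OF zb _ refl])
      fix k assume k: "k \<in> Ks"
      have b: "\<beta> i k = \<alpha> k" using True k by blast
      have "smat (c i * \<alpha> k) (z i) + lie (T k) ?Y = smat (\<alpha> k) (smat (c i) (z i) + ?Y)"
        using trans[OF TZ[OF k, symmetric] insert(7)[OF k]] unfolding TY[OF k] b Zs .
      then show "lie (T k) ?Y = smat (\<alpha> k) ?Y"
        by (simp add: fun_eq_iff smat_def algebra_simps)
    qed (use insert(5) in auto)
    then have y: "?Y \<in> ?S" by (rule subsetD[OF mono])
    have x: "smat (c i) (z i) \<in> ?S" using True by (intro cmat.span_scale cmat.span_base) auto
    show ?thesis unfolding Zs by (rule cmat.span_add[OF x y])
  next
    case False
    then obtain k where k: "k \<in> Ks" "\<beta> i k \<noteq> \<alpha> k" by blast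
    have eq: "smat (\<alpha> k - \<beta> i k) Z = (\<Sum>j\<in>I. smat (c j * (\<beta> j k - \<beta> i k)) (z j))"
    proof -
      have "smat (\<alpha> k - \<beta> i k) Z = lie (T k) Z - smat (\<beta> i k) Z"
        unfolding insert(7)[OF k(1)] by (simp add: fun_eq_iff smat_def algebra_simps)
      also have "\<dots> = (\<Sum>j\<in>I. smat (c j * \<beta> j k) (z j)) - smat (\<beta> i k) ?Y"
        unfolding TZ[OF k(1)] by (subst Zs) (simp add: fun_eq_iff smat_def algebra_simps)
      also have "\<dots> = (\<Sum>j\<in>I. smat (c j * (\<beta> j k - \<beta> i k)) (z j))"
        unfolding cmat.scale_sum_right sum_subtractf[symmetric]
        by (intro sum.cong refl) (simp add: fun_eq_iff smat_def algebra_simps)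
      finally show ?thesis .
    qed
    have Zb: "Z \<in> box n" unfolding Zs
      by (intro cmat.subspace_add[OF subspace_box] cmat.subspace_scale[OF subspace_box] zi Yb)
    have "smat (\<alpha> k - \<beta> i k) Z \<in> cmat.span (z ` {i \<in> I. \<forall>k\<in>Ks. \<beta> i k = \<alpha> k})"
    proof (rule insert(3)[OF zb _ eq])
      fix k' assume k': "k' \<in> Ks"
      show "lie (T k') (smat (\<alpha> k - \<beta> i k) Z) = smat (\<alpha> k') (smat (\<alpha> k - \<beta> i k) Z)"
        unfolding lie_box(4)[OF Zb Zb T[OF k']] insert(7)[OF k'] by (simp add: mult.commute)
    qed (use insert(5) in auto)
    from cmat.span_scale[OF subsetD[OF mono this], of "1 / (\<alpha> k - \<beta> i k)"]
    show ?thesis using k(2) by simp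
  qed
qed

lemma span_finite_sum:
  assumes "finite I" "Z \<in> cmat.span (z ` I)"
  shows "\<exists>c. Z = (\<Sum>i\<in>I. smat (c i) (z i))"
proof -
  let ?V = "{\<Sum>i\<in>I. smat (c i) (z i) | c. True}"
  have V: "cmat.subspace ?V"
  proof (rule cmat.subspaceI)
    have "(\<Sum>i\<in>I. smat 0 (z i)) = 0" by (rule sum.neutral) (simp only: cmat.scale_zero_left, simp)
    then show "0 \<in> ?V" by (intro CollectI exI[of _ "\<lambda>_. 0"] conjI TrueI) (rule sym)
  next
    fix x y assume "x \<in> ?V" "y \<in> ?V"
    then obtain c d where x: "x = (\<Sum>i\<in>I. smat (c i) (z i))" and y: "y = (\<Sum>i\<in>I. smat (d i) (z i))" by blast
    have "x + y = (\<Sum>i\<in>I. smat (c i + d i) (z i))"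
      unfolding x y sum.distrib[symmetric] by (intro sum.cong refl) (simp only: cmat.scale_left_distrib)
    then show "x + y \<in> ?V" by (intro CollectI exI[of _ "\<lambda>i. c i + d i"] conjI TrueI)
  next
    fix e x assume "x \<in> ?V"
    then obtain c where x: "x = (\<Sum>i\<in>I. smat (c i) (z i))" by blast
    have "smat e x = (\<Sum>i\<in>I. smat (e * c i) (z i))"
      unfolding x cmat.scale_sum_right by (intro sum.cong refl) (simp only: cmat.scale_scale)
    then show "smat e x \<in> ?V" by (intro CollectI exI[of _ "\<lambda>i. e * c i"] conjI TrueI)
  qed
  have "z ` I \<subseteq> ?V"
  proof
    fix y assume "y \<in> z ` I"
    then obtain i where i: "i \<in> I" "y = z i" by blast
    have "(\<Sum>j\<in>I. smat (if j = i then 1 else 0) (z j)) = smat 1 (z i) + (\<Sum>j\<in>I - {i}. smat (if j = i then 1 else 0) (z j))"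
      using sum.remove[OF assms(1) i(1), of "\<lambda>j. smat (if j = i then 1 else 0) (z j)"] by (simp only: if_True simp_thms)
    also have "(\<Sum>j\<in>I - {i}. smat (if j = i then 1 else 0) (z j)) = 0"
    proof (rule sum.neutral, rule ballI)
      fix j assume "j \<in> I - {i}"
      then have "(if j = i then 1 else 0) = (0::complex)" by simp
      then show "smat (if j = i then 1 else 0) (z j) = 0" by (simp only: cmat.scale_zero_left)
    qed
    finally have "y = (\<Sum>j\<in>I. smat (if j = i then 1 else 0) (z j))" unfolding i(2) by (simp only: cmat.scale_one add_0_right)
    then show "y \<in> ?V" by (intro CollectI exI[of _ "\<lambda>j. if j = i then 1 else 0"] conjI TrueI)
  qed
  then have "cmat.span (z ` I) \<subseteq> ?V" by (rule cmat.span_minimal[OF _ V])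
  with assms(2) show ?thesis by blast
qed

lemma elemT_0: "elemT n 0 = elemH n"
  by (simp add: elemT_def elemH_def)

lemma sub_h_eq: "sub_h n = cmat.span (torus n ` {1..n div 2})"
proof (cases "n < 2")
  case True
  then show ?thesis by (simp add: sub_h_def sub_tm_def sub_a_def set_plus_def)
next
  case False
  then have n: "n div 2 = Suc ((n - 2) div 2)" by (metis Suc_1 div_2_gt_zero div_if le_div_geq numeral_2_eq_2 not_less zero_less_Suc)
  have "{1..n div 2} = insert 1 (Suc ` {1..(n-2) div 2})" unfolding n by (auto simp: image_iff)
  then have "torus n ` {1..n div 2} = insert (torus n 1) ((\<lambda>k. torus n (Suc k)) ` {1..(n-2) div 2})"
    by (simp only: image_insert image_image)
  then have "torus n ` {1..n div 2} = elemT n ` {1..(n-2) div 2} \<union> {elemH n}"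
    by (simp add: torus_def elemT_0)
  then show ?thesis using False
    by (simp only: cmat.span_Un sub_h_def sub_tm_def sub_a_def set_plus_def) auto
qed

text \<open>
  \<open>N\<close> may be any positive system; \<open>pos x y\<close> says that the root vector \<open>R n x y\<close> lies in it.
\<close>

locale so_pos =
  fixes N Nb :: "cmat set" and n :: nat
  assumes tri: "triangular (so n) N (sub_h n) Nb n"
    and hN: "\<And>x y. x \<in> sub_h n \<Longrightarrow> y \<in> N \<Longrightarrow> lie x y \<in> N"
    and hNb: "\<And>x y. x \<in> sub_h n \<Longrightarrow> y \<in> Nb \<Longrightarrow> lie x y \<in> Nb"
begin

abbreviation Ks where "Ks \<equiv> {1..n div 2}"

lemmas NL = lie_subalgebraD[OF triangular.N[OF tri]]
lemmas NbL = lie_subalgebraD[OF triangular.Nb[OF tri]]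
lemmas hL = lie_subalgebraD[OF triangular.h[OF tri]]
lemmas soL = lie_subalgebraD[OF lie_subalgebra_so[of n]]
lemmas parts = triangular.parts_subset[OF tri]

lemma N_h: "x \<in> N \<Longrightarrow> x \<in> sub_h n \<Longrightarrow> x = 0"
  using triangular.direct[OF tri, of x "- x" 0] hL(5) NbL(4) by auto

lemma Nb_h: "x \<in> Nb \<Longrightarrow> x \<in> sub_h n \<Longrightarrow> x = 0"
  using triangular.direct[OF tri, of 0 "- x" x] hL(5) NL(4) by auto

lemma torus_h: "k \<in> Ks \<Longrightarrow> torus n k \<in> sub_h n"
  unfolding sub_h_eq by (rule cmat.span_base) (rule imageI)

lemma torus_box: "k \<in> Ks \<Longrightarrow> torus n k \<in> box n"
  using torus_h parts(2) so_box by blast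

lemma R_box: "x \<in> idx n \<Longrightarrow> y \<in> idx n \<Longrightarrow> R n x y \<in> box n"
  using R_so so_box by blast

lemma lie_torus: "k \<in> Ks \<Longrightarrow> x \<in> idx n \<Longrightarrow> y \<in> idx n \<Longrightarrow> lie (torus n k) (R n x y) = smat (sign_weight x k + sign_weight y k) (R n x y)"
  by (rule lie_torus_R) auto

lemma R_diag: "x \<in> idx n \<Longrightarrow> R n x (- x) \<in> sub_h n"
proof -
  have p: "R n x (- x) \<in> sub_h n" if x: "x \<in> idx n" "x > 0" for x
  proof -
    have k: "nat x \<in> Ks" using idx_abs[OF x(1)] x(2) by simp
    then have "torus n (nat x) = smat (1/2) (R n x (- x))" using torus_R[of "nat x" n] x(2) by auto
    then have "R n x (- x) = smat 2 (torus n (nat x))" by simp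
    then show ?thesis using hL(2)[OF torus_h[OF k]] by (simp only:)
  qed
  assume x: "x \<in> idx n"
  consider "x > 0" | "x = 0" | "x < 0" by linarith
  then show ?thesis
  proof cases
    case 1
    then show ?thesis using p x by blast
  next
    case 2
    then have "R n x (- x) = 0" using R_self[of n 0] by simp
    then show ?thesis using hL(4) by (simp only:)
  next
    case 3
    have "R n (- x) (- (- x)) \<in> sub_h n" using 3 idx_uminus[OF x] by (intro p) auto
    then have "R n (- x) x \<in> sub_h n" by simp
    from hL(2)[OF this, of "-1"] show ?thesis by (simp only: R_anti[of n x "- x"])
  qed
qed

lemma sign_weight_inj:
  assumes x: "x \<in> idx n" and y: "y \<in> idx n" and e: "\<And>k. k \<in> Ks \<Longrightarrow> sign_weight x k = sign_weight y k"
  shows "x = y"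
proof (cases "x = 0")
  case True
  show ?thesis
  proof (rule ccontr)
    assume "x \<noteq> y"
    then have "y \<noteq> 0" using True by simp
    then show False using e[OF idx_abs[OF y]] True by (auto simp: sign_weight_def split: if_splits)
  qed
next
  case False
  then show ?thesis using e[OF idx_abs[OF x]] by (auto simp: sign_weight_def abs_if split: if_splits)
qed

text \<open>Let x be nonzero. If neither x' nor y' equals x, each of them contributes 0 or the wrong
  sign to the coordinate of x, and the sum cannot be right. Once one index is matched, the other is
  determined by its weight.\<close>

lemma wt_pair:
  assumes I: "x \<in> idx n" "y \<in> idx n" "x' \<in> idx n" "y' \<in> idx n" and xy: "x \<noteq> y" "x \<noteq> - y"
    and e: "\<And>k. k \<in> Ks \<Longrightarrow> sign_weight x' k + sign_weight y' k = sign_weight x k + sign_weight y k"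
  shows "x' = x \<and> y' = y \<or> x' = y \<and> y' = x"
proof -
  have *: "x' = x \<or> y' = x" if x: "x \<in> idx n" "x \<noteq> 0" and xy: "x \<noteq> y" "x \<noteq> - y"
    and e: "\<And>k. k \<in> Ks \<Longrightarrow> sign_weight x' k + sign_weight y' k = sign_weight x k + sign_weight y k" for x y
  proof (rule ccontr)
    assume n: "\<not> (x' = x \<or> y' = x)"
    have "sign_weight y (nat \<bar>x\<bar>) = 0" using xy by (auto simp: sign_weight_def abs_if)
    then have "sign_weight x' (nat \<bar>x\<bar>) + sign_weight y' (nat \<bar>x\<bar>) = sign_weight x (nat \<bar>x\<bar>)" using e[OF idx_abs[OF x]] by simp
    then show False using n x(2) by (auto simp: sign_weight_def abs_if split: if_splits)
  qed
  have "x' = x \<or> y' = x \<or> x' = y \<or> y' = y"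
  proof (cases "x = 0")
    case True
    then have "y \<noteq> 0" using xy by simp
    with *[OF I(2) this, of x] xy e show ?thesis by (auto simp: add.commute)
  qed (use *[OF I(1) _ xy e] in auto)
  then consider "x' = x" | "y' = x" | "x' = y" | "y' = y" by blast
  then show ?thesis
  proof cases
    case 1 with sign_weight_inj[OF I(4,2)] e show ?thesis by auto
  next
    case 2 with sign_weight_inj[OF I(3,2)] e show ?thesis by (auto simp: add.commute)
  next
    case 3 with sign_weight_inj[OF I(4,1)] e show ?thesis by (auto simp: add.commute)
  next
    case 4 with sign_weight_inj[OF I(3,1)] e show ?thesis by auto
  qed
qed

text \<open>Root spaces are one-dimensional: by \<open>wt_pair\<close> the only vectors of this
  weight among the spanning ones are \<open>R n x y\<close> and its negative
  \<open>R n y x\<close>.\<close>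

lemma weight_vector_R:
  assumes I: "x \<in> idx n" "y \<in> idx n" and xy: "x \<noteq> y" "x \<noteq> - y"
    and Z: "Z \<in> so n" and w: "\<And>k. k \<in> Ks \<Longrightarrow> lie (torus n k) Z = smat (sign_weight x k + sign_weight y k) Z"
  shows "\<exists>c. Z = smat c (R n x y)"
proof -
  let ?I = "idx n \<times> idx n"
  have fI: "finite ?I" using finite_idx by simp
  let ?z = "\<lambda>(x, y). R n x y"
  obtain c where c: "Z = (\<Sum>i\<in>?I. smat (c i) (?z i))"
    using span_finite_sum[OF fI] so_span_R[of n] Z by blast
  have zb: "?z i \<in> box n" if "i \<in> ?I" for i using that R_box by auto
  have zw: "lie (torus n k) (?z i) = smat ((\<lambda>(x, y) k. sign_weight x k + sign_weight y k) i k) (?z i)" if "i \<in> ?I" "k \<in> Ks" for i k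
    using that(1) lie_torus[OF that(2)] by (cases i) (simp only: prod.case mem_Times_iff fst_conv snd_conv)
  have "Z \<in> cmat.span (?z ` {i \<in> ?I. \<forall>k\<in>Ks. (\<lambda>(x, y) k. sign_weight x k + sign_weight y k) i k = sign_weight x k + sign_weight y k})"
    by (rule weight_span[OF fI torus_box zb zw c w])
  also have "\<dots> \<subseteq> cmat.span {R n x y}"
  proof (rule cmat.span_minimal[OF _ cmat.subspace_span], rule subsetI)
    fix A assume "A \<in> ?z ` {i \<in> ?I. \<forall>k\<in>Ks. (\<lambda>(x, y) k. sign_weight x k + sign_weight y k) i k = sign_weight x k + sign_weight y k}"
    then obtain x' y' where xy': "x' \<in> idx n" "y' \<in> idx n" "A = R n x' y'"
      "\<And>k. k \<in> Ks \<Longrightarrow> sign_weight x' k + sign_weight y' k = sign_weight x k + sign_weight y k" by auto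
    from wt_pair[OF I xy'(1,2) xy xy'(4)] have "A = R n x y \<or> A = R n y x" using xy'(3) by blast
    then show "A \<in> cmat.span {R n x y}"
    proof
      assume "A = R n y x"
      then show ?thesis unfolding R_anti[of n y x] by (simp only:) (intro cmat.span_scale cmat.span_base singletonI)
    qed (auto intro: cmat.span_base)
  qed
  finally show ?thesis unfolding cmat.span_singleton by blast
qed

text \<open>The three summands of the decomposition are stable under the torus, so the components of
  \<open>R n x y\<close> have its weight. Those in N and Nb are multiples of it, and the one in
  \<open>sub_h n\<close> vanishes as the weight is nonzero.\<close>

lemma R_N_or_Nb:
  assumes I: "x \<in> idx n" "y \<in> idx n" and xy: "x \<noteq> y" "x \<noteq> - y"
  shows "R n x y \<in> N \<or> R n x y \<in> Nb"
proof -
  have "R n x y \<in> N + sub_h n + Nb" using R_so[OF I] triangular.gsum[OF tri] by simp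
  then obtain a b c where abc: "R n x y = a + b + c" "a \<in> N" "b \<in> sub_h n" "c \<in> Nb"
    by (auto elim!: set_plus_elim)
  have so: "a \<in> so n" "b \<in> so n" "c \<in> so n" using abc parts by auto
  then have bx: "a \<in> box n" "b \<in> box n" "c \<in> box n" using so_box by auto
  have w: "lie (torus n k) a = smat (sign_weight x k + sign_weight y k) a \<and> smat (sign_weight x k + sign_weight y k) b = 0 \<and> lie (torus n k) c = smat (sign_weight x k + sign_weight y k) c"
    if k: "k \<in> Ks" for k
  proof -
    let ?T = "torus n k" let ?w = "sign_weight x k + sign_weight y k"
    have "lie ?T (a + b + c) = lie ?T a + lie ?T b + lie ?T c"
      using bx torus_box[OF k] cmat.subspace_add[OF subspace_box bx(1,2)] lie_box(2)[OF bx(1,2) torus_box[OF k]] lie_box(2)[of "a + b" n c ?T]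
      by (simp only:)
    moreover have "lie ?T b = 0" by (rule triangular.abel[OF tri torus_h[OF k] abc(3)])
    ultimately have "smat ?w (a + b + c) = lie ?T a + lie ?T c"
      using lie_torus[OF k I] unfolding abc(1) by (simp only: add_0_right)
    then have z: "(lie ?T a - smat ?w a) + (- smat ?w b) + (lie ?T c - smat ?w c) = 0"
      unfolding cmat.scale_right_distrib by (simp add: algebra_simps fun_eq_iff)
    have "lie ?T a - smat ?w a \<in> N" by (intro NL(6) NL(2) hN[OF torus_h[OF k]] abc)
    moreover have "- smat ?w b \<in> sub_h n" by (intro hL abc)
    moreover have "lie ?T c - smat ?w c \<in> Nb" by (intro NbL(6) NbL(2) hNb[OF torus_h[OF k]] abc)
    ultimately have "lie ?T a - smat ?w a = 0 \<and> - smat ?w b = 0 \<and> lie ?T c - smat ?w c = 0"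
      using z by (rule triangular.direct[OF tri])
    then show ?thesis by (simp only: right_minus_eq neg_equal_0_iff_equal)
  qed
  obtain c1 where c1: "a = smat c1 (R n x y)" using weight_vector_R[OF I xy so(1)] w by blast
  obtain c2 where c2: "c = smat c2 (R n x y)" using weight_vector_R[OF I xy so(3)] w by blast
  obtain k where k: "k \<in> Ks" "sign_weight x k + sign_weight y k \<noteq> 0"
  proof (cases "x = 0")
    case True
    then have "y \<noteq> 0" using xy by simp
    with True show ?thesis by (intro that[OF idx_abs[OF I(2)]]) (auto simp: sign_weight_def abs_if)
  next
    case False
    with xy show ?thesis by (intro that[OF idx_abs[OF I(1)]]) (auto simp: sign_weight_def abs_if)
  qed
  have b: "b = 0" using w[OF k(1)] k(2) cmat.scale_eq_0_iff by blast
  consider "c1 \<noteq> 0" | "c2 \<noteq> 0" | "c1 = 0" "c2 = 0" by blast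
  then show ?thesis
  proof cases
    case 1
    have "smat (1 / c1) a \<in> N" using abc NL by blast
    then show ?thesis using c1 1 by simp
  next
    case 2
    have "smat (1 / c2) c \<in> Nb" using abc NbL by blast
    then show ?thesis using c2 2 by simp
  next
    case 3
    have "R n x y = 0" using abc(1) b unfolding c1 c2 3 cmat.scale_zero_left by (simp only: add_0_left)
    then show ?thesis using NL(4) by simp
  qed
qed

text \<open>The bracket of opposite root vectors lies in \<open>sub_h n\<close>; it is not zero,
  since for x nonzero it multiplies \<open>nu n x\<close> by a nonzero scalar. If x is 0, the roles
  of x and y are exchanged.\<close>

lemma opposite_roots_not_both:
  assumes V: "lie_subalgebra V" "\<And>x. x \<in> V \<Longrightarrow> x \<in> sub_h n \<Longrightarrow> x = 0"
    and I: "x \<in> idx n" "y \<in> idx n" and xy: "x \<noteq> y" "x \<noteq> - y"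
    and r: "R n x y \<in> V" "R n (- x) (- y) \<in> V"
  shows False
proof -
  have main: False if I: "x \<in> idx n" "y \<in> idx n" and xy: "x \<noteq> y" "x \<noteq> - y"
    and r: "R n x y \<in> V" "R n (- x) (- y) \<in> V" and x0: "x \<noteq> 0" for x y
  proof -
    note m = idx_uminus[OF I(1)] idx_uminus[OF I(2)]
    \<comment> \<open>The value of the form on \<open>nu n y\<close> and \<open>nu n (- y)\<close>,
      according to \<open>ip_nu\<close>.\<close>
    define cy :: complex where "cy = (if y = 0 then 1 else 2)"
    have "lie (R n x y) (R n (- x) (- y)) = smat 0 (sk (nu n x) (nu n (- y))) - smat 2 (R n y (- y)) + smat cy (R n (- x) x) - smat 0 (sk (nu n y) (nu n (-x)))"
      unfolding R_def lie_sk_sk[OF nu_vs[OF I(1)] nu_vs[OF I(2)] nu_vs[OF m(1)] nu_vs[OF m(2)]]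
      using xy x0 by (simp add: ip_nu I m cy_def cmat.scale_zero_left)
    then have C: "lie (R n x y) (R n (- x) (- y)) = smat cy (R n (- x) x) - smat 2 (R n y (- y))"
      by (simp add: fun_eq_iff smat_def)
    have "R n (- x) x \<in> sub_h n" using R_diag[OF m(1)] by simp
    then have "lie (R n x y) (R n (- x) (- y)) \<in> sub_h n"
      unfolding C by (intro hL R_diag I)
    with lie_subalgebraD(3)[OF V(1) r] have "lie (R n x y) (R n (- x) (- y)) = 0" by (rule V(2))
    then have e: "smat cy (R n (- x) x) = smat 2 (R n y (- y))" unfolding C by (simp only: right_minus_eq)
    have "act n (smat cy (R n (- x) x)) (nu n x) i = act n (smat 2 (R n y (- y))) (nu n x) i" for i
      unfolding e by (rule refl)
    then have "cy * nu n x i = 0" for i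
      unfolding act_lin R_def act_sk using xy x0 by (simp add: ip_nu I m)
    moreover have "nu n x (n + 1 - 2 * nat \<bar>x\<bar>) = 1" using x0 by (simp add: nu_def)
    ultimately show False using mult_eq_0_iff[of cy 1] by (metis cy_def zero_neq_one zero_neq_numeral)
  qed
  show False
  proof (cases "x = 0")
    case False
    then show False using main[OF I xy r] by blast
  next
    case True
    then have y0: "y \<noteq> 0" using xy by simp
    have "R n y x \<in> V" "R n (- y) (- x) \<in> V"
      unfolding R_anti[of n y x] R_anti[of n "- y" "- x"] using r lie_subalgebraD(2)[OF V(1)] by blast+
    then show False using main[OF I(2,1) _ _ _ _ y0] xy by auto
  qed
qed

definition pos where "pos x y \<longleftrightarrow> R n x y \<in> N"

lemma pos_sym: "pos x y \<Longrightarrow> pos y x"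
  unfolding pos_def R_anti[of n y x] by (rule NL(2))

lemma pos_opp: "x \<in> idx n \<Longrightarrow> y \<in> idx n \<Longrightarrow> x \<noteq> y \<Longrightarrow> x \<noteq> - y \<Longrightarrow> pos (- x) (- y) \<longleftrightarrow> \<not> pos x y"
proof
  assume a: "x \<in> idx n" "y \<in> idx n" "x \<noteq> y" "x \<noteq> - y"
  show "\<not> pos x y" if "pos (- x) (- y)"
    using opposite_roots_not_both[OF triangular.N[OF tri] N_h a] that unfolding pos_def by blast
  assume "\<not> pos x y"
  then have "R n x y \<in> Nb" using R_N_or_Nb[OF a] by (simp add: pos_def)
  then have "R n (- x) (- y) \<notin> Nb" using opposite_roots_not_both[OF triangular.Nb[OF tri] Nb_h a] by blast
  then show "pos (- x) (- y)" using R_N_or_Nb[OF idx_uminus[OF a(1)] idx_uminus[OF a(2)]] a by (simp add: pos_def)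
qed

text \<open>The weights of the two root vectors add up to that of \<open>R n x z\<close>, which is a
  nonzero multiple of their bracket.\<close>

lemma pos_trans:
  assumes I: "x \<in> idx n" "y \<in> idx n" "z \<in> idx n" and ne: "x \<noteq> y" "z \<noteq> - y" "z \<noteq> - x"
    and p: "pos x y" "pos (- y) z"
  shows "pos x z"
proof -
  note m = idx_uminus[OF I(2)]
  define cy :: complex where "cy = (if y = 0 then 1 else 2)"
  have "lie (R n x y) (R n (- y) z) = smat cy (sk (nu n x) (nu n z)) - smat 0 (sk (nu n y) (nu n z))
     + smat 0 (sk (nu n (- y)) (nu n x)) - smat 0 (sk (nu n (- y)) (nu n y))"
    unfolding R_def lie_sk_sk[OF nu_vs[OF I(1)] nu_vs[OF I(2)] nu_vs[OF m] nu_vs[OF I(3)]]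
    using ne by (simp add: ip_nu I m cy_def)
  then have "lie (R n x y) (R n (- y) z) = smat cy (R n x z)" by (simp add: R_def fun_eq_iff smat_def)
  then have "smat cy (R n x z) \<in> N" using NL(3) p unfolding pos_def by metis
  from NL(2)[OF this, of "1 / cy"] show ?thesis by (simp add: pos_def cy_def split: if_splits)
qed

text \<open>The witness maximizes the number of \<open>y\<close> with \<open>pos x y\<close>.\<close>

lemma top_exists:
  assumes L: "L \<subseteq> idx n" "\<And>x. x \<in> L \<Longrightarrow> - x \<in> L" and ex: "x\<^sub>0 \<in> L" "x\<^sub>0 \<noteq> 0"
  obtains x where "x \<in> L" "x \<noteq> 0" "\<And>y. y \<in> L \<Longrightarrow> y \<noteq> x \<Longrightarrow> y \<noteq> - x \<Longrightarrow> pos x y"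
proof -
  have fL: "finite L" using L(1) finite_idx finite_subset by blast
  define S where "S x = {y \<in> L. y \<noteq> x \<and> y \<noteq> - x \<and> pos x y}" for x
  have fS: "finite (S x)" for x unfolding S_def using fL by simp
  have bd: "\<forall>y. y \<in> L \<and> y \<noteq> 0 \<longrightarrow> card (S y) \<le> card L"
    unfolding S_def by (intro allI impI card_mono fL) auto
  obtain x where x: "x \<in> L" "x \<noteq> 0" and mx: "\<And>y. y \<in> L \<Longrightarrow> y \<noteq> 0 \<Longrightarrow> card (S y) \<le> card (S x)"
    using ex_has_greatest_nat[of "\<lambda>y. y \<in> L \<and> y \<noteq> 0" x\<^sub>0 "\<lambda>y. card (S y)" "card L + 1"] ex bd by fastforce
  have "pos x y" if y: "y \<in> L" "y \<noteq> x" "y \<noteq> - x" for y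
  proof (rule ccontr)
    assume np: "\<not> pos x y"
    note I = subsetD[OF L(1) x(1)] subsetD[OF L(1) y(1)]
    \<comment> \<open>If \<open>pos x y\<close> fails, then \<open>- y\<close> beats x:
      \<open>pos z (- x)\<close> holds, so by transitivity every w in \<open>S x\<close> other than
      z lies in \<open>S z\<close>, and \<open>- x\<close> is gained. If z itself is in
      \<open>S x\<close>, it gets lost, but then x is gained as well.\<close>
    define z where "z = - y"
    have z: "z \<in> L" "z \<noteq> x" "z \<noteq> - x" using L(2) y unfolding z_def by auto
    have Iz: "z \<in> idx n" using z L(1) by blast
    have "pos (- x) z" using pos_opp[OF I] np y unfolding z_def by auto
    then have pz: "pos z (- x)" by (rule pos_sym)
    have xm: "x \<noteq> - x" "- x \<in> L" using x L(2) by auto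
    have step: "w \<in> S z" if w: "w \<in> S x" "w \<noteq> z" for w
    proof -
      have w': "w \<in> L" "w \<noteq> x" "w \<noteq> - x" "pos x w" using w unfolding S_def by auto
      have "w \<noteq> - z" using w'(4) np unfolding z_def by auto
      moreover have "pos z w"
        by (rule pos_trans[OF Iz idx_uminus[OF I(1)]]) (use w w' L(1) z pz \<open>w \<noteq> - z\<close> in auto)
      ultimately show ?thesis using w w' unfolding S_def by auto
    qed
    have mxS: "- x \<in> S z" "- x \<notin> S x" "x \<notin> S x" using z xm pz unfolding S_def by auto
    show False
    proof (cases "z = 0")
      \<comment> \<open>The index 0 does not compete for the maximum. In this case
        \<open>- x\<close> beats x, with 0 as the additional element.\<close>
      case True
      have "0 \<notin> S x" using np True unfolding S_def z_def by auto
      have "w \<in> S (- x)" if w: "w \<in> insert 0 (S x)" for w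
      proof (cases "w = 0")
        case True
        then show ?thesis using pos_sym[OF pz] \<open>z = 0\<close> z x unfolding S_def by auto
      next
        case False
        then have w': "w \<in> S x" using w by simp
        then have "w \<in> S z" using step False \<open>z = 0\<close> by blast
        then have "pos 0 w" "w \<in> L" "w \<noteq> x" "w \<noteq> - x" using w' \<open>z = 0\<close> unfolding S_def by auto
        moreover have "pos (- x) w"
          by (rule pos_trans[of "- x" 0 w]) (use calculation pos_sym[OF pz] True Iz L(1) idx_uminus[OF I(1)] x False in auto)
        ultimately show ?thesis unfolding S_def by auto
      qed
      then have "card (insert 0 (S x)) \<le> card (S (- x))" by (intro card_mono fS) blast
      moreover have "card (S (- x)) \<le> card (S x)" using xm x by (intro mx) auto
      ultimately show False using \<open>0 \<notin> S x\<close> fS by simp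
    next
      case False
      have "card (S x) < card (S z)"
      proof (cases "z \<in> S x")
        case True
        then have "pos z x" unfolding S_def using pos_sym by blast
        then have "x \<in> S z" using z x unfolding S_def by auto
        then have "insert x (insert (- x) (S x - {z})) \<subseteq> S z" using step mxS by auto
        then have "card (insert x (insert (- x) (S x - {z}))) \<le> card (S z)" by (intro card_mono fS)
        moreover have "card (insert x (insert (- x) (S x - {z}))) = Suc (card (S x))"
          using mxS xm fS[of x] True card_Suc_Diff1[OF fS True] by simp
        ultimately show ?thesis by simp
      next
        case False
        then have "insert (- x) (S x) \<subseteq> S z" using step mxS by auto
        then have "card (insert (- x) (S x)) \<le> card (S z)" by (intro card_mono fS)
        then show ?thesis using mxS fS by simp
      qed
      then show False using mx[OF z(1) False] by simp
    qed
  qed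
  then show ?thesis using that x by blast
qed

end

section \<open>The positive roots and their half sum\<close>

context so_pos
begin

text \<open>Comparing absolute values selects one of \<open>(x, y)\<close> and \<open>(y, x)\<close>
  for each positive root, and excludes x = y and x = - y.\<close>

definition B where "B = {(x, y). x \<in> idx n \<and> y \<in> idx n \<and> \<bar>x\<bar> < \<bar>y\<bar> \<and> pos x y}"
definition root_vector where "root_vector = (\<lambda>(x, y). R n x y)"

lemma B_D: "(x, y) \<in> B \<Longrightarrow> x \<in> idx n \<and> y \<in> idx n \<and> x \<noteq> y \<and> x \<noteq> - y \<and> R n x y \<in> N"
  unfolding B_def pos_def by auto

lemma finite_B: "finite B"
  by (rule finite_subset[of _ "idx n \<times> idx n"]) (auto simp: B_def finite_idx)

lemma root_vector_N: "b \<in> B \<Longrightarrow> root_vector b \<in> N"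
  using B_D by (cases b) (auto simp: root_vector_def)

lemma root_vector_box: "b \<in> B \<Longrightarrow> root_vector b \<in> box n"
  using root_vector_N parts so_box by blast

lemma subspace_N: "cmat.subspace N" and subspace_Nb: "cmat.subspace Nb" and subspace_h: "cmat.subspace (sub_h n)"
  using triangular.N[OF tri] triangular.Nb[OF tri] triangular.h[OF tri] unfolding lie_subalgebra_def by blast+

text \<open>The span of the positive root vectors, together with \<open>sub_h n\<close> and Nb,
  contains every \<open>R n x y\<close> and hence all of \<open>so n\<close>. By directness an
  element of N has no part in the last two.\<close>

lemma N_span: "N = cmat.span (root_vector ` B)"
proof (rule equalityI)
  show "cmat.span (root_vector ` B) \<subseteq> N"
    by (rule cmat.span_minimal[OF _ subspace_N]) (use root_vector_N in blast)
next
  let ?W = "{x + y | x y. x \<in> sub_h n \<and> y \<in> Nb}"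
  let ?U = "{x + y | x y. x \<in> cmat.span (root_vector ` B) \<and> y \<in> ?W}"
  have W: "cmat.subspace ?W" by (rule cmat.subspace_sums[OF subspace_h subspace_Nb])
  have U: "cmat.subspace ?U" by (rule cmat.subspace_sums[OF cmat.subspace_span W])
  have z: "0 \<in> cmat.span (root_vector ` B)" "0 \<in> sub_h n" "0 \<in> Nb" using cmat.span_zero hL NbL by blast+
  have zW: "0 \<in> ?W" by (intro CollectI exI[of _ 0] conjI z) simp
  have in1: "x \<in> ?U" if "x \<in> cmat.span (root_vector ` B)" for x
    by (rule CollectI, rule exI[of _ x], rule exI[of _ 0]) (use that zW in simp)
  have inW: "x \<in> ?U" if "x \<in> ?W" for x
    by (rule CollectI, rule exI[of _ 0], rule exI[of _ x]) (use that z in simp)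
  have in2: "x \<in> ?U" if "x \<in> sub_h n" for x
    by (rule inW, rule CollectI, rule exI[of _ x], rule exI[of _ 0]) (use that z in simp)
  have in3: "x \<in> ?U" if "x \<in> Nb" for x
    by (rule inW, rule CollectI, rule exI[of _ 0], rule exI[of _ x]) (use that z in simp)
  have RU: "R n x y \<in> ?U" if I: "x \<in> idx n" "y \<in> idx n" for x y
  proof -
    consider "x = y" | "x = - y" | "x \<noteq> y" "x \<noteq> - y" by blast
    then show ?thesis
    proof cases
      case 1
      then have "R n x y = 0" using R_self[of n y] by simp
      then show ?thesis using cmat.subspace_0[OF U] by (simp only:)
    next
      case 2
      then show ?thesis using in2[OF R_diag[OF I(1)]] by simp
    next
      case 3
      show ?thesis
      proof (cases "R n x y \<in> Nb")
        case False
        then have p: "pos x y" using R_N_or_Nb[OF I 3] by (simp add: pos_def)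
        consider "(x, y) \<in> B" | "(y, x) \<in> B" using p pos_sym[OF p] I 3 unfolding B_def by fastforce
        then show ?thesis
        proof cases
          case 1
          then have "R n x y \<in> root_vector ` B" by (intro image_eqI[OF _ 1]) (simp add: root_vector_def)
          then show ?thesis by (intro in1 cmat.span_base)
        next
          case 2
          then have "R n y x \<in> root_vector ` B" by (intro image_eqI[OF _ 2]) (simp add: root_vector_def)
          then have "smat (-1) (R n y x) \<in> cmat.span (root_vector ` B)" by (intro cmat.span_scale cmat.span_base)
          then have "R n x y \<in> cmat.span (root_vector ` B)" by (simp only: R_anti[of n x y])
          then show ?thesis by (rule in1)
        qed
      qed (rule in3)
    qed
  qed
  show "N \<subseteq> cmat.span (root_vector ` B)"
  proof
    fix Z assume Z: "Z \<in> N"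
    have "cmat.span ((\<lambda>(x, y). R n x y) ` (idx n \<times> idx n)) \<subseteq> ?U"
      by (rule cmat.span_minimal[OF _ U]) (use RU in auto)
    then have "Z \<in> ?U" using so_span_R[of n] parts(1) Z by blast
    then obtain a b c where abc: "a \<in> cmat.span (root_vector ` B)" "b \<in> sub_h n" "c \<in> Nb" "Z = a + (b + c)" by blast
    have aN: "a \<in> N" using abc(1) cmat.span_minimal[OF _ subspace_N, of "root_vector ` B"] root_vector_N by blast
    have "(a - Z) + b + c = 0" unfolding abc(4) by (simp add: algebra_simps)
    with triangular.direct[OF tri NL(6)[OF aN Z] abc(2,3)] have "a - Z = 0" by blast
    then have "Z = a" by (simp only: right_minus_eq)
    then show "Z \<in> cmat.span (root_vector ` B)" using abc(1) by (simp only:)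
  qed
qed

lemma R_nonzero:
  assumes "x \<in> idx n" "y \<in> idx n" "x \<noteq> y" "x \<noteq> - y"
  shows "R n x y \<noteq> 0"
proof
  assume "R n x y = 0"
  then have "R n x y \<in> N" "R n x y \<in> Nb" using NL(4) NbL(4) by simp_all
  then show False
    using opposite_roots_not_both[OF triangular.N[OF tri] N_h assms] opposite_roots_not_both[OF triangular.Nb[OF tri] Nb_h assms]
      R_N_or_Nb[OF idx_uminus[OF assms(1)] idx_uminus[OF assms(2)]] assms(3,4) by auto
qed

definition root_weight :: "int \<times> int \<Rightarrow> nat \<Rightarrow> complex" where "root_weight = (\<lambda>(x, y) k. sign_weight x k + sign_weight y k)"

lemma lie_root_vector: "b \<in> B \<Longrightarrow> k \<in> Ks \<Longrightarrow> lie (torus n k) (root_vector b) = smat (root_weight b k) (root_vector b)"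
  using lie_torus B_D by (cases b) (auto simp: root_vector_def root_weight_def)

lemma root_vector_nonzero: "b \<in> B \<Longrightarrow> root_vector b \<noteq> 0"
  using R_nonzero B_D by (cases b) (auto simp: root_vector_def)

lemma root_weight_inj: "b \<in> B \<Longrightarrow> b' \<in> B \<Longrightarrow> (\<And>k. k \<in> Ks \<Longrightarrow> root_weight b' k = root_weight b k) \<Longrightarrow> b' = b"
proof -
  assume b: "b \<in> B" "b' \<in> B" and w: "\<And>k. k \<in> Ks \<Longrightarrow> root_weight b' k = root_weight b k"
  obtain x y x' y' where e: "b = (x, y)" "b' = (x', y')" by (cases b; cases b')
  have "x' = x \<and> y' = y \<or> x' = y \<and> y' = x"
    using b w B_D unfolding e root_weight_def by (intro wt_pair) auto
  then show ?thesis using b unfolding e B_def by auto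
qed

text \<open>The value 0 outside \<open>sub_h n\<close> matches the convention in
  \<open>weights\<close>; inside, the choice is unique by
  \<open>root_functional_eqI\<close>.\<close>

definition root_functional :: "int \<times> int \<Rightarrow> cmat \<Rightarrow> complex" where
  "root_functional b Y = (if Y \<in> sub_h n then SOME c. lie Y (root_vector b) = smat c (root_vector b) else 0)"

lemma root_functional_spec:
  assumes b: "b \<in> B" and Y: "Y \<in> sub_h n"
  shows "lie Y (root_vector b) = smat (root_functional b Y) (root_vector b)"
proof -
  let ?V = "{Y \<in> box n. \<exists>c. lie Y (root_vector b) = smat c (root_vector b)}"
  note Rb = root_vector_box[OF b]
  have V: "cmat.subspace ?V"
  proof (rule cmat.subspaceI)
    have "lie (smat 0 (root_vector b)) (root_vector b) = smat 0 (lie (root_vector b) (root_vector b))" by (rule lie_box(3)[OF Rb Rb Rb])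
    then have "lie 0 (root_vector b) = smat 0 (root_vector b)" by (simp only: cmat.scale_zero_left)
    then show "0 \<in> ?V" using cmat.subspace_0[OF subspace_box[of n]] by blast
  next
    fix x y assume "x \<in> ?V" "y \<in> ?V"
    then obtain c d where x: "x \<in> box n" "lie x (root_vector b) = smat c (root_vector b)" and y: "y \<in> box n" "lie y (root_vector b) = smat d (root_vector b)" by blast
    have "lie (x + y) (root_vector b) = smat (c + d) (root_vector b)"
      unfolding lie_box(1)[OF x(1) y(1) Rb] x(2) y(2) by (rule cmat.scale_left_distrib[symmetric])
    then show "x + y \<in> ?V" using cmat.subspace_add[OF subspace_box x(1) y(1)] by blast
  next
    fix e x assume "x \<in> ?V"
    then obtain c where x: "x \<in> box n" "lie x (root_vector b) = smat c (root_vector b)" by blast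
    have "lie (smat e x) (root_vector b) = smat (e * c) (root_vector b)"
      unfolding lie_box(3)[OF x(1) x(1) Rb] x(2) by (rule cmat.scale_scale)
    then show "smat e x \<in> ?V" using cmat.subspace_scale[OF subspace_box x(1)] by blast
  qed
  have "torus n ` Ks \<subseteq> ?V" using torus_box lie_root_vector[OF b] by blast
  then have "sub_h n \<subseteq> ?V" unfolding sub_h_eq by (rule cmat.span_minimal[OF _ V])
  then have "\<exists>c. lie Y (root_vector b) = smat c (root_vector b)" using Y by blast
  then have "lie Y (root_vector b) = smat (SOME c. lie Y (root_vector b) = smat c (root_vector b)) (root_vector b)" by (rule someI_ex)
  then show ?thesis using Y by (simp add: root_functional_def)
qed

lemma root_functional_eqI: "b \<in> B \<Longrightarrow> Y \<in> sub_h n \<Longrightarrow> lie Y (root_vector b) = smat c (root_vector b) \<Longrightarrow> root_functional b Y = c"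
  using root_functional_spec[of b Y] cmat.scale_right_imp_eq[OF root_vector_nonzero, of b "root_functional b Y" c] by simp

lemma root_functional_torus: "b \<in> B \<Longrightarrow> k \<in> Ks \<Longrightarrow> root_functional b (torus n k) = root_weight b k"
  by (rule root_functional_eqI) (simp_all only: torus_h lie_root_vector)

lemma h_box: "Y \<in> sub_h n \<Longrightarrow> Y \<in> box n"
  using parts(2) so_box by blast

lemma root_functional_add:
  assumes b: "b \<in> B" and Y: "Y \<in> sub_h n" "Y' \<in> sub_h n"
  shows "root_functional b (Y + Y') = root_functional b Y + root_functional b Y'"
proof (rule root_functional_eqI[OF b hL(1)[OF Y]])
  show "lie (Y + Y') (root_vector b) = smat (root_functional b Y + root_functional b Y') (root_vector b)"
    unfolding lie_box(1)[OF h_box[OF Y(1)] h_box[OF Y(2)] root_vector_box[OF b]] root_functional_spec[OF b Y(1)] root_functional_spec[OF b Y(2)]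
    by (rule cmat.scale_left_distrib[symmetric])
qed

lemma root_functional_smat:
  assumes b: "b \<in> B" and Y: "Y \<in> sub_h n"
  shows "root_functional b (smat c Y) = c * root_functional b Y"
proof (rule root_functional_eqI[OF b hL(2)[OF Y]])
  show "lie (smat c Y) (root_vector b) = smat (c * root_functional b Y) (root_vector b)"
    unfolding lie_box(3)[OF h_box[OF Y] h_box[OF Y] root_vector_box[OF b]] root_functional_spec[OF b Y] by (rule cmat.scale_scale)
qed

lemma weight_space_sub:
  assumes Z: "Z \<in> weight_space (sub_h n) N l"
  shows "Z \<in> cmat.span (root_vector ` {b \<in> B. \<forall>k\<in>Ks. root_weight b k = l (torus n k)})"
proof -
  have ZN: "Z \<in> N" and w: "\<And>Y. Y \<in> sub_h n \<Longrightarrow> lie Y Z = smat (l Y) Z" using Z unfolding weight_space_def by blast+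
  obtain c where c: "Z = (\<Sum>b\<in>B. smat (c b) (root_vector b))" using span_finite_sum[OF finite_B] ZN N_span by blast
  show ?thesis
    by (rule weight_span[OF finite_B torus_box root_vector_box lie_root_vector c]) (simp_all only: w torus_h)
qed

lemma weight_space_root_functional:
  assumes b: "b \<in> B"
  shows "weight_space (sub_h n) N (root_functional b) = cmat.span {root_vector b}"
proof (rule equalityI; rule subsetI)
  fix Z assume "Z \<in> weight_space (sub_h n) N (root_functional b)"
  then have Z: "Z \<in> cmat.span (root_vector ` {b' \<in> B. \<forall>k\<in>Ks. root_weight b' k = root_functional b (torus n k)})" by (rule weight_space_sub)
  have "{b' \<in> B. \<forall>k\<in>Ks. root_weight b' k = root_functional b (torus n k)} \<subseteq> {b}"
    using root_weight_inj[OF b] root_functional_torus[OF b] by auto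
  then have "root_vector ` {b' \<in> B. \<forall>k\<in>Ks. root_weight b' k = root_functional b (torus n k)} \<subseteq> {root_vector b}" by blast
  from cmat.span_mono[OF this] Z show "Z \<in> cmat.span {root_vector b}" by blast
next
  fix Z assume "Z \<in> cmat.span {root_vector b}"
  then obtain c where Z: "Z = smat c (root_vector b)" unfolding cmat.span_singleton by blast
  have "lie Y (smat c (root_vector b)) = smat (root_functional b Y) (smat c (root_vector b))" if Y: "Y \<in> sub_h n" for Y
    unfolding lie_box(4)[OF root_vector_box[OF b] root_vector_box[OF b] h_box[OF Y]] root_functional_spec[OF b Y] by (simp add: mult.commute)
  then show "Z \<in> weight_space (sub_h n) N (root_functional b)"
    unfolding weight_space_def Z using NL(2)[OF root_vector_N[OF b]] by blast
qed

lemma weights_eq: "weights (sub_h n) N = root_functional ` B"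
proof (rule equalityI; rule subsetI)
  fix l assume l: "l \<in> weights (sub_h n) N"
  then have l0: "\<And>Y. Y \<notin> sub_h n \<Longrightarrow> l Y = 0" and ne: "weight_space (sub_h n) N l \<noteq> {0}" unfolding weights_def by blast+
  have "0 \<in> weight_space (sub_h n) N l"
  proof -
    have "lie Y 0 = smat (l Y) 0" for Y by (simp add: lie_def mmul_def smat_def fun_eq_iff)
    then show ?thesis unfolding weight_space_def using NL(4) by blast
  qed
  then obtain Z where Z: "Z \<in> weight_space (sub_h n) N l" "Z \<noteq> 0" using ne by blast
  have Zs: "Z \<in> cmat.span (root_vector ` {b \<in> B. \<forall>k\<in>Ks. root_weight b k = l (torus n k)})" by (rule weight_space_sub[OF Z(1)])
  have "{b \<in> B. \<forall>k\<in>Ks. root_weight b k = l (torus n k)} \<noteq> {}"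
  proof
    assume e: "{b \<in> B. \<forall>k\<in>Ks. root_weight b k = l (torus n k)} = {}"
    show False using Zs Z(2) unfolding e by simp
  qed
  then obtain b where b: "b \<in> B" "\<And>k. k \<in> Ks \<Longrightarrow> root_weight b k = l (torus n k)" by blast
  have "{b' \<in> B. \<forall>k\<in>Ks. root_weight b' k = l (torus n k)} \<subseteq> {b}"
    using root_weight_inj[OF b(1)] b(2) by auto
  then have "root_vector ` {b' \<in> B. \<forall>k\<in>Ks. root_weight b' k = l (torus n k)} \<subseteq> {root_vector b}" by blast
  from cmat.span_mono[OF this] Zs have "Z \<in> cmat.span {root_vector b}" by blast
  then have Zl: "Z \<in> weight_space (sub_h n) N (root_functional b)" unfolding weight_space_root_functional[OF b(1)] .
  have "l Y = root_functional b Y" for Y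
  proof (cases "Y \<in> sub_h n")
    case True
    then have "smat (l Y) Z = smat (root_functional b Y) Z" using Z(1) Zl unfolding weight_space_def by auto
    then show ?thesis using cmat.scale_right_imp_eq[OF Z(2)] by blast
  next
    case False
    then show ?thesis using l0 by (simp add: root_functional_def)
  qed
  then have "l = root_functional b" by (rule ext)
  then show "l \<in> root_functional ` B" using b(1) by (rule image_eqI)
next
  fix l assume "l \<in> root_functional ` B"
  then obtain b where b: "b \<in> B" "l = root_functional b" by blast
  have "root_vector b \<in> weight_space (sub_h n) N l"
    unfolding b(2) weight_space_root_functional[OF b(1)] by (rule cmat.span_base) simp
  then have "weight_space (sub_h n) N l \<noteq> {0}" using root_vector_nonzero[OF b(1)] by blast
  moreover have "l Y = 0" if "Y \<notin> sub_h n" for Y using that unfolding b(2) root_functional_def by simp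
  ultimately show "l \<in> weights (sub_h n) N" unfolding weights_def by blast
qed

text \<open>Different elements of \<open>B\<close> give different functionals with one-dimensional
  weight spaces, so each of them counts once.\<close>

lemma rho_sum: "rho (sub_h n) N Y = 1 / 2 * (\<Sum>b\<in>B. root_functional b Y)"
proof -
  have inj: "inj_on root_functional B"
  proof (rule inj_onI)
    fix b b' assume b: "b \<in> B" "b' \<in> B" and e: "root_functional b = root_functional b'"
    show "b = b'" using root_weight_inj[OF b(2,1)] root_functional_torus[OF b(1)] root_functional_torus[OF b(2)] e by simp
  qed
  have dim: "cmat.dim (weight_space (sub_h n) N (root_functional b)) = 1" if b: "b \<in> B" for b
  proof -
    have "cmat.independent {root_vector b}" using root_vector_nonzero[OF b] by (simp only: cmat.dependent_single not_False_eq_True)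
    then have "cmat.dim {root_vector b} = card {root_vector b}" by (rule cmat.dim_eq_card_independent)
    then show ?thesis unfolding weight_space_root_functional[OF b] by (simp only: cmat.dim_span) simp
  qed
  show ?thesis
    unfolding rho_def weights_eq sum.reindex[OF inj] by (simp add: dim)
qed

lemma rho_add: "Y \<in> sub_h n \<Longrightarrow> Y' \<in> sub_h n \<Longrightarrow> rho (sub_h n) N (Y + Y') = rho (sub_h n) N Y + rho (sub_h n) N Y'"
  by (simp only: rho_sum root_functional_add sum.distrib distrib_left cong: sum.cong)

lemma rho_smat: "Y \<in> sub_h n \<Longrightarrow> rho (sub_h n) N (smat c Y) = c * rho (sub_h n) N Y"
proof -
  assume Y: "Y \<in> sub_h n"
  have "(\<Sum>b\<in>B. root_functional b (smat c Y)) = c * (\<Sum>b\<in>B. root_functional b Y)"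
    unfolding sum_distrib_left by (intro sum.cong refl root_functional_smat Y)
  then show ?thesis by (simp only: rho_sum) simp
qed

definition pos_off where "pos_off x y \<longleftrightarrow> y \<noteq> x \<and> y \<noteq> - x \<and> pos x y"
definition signed where "signed S = {x \<in> idx n. x = 0 \<or> nat \<bar>x\<bar> \<in> S}"

text \<open>The half sum of the positive roots with indices in \<open>S\<close>, evaluated at \<open>torus n k\<close>.\<close>

definition half_sum :: "nat set \<Rightarrow> nat \<Rightarrow> complex" where
  "half_sum S k = 1 / 2 * (\<Sum>y\<in>signed S. of_bool (pos_off (int k) y) - of_bool (pos_off (- int k) y))"

lemma finite_signed: "finite (signed S)"
  unfolding signed_def using finite_idx by simp

lemma rho_torus:
  assumes k: "k \<in> Ks"
  shows "rho (sub_h n) N (torus n k) = half_sum Ks k"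
proof -
  \<comment> \<open>\<open>?P\<close> lists each positive root twice, as \<open>(x, y)\<close> and
    as \<open>(y, x)\<close>. Hence the sum of the weights over \<open>B\<close> is the sum over
    \<open>?P\<close> of the contribution of the first index alone, to which only k and - k
    contribute.\<close>
  let ?P = "{(x, y) \<in> idx n \<times> idx n. pos_off x y}"
  have fP: "finite ?P" by (rule finite_subset[of _ "idx n \<times> idx n"]) (auto simp: finite_idx)
  have sym: "prod.swap ` ?P = ?P"
  proof (rule equalityI; rule subsetI)
    fix p assume "p \<in> prod.swap ` ?P"
    then show "p \<in> ?P" using pos_sym by (auto simp: pos_off_def)
  next
    fix p assume p: "p \<in> ?P"
    then have "prod.swap p \<in> ?P" using pos_sym by (auto simp: pos_off_def)
    then show "p \<in> prod.swap ` ?P" by (intro image_eqI[of _ _ "prod.swap p"]) simp_all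
  qed
  have PB: "?P = B \<union> prod.swap ` B" "B \<inter> prod.swap ` B = {}"
  proof -
    show "B \<inter> prod.swap ` B = {}" unfolding B_def by auto
    show "?P = B \<union> prod.swap ` B"
    proof (rule equalityI; rule subsetI)
      fix p assume p: "p \<in> ?P"
      obtain x y where e: "p = (x, y)" by (cases p)
      have "\<bar>x\<bar> < \<bar>y\<bar> \<or> \<bar>y\<bar> < \<bar>x\<bar>" using p unfolding e pos_off_def by auto
      then show "p \<in> B \<union> prod.swap ` B"
      proof
        assume "\<bar>x\<bar> < \<bar>y\<bar>"
        then have "p \<in> B" using p unfolding e pos_off_def B_def by auto
        then show ?thesis by blast
      next
        assume "\<bar>y\<bar> < \<bar>x\<bar>"
        then have "(y, x) \<in> B" using p pos_sym unfolding e pos_off_def B_def by auto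
        then have "p \<in> prod.swap ` B" unfolding e by (intro image_eqI[of _ _ "(y, x)"]) simp_all
        then show ?thesis by blast
      qed
    next
      fix p assume "p \<in> B \<union> prod.swap ` B"
      then show "p \<in> ?P" using pos_sym by (auto simp: B_def pos_off_def)
    qed
  qed
  let ?f = "\<lambda>p. sign_weight (fst p) k + sign_weight (snd p) k"
  have "(\<Sum>p\<in>?P. ?f p) = (\<Sum>p\<in>B. ?f p) + (\<Sum>p\<in>prod.swap ` B. ?f p)"
    unfolding PB(1) using finite_B PB(2) by (intro sum.union_disjoint) auto
  also have "(\<Sum>p\<in>prod.swap ` B. ?f p) = (\<Sum>p\<in>B. ?f p)"
    by (subst sum.reindex) (simp_all add: add.commute)
  finally have 1: "(\<Sum>p\<in>?P. ?f p) = 2 * (\<Sum>p\<in>B. ?f p)" by simp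
  have "(\<Sum>p\<in>?P. sign_weight (snd p) k) = (\<Sum>p\<in>prod.swap ` ?P. sign_weight (snd p) k)" by (simp only: sym)
  also have "\<dots> = (\<Sum>p\<in>?P. sign_weight (fst p) k)" by (subst sum.reindex) simp_all
  finally have 2: "(\<Sum>p\<in>?P. ?f p) = 2 * (\<Sum>p\<in>?P. sign_weight (fst p) k)" by (simp add: sum.distrib)
  have "(\<Sum>p\<in>?P. sign_weight (fst p) k) = (\<Sum>p\<in>idx n \<times> idx n. if pos_off (fst p) (snd p) then sign_weight (fst p) k else 0)"
    by (rule sum.mono_neutral_cong_left) (auto simp: finite_idx)
  also have "\<dots> = (\<Sum>x\<in>idx n. \<Sum>y\<in>idx n. of_bool (pos_off x y) * sign_weight x k)"
    unfolding sum.cartesian_product by (intro sum.cong refl) auto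
  also have "\<dots> = (\<Sum>y\<in>idx n. \<Sum>x\<in>idx n. of_bool (pos_off x y) * sign_weight x k)" by (rule sum.swap)
  also have "\<dots> = (\<Sum>y\<in>idx n. of_bool (pos_off (int k) y) - of_bool (pos_off (- int k) y))"
  proof (intro sum.cong refl)
    fix y
    have ki: "int k \<in> idx n" using k by (intro idx_pos) auto
    have k0: "int k \<noteq> - int k" using k by auto
    have "(\<Sum>x\<in>idx n. of_bool (pos_off x y) * sign_weight x k) = (\<Sum>x\<in>{int k, - int k}. of_bool (pos_off x y) * sign_weight x k)"
      using ki idx_uminus[OF ki] by (intro sum.mono_neutral_right finite_idx) (auto simp: sign_weight_def)
    also have "\<dots> = of_bool (pos_off (int k) y) - of_bool (pos_off (- int k) y)"
      using k0 by (simp add: sign_weight_def)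
    finally show "(\<Sum>x\<in>idx n. of_bool (pos_off x y) * sign_weight x k) = of_bool (pos_off (int k) y) - of_bool (pos_off (- int k) y)" .
  qed
  finally have 3: "(\<Sum>p\<in>?P. sign_weight (fst p) k) = (\<Sum>y\<in>idx n. of_bool (pos_off (int k) y) - of_bool (pos_off (- int k) y))" .
  have LK: "signed Ks = idx n" unfolding signed_def using idx_abs by auto
  have "rho (sub_h n) N (torus n k) = 1 / 2 * (\<Sum>b\<in>B. ?f b)"
    unfolding rho_sum using root_functional_torus[OF _ k] by (simp add: root_weight_def case_prod_beta cong: sum.cong)
  also have "(\<Sum>b\<in>B. ?f b) = (\<Sum>p\<in>?P. sign_weight (fst p) k)" using 1 2 by simp
  finally show ?thesis unfolding 3 half_sum_def LK .
qed

lemma signed_remove: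
  assumes x: "x \<in> idx n" "x \<noteq> 0" "nat \<bar>x\<bar> \<in> S"
  shows "signed S = insert x (insert (- x) (signed (S - {nat \<bar>x\<bar>})))" "x \<notin> signed (S - {nat \<bar>x\<bar>})" "- x \<notin> signed (S - {nat \<bar>x\<bar>})"
  using x idx_uminus[OF x(1)] by (auto simp: signed_def)

text \<open>For the top index x all roots x + y with y in the rest are positive, and those with - x
  in place of x are negative, which gives the first value. Relative to another k, the index x stands
  above both k and - k, and - x below both, so their terms cancel in
  \<open>half_sum\<close>.\<close>

lemma half_sum_top:
  assumes x: "x \<in> idx n" "x \<noteq> 0" "nat \<bar>x\<bar> \<in> S"
    and top: "\<And>y. y \<in> signed S \<Longrightarrow> y \<noteq> x \<Longrightarrow> y \<noteq> - x \<Longrightarrow> pos x y"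
  shows "half_sum S (nat \<bar>x\<bar>) = of_int (sgn x) * of_nat (card (signed (S - {nat \<bar>x\<bar>}))) / 2"
    and "k \<in> Ks \<Longrightarrow> k \<in> S \<Longrightarrow> k \<noteq> nat \<bar>x\<bar> \<Longrightarrow> half_sum S k = half_sum (S - {nat \<bar>x\<bar>}) k"
proof -
  let ?S = "S - {nat \<bar>x\<bar>}"
  note L = signed_remove[OF x]
  have xm: "x \<noteq> - x" using x by auto
  have LSI: "y \<in> idx n" if "y \<in> signed T" for y T using that by (simp add: signed_def)
  have LSu: "- y \<in> signed T" if "y \<in> signed T" for y T using that idx_uminus by (auto simp: signed_def)
  have p1: "pos x y" "\<not> pos (- x) y" if y: "y \<in> signed ?S" for y
  proof -
    have yx: "y \<noteq> x" "y \<noteq> - x" using y L by blast+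
    have yS: "y \<in> signed S" using y L by blast
    show "pos x y" by (rule top[OF yS yx])
    have "- y \<noteq> x" "- y \<noteq> - x" using yx by auto
    then have "pos x (- y)" by (intro top LSu yS)
    then show "\<not> pos (- x) y"
      using pos_opp[OF x(1) idx_uminus[OF LSI[OF y]]] yx by auto
  qed
  have s: "(\<Sum>y\<in>signed S. f y) = f x + f (- x) + (\<Sum>y\<in>signed ?S. f y)" for f :: "int \<Rightarrow> complex"
    unfolding L(1) using L(2,3) xm finite_signed by (simp add: add.assoc)
  have ps1: "pos_off x y" "\<not> pos_off (- x) y" if "y \<in> signed ?S" for y
    using p1[OF that] L(2,3) that unfolding pos_off_def by auto
  show "half_sum S (nat \<bar>x\<bar>) = of_int (sgn x) * of_nat (card (signed ?S)) / 2"
  proof (cases "x > 0")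
    case True
    then have "(\<Sum>y\<in>signed ?S. of_bool (pos_off (int (nat \<bar>x\<bar>)) y) - of_bool (pos_off (- int (nat \<bar>x\<bar>)) y)) = (\<Sum>y\<in>signed ?S. 1 :: complex)"
      using ps1 by (intro sum.cong refl) simp
    then show ?thesis using True unfolding half_sum_def s by (simp add: pos_off_def)
  next
    case False
    then have "(\<Sum>y\<in>signed ?S. of_bool (pos_off (int (nat \<bar>x\<bar>)) y) - of_bool (pos_off (- int (nat \<bar>x\<bar>)) y)) = (\<Sum>y\<in>signed ?S. - 1 :: complex)"
      using ps1 by (intro sum.cong refl) simp
    then show ?thesis using False x(2) unfolding half_sum_def s by (simp add: pos_off_def)
  qed
  show "half_sum S k = half_sum ?S k" if k: "k \<in> Ks" "k \<in> S" "k \<noteq> nat \<bar>x\<bar>"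
  proof -
    have ki: "int k \<in> idx n" using k by (intro idx_pos) auto
    have kL: "int k \<in> signed ?S" "- int k \<in> signed ?S" using ki idx_uminus[OF ki] k by (auto simp: signed_def)
    have "pos_off (int k) x" "\<not> pos_off (int k) (- x)" "pos_off (- int k) x" "\<not> pos_off (- int k) (- x)"
      using p1[OF kL(1)] p1[OF kL(2)] pos_sym kL L(2,3) unfolding pos_off_def by auto
    then show ?thesis unfolding half_sum_def s by simp
  qed
qed

end

section \<open>Removing pairs of indices modulo a right ideal\<close>

lemma C_elem_le_1:
  assumes "so_alg A K" "finite G" "K \<subseteq> G" "card K < 2"
  shows "C_elem G A K u = 1"
proof -
  have "card K div 2 = 0" using assms(4) by simp
  then show ?thesis
    using assms(2,3) by (simp add: C_elem_def so_alg.Pf2_def[OF assms(1)] fB_1 dcoef_def)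
qed

lemma notin_imageI: "(\<And>k. k \<in> S \<Longrightarrow> a \<noteq> f k) \<Longrightarrow> a \<notin> f ` S"
  by blast

lemma (in so_pair) C_elem_mod_right_ideal:
  assumes add: "\<And>w z. w \<in> J \<Longrightarrow> z \<in> J \<Longrightarrow> w + z \<in> J" and diff: "\<And>w z. w \<in> J \<Longrightarrow> z \<in> J \<Longrightarrow> w - z \<in> J"
    and cs: "\<And>c z. z \<in> J \<Longrightarrow> cs c * z \<in> J" and J: "\<And>i a. i \<in> M \<Longrightarrow> X i * a \<in> J" and zero: "0 \<in> J"
  shows "C_elem G A (insert p (insert q M)) u - (cs (u\<^sup>2) - (H - cs (of_nat (card M) / 2)) ^ 2) * C_elem G A M u \<in> J"
proof -
  let ?c = "C_elem G A M u"
  have sum: "(\<Sum>i\<in>M. f i) \<in> J" if "\<And>i. i \<in> M \<Longrightarrow> f i \<in> J" for f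
  proof -
    have "sum f I \<in> J" if "I \<subseteq> M" for I
      using that \<open>\<And>i. i \<in> M \<Longrightarrow> f i \<in> J\<close>
      by (induct I rule: infinite_finite_induct) (simp_all add: zero add)
    then show ?thesis by blast
  qed
  have "step u ?c - (cs (u\<^sup>2) - (H - cs (of_nat (card M) / 2)) ^ 2) * ?c =
     (\<Sum>i\<in>M. X i * ((H - cs ((of_nat (card M) - 3) / 2)) * (A p i * ?c - ?c * A p i)))
     - (\<Sum>i\<in>M. X i * (X i * ?c))
     + cs 2 * (\<Sum>i\<in>M. X i * (?c * A p i))
     - cs (1 / 2) * (\<Sum>i\<in>M. X i * (M.Om * (A p i * ?c - ?c * A p i) - (A p i * ?c - ?c * A p i) * M.Om))
     - cs (1 / 2) * (\<Sum>i\<in>M. \<Sum>j\<in>M. X i * (X j *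
         (A p i * (A p j * ?c - ?c * A p j) - (A p j * ?c - ?c * A p j) * A p i)))"
    unfolding step_def mult.assoc[symmetric]
    by (simp add: distrib_right left_diff_distrib sum_distrib_right power2_eq_square)
  also have "\<dots> \<in> J"
    by (intro add diff cs sum J)
  finally show ?thesis unfolding C_elem_step .
qed

context so_pos
begin

definition emb_so :: "cmat \<Rightarrow> uprod" where "emb_so x = lift (so n) (uea_emb (so n) x)"

lemmas emb_so_lin = lift_emb_lin[OF lie_subalgebra_so[of n], folded emb_so_def]

section \<open>The image of $C_n(u)$ under the Harish-Chandra map\<close>

inductive_set N_ideal :: "uprod set" where
  zero: "0 \<in> N_ideal"
| step: "z \<in> N_ideal \<Longrightarrow> x \<in> N \<Longrightarrow> z + emb_so x * a \<in> N_ideal"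

lemma N_ideal_add: "w \<in> N_ideal \<Longrightarrow> z \<in> N_ideal \<Longrightarrow> z + w \<in> N_ideal"
  by (induct rule: N_ideal.induct) (simp_all add: add.assoc[symmetric] N_ideal.step)

lemma N_ideal_right: "z \<in> N_ideal \<Longrightarrow> z * a \<in> N_ideal"
  by (induct rule: N_ideal.induct) (simp_all add: distrib_right mult.assoc N_ideal.intros)

lemma N_ideal_minus: "z \<in> N_ideal \<Longrightarrow> - z \<in> N_ideal"
  using N_ideal_right[of z "-1"] by simp

lemma N_ideal_diff: "z \<in> N_ideal \<Longrightarrow> w \<in> N_ideal \<Longrightarrow> z - w \<in> N_ideal"
  using N_ideal_add[OF N_ideal_minus, of w z] by simp

lemma N_ideal_cs: "z \<in> N_ideal \<Longrightarrow> cs c * z \<in> N_ideal"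
  unfolding cs_comm by (rule N_ideal_right)

lemma N_ideal_N: "x \<in> N \<Longrightarrow> emb_so x * a \<in> N_ideal"
  using N_ideal.step[OF N_ideal.zero, of x a] by simp

text \<open>\<open>sub_h n\<close> normalizes N, so the right ideal is also stable under left
  multiplication by it. This permits multiplying a congruence for fewer indices by the next factor
  from the left.\<close>

lemma N_ideal_h:
  assumes Y: "Y \<in> sub_h n"
  shows "z \<in> N_ideal \<Longrightarrow> emb_so Y * z \<in> N_ideal"
proof (induct rule: N_ideal.induct)
  case zero
  show ?case by (simp add: N_ideal.zero)
next
  case (step z x a)
  have so: "Y \<in> so n" "x \<in> so n" using Y step(3) parts by blast+
  have "emb_so Y * (z + emb_so x * a) = emb_so Y * z + (emb_so Y * emb_so x) * a" by (simp add: distrib_left mult.assoc)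
  also have "emb_so Y * emb_so x = emb_so x * emb_so Y + emb_so (lie Y x)" by (rule emb_so_lin(3)[OF so])
  finally have "emb_so Y * (z + emb_so x * a) = (emb_so Y * z + emb_so x * (emb_so Y * a)) + emb_so (lie Y x) * a"
    by (simp add: distrib_right mult.assoc add.assoc)
  then show ?case using N_ideal.step[OF N_ideal.step[OF step(2,3)] hN[OF Y step(3)]] by simp
qed

definition factor :: "complex \<Rightarrow> (nat \<Rightarrow> complex) \<Rightarrow> nat \<Rightarrow> uprod" where
  "factor u r k = cs (u\<^sup>2) - (emb_so (torus n k) - cs (r k)) ^ 2"

lemma N_ideal_factor: "k \<in> Ks \<Longrightarrow> z \<in> N_ideal \<Longrightarrow> factor u r k * z \<in> N_ideal"
proof -
  assume k: "k \<in> Ks" and z: "z \<in> N_ideal"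
  have *: "(emb_so (torus n k) - cs (r k)) * w \<in> N_ideal" if "w \<in> N_ideal" for w
    unfolding left_diff_distrib by (intro N_ideal_diff N_ideal_h[OF torus_h[OF k]] N_ideal_cs that)
  have "(emb_so (torus n k) - cs (r k)) ^ 2 * z \<in> N_ideal"
    unfolding power2_eq_square mult.assoc by (intro * z)
  then show ?thesis unfolding factor_def left_diff_distrib by (intro N_ideal_diff N_ideal_cs z)
qed

definition indices :: "nat set \<Rightarrow> nat set" where
  "indices S = (\<lambda>k. n + 1 - 2 * k) ` S \<union> (\<lambda>k. n + 2 - 2 * k) ` S \<union> (if odd n then {1} else {})"

lemma indices_sub: "S \<subseteq> Ks \<Longrightarrow> indices S \<subseteq> {1..n}"
  unfolding indices_def by (auto elim!: oddE) (fastforce | arith)+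

lemma indices_Ks: "indices Ks = {1..n}"
proof (rule equalityI[OF indices_sub[OF order_refl]], rule subsetI)
  fix a assume a: "a \<in> {1..n}"
  show "a \<in> indices Ks"
  proof (cases "odd n \<and> a = 1")
    case True
    then show ?thesis unfolding indices_def by simp
  next
    case False
    define k where "k = (n + 2 - a) div 2"
    have k: "1 \<le> k" "k \<le> n div 2" using a False unfolding k_def atLeastAtMost_iff by presburger+
    have "n + 2 - a = 2 * k \<or> n + 2 - a = 2 * k + 1" unfolding k_def by presburger
    then have "a = n + 1 - 2 * k \<or> a = n + 2 - 2 * k" using a unfolding atLeastAtMost_iff by arith
    then show ?thesis using k unfolding indices_def by auto
  qed
qed

text \<open>The recursion shifts H by half the number of remaining indices, and
  \<open>half_sum_top\<close> contains half the number of remaining signed indices; the equality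
  makes the two shifts match.\<close>

lemma card_indices:
  assumes S: "S \<subseteq> Ks"
  shows "card (indices S) = card (signed S)"
proof -
  have fS: "finite S" using S finite_subset by blast
  have k: "1 \<le> k" "2 * k \<le> n" if "k \<in> S" for k
  proof -
    have "1 \<le> k" "k \<le> n div 2" using S that by auto
    then show "1 \<le> k" "2 * k \<le> n" by arith+
  qed
  have inj: "inj_on (\<lambda>k. n + 1 - 2 * k) S" "inj_on (\<lambda>k. n + 2 - 2 * k) S"
    by (rule inj_onI, use k in fastforce)+
  have ne: "n + 1 - 2 * k \<noteq> n + 2 - 2 * l" if "2 * k \<le> n" "2 * l \<le> n" for k l using that by presburger
  have d1: "(\<lambda>k. n + 1 - 2 * k) ` S \<inter> (\<lambda>k. n + 2 - 2 * k) ` S = {}" using ne k(2) by blast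
  have ne1: "n + 1 - 2 * k \<noteq> 1" "n + 2 - 2 * k \<noteq> 1" if "2 * k \<le> n" "odd n" for k using that by presburger+
  have "1 \<notin> (\<lambda>k. n + 1 - 2 * k) ` S" "1 \<notin> (\<lambda>k. n + 2 - 2 * k) ` S" if "odd n"
    by (rule notin_imageI, rule not_sym, rule ne1[OF k(2) that], assumption)+
  then have d2: "((\<lambda>k. n + 1 - 2 * k) ` S \<union> (\<lambda>k. n + 2 - 2 * k) ` S) \<inter> (if odd n then {1} else {}) = {}"
    by (cases "odd n") (simp_all only: if_True if_False Int_insert_right Un_iff Int_empty_right simp_thms)
  have 1: "card (indices S) = 2 * card S + (if odd n then 1 else 0)"
    unfolding indices_def using fS d1 d2 inj by (subst card_Un_disjoint; simp add: card_Un_disjoint card_image)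
  have signed: "signed S = int ` S \<union> (\<lambda>k. - int k) ` S \<union> (if odd n then {0} else {})"
  proof (rule equalityI; rule subsetI)
    fix x assume x: "x \<in> signed S"
    then show "x \<in> int ` S \<union> (\<lambda>k. - int k) ` S \<union> (if odd n then {0} else {})"
      by (cases "x \<ge> 0") (auto simp: signed_def idx_def image_iff intro: bexI[of _ "nat \<bar>x\<bar>"])
  next
    fix x assume "x \<in> int ` S \<union> (\<lambda>k. - int k) ` S \<union> (if odd n then {0} else {})"
    then show "x \<in> signed S" using k k(1)[of 0] by (auto simp: signed_def idx_def split: if_splits)
  qed
  have "card (signed S) = 2 * card S + (if odd n then 1 else 0)"
  proof -
    have a: "int ` S \<inter> (\<lambda>k. - int k) ` S = {}" using k by force
    have b: "(int ` S \<union> (\<lambda>k. - int k) ` S) \<inter> (if odd n then {0} else {}) = {}" using k by force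
    have c: "card (int ` S) = card S" "card ((\<lambda>k. - int k) ` S) = card S" by (auto intro!: card_image inj_onI)
    show ?thesis unfolding signed using fS a b c by (subst card_Un_disjoint; simp add: card_Un_disjoint)
  qed
  then show ?thesis using 1 by simp
qed

lemma unitv_signed:
  assumes S: "S \<subseteq> Ks" and a: "a \<in> indices S"
  obtains y c d where "y \<in> signed S" "unitv a = (\<lambda>i. c * nu n y i + d * nu n (- y) i)"
proof -
  consider "odd n" "a = 1" | k where "k \<in> S" "a = n + 1 - 2 * k" | k where "k \<in> S" "a = n + 2 - 2 * k"
    using a unfolding indices_def by (auto split: if_splits)
  then show ?thesis
  proof cases
    case 1
    show ?thesis by (rule that[of 0 1 0]) (use 1 in \<open>auto simp: signed_def idx_def unitv_def nu_def fun_eq_iff\<close>)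
  next
    case (2 k)
    have k: "1 \<le> k" "k \<le> n div 2" using 2 S by auto
    have ne: "n + 1 - 2 * k \<noteq> n + 2 - 2 * k" using k by arith
    show ?thesis
      by (rule that[of "int k" "1/2" "1/2"]) (use k 2 ne in \<open>auto simp: signed_def idx_pos unitv_def nu_def fun_eq_iff\<close>)
  next
    case (3 k)
    have k: "1 \<le> k" "k \<le> n div 2" using 3 S by auto
    have ne: "n + 1 - 2 * k \<noteq> n + 2 - 2 * k" using k by arith
    show ?thesis
      by (rule that[of "int k" "-\<i>/2" "\<i>/2"]) (use k 3 ne in \<open>auto simp: signed_def idx_pos unitv_def nu_def fun_eq_iff\<close>)
  qed
qed

lemma C_elem_factor:
  assumes S: "S \<subseteq> Ks" and x: "x \<in> idx n" "x \<noteq> 0" "nat \<bar>x\<bar> \<in> S"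
    and top: "\<And>y. y \<in> signed S \<Longrightarrow> y \<noteq> x \<Longrightarrow> y \<noteq> - x \<Longrightarrow> pos x y"
  shows "C_elem {1..n} (A_so n) (indices S) u - factor u (half_sum S) (nat \<bar>x\<bar>) * C_elem {1..n} (A_so n) (indices (S - {nat \<bar>x\<bar>})) u \<in> N_ideal"
proof -
  define k where "k = nat \<bar>x\<bar>"
  have kS: "k \<in> S" "k \<in> Ks" "1 \<le> k" "k \<le> n div 2" using x S unfolding k_def by auto
  define S' where "S' = S - {k}"
  have S': "S' \<subseteq> Ks" "S' \<subseteq> S" using S unfolding S'_def by blast+
  define M where "M = indices S'"
  define P where "P = n + 1 - 2 * k"
  define Q where "Q = n + 2 - 2 * k"
  \<comment> \<open>For negative x the two indices trade places: then \<open>X i\<close> becomes a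
    multiple of the bivector of \<open>nu n x\<close> and a unit vector, and H becomes the negative
    of \<open>torus n k\<close>.\<close>
  define p where "p = (if x > 0 then P else Q)"
  define q where "q = (if x > 0 then Q else P)"
  define \<epsilon> :: complex where "\<epsilon> = (if x > 0 then 1 else - 1)"
  have PQ: "P \<noteq> Q" "P \<in> {1..n}" "Q \<in> {1..n}" using kS unfolding P_def Q_def atLeastAtMost_iff by arith+
  have MSS: "indices S = insert P (insert Q M)"
    unfolding M_def S'_def indices_def P_def Q_def using kS(1) by blast
  have notM: "P \<notin> M" "Q \<notin> M"
  proof -
    have l: "l \<le> n div 2" "1 \<le> l" "l \<noteq> k" if "l \<in> S'" for l using that S' unfolding S'_def by auto
    have n1: "n + 1 - 2 * k \<noteq> n + 1 - 2 * l" "n + 2 - 2 * k \<noteq> n + 2 - 2 * l"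
       "n + 1 - 2 * k \<noteq> n + 2 - 2 * l" "n + 2 - 2 * k \<noteq> n + 1 - 2 * l" if "l \<le> n div 2" "1 \<le> l" "l \<noteq> k" for l
    proof -
      have le: "2 * l \<le> n" "2 * k \<le> n" using that(1) kS(4) by arith+
      show "n + 1 - 2 * k \<noteq> n + 1 - 2 * l" "n + 2 - 2 * k \<noteq> n + 2 - 2 * l" using le that(3) by arith+
      show "n + 1 - 2 * k \<noteq> n + 2 - 2 * l" "n + 2 - 2 * k \<noteq> n + 1 - 2 * l" using le by presburger+
    qed
    have n2: "n + 1 - 2 * k \<noteq> 1" "n + 2 - 2 * k \<noteq> 1" if "odd n" using that kS(3,4) by presburger+
    note n1 = n1[OF l]
    have "P \<notin> (\<lambda>k. n + 1 - 2 * k) ` S'" "P \<notin> (\<lambda>k. n + 2 - 2 * k) ` S'"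
      "Q \<notin> (\<lambda>k. n + 1 - 2 * k) ` S'" "Q \<notin> (\<lambda>k. n + 2 - 2 * k) ` S'"
      unfolding P_def Q_def by (rule notin_imageI, rule n1, assumption+)+
    moreover have "P \<notin> (if odd n then {1} else {})" "Q \<notin> (if odd n then {1} else {})"
      unfolding P_def Q_def using n2 by (cases "odd n"; simp only: if_True if_False singleton_iff empty_iff not_False_eq_True)+
    ultimately show "P \<notin> M" "Q \<notin> M" unfolding M_def indices_def by blast+
  qed
  have K: "insert p (insert q M) = indices S" unfolding MSS p_def q_def by auto
  have Ksub: "indices S \<subseteq> {1..n}" using indices_sub[OF S] .
  have SP: "so_pair (A_so n) M p q {1..n}"
    unfolding so_pair_def K using so_alg_A_so[OF Ksub] Ksub PQ notM by (auto simp: p_def q_def)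
  have pq1: "p \<in> {1..n}" "q \<in> {1..n}" using PQ unfolding p_def q_def by auto
  have M1: "i \<in> {1..n}" if "i \<in> M" for i using that Ksub MSS by blast
  define H where "H = sc \<i> (A_so n q p)"
  define X where "X i = A_so n p i + sc \<i> (A_so n q i)" for i
  have HH: "H = sc \<epsilon> (emb_so (torus n k))"
  proof -
    have e: "n - 2 * (k - 1) = Q" "n - 1 - 2 * (k - 1) = P" using kS unfolding Q_def P_def by arith+
    have h: "torus n k = smat \<i> (skew Q P)" unfolding torus_def elemT_def e by (rule refl)
    have s: "skew Q P \<in> so n" "skew q p \<in> so n" by (intro skew_so PQ pq1)+
    have "H = emb_so (smat \<i> (skew q p))" unfolding H_def A_so_def emb_so_def[symmetric] emb_so_lin(2)[OF s(2)] by (rule refl)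
    also have "smat \<i> (skew q p) = smat \<epsilon> (smat \<i> (skew Q P))"
      unfolding q_def p_def \<epsilon>_def using skew_anti[of P Q] by (simp add: mult.commute)
    finally show ?thesis unfolding h emb_so_lin(2)[OF soL(2)[OF s(1)]] .
  qed
  have nuN: "sk (nu n x) (unitv i) \<in> N" if i: "i \<in> M" for i
  proof -
    obtain y c d where y: "y \<in> signed S'" "unitv i = (\<lambda>i. c * nu n y i + d * nu n (- y) i)"
      using unitv_signed[OF S'(1) i[unfolded M_def]] .
    have "y \<noteq> x" "y \<noteq> - x" using signed_remove(2,3)[OF x] y(1) unfolding S'_def k_def by blast+
    moreover have "y \<in> signed S" "- y \<in> signed S" using y(1) S'(2) idx_uminus unfolding signed_def by auto
    ultimately have "R n x y \<in> N" "R n x (- y) \<in> N" using top[of y] top[of "- y"] unfolding pos_def by auto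
    then have "smat c (R n x y) + smat d (R n x (- y)) \<in> N" by (intro NL)
    moreover have "sk (nu n x) (unitv i) = smat c (R n x y) + smat d (R n x (- y))"
      unfolding y(2) R_def by (simp add: sk_def smat_def fun_eq_iff algebra_simps)
    ultimately show ?thesis by (simp only:)
  qed
  have Xn: "\<exists>z\<in>N. X i = emb_so z" if i: "i \<in> M" for i
  proof -
    have s: "skew p i \<in> so n" "skew q i \<in> so n" by (intro skew_so pq1 M1[OF i])+
    have "X i = emb_so (skew p i + smat \<i> (skew q i))"
      unfolding X_def A_so_def emb_so_def[symmetric] emb_so_lin(1)[OF s(1) soL(2)[OF s(2)]] emb_so_lin(2)[OF s(2)] by (rule refl)
    moreover have "skew p i + smat \<i> (skew q i) = smat (if x > 0 then 1 else \<i>) (sk (nu n x) (unitv i))"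
    proof -
      have "nu n x = (\<lambda>a. unitv P a + (if x > 0 then \<i> else - \<i>) * unitv Q a)"
      proof
        fix a
        have "nu n x a = (if a = P then 1 else if a = Q then (if x > 0 then \<i> else - \<i>) else 0)"
          using x(2) by (simp only: nu_def P_def Q_def k_def if_False)
        then show "nu n x a = unitv P a + (if x > 0 then \<i> else - \<i>) * unitv Q a"
          using PQ(1) by (simp add: unitv_def)
      qed
      then show ?thesis unfolding skew_sk p_def q_def
        by (auto simp: sk_def smat_def fun_eq_iff algebra_simps)
    qed
    ultimately have "X i = emb_so (smat (if x > 0 then 1 else \<i>) (sk (nu n x) (unitv i)))" by (simp only:)
    then show ?thesis by (rule bexI[OF _ NL(2)[OF nuN[OF i]]])
  qed
  have XN: "(A_so n p i + sc \<i> (A_so n q i)) * a \<in> N_ideal" if "i \<in> M" for i a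
    using Xn[OF that] N_ideal_N unfolding X_def by auto
  have "C_elem {1..n} (A_so n) (insert p (insert q M)) u - (cs (u\<^sup>2) - (H - cs (of_nat (card M) / 2)) ^ 2) * C_elem {1..n} (A_so n) M u \<in> N_ideal"
    unfolding H_def by (rule so_pair.C_elem_mod_right_ideal[OF SP]) (assumption | rule N_ideal_add N_ideal_diff N_ideal_cs N_ideal.zero XN)+
  then have 1: "C_elem {1..n} (A_so n) (indices S) u - (cs (u\<^sup>2) - (H - cs (of_nat (card M) / 2)) ^ 2) * C_elem {1..n} (A_so n) M u \<in> N_ideal"
    unfolding K .
  have r: "half_sum S k = \<epsilon> * (of_nat (card M) / 2)"
    using half_sum_top(1)[OF x top] card_indices[OF S'(1)] x(2) unfolding k_def[symmetric] S'_def[symmetric] M_def \<epsilon>_def by auto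
  \<comment> \<open>H and the shift change sign together, and the square no longer sees
    \<open>\<epsilon>\<close>.\<close>
  have "H - cs (of_nat (card M) / 2) = sc \<epsilon> (emb_so (torus n k) - cs (half_sum S k))"
    unfolding HH r by (auto simp: \<epsilon>_def sc_def cs_minus)
  then have "(H - cs (of_nat (card M) / 2)) ^ 2 = (emb_so (torus n k) - cs (half_sum S k)) ^ 2"
    by (auto simp: \<epsilon>_def sc_minus_left power2_eq_square algebra_simps)
  with 1 show ?thesis unfolding factor_def k_def[symmetric] S'_def[symmetric] M_def[symmetric] by simp
qed

text \<open>The order of removal depends on N, and the product is formed in a ring that is not
  commutative; hence only some enumeration ks is claimed. The order becomes irrelevant once the
  product is read in U(h).\<close>

lemma C_elem_prod:
  assumes "finite S" "S \<subseteq> Ks"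
  shows "\<exists>ks. set ks = S \<and> distinct ks \<and> C_elem {1..n} (A_so n) (indices S) u - prod_list (map (factor u (half_sum S)) ks) \<in> N_ideal"
  using assms
proof (induct S rule: finite_psubset_induct)
  case (psubset S)
  show ?case
  proof (cases "S = {}")
    case True
    have "indices S \<subseteq> {1..n}" by (rule indices_sub[OF psubset(3)])
    moreover have "card (indices S) < 2" unfolding indices_def True by simp
    ultimately have "C_elem {1..n} (A_so n) (indices S) u = 1" by (intro C_elem_le_1 so_alg_A_so) auto
    then show ?thesis using True by (intro exI[of _ "[]"]) (simp add: N_ideal.zero)
  next
    case False
    then obtain k where k: "k \<in> S" by blast
    have kL: "int k \<in> signed S" "int k \<noteq> 0" using k psubset(3) idx_pos[of k n] unfolding signed_def by auto
    obtain x where x: "x \<in> signed S" "x \<noteq> 0" and top: "\<And>y. y \<in> signed S \<Longrightarrow> y \<noteq> x \<Longrightarrow> y \<noteq> - x \<Longrightarrow> pos x y"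
      by (rule top_exists[of "signed S" "int k"]) (use kL idx_uminus in \<open>auto simp: signed_def\<close>)
    have x': "x \<in> idx n" "x \<noteq> 0" "nat \<bar>x\<bar> \<in> S" using x unfolding signed_def by auto
    let ?k = "nat \<bar>x\<bar>" let ?S = "S - {?k}"
    have "\<exists>ks. set ks = ?S \<and> distinct ks \<and> C_elem {1..n} (A_so n) (indices ?S) u - prod_list (map (factor u (half_sum ?S)) ks) \<in> N_ideal"
      using x'(3) psubset(3) by (intro psubset(2)) auto
    then obtain ks where ks: "set ks = ?S" "distinct ks" "C_elem {1..n} (A_so n) (indices ?S) u - prod_list (map (factor u (half_sum ?S)) ks) \<in> N_ideal" by blast
    have m: "map (factor u (half_sum ?S)) ks = map (factor u (half_sum S)) ks"
    proof (rule map_cong[OF refl])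
      fix l assume "l \<in> set ks"
      then have "half_sum S l = half_sum ?S l" using ks(1) psubset(3) by (intro half_sum_top(2)[OF x' top]) auto
      then show "factor u (half_sum ?S) l = factor u (half_sum S) l" by (simp add: factor_def)
    qed
    have kK: "?k \<in> Ks" using x'(3) psubset(3) by blast
    let ?c = "C_elem {1..n} (A_so n) (indices ?S) u" and ?P = "prod_list (map (factor u (half_sum S)) ks)"
    have "(C_elem {1..n} (A_so n) (indices S) u - factor u (half_sum S) ?k * ?c) + factor u (half_sum S) ?k * (?c - ?P) \<in> N_ideal"
      using C_elem_factor[OF psubset(3) x' top] N_ideal_factor[OF kK ks(3)] unfolding m by (intro N_ideal_add) auto
    then have "C_elem {1..n} (A_so n) (indices S) u - prod_list (map (factor u (half_sum S)) (?k # ks)) \<in> N_ideal"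
      by (simp add: right_diff_distrib)
    moreover have "set (?k # ks) = S" "distinct (?k # ks)" using ks x'(3) by auto
    ultimately show ?thesis by blast
  qed
qed

end

context so_pos
begin

text \<open>The analogue of \<open>factor\<close> lifted from U(h) instead of U(so_n). The two
  differ in the product ring but agree in the component of \<open>so n\<close>.\<close>

definition factor_h :: "complex \<Rightarrow> (nat \<Rightarrow> complex) \<Rightarrow> nat \<Rightarrow> uprod" where
  "factor_h u r k = cs (u\<^sup>2) - (lift (sub_h n) (uea_emb (sub_h n) (torus n k)) - cs (r k)) ^ 2"

lemma hLie: "lie_subalgebra (sub_h n)" by (rule triangular.h[OF tri])

lemma N_ideal_hc: "z \<in> N_ideal \<Longrightarrow> component z (so n) \<in> hc_complement (so n) N Nb"
proof -
  let ?R = "uea (so n)"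
  interpret Rg: ring ?R by (rule ring_uea[OF lie_subalgebra_so])
  let ?Z = "{uea_emb (so n) x \<otimes>\<^bsub>?R\<^esub> a | x a. x \<in> N \<and> a \<in> carrier ?R}"
  assume "z \<in> N_ideal"
  then have *: "component z (so n) \<in> generate (add_monoid ?R) ?Z"
  proof (induct rule: N_ideal.induct)
    case zero
    show ?case using generate.one[of "add_monoid ?R" ?Z] by (simp add: component_simps[OF lie_subalgebra_so])
  next
    case (step z x a)
    have x: "x \<in> so n" using step(3) parts by blast
    have e: "component (emb_so x) (so n) = uea_emb (so n) x"
      unfolding emb_so_def by (simp add: component_lift[OF lie_subalgebra_so lie_subalgebra_so] uea_emb_closed[OF lie_subalgebra_so x] uea_incl_self[OF lie_subalgebra_so])
    have "uea_emb (so n) x \<otimes>\<^bsub>?R\<^esub> component a (so n) \<in> ?Z"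
      using step(3) component_closed[OF lie_subalgebra_so] by blast
    from generate.eng[OF step(2) generate.incl[OF this, of "add_monoid ?R"]]
    show ?case by (simp add: component_simps[OF lie_subalgebra_so] e)
  qed
  have "\<zero>\<^bsub>?R\<^esub> \<in> generate (add_monoid ?R) {a \<otimes>\<^bsub>?R\<^esub> uea_emb (so n) y | a y. a \<in> carrier ?R \<and> y \<in> Nb}"
    using generate.one[of "add_monoid ?R"] by simp
  moreover have "component z (so n) = component z (so n) \<oplus>\<^bsub>?R\<^esub> \<zero>\<^bsub>?R\<^esub>"
    using component_closed[OF lie_subalgebra_so] by simp
  ultimately show ?thesis using * unfolding hc_complement_def set_add_def' by blast
qed

lemma component_emb: 
  assumes g: "lie_subalgebra g" and h: "lie_subalgebra h" "g \<subseteq> h" and x: "x \<in> g"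
  shows "component (lift g (uea_emb g x)) h = uea_emb h x"
  using component_lift[OF g h uea_emb_closed[OF g x]] uea_incl_simps(5)[OF g h x] by simp

text \<open>The product of the \<open>factor_h\<close> is fixed by taking the component at
  \<open>sub_h n\<close> and lifting it back, so its component at \<open>so n\<close> is the image
  of the one at \<open>sub_h n\<close>.\<close>

lemma prod_factor_component:
  assumes "set ks \<subseteq> Ks"
  shows "component (prod_list (map (factor u r) ks)) (so n) = uea_incl (sub_h n) (so n) (component (prod_list (map (factor_h u r) ks)) (sub_h n))"
proof -
  let ?h = "sub_h n" and ?g = "so n"
  note at = component_simps[OF lie_subalgebra_so[of n]] component_pow[OF lie_subalgebra_so[of n]]
  have 1: "component (prod_list (map (factor u r) ks)) ?g = component (prod_list (map (factor_h u r) ks)) ?g"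
    using assms
  proof (induct ks)
    case (Cons k ks)
    have k: "torus n k \<in> ?h" "torus n k \<in> ?g" using Cons(2) torus_h parts by auto
    have "component (factor u r k) ?g = component (factor_h u r k) ?g"
      unfolding factor_def factor_h_def emb_so_def at
        component_emb[OF hLie lie_subalgebra_so parts(2) k(1)] component_emb[OF lie_subalgebra_so lie_subalgebra_so order_refl k(2)] by (rule refl)
    then show ?case using Cons by (simp add: at)
  qed simp
  let ?f = "\<lambda>x. lift ?h (component x ?h)"
  note hom = hom_simps[OF calg_hom_lift[OF hLie]]
  have 2: "?f (prod_list (map (factor_h u r) ks)) = prod_list (map (factor_h u r) ks)"
    using assms
  proof (induct ks)
    case Nil
    show ?case using hom(5) by simp
  next
    case (Cons k ks)
    have k: "torus n k \<in> ?h" using Cons(2) torus_h by auto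
    have d: "?f (x - y) = ?f x - ?f y" for x y using hom(1)[of "x - y" y] by (simp add: algebra_simps)
    have "?f (factor_h u r k) = factor_h u r k"
      unfolding factor_h_def power2_eq_square d hom(2,3) component_emb[OF hLie hLie order_refl k] by (rule refl)
    then show ?case using Cons by (simp add: hom(2))
  qed
  show ?thesis
    unfolding 1 by (subst 2[symmetric]) (rule component_lift[OF hLie lie_subalgebra_so parts(2) component_closed[OF hLie]])
qed

text \<open>The decomposition exists by \<open>C_elem_prod\<close>, with an error term in N U(g)
  alone, and it is unique by \<open>hc_unique\<close>.\<close>

theorem hc_proj_Cn:
  "\<exists>ks. set ks = Ks \<and> distinct ks \<and>
     hc_proj (so n) (sub_h n) N Nb (Cn n u) = component (prod_list (map (factor_h u (half_sum Ks)) ks)) (sub_h n)"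
proof -
  obtain ks where ks: "set ks = Ks" "distinct ks"
    and c: "C_elem {1..n} (A_so n) (indices Ks) u - prod_list (map (factor u (half_sum Ks)) ks) \<in> N_ideal"
    using C_elem_prod[of Ks u] by auto
  let ?P = "prod_list (map (factor u (half_sum Ks)) ks)" and ?Ph = "component (prod_list (map (factor_h u (half_sum Ks)) ks)) (sub_h n)"
  let ?C = "C_elem {1..n} (A_so n) {1..n} u"
  let ?R = "uea (so n)"
  have "Cn n u = component ?C (so n)" by (rule Cn_eq_C_elem) auto
  also have "\<dots> = component (?P + (?C - ?P)) (so n)" by simp
  also have "\<dots> = component ?P (so n) \<oplus>\<^bsub>?R\<^esub> component (?C - ?P) (so n)" by (simp only: component_simps[OF lie_subalgebra_so])
  also have "component ?P (so n) = uea_incl (sub_h n) (so n) ?Ph" using ks by (intro prod_factor_component) simp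
  finally have e: "Cn n u = uea_incl (sub_h n) (so n) ?Ph \<oplus>\<^bsub>?R\<^esub> component (?C - ?P) (so n)" .
  have q: "component (?C - ?P) (so n) \<in> hc_complement (so n) N Nb"
    using N_ideal_hc[OF c] unfolding indices_Ks .
  have Ph: "?Ph \<in> carrier (uea (sub_h n))" by (rule component_closed[OF hLie])
  have "hc_proj (so n) (sub_h n) N Nb (Cn n u) = ?Ph"
    unfolding hc_proj_def
  proof (rule the_equality)
    show "?Ph \<in> carrier (uea (sub_h n)) \<and> (\<exists>q\<in>hc_complement (so n) N Nb. Cn n u = uea_incl (sub_h n) (so n) ?Ph \<oplus>\<^bsub>?R\<^esub> q)"
      using Ph q e by blast
    fix p assume "p \<in> carrier (uea (sub_h n)) \<and> (\<exists>q\<in>hc_complement (so n) N Nb. Cn n u = uea_incl (sub_h n) (so n) p \<oplus>\<^bsub>?R\<^esub> q)"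
    then obtain q' where p: "p \<in> carrier (uea (sub_h n))" "q' \<in> hc_complement (so n) N Nb"
      "Cn n u = uea_incl (sub_h n) (so n) p \<oplus>\<^bsub>?R\<^esub> q'" by blast
    show "p = ?Ph"
      by (rule triangular.hc_unique[OF tri p(1) Ph p(2) q]) (use p(3) e in simp)
  qed
  then show ?thesis using ks by blast
qed

end

text \<open>The automorphism of \<open>uea_shift\<close>, on representatives in the free algebra.\<close>

definition shiftv :: "cmat set \<Rightarrow> (cmat \<Rightarrow> complex) \<Rightarrow> cmat \<Rightarrow> uprod" where
  "shiftv h r x = lift h (uea_emb h x) + cs (r x)"

definition shift :: "cmat set \<Rightarrow> (cmat \<Rightarrow> complex) \<Rightarrow> uea_elem \<Rightarrow> uea_elem" where
  "shift h r = restrict (\<lambda>y. component (ev cs (shiftv h r) (SOME f. f \<in> y)) h) (carrier (uea h))"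

definition lin_on :: "cmat set \<Rightarrow> (cmat \<Rightarrow> complex) \<Rightarrow> bool" where
  "lin_on h r \<longleftrightarrow> (\<forall>x\<in>h. \<forall>y\<in>h. r (x + y) = r x + r y) \<and> (\<forall>c. \<forall>x\<in>h. r (smat c x) = c * r x)"

section \<open>The enveloping algebra of an abelian Lie algebra and its shifts\<close>

context
  fixes h assumes h: "lie_subalgebra h" and abel: "\<And>x y. x \<in> h \<Longrightarrow> y \<in> h \<Longrightarrow> lie x y = 0"
begin

lemma uea_comm:
  assumes a: "a \<in> carrier (uea h)" and b: "b \<in> carrier (uea h)"
  shows "a \<otimes>\<^bsub>uea h\<^esub> b = b \<otimes>\<^bsub>uea h\<^esub> a"
proof -
  interpret ring "uea h" by (rule ring_uea[OF h])
  have z: "uea_emb h 0 = \<zero>\<^bsub>uea h\<^esub>"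
  proof -
    have 0: "0 \<in> h" using lie_subalgebraD[OF h] by blast
    have "uea_emb h (smat 0 0) = \<zero>\<^bsub>uea h\<^esub>"
      unfolding uea_emb_smat[OF h 0] using uea_const_simps(4)[OF h] uea_emb_closed[OF h 0] by simp
    then show ?thesis by (simp only: cmat.scale_zero_left)
  qed
  have embc: "uea_emb h x \<otimes>\<^bsub>uea h\<^esub> y = y \<otimes>\<^bsub>uea h\<^esub> uea_emb h x" if x: "x \<in> h" and y: "y \<in> carrier (uea h)" for x y
    using h y
  proof (induct rule: uea_gen_induct)
    case (const c)
    show ?case using uea_const_comm[OF h uea_emb_closed[OF h x]] by simp
  next
    case (emb y)
    show ?case
      using uea_emb_lie[OF h x emb] abel[OF x emb] z uea_emb_closed[OF h x] uea_emb_closed[OF h emb] by simp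
  next
    case (add a b)
    then show ?case by (simp add: r_distr l_distr uea_emb_closed[OF h x])
  next
    case (mult a b)
    note cl = mult(1,2) uea_emb_closed[OF h x]
    have "uea_emb h x \<otimes>\<^bsub>uea h\<^esub> (a \<otimes>\<^bsub>uea h\<^esub> b) = a \<otimes>\<^bsub>uea h\<^esub> (uea_emb h x \<otimes>\<^bsub>uea h\<^esub> b)"
      using cl mult(3) by (simp add: m_assoc[symmetric])
    also have "\<dots> = a \<otimes>\<^bsub>uea h\<^esub> b \<otimes>\<^bsub>uea h\<^esub> uea_emb h x"
      using cl mult(4) by (simp add: m_assoc)
    finally show ?case .
  qed
  show ?thesis
    using h a
  proof (induct rule: uea_gen_induct)
    case (const c)
    show ?case by (rule uea_const_comm[OF h b])
  next
    case (emb x)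
    then show ?case using embc b by blast
  next
    case (add a a')
    then show ?case using b by (simp add: r_distr l_distr)
  next
    case (mult a a')
    have "a \<otimes>\<^bsub>uea h\<^esub> a' \<otimes>\<^bsub>uea h\<^esub> b = a \<otimes>\<^bsub>uea h\<^esub> b \<otimes>\<^bsub>uea h\<^esub> a'"
      unfolding m_assoc[OF mult(1,2) b] mult(4) m_assoc[OF mult(1) b mult(2)] by (rule refl)
    also have "\<dots> = b \<otimes>\<^bsub>uea h\<^esub> (a \<otimes>\<^bsub>uea h\<^esub> a')" unfolding mult(3) by (rule m_assoc[OF b mult(1,2)])
    finally show ?case .
  qed
qed

text \<open>Adding the scalar r x to x respects the defining relations: r is linear, and both sides
  of the bracket relation vanish because h is abelian. So the choice of a representative does not
  matter.\<close>

lemma shift_uea_class: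
  assumes r: "lin_on h r" and f: "f \<in> fcar h"
  shows "shift h r (uea_class h f) = component (ev cs (shiftv h r) f) h"
proof -
  have "(SOME f'. f' \<in> uea_class h f) \<in> uea_class h f" using uea_class_self[OF h f] by (rule someI)
  with in_uea_class[OF h f] have *: "(SOME f'. f' \<in> uea_class h f) \<in> fcar h" "uea_class h (SOME f'. f' \<in> uea_class h f) = uea_class h f" by blast+
  then have i: "(SOME f'. f' \<in> uea_class h f) - f \<in> uea_ideal h" using uea_class_eq_iff[OF h *(1) f] by blast
  have 0: "0 \<in> h" using lie_subalgebraD[OF h] by blast
  have r0: "r 0 = 0" using r 0 cmat.scale_zero_left[of 0] unfolding lin_on_def by (metis mult_zero_left)
  have "ev cs (shiftv h r) ((SOME f'. f' \<in> uea_class h f) - f) = 0"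
  proof (rule ev_uea_ideal[OF h scalar_hom_cs _ _ _ i])
    fix x y assume xy: "x \<in> h" "y \<in> h"
    show "shiftv h r (x + y) = shiftv h r x + shiftv h r y"
      using r xy unfolding shiftv_def lift_emb_lin(1)[OF h xy] lin_on_def by (simp add: cs_add)
    have c: "lift h (uea_emb h x) * lift h (uea_emb h y) = lift h (uea_emb h y) * lift h (uea_emb h x)"
      using lift_emb_lin(3)[OF h xy] unfolding abel[OF xy] lift_emb_lin(4)[OF h] by simp
    have "(a + cs p) * (b + cs q) - (b + cs q) * (a + cs p) = a * b - b * a" for a b :: uprod and p q
      using cs_comm[of p b] cs_comm[of q a] cs_comm[of p "cs q"] by (simp add: algebra_simps)
    then have "shiftv h r x * shiftv h r y - shiftv h r y * shiftv h r x = 0"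
      unfolding shiftv_def by (simp only: c diff_self)
    moreover have "shiftv h r (lie x y) = 0" unfolding shiftv_def abel[OF xy] lift_emb_lin(4)[OF h] r0 by simp
    ultimately show "shiftv h r x * shiftv h r y - shiftv h r y * shiftv h r x = shiftv h r (lie x y)" by simp
  next
    fix c x assume x: "x \<in> h"
    show "shiftv h r (smat c x) = cs c * shiftv h r x"
      using r x unfolding shiftv_def lift_emb_lin(2)[OF h x] lin_on_def by (simp add: cs_mult sc_def distrib_left)
  qed
  then show ?thesis using uea_class_simps(1)[OF h f] by (simp add: shift_def cs.ev_diff)
qed

lemma shift_simps:
  assumes r: "lin_on h r"
  shows "y \<in> carrier (uea h) \<Longrightarrow> shift h r y \<in> carrier (uea h)"
    "y \<in> carrier (uea h) \<Longrightarrow> z \<in> carrier (uea h) \<Longrightarrow> shift h r (y \<otimes>\<^bsub>uea h\<^esub> z) = shift h r y \<otimes>\<^bsub>uea h\<^esub> shift h r z"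
    "y \<in> carrier (uea h) \<Longrightarrow> z \<in> carrier (uea h) \<Longrightarrow> shift h r (y \<oplus>\<^bsub>uea h\<^esub> z) = shift h r y \<oplus>\<^bsub>uea h\<^esub> shift h r z"
    "shift h r (uea_const h c) = uea_const h c"
    "x \<in> h \<Longrightarrow> shift h r (uea_emb h x) = uea_emb h x \<oplus>\<^bsub>uea h\<^esub> uea_const h (r x)"
proof -
  note at = component_simps[OF h]
  show "y \<in> carrier (uea h) \<Longrightarrow> shift h r y \<in> carrier (uea h)"
    by (simp add: shift_def component_closed[OF h])
  show "shift h r (y \<otimes>\<^bsub>uea h\<^esub> z) = shift h r y \<otimes>\<^bsub>uea h\<^esub> shift h r z" if yz: "y \<in> carrier (uea h)" "z \<in> carrier (uea h)"
  proof -
    obtain f where f: "f \<in> fcar h" "y = uea_class h f" using uea_cases[OF h yz(1)] by blast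
    obtain f' where f': "f' \<in> fcar h" "z = uea_class h f'" using uea_cases[OF h yz(2)] by blast
    show ?thesis unfolding f(2) f'(2) uea_class_simps(2)[OF h f(1) f'(1), symmetric]
        shift_uea_class[OF r f(1)] shift_uea_class[OF r f'(1)] shift_uea_class[OF r fcar_intros(1)[OF f(1) f'(1)]] cs.ev_mult at by (rule refl)
  qed
  show "shift h r (y \<oplus>\<^bsub>uea h\<^esub> z) = shift h r y \<oplus>\<^bsub>uea h\<^esub> shift h r z" if yz: "y \<in> carrier (uea h)" "z \<in> carrier (uea h)"
  proof -
    obtain f where f: "f \<in> fcar h" "y = uea_class h f" using uea_cases[OF h yz(1)] by blast
    obtain f' where f': "f' \<in> fcar h" "z = uea_class h f'" using uea_cases[OF h yz(2)] by blast
    show ?thesis unfolding f(2) f'(2) uea_class_simps(3)[OF h f(1) f'(1), symmetric]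
        shift_uea_class[OF r f(1)] shift_uea_class[OF r f'(1)] shift_uea_class[OF r fcar_intros(2)[OF f(1) f'(1)]] cs.ev_add at by (rule refl)
  qed
  show "shift h r (uea_const h c) = uea_const h c"
    unfolding uea_const_uea_class shift_uea_class[OF r fcar_intros(7)] cs.ev_scalar at by (rule refl)
  show "shift h r (uea_emb h x) = uea_emb h x \<oplus>\<^bsub>uea h\<^esub> uea_const h (r x)" if x: "x \<in> h"
    unfolding uea_emb_uea_class[of h x] shift_uea_class[OF r fcar_intros(8)[OF x]] cs.ev_letter shiftv_def at component_lift[OF h h order_refl uea_emb_closed[OF h x], unfolded uea_emb_uea_class]
    using uea_incl_self[OF h uea_emb_closed[OF h x]] by (simp only: uea_emb_uea_class)
qed

lemma lin_on_minus: "lin_on h r \<Longrightarrow> lin_on h (\<lambda>x. - r x)"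
  unfolding lin_on_def by auto

lemma shift_inverse:
  assumes r: "lin_on h r" and y: "y \<in> carrier (uea h)" and s: "\<And>x. x \<in> h \<Longrightarrow> s x = - r x" "lin_on h s"
  shows "shift h s (shift h r y) = y"
  using h y
proof (induct rule: uea_gen_induct)
  case (const c)
  show ?case by (simp add: shift_simps[OF r] shift_simps[OF s(2)])
next
  case (emb x)
  interpret ring "uea h" by (rule ring_uea[OF h])
  note cl = uea_emb_closed[OF h emb] uea_const_closed[OF h]
  have "uea_const h (- r x) \<oplus>\<^bsub>uea h\<^esub> uea_const h (r x) = \<zero>\<^bsub>uea h\<^esub>"
    unfolding uea_const_simps(1)[OF h, symmetric] by (simp add: uea_const_simps(4)[OF h])
  then show ?case using cl
    by (simp add: shift_simps(5)[OF r emb] shift_simps[OF s(2)] emb s(1) a_assoc)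
next
  case (add a b)
  then show ?case by (simp add: shift_simps[OF r] shift_simps[OF s(2)])
next
  case (mult a b)
  then show ?case by (simp add: shift_simps[OF r] shift_simps[OF s(2)])
qed

lemma shift_iso:
  assumes r: "lin_on h r"
  shows "shift h r \<in> ring_iso (uea h) (uea h)"
proof -
  note m = lin_on_minus[OF r]
  have one: "shift h r \<one>\<^bsub>uea h\<^esub> = \<one>\<^bsub>uea h\<^esub>"
    unfolding uea_const_simps(3)[OF h, symmetric] by (rule shift_simps(4)[OF r])
  have "shift h r \<in> ring_hom (uea h) (uea h)"
    using shift_simps[OF r] one by (intro ring_hom_memI) auto
  moreover have "bij_betw (shift h r) (carrier (uea h)) (carrier (uea h))"
    by (rule bij_betw_byWitness[of _ "shift h (\<lambda>x. - r x)"])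
      (use shift_simps(1)[OF r] shift_simps(1)[OF m] in \<open>auto simp: shift_inverse r m\<close>)
  ultimately show ?thesis unfolding ring_iso_def by blast
qed

text \<open>Constants and h generate U(h), so the conditions on \<open>uea_shift\<close> leave only
  one function on the carrier.\<close>

lemma uea_shift_eq:
  assumes r: "lin_on h r"
  shows "uea_shift h r = shift h r"
  unfolding uea_shift_def
proof (rule the_equality)
  show "shift h r \<in> ring_iso (uea h) (uea h) \<and> shift h r \<in> extensional (carrier (uea h)) \<and>
     (\<forall>c. shift h r (uea_const h c) = uea_const h c) \<and>
     (\<forall>Y\<in>h. shift h r (uea_emb h Y) = uea_emb h Y \<oplus>\<^bsub>uea h\<^esub> uea_const h (r Y))"
    using shift_iso[OF r] shift_simps[OF r] by (auto simp: shift_def)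
  fix \<phi> assume p: "\<phi> \<in> ring_iso (uea h) (uea h) \<and> \<phi> \<in> extensional (carrier (uea h)) \<and>
     (\<forall>c. \<phi> (uea_const h c) = uea_const h c) \<and>
     (\<forall>Y\<in>h. \<phi> (uea_emb h Y) = uea_emb h Y \<oplus>\<^bsub>uea h\<^esub> uea_const h (r Y))"
  then have hom: "\<phi> \<in> ring_hom (uea h) (uea h)" and ext: "\<phi> \<in> extensional (carrier (uea h))"
    and c: "\<And>c. \<phi> (uea_const h c) = uea_const h c"
    and e: "\<And>Y. Y \<in> h \<Longrightarrow> \<phi> (uea_emb h Y) = uea_emb h Y \<oplus>\<^bsub>uea h\<^esub> uea_const h (r Y)"
    by (auto simp: ring_iso_def)
  show "\<phi> = shift h r"
  proof (rule extensionalityI[OF ext])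
    show "shift h r \<in> extensional (carrier (uea h))" by (simp add: shift_def)
    fix y assume "y \<in> carrier (uea h)"
    with h show "\<phi> y = shift h r y"
    proof (induct rule: uea_gen_induct)
      case (add a b)
      then show ?case by (simp add: ring_hom_add[OF hom] shift_simps[OF r])
    next
      case (mult a b)
      then show ?case by (simp add: ring_hom_mult[OF hom] shift_simps[OF r])
    qed (simp_all add: c e shift_simps[OF r])
  qed
qed

lemma calg_hom_shift:
  assumes r: "lin_on h r"
  shows "calg_hom (\<lambda>x. lift h (shift h r (component x h)))"
  unfolding calg_hom_def
  by (simp add: component_simps[OF h] shift_simps[OF r] component_closed[OF h] lift_add[OF h] lift_mult[OF h] lift_const[OF h])

lemma comm_monoid_uea: "comm_monoid (uea h)"
  by (rule monoid.monoid_comm_monoidI[OF ring.is_monoid[OF ring_uea[OF h]] uea_comm])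

lemma component_prod_list:
  assumes "distinct ks"
  shows "component (prod_list (map f ks)) h = (\<Otimes>\<^bsub>uea h\<^esub>k\<in>set ks. component (f k) h)"
  using assms
proof (induct ks)
  case Nil
  show ?case by (simp add: component_simps[OF h] comm_monoid.finprod_empty[OF comm_monoid_uea])
next
  case (Cons k ks)
  have "(\<Otimes>\<^bsub>uea h\<^esub>k\<in>insert k (set ks). component (f k) h) = component (f k) h \<otimes>\<^bsub>uea h\<^esub> (\<Otimes>\<^bsub>uea h\<^esub>k\<in>set ks. component (f k) h)"
    using Cons(2) by (intro comm_monoid.finprod_insert[OF comm_monoid_uea]) (auto simp: component_closed[OF h])
  then show ?case using Cons by (simp add: component_simps[OF h])
qed

end

context so_pos
begin

theorem shifted_hc_proj_Cn:
  "uea_shift (sub_h n) (rho (sub_h n) N) (hc_proj (so n) (sub_h n) N Nb (Cn n u)) = hc_image n u"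
proof -
  let ?h = "sub_h n" let ?R = "uea ?h"
  note h = hLie
  note ab = triangular.abel[OF tri]
  interpret Rh: ring ?R by (rule ring_uea[OF h])
  interpret Rm: comm_monoid ?R by (rule comm_monoid_uea[OF h ab])
  let ?\<rho> = "rho ?h N"
  have lin: "lin_on ?h ?\<rho>" unfolding lin_on_def using rho_add rho_smat by blast
  obtain ks where ks: "set ks = Ks" "distinct ks"
    and p: "hc_proj (so n) ?h N Nb (Cn n u) = component (prod_list (map (factor_h u (half_sum Ks)) ks)) ?h"
    using hc_proj_Cn[of u] by blast
  define t where "t k = lift ?h (uea_emb ?h (torus n k))" for k
  define f where "f k = cs (u\<^sup>2) - t k ^ 2" for k
  define F where "F x = lift ?h (shift ?h ?\<rho> (component x ?h))" for x
  have "calg_hom F" using calg_hom_shift[OF h ab lin] unfolding F_def .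
  note hom = hom_simps[OF this]
  have d: "F (x - y) = F x - F y" for x y using hom(1)[of "x - y" y] by (simp add: algebra_simps)
  \<comment> \<open>By \<open>rho_torus\<close> the number subtracted in the factor is the value of
    \<rho>, which the shift adds again.\<close>
  have Ff: "F (factor_h u (half_sum Ks) k) = f k" if k: "k \<in> Ks" for k
  proof -
    note kh = torus_h[OF k]
    have e: "shift ?h ?\<rho> (uea_emb ?h (torus n k)) = uea_emb ?h (torus n k) \<oplus>\<^bsub>?R\<^esub> uea_const ?h (half_sum Ks k)"
      using shift_simps(5)[OF h ab lin kh] unfolding rho_torus[OF k] .
    have "F (t k) = t k + cs (half_sum Ks k)"
      unfolding F_def t_def component_emb[OF h h order_refl kh] e
        lift_add[OF h uea_emb_closed[OF h kh] uea_const_closed[OF h]] lift_const[OF h] by (rule refl)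
    then show ?thesis
      unfolding factor_h_def f_def t_def[symmetric] power2_eq_square d hom(2,3) by simp
  qed
  have FP: "F (prod_list (map (factor_h u (half_sum Ks)) ks)) = prod_list (map f ks)" if "set ks \<subseteq> Ks" for ks
    using that by (induct ks) (simp_all add: hom(2,5) Ff del: One_nat_def atLeastAtMost_iff)
  have "shift ?h ?\<rho> (component (prod_list (map (factor_h u (half_sum Ks)) ks)) ?h) = component (F (prod_list (map (factor_h u (half_sum Ks)) ks))) ?h"
    using shift_simps(1)[OF h ab lin component_closed[OF h]] by (simp add: F_def component_lift[OF h h] uea_incl_self[OF h])
  also have "\<dots> = component (prod_list (map f ks)) ?h" using FP[of ks] ks by simp
  also have "\<dots> = (\<Otimes>\<^bsub>?R\<^esub>k\<in>Ks. component (f k) ?h)"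
    using component_prod_list[OF h ab ks(2), of f] unfolding ks(1) by blast
  finally have 1: "shift ?h ?\<rho> (hc_proj (so n) ?h N Nb (Cn n u)) = (\<Otimes>\<^bsub>?R\<^esub>k\<in>Ks. component (f k) ?h)" unfolding p .
  have af: "component (f k) ?h = uea_const ?h (u\<^sup>2) \<ominus>\<^bsub>?R\<^esub> uea_emb ?h (torus n k) [^]\<^bsub>?R\<^esub> (2::nat)" if k: "k \<in> Ks" for k
    unfolding f_def t_def component_simps[OF h] component_pow[OF h] component_emb[OF h h order_refl torus_h[OF k]] by (rule refl)
  have "(\<Otimes>\<^bsub>?R\<^esub>k\<in>Ks. component (f k) ?h) = hc_image n u"
  proof (cases "n < 2")
    case True
    then have "Ks = {}" by simp
    then show ?thesis using True by (simp add: hc_image_def)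
  next
    case False
    have s: "n div 2 = Suc ((n - 2) div 2)" using False by presburger
    have K: "Ks = insert 1 (Suc ` {1..(n-2) div 2})" unfolding s by (auto simp: image_iff)
    have "(\<Otimes>\<^bsub>?R\<^esub>k\<in>Ks. component (f k) ?h) = component (f 1) ?h \<otimes>\<^bsub>?R\<^esub> (\<Otimes>\<^bsub>?R\<^esub>k\<in>Suc ` {1..(n-2) div 2}. component (f k) ?h)"
      unfolding K by (rule Rm.finprod_insert) (auto simp: component_closed[OF h])
    also have "(\<Otimes>\<^bsub>?R\<^esub>k\<in>Suc ` {1..(n-2) div 2}. component (f k) ?h) = (\<Otimes>\<^bsub>?R\<^esub>i\<in>{1..(n-2) div 2}. component (f (Suc i)) ?h)"
      by (rule Rm.finprod_reindex) (auto simp: component_closed[OF h])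
    also have "\<dots> = (\<Otimes>\<^bsub>?R\<^esub>i\<in>{1..(n-2) div 2}. uea_const ?h (u\<^sup>2) \<ominus>\<^bsub>?R\<^esub> uea_emb ?h (elemT n i) [^]\<^bsub>?R\<^esub> (2::nat))"
    proof -
      have e: "component (f (Suc i)) ?h = uea_const ?h (u\<^sup>2) \<ominus>\<^bsub>?R\<^esub> uea_emb ?h (elemT n i) [^]\<^bsub>?R\<^esub> (2::nat)"
        if "i \<in> {1..(n-2) div 2}" for i
        using af[of "Suc i"] that unfolding s by (simp add: torus_def)
      show ?thesis by (rule Rm.finprod_cong') (use e component_closed[OF h] in \<open>auto simp flip: e\<close>)
    qed
    also have "component (f 1) ?h = uea_const ?h (u\<^sup>2) \<ominus>\<^bsub>?R\<^esub> uea_emb ?h (elemH n) [^]\<^bsub>?R\<^esub> (2::nat)"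
      using af[of 1] unfolding s by (simp add: torus_def elemT_0)
    finally show ?thesis using False by (simp add: hc_image_def Let_def)
  qed
  with 1 have "shift ?h ?\<rho> (hc_proj (so n) ?h N Nb (Cn n u)) = hc_image n u" by (rule trans)
  moreover have "uea_shift ?h ?\<rho> = shift ?h ?\<rho>" by (rule uea_shift_eq[OF h ab lin])
  ultimately show ?thesis by (simp only:)
qed

end

section \<open>The positive system of a pair of opposite Borel subalgebras\<close>

lemma subspace_plus:
  assumes "cmat.subspace V" "cmat.subspace U"
  shows "cmat.subspace (V + U)"
proof -
  have "V + U = {x + y | x y. x \<in> V \<and> y \<in> U}" by (auto simp: set_plus_def)
  then show ?thesis using cmat.subspace_sums[OF assms] by simp
qed

lemma subset_plus:
  assumes "cmat.subspace V" "cmat.subspace U"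
  shows "V \<subseteq> V + U" "U \<subseteq> V + U"
proof -
  have "x + y \<in> V + U" if "x \<in> V" "y \<in> U" for x y using that by (rule set_plus_intro)
  from this[of _ 0] this[of 0] show "V \<subseteq> V + U" "U \<subseteq> V + U"
    using cmat.subspace_0[OF assms(1)] cmat.subspace_0[OF assms(2)] by auto
qed

lemma lie_plus_right:
  assumes "X \<in> box n" "V \<subseteq> box n" "U \<subseteq> box n" "y \<in> V + U"
    and "\<And>y. y \<in> V \<Longrightarrow> lie X y \<in> V'" "\<And>y. y \<in> U \<Longrightarrow> lie X y \<in> U'"
  shows "lie X y \<in> V' + U'"
proof -
  obtain v w where y: "y = v + w" "v \<in> V" "w \<in> U" using assms(4) by (rule set_plus_elim)
  have "v \<in> box n" "w \<in> box n" using y assms by blast+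
  then have "lie X y = lie X v + lie X w" unfolding y(1) using assms(1) by (rule lie_box(2))
  then show ?thesis using assms(5)[OF y(2)] assms(6)[OF y(3)] by (simp only:) (rule set_plus_intro)
qed

lemma lie_plus_left:
  assumes "Y \<in> box n" "V \<subseteq> box n" "U \<subseteq> box n" "x \<in> V + U" "cmat.subspace W"
    and "\<And>x. x \<in> V \<Longrightarrow> lie x Y \<in> W" "\<And>x. x \<in> U \<Longrightarrow> lie x Y \<in> W"
  shows "lie x Y \<in> W"
proof -
  obtain v w where x: "x = v + w" "v \<in> V" "w \<in> U" using assms(4) by (rule set_plus_elim)
  have "v \<in> box n" "w \<in> box n" using x assms by blast+
  then have "lie x Y = lie v Y + lie w Y" unfolding x(1) using assms(1) by (rule lie_box(1))
  then show ?thesis using cmat.subspace_add[OF assms(5) assms(6)[OF x(2)] assms(7)[OF x(3)]] by (simp only:)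
qed

lemma lie_subalgebra_plus:
  assumes V: "cmat.subspace V" "V \<subseteq> box n" and U: "cmat.subspace U" "U \<subseteq> box n"
    and VV: "\<And>x y. x \<in> V \<Longrightarrow> y \<in> V \<Longrightarrow> lie x y \<in> V" and UV: "\<And>x y. x \<in> U \<Longrightarrow> y \<in> V \<Longrightarrow> lie x y \<in> V"
    and UU: "\<And>x y. x \<in> U \<Longrightarrow> y \<in> U \<Longrightarrow> lie x y \<in> U"
  shows "lie_subalgebra (V + U)"
  unfolding lie_subalgebra_def
proof (intro conjI ballI)
  note W = subspace_plus[OF V(1) U(1)] and sub = subset_plus[OF V(1) U(1)]
  show "cmat.subspace (V + U)" by (rule W)
  have box: "V + U \<subseteq> box n"
  proof
    fix x assume "x \<in> V + U"
    then obtain v w where x: "x = v + w" "v \<in> V" "w \<in> U" by (rule set_plus_elim)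
    then show "x \<in> box n" using cmat.subspace_add[OF subspace_box subsetD[OF V(2) x(2)] subsetD[OF U(2) x(3)]] by (simp only:)
  qed
  have VU: "lie x y \<in> V" if "x \<in> V" "y \<in> U" for x y
    using UV[OF that(2,1)] cmat.subspace_neg[OF V(1)] lie_anti(1)[of x y] by simp
  fix x y assume x: "x \<in> V + U" and y: "y \<in> V + U"
  have yb: "y \<in> box n" using y box by blast
  show "lie x y \<in> V + U"
  proof (rule lie_plus_left[OF yb V(2) U(2) x W])
    fix x assume x: "x \<in> V"
    have "lie x y \<in> V + V"
      by (rule lie_plus_right[OF _ V(2) U(2) y]) (use x V VV VU in auto)
    also have "V + V \<subseteq> V" using cmat.subspace_add[OF V(1)] by (auto elim!: set_plus_elim)
    finally show "lie x y \<in> V + U" using sub by blast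
  next
    fix x assume x: "x \<in> U"
    show "lie x y \<in> V + U"
      by (rule lie_plus_right[OF _ V(2) U(2) y]) (use x U UV UU in auto)
  qed
qed

lemma vs_D: "w \<in> vs m \<Longrightarrow> a \<notin> {1..m} \<Longrightarrow> w a = 0"
  unfolding vs_def by blast

lemma vs_I: "(\<And>a. a \<notin> {1..m} \<Longrightarrow> w a = 0) \<Longrightarrow> w \<in> vs m"
  unfolding vs_def by blast

lemma span_sk:
  "cmat.span ((\<lambda>i. sk v (unitv i)) ` {1..m}) = {sk v w | w. w \<in> vs m}"
proof (rule equalityI)
  show "cmat.span ((\<lambda>i. sk v (unitv i)) ` {1..m}) \<subseteq> {sk v w | w. w \<in> vs m}"
  proof (rule cmat.span_minimal)
    show "(\<lambda>i. sk v (unitv i)) ` {1..m} \<subseteq> {sk v w | w. w \<in> vs m}" using unitv_vs by blast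
    show "cmat.subspace {sk v w | w. w \<in> vs m}"
    proof (rule cmat.subspaceI)
      have "0 = sk v (\<lambda>_. 0)" by (simp add: sk_def fun_eq_iff)
      moreover have "(\<lambda>_. 0) \<in> vs m" by (simp add: vs_def)
      ultimately show "0 \<in> {sk v w | w. w \<in> vs m}" by blast
    next
      fix x y assume "x \<in> {sk v w | w. w \<in> vs m}" "y \<in> {sk v w | w. w \<in> vs m}"
      then obtain w w' where w: "x = sk v w" "w \<in> vs m" "y = sk v w'" "w' \<in> vs m" by blast
      have "x + y = sk v (\<lambda>i. w i + w' i)" unfolding w by (simp add: sk_def fun_eq_iff algebra_simps)
      moreover have "(\<lambda>i. w i + w' i) \<in> vs m" using vs_D[OF w(2)] vs_D[OF w(4)] by (intro vs_I) simp
      ultimately show "x + y \<in> {sk v w | w. w \<in> vs m}" by blast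
    next
      fix c x assume "x \<in> {sk v w | w. w \<in> vs m}"
      then obtain w where w: "x = sk v w" "w \<in> vs m" by blast
      have "smat c x = sk v (\<lambda>i. c * w i)" unfolding w by (simp add: sk_def smat_def fun_eq_iff algebra_simps)
      moreover have "(\<lambda>i. c * w i) \<in> vs m" using w unfolding vs_def by auto
      ultimately show "smat c x \<in> {sk v w | w. w \<in> vs m}" by blast
    qed
  qed
next
  show "{sk v w | w. w \<in> vs m} \<subseteq> cmat.span ((\<lambda>i. sk v (unitv i)) ` {1..m})"
  proof
    fix x assume "x \<in> {sk v w | w. w \<in> vs m}"
    then obtain w where w: "x = sk v w" "w \<in> vs m" by blast
    have sa: "(\<Sum>i\<in>S. f i) r s = (\<Sum>i\<in>S. f i r s)" for f :: "nat \<Rightarrow> cmat" and S r s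
      by (induct S rule: infinite_finite_induct) auto
    have z: "w s = 0" if "s \<notin> {1..m}" for s using w(2) that unfolding vs_def by blast
    have d: "(\<Sum>i\<in>{1..m}. if i = s then w s else 0) = w s" for s
      using z[of s] by simp
    have "(\<Sum>i\<in>{1..m}. smat (w i) (sk v (unitv i))) r s = x r s" for r s
    proof -
      have e: "smat (w i) (sk v (unitv i)) r s = v r * (if i = s then w s else 0) - v s * (if i = r then w r else 0)" for i
        by (auto simp: smat_def sk_def unitv_def)
      show ?thesis unfolding sa e sum_subtractf sum_distrib_left[symmetric] d by (simp add: w(1) sk_def)
    qed
    then have "x = (\<Sum>i\<in>{1..m}. smat (w i) (sk v (unitv i)))" by (intro ext) simp
    also have "\<dots> \<in> cmat.span ((\<lambda>i. sk v (unitv i)) ` {1..m})"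
      by (intro cmat.span_sum cmat.span_scale cmat.span_base imageI)
    finally show "x \<in> cmat.span ((\<lambda>i. sk v (unitv i)) ` {1..m})" .
  qed
qed

text \<open>As derived algebras, u and ubar contain all brackets of their Borel subalgebras; so they
  are subalgebras stable under t. Directness of the sum comes from the three intersections.\<close>

lemma opposite_borelsD:
  assumes "opposite_borels m t u ubar" and t: "cmat.subspace t"
  shows "lie_subalgebra u" "u \<subseteq> m" "lie_subalgebra ubar" "ubar \<subseteq> m" "t \<subseteq> m"
    "x \<in> t \<Longrightarrow> y \<in> u \<Longrightarrow> lie x y \<in> u" "x \<in> t \<Longrightarrow> y \<in> ubar \<Longrightarrow> lie x y \<in> ubar"
    "m = t + u + ubar"
    "a \<in> u \<Longrightarrow> b \<in> t \<Longrightarrow> c \<in> ubar \<Longrightarrow> a + b + c = 0 \<Longrightarrow> a = 0 \<and> b = 0 \<and> c = 0"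
proof -
  note o = assms(1)[unfolded opposite_borels_def]
  have gen: "lie_subalgebra v" "v \<subseteq> m" "t \<subseteq> m" "\<And>x y. x \<in> t \<Longrightarrow> y \<in> v \<Longrightarrow> lie x y \<in> v"
    if "borel_subalgebra m (t + v)" "v = lie_derived (t + v)" for v
  proof -
    have B: "lie_subalgebra (t + v)" "t + v \<subseteq> m" using that(1) unfolding borel_subalgebra_def by blast+
    have sv: "cmat.subspace v" by (subst that(2)) (simp add: lie_derived_def)
    note sub = subset_plus[OF t sv]
    have der: "lie x y \<in> v" if "x \<in> t + v" "y \<in> t + v" for x y
      by (subst \<open>v = _\<close>, unfold lie_derived_def, rule cmat.span_base) (use that in blast)
    show "lie_subalgebra v" unfolding lie_subalgebra_def using sv der sub by blast
    show "v \<subseteq> m" "t \<subseteq> m" using sub B by blast+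
    show "\<And>x y. x \<in> t \<Longrightarrow> y \<in> v \<Longrightarrow> lie x y \<in> v" using der sub by blast
  qed
  note oo = o[THEN conjunct2] note oo2 = oo[THEN conjunct2] note oo3 = oo2[THEN conjunct2] note oo4 = oo3[THEN conjunct2]
  note oo5 = oo4[THEN conjunct2] note oo6 = oo5[THEN conjunct2]
  note bu = o[THEN conjunct1] oo2[THEN conjunct1] and bb = oo3[THEN conjunct1] oo5[THEN conjunct1]
  note int = oo[THEN conjunct1] oo4[THEN conjunct1] oo6[THEN conjunct1] and sum = oo6[THEN conjunct2]
  note gu = gen[OF bu] and gb = gen[OF bb]
  show "lie_subalgebra u" "u \<subseteq> m" "t \<subseteq> m" by (rule gu)+
  show "lie_subalgebra ubar" "ubar \<subseteq> m" by (rule gb)+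
  show "x \<in> t \<Longrightarrow> y \<in> u \<Longrightarrow> lie x y \<in> u" by (rule gu(4))
  show "x \<in> t \<Longrightarrow> y \<in> ubar \<Longrightarrow> lie x y \<in> ubar" by (rule gb(4))
  show "m = t + u + ubar" by (rule sum)
  have su: "cmat.subspace u" and sb: "cmat.subspace ubar"
    using gu(1) gb(1) unfolding lie_subalgebra_def by blast+
  show "a = 0 \<and> b = 0 \<and> c = 0" if a: "a \<in> u" and b: "b \<in> t" and c: "c \<in> ubar" and s: "a + b + c = 0"
  proof -
    \<comment> \<open>This element lies in both Borel subalgebras, hence in t; the intersections of
      t with u and with ubar then leave only 0.\<close>
    have "b + a = 0 + - c" using s by (simp add: eq_neg_iff_add_eq_0 add.commute)
    moreover have "b + a \<in> t + u" using b a by (rule set_plus_intro)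
    moreover have "0 + - c \<in> t + ubar"
      using cmat.subspace_0[OF t] cmat.subspace_neg[OF sb c] by (rule set_plus_intro)
    ultimately have ba: "b + a \<in> t" using int(3) by auto
    have "a = (b + a) - b" by simp
    then have "a \<in> t" using cmat.subspace_diff[OF t ba b] by (simp only:)
    then have a0: "a = 0" using a int(1) by blast
    then have "c = - b" using s by (simp add: eq_neg_iff_add_eq_0 add.commute)
    then have "c \<in> t" using cmat.subspace_neg[OF t b] by (simp only:)
    then have "c = 0" using c int(2) by blast
    then show ?thesis using a0 s by simp
  qed
qed

lemma sub_h_subspace: "cmat.subspace (sub_h n)"
  unfolding sub_h_eq by (rule cmat.subspace_span)

lemma sub_h_so: "sub_h n \<subseteq> so n"
proof -
  have "cmat.subspace (so n)" using lie_subalgebra_so unfolding lie_subalgebra_def by blast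
  then show ?thesis unfolding sub_h_eq by (rule cmat.span_minimal[rotated]) (auto intro!: torus_so)
qed

text \<open>\<open>torus n l\<close> is a multiple of \<open>R n l (- l)\<close>, on which every
  \<open>torus n k\<close> acts with weight 0.\<close>

lemma sub_h_abel:
  assumes x: "x \<in> sub_h n" and y: "y \<in> sub_h n"
  shows "lie x y = 0"
proof -
  have b: "x \<in> box n" if "x \<in> sub_h n" for x using that sub_h_so so_box by blast
  have TT: "lie (torus n k) (torus n l) = 0" if k: "k \<in> {1..n div 2}" and l: "l \<in> {1..n div 2}" for k l
  proof -
    have k': "1 \<le> k" "k \<le> n div 2" and l': "1 \<le> l" "l \<le> n div 2" using k l by auto
    note li = idx_pos[OF l'] and lm = idx_uminus[OF idx_pos[OF l']]
    have Rb: "R n (int l) (- int l) \<in> box n" using R_so[OF li lm] so_box by blast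
    have Tb: "torus n k \<in> box n" using torus_so[OF k'] so_box by blast
    have "sign_weight (int l) k + sign_weight (- int l) k = 0" using k' l' by (auto simp: sign_weight_def)
    then have "lie (torus n k) (R n (int l) (- int l)) = 0"
      using lie_torus_R[OF k' li lm] by (simp only: cmat.scale_zero_left)
    then show ?thesis unfolding torus_R[OF l'] lie_box(4)[OF Rb Rb Tb] by (simp only: cmat.scale_zero_right)
  qed
  have sub: "cmat.subspace {x \<in> box n. \<forall>y\<in>Y. lie x y = 0}" if Y: "Y \<subseteq> box n" for Y
  proof (rule cmat.subspaceI)
    have "lie 0 y = 0" for y by (simp add: lie_def mmul_def fun_eq_iff)
    then show "0 \<in> {x \<in> box n. \<forall>y\<in>Y. lie x y = 0}" using cmat.subspace_0[OF subspace_box] by blast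
  next
    fix x x' assume "x \<in> {x \<in> box n. \<forall>y\<in>Y. lie x y = 0}" "x' \<in> {x \<in> box n. \<forall>y\<in>Y. lie x y = 0}"
    then have x: "x \<in> box n" "x' \<in> box n" "\<And>y. y \<in> Y \<Longrightarrow> lie x y = 0" "\<And>y. y \<in> Y \<Longrightarrow> lie x' y = 0" by blast+
    have "lie (x + x') y = 0" if "y \<in> Y" for y
      using lie_box(1)[OF x(1,2) subsetD[OF Y that]] x(3,4)[OF that] by (simp only: add_0_left)
    then show "x + x' \<in> {x \<in> box n. \<forall>y\<in>Y. lie x y = 0}" using cmat.subspace_add[OF subspace_box x(1,2)] by blast
  next
    fix c x assume "x \<in> {x \<in> box n. \<forall>y\<in>Y. lie x y = 0}"
    then have x: "x \<in> box n" "\<And>y. y \<in> Y \<Longrightarrow> lie x y = 0" by blast+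
    have "lie (smat c x) y = 0" if "y \<in> Y" for y
      using lie_box(3)[OF x(1,1) subsetD[OF Y that]] x(2)[OF that] by (simp only: cmat.scale_zero_right)
    then show "smat c x \<in> {x \<in> box n. \<forall>y\<in>Y. lie x y = 0}" using cmat.subspace_scale[OF subspace_box x(1)] by blast
  qed
  have Tb: "torus n ` {1..n div 2} \<subseteq> box n"
    using torus_so by (intro image_subsetI subsetD[OF so_box]) auto
  have "sub_h n \<subseteq> {x \<in> box n. \<forall>y\<in>torus n ` {1..n div 2}. lie x y = 0}"
    by (subst sub_h_eq, rule cmat.span_minimal[OF _ sub[OF Tb]]) (use TT Tb in blast)
  then have 1: "lie x y = 0" if "x \<in> sub_h n" "y \<in> torus n ` {1..n div 2}" for x y using that by blast
  have hb: "sub_h n \<subseteq> box n" using b by blast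
  have "sub_h n \<subseteq> {x \<in> box n. \<forall>y\<in>sub_h n. lie x y = 0}"
  proof (subst sub_h_eq, rule cmat.span_minimal[OF _ sub[OF hb]], rule subsetI)
    fix T assume T: "T \<in> torus n ` {1..n div 2}"
    have "lie T y = 0" if "y \<in> sub_h n" for y
      unfolding lie_anti(1)[of T y] 1[OF that T] by simp
    then show "T \<in> {x \<in> box n. \<forall>y\<in>sub_h n. lie x y = 0}" using T Tb by blast
  qed
  then show ?thesis using x y by blast
qed

context
  fixes n :: nat and u ubar :: "cmat set"
  assumes ob: "opposite_borels (sub_m n) (sub_tm n) u ubar" and n2: "2 \<le> n"
begin

lemma one_idx: "1 \<in> idx n" "- 1 \<in> idx n"
  using n2 by (auto simp: idx_def)

abbreviation "\<nu> \<equiv> nu n"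

lemma nu1: "\<nu> 1 = (\<lambda>a. unitv (n - 1) a + \<i> * unitv n a)" "\<nu> (- 1) = (\<lambda>a. unitv (n - 1) a - \<i> * unitv n a)"
proof -
  have "n + 1 - 2 * nat \<bar>1\<bar> = n - 1" "n + 2 - 2 * nat \<bar>1\<bar> = n" "n + 1 - 2 * nat \<bar>-1\<bar> = n - 1" "n + 2 - 2 * nat \<bar>-1\<bar> = n" "n - 1 \<noteq> n"
    using n2 by simp_all
  then show "\<nu> 1 = (\<lambda>a. unitv (n - 1) a + \<i> * unitv n a)" "\<nu> (- 1) = (\<lambda>a. unitv (n - 1) a - \<i> * unitv n a)"
    by (simp_all add: nu_def unitv_def fun_eq_iff)
qed

text \<open>\<open>elemX n i\<close> and \<open>elemXbar n i\<close> are the bivectors of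
  \<open>nu n 1\<close> and of \<open>nu n (- 1)\<close> with the i-th unit vector.\<close>

lemma sub_n_eq: "sub_n n = {sk (\<nu> 1) w | w. w \<in> vs (n - 2)}" "sub_nbar n = {sk (\<nu> (- 1)) w | w. w \<in> vs (n - 2)}"
proof -
  have "elemX n = (\<lambda>i. sk (\<nu> 1) (unitv i))" "elemXbar n = (\<lambda>i. sk (\<nu> (- 1)) (unitv i))"
    unfolding elemX_def[abs_def] elemXbar_def[abs_def] nu1 skew_sk
    by (simp_all add: fun_eq_iff sk_def smat_def algebra_simps)
  then show "sub_n n = {sk (\<nu> 1) w | w. w \<in> vs (n - 2)}" "sub_nbar n = {sk (\<nu> (- 1)) w | w. w \<in> vs (n - 2)}"
    unfolding sub_n_def sub_nbar_def span_sk[symmetric] by (simp_all only:)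
qed

lemma vs_mono: "w \<in> vs (n - 2) \<Longrightarrow> w \<in> vs n"
  unfolding vs_def by fastforce

lemma vs_zero: "w \<in> vs (n - 2) \<Longrightarrow> w (n - 1) = 0" "w \<in> vs (n - 2) \<Longrightarrow> w n = 0"
proof -
  have "n - 1 \<notin> {1..n-2}" "n \<notin> {1..n-2}" using n2 by auto
  then show "w \<in> vs (n - 2) \<Longrightarrow> w (n - 1) = 0" "w \<in> vs (n - 2) \<Longrightarrow> w n = 0" using vs_D by blast+
qed

lemma nu_out: "a \<noteq> n - 1 \<Longrightarrow> a \<noteq> n \<Longrightarrow> e = 1 \<or> e = - 1 \<Longrightarrow> \<nu> e a = 0"
  using nu1 by (auto simp: unitv_def)

lemma ip_nu_vs: 
  assumes w: "w \<in> vs (n - 2)" and e: "e = 1 \<or> e = - 1"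
  shows "ip n (\<nu> e) w = 0" "ip n w (\<nu> e) = 0"
proof -
  have "\<nu> e a * w a = 0" for a
    using vs_zero[OF w] nu_out[OF _ _ e, of a] by (cases "a = n - 1 \<or> a = n") auto
  then show "ip n (\<nu> e) w = 0" "ip n w (\<nu> e) = 0" unfolding ip_def
    by (intro sum.neutral ballI; simp only: mult.commute[of "w _"])+
qed

lemma act_m:
  assumes Z: "Z \<in> so (n - 2)"
  shows "e = 1 \<or> e = - 1 \<Longrightarrow> act n Z (\<nu> e) = (\<lambda>_. 0)" "act n Z w \<in> vs (n - 2)"
proof -
  have z: "Z a b = 0" if "a \<notin> {1..n-2} \<or> b \<notin> {1..n-2}" for a b using Z that unfolding so_def by blast
  have "Z a b * \<nu> e b = 0" if "e = 1 \<or> e = - 1" for a b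
  proof (cases "b = n - 1 \<or> b = n")
    case True
    then have "b \<notin> {1..n-2}" using n2 by auto
    then show ?thesis using z[of a b] by simp
  next
    case False
    then show ?thesis using nu_out[OF _ _ that, of b] by simp
  qed
  then show "e = 1 \<or> e = - 1 \<Longrightarrow> act n Z (\<nu> e) = (\<lambda>_. 0)"
    unfolding act_def by (intro ext sum.neutral ballI)
  have "act n Z w a = 0" if "a \<notin> {1..n-2}" for a using z that by (simp add: act_def)
  then show "act n Z w \<in> vs (n - 2)" unfolding vs_def by blast
qed

lemma so_m: "so (n - 2) \<subseteq> so n" by (rule lie_subalgebra_so_mono) simp

lemma lie_m_X:
  assumes Z: "Z \<in> so (n - 2)" and w: "w \<in> vs (n - 2)" and e: "e = 1 \<or> e = - 1"
  shows "lie Z (sk (\<nu> e) w) = sk (\<nu> e) (act n Z w)"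
proof -
  have "\<nu> e \<in> vs n" using e nu_vs one_idx by blast
  then have "lie Z (sk (\<nu> e) w) = sk (act n Z (\<nu> e)) w + sk (\<nu> e) (act n Z w)"
    using so_m Z vs_mono[OF w] by (intro lie_sk) auto
  also have "sk (act n Z (\<nu> e)) w = 0" unfolding act_m(1)[OF Z e] by (simp add: sk_def fun_eq_iff)
  finally show ?thesis by (simp only: add_0_left)
qed

lemma one_Ks: "1 \<le> (1::nat)" "1 \<le> n div 2" using n2 by auto

lemma H_torus: "elemH n = torus n 1" by (simp add: torus_def elemT_0)

lemma lie_H_m:
  assumes Z: "Z \<in> so (n - 2)"
  shows "lie (elemH n) Z = 0"
proof -
  have H: "elemH n = smat (1/2) (sk (\<nu> 1) (\<nu> (-1)))" unfolding H_torus torus_R[OF one_Ks] R_def by simp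
  have v: "\<nu> 1 \<in> vs n" "\<nu> (-1) \<in> vs n" using nu_vs one_idx by blast+
  have Zn: "Z \<in> so n" using Z so_m by blast
  have "lie Z (sk (\<nu> 1) (\<nu> (-1))) = sk (act n Z (\<nu> 1)) (\<nu> (-1)) + sk (\<nu> 1) (act n Z (\<nu> (-1)))"
    by (rule lie_sk[OF Zn v])
  also have "\<dots> = 0" using act_m(1)[OF Z, of 1] act_m(1)[OF Z, of "-1"] by (simp add: sk_def fun_eq_iff)
  finally have 0: "lie Z (sk (\<nu> 1) (\<nu> (-1))) = 0" .
  have b: "sk (\<nu> 1) (\<nu> (-1)) \<in> box n" "Z \<in> box n" using sk_so[OF v] Zn so_box by blast+
  have "lie Z (elemH n) = 0" unfolding H lie_box(4)[OF b(1,1,2)] 0 by (rule cmat.scale_zero_right)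
  then show ?thesis using lie_anti(1)[of "elemH n" Z] by simp
qed

lemma lie_H_X:
  assumes w: "w \<in> vs (n - 2)" and e: "e = 1 \<or> e = - 1"
  shows "lie (elemH n) (sk (\<nu> e) w) = smat (of_int e) (sk (\<nu> e) w)"
proof -
  have ei: "e \<in> idx n" using e one_idx by blast
  have aw: "act n (elemH n) w = (\<lambda>_. 0)"
    unfolding H_torus torus_R[OF one_Ks] R_def act_lin act_sk using ip_nu_vs[OF w] by (simp add: fun_eq_iff)
  have an: "act n (elemH n) (\<nu> e) = (\<lambda>i. of_int e * \<nu> e i)"
    unfolding H_torus act_torus[OF one_Ks ei] using e by (auto simp: sign_weight_def)
  show ?thesis
    unfolding H_torus lie_sk[OF torus_so[OF one_Ks] nu_vs[OF ei] vs_mono[OF w]]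
    unfolding H_torus[symmetric] aw an by (simp add: sk_def smat_def fun_eq_iff algebra_simps)
qed

lemma lie_X_X:
  assumes w: "w \<in> vs (n - 2)" "w' \<in> vs (n - 2)" and e: "e = 1 \<or> e = - 1"
  shows "lie (sk (\<nu> e) w) (sk (\<nu> e) w') = 0"
proof -
  have ei: "e \<in> idx n" using e one_idx by blast
  have "ip n (\<nu> e) (\<nu> e) = 0" unfolding ip_nu[OF ei ei] using e by auto
  then show ?thesis
    unfolding lie_sk_sk[OF nu_vs[OF ei] vs_mono[OF w(1)] nu_vs[OF ei] vs_mono[OF w(2)]]
      ip_nu_vs[OF w(1) e] ip_nu_vs[OF w(2) e]
    by (simp add: sk_def smat_def fun_eq_iff)
qed

lemma sub_subspaces: "cmat.subspace (sub_n n)" "cmat.subspace (sub_nbar n)" "cmat.subspace (sub_tm n)" "cmat.subspace (sub_a n)"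
  by (simp_all add: sub_n_def sub_nbar_def sub_tm_def sub_a_def)

lemmas obD = opposite_borelsD[OF ob sub_subspaces(3), unfolded sub_m_def]

lemma subspace_u: "cmat.subspace u" "cmat.subspace ubar"
  using obD(1,3) unfolding lie_subalgebra_def by blast+

lemma X_so: "{sk (\<nu> e) w | w. w \<in> vs (n - 2)} \<subseteq> so n" if "e = 1 \<or> e = - 1"
  using that one_idx nu_vs vs_mono by (auto intro!: sk_so)

text \<open>One argument for both halves of the decomposition: e = 1 gives the positive system, e =
  - 1 its opposite.\<close>

lemma half:
  assumes e: "e = 1 \<or> e = - 1" and X: "X = {sk (\<nu> e) w | w. w \<in> vs (n - 2)}" "cmat.subspace X"
    and v: "lie_subalgebra v" "v \<subseteq> so (n - 2)" "\<And>x y. x \<in> sub_tm n \<Longrightarrow> y \<in> v \<Longrightarrow> lie x y \<in> v"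
  shows "lie_subalgebra (X + v)" "\<And>x y. x \<in> sub_h n \<Longrightarrow> y \<in> X + v \<Longrightarrow> lie x y \<in> X + v"
proof -
  have sv: "cmat.subspace v" using v(1) unfolding lie_subalgebra_def by blast
  have Xb: "X \<subseteq> box n" unfolding X(1) using X_so[OF e] so_box by blast
  have vb: "v \<subseteq> box n" using v(2) so_m so_box by blast
  have mX: "lie Z y \<in> X" if "Z \<in> so (n - 2)" "y \<in> X" for Z y
    using that lie_m_X[OF that(1) _ e] act_m(2)[OF that(1)] unfolding X(1) by blast
  show "lie_subalgebra (X + v)"
  proof (rule lie_subalgebra_plus[OF X(2) Xb sv vb])
    show "lie x y \<in> X" if "x \<in> X" "y \<in> X" for x y
    proof -
      have "lie x y = 0" using that lie_X_X[OF _ _ e] unfolding X(1) by blast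
      then show ?thesis using cmat.subspace_0[OF X(2)] by (simp only:)
    qed
    show "lie x y \<in> X" if "x \<in> v" "y \<in> X" for x y using mX that v(2) by blast
    show "lie x y \<in> v" if "x \<in> v" "y \<in> v" for x y using lie_subalgebraD(3)[OF v(1) that] .
  qed
  fix x y assume x: "x \<in> sub_h n" and y: "y \<in> X + v"
  have tb: "sub_tm n \<subseteq> box n" using obD(5) so_m so_box by blast
  have ab: "sub_a n \<subseteq> box n"
    using subset_plus(2)[OF sub_subspaces(3,4)] sub_h_so[of n] so_box unfolding sub_h_def by blast
  have aE: "\<exists>c. x = smat c (elemH n)" if "x \<in> sub_a n" for x
    using that n2 unfolding sub_a_def cmat.span_singleton by auto
  have Hb: "elemH n \<in> box n" using elem_so(1)[OF n2] so_box by blast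
  have xb: "x \<in> box n" using x sub_h_so so_box by blast
  show "lie x y \<in> X + v"
  proof (rule lie_plus_right[OF xb Xb vb y])
    fix y assume y: "y \<in> X"
    show "lie x y \<in> X"
    proof (rule lie_plus_left[OF _ tb ab x[unfolded sub_h_def] X(2)])
      show "y \<in> box n" using y Xb by blast
      show "lie x y \<in> X" if "x \<in> sub_tm n" for x using mX y that obD(5) by blast
      fix x assume "x \<in> sub_a n"
      then obtain c where c: "x = smat c (elemH n)" using aE by blast
      obtain w where w: "y = sk (\<nu> e) w" "w \<in> vs (n - 2)" using y X(1) by blast
      have "lie x y = smat c (smat (of_int e) y)"
        unfolding c lie_box(3)[OF Hb Hb subsetD[OF Xb y]] unfolding w(1) lie_H_X[OF w(2) e] by (rule refl)
      then show "lie x y \<in> X" using cmat.subspace_scale[OF X(2) cmat.subspace_scale[OF X(2) y]] by (simp only:)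
    qed
  next
    fix y assume y: "y \<in> v"
    show "lie x y \<in> v"
    proof (rule lie_plus_left[OF _ tb ab x[unfolded sub_h_def] sv])
      show yb: "y \<in> box n" using y vb by blast
      show "lie x y \<in> v" if "x \<in> sub_tm n" for x using v(3) y that by blast
      fix x assume "x \<in> sub_a n"
      then obtain c where c: "x = smat c (elemH n)" using aE by blast
      have "lie (elemH n) y = 0" using lie_H_m y v(2) by blast
      then have "lie x y = 0" unfolding c lie_box(3)[OF Hb Hb yb] by (simp only: cmat.scale_zero_right)
      then show "lie x y \<in> v" using cmat.subspace_0[OF sv] by (simp only:)
    qed
  qed
qed

lemma so_decomp: "so n = (sub_n n + u) + sub_h n + (sub_nbar n + ubar)"
proof (rule equalityI)
  note sN = subspace_plus[OF sub_subspaces(1) subspace_u(1)] and sB = subspace_plus[OF sub_subspaces(2) subspace_u(2)]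
  note sh = sub_h_subspace[of n]
  note sNh = subspace_plus[OF sN sh]
  let ?W = "(sub_n n + u) + sub_h n + (sub_nbar n + ubar)"
  have W: "cmat.subspace ?W" by (rule subspace_plus[OF sNh sB])
  have i1: "sub_n n + u \<subseteq> ?W" "sub_h n \<subseteq> ?W" "sub_nbar n + ubar \<subseteq> ?W"
    using subset_plus[OF sN sh] subset_plus[OF sNh sB] by blast+
  have i2: "sub_n n \<subseteq> ?W" "u \<subseteq> ?W" "sub_nbar n \<subseteq> ?W" "ubar \<subseteq> ?W" "sub_tm n \<subseteq> ?W" "sub_a n \<subseteq> ?W"
    using i1 subset_plus[OF sub_subspaces(1) subspace_u(1)] subset_plus[OF sub_subspaces(2) subspace_u(2)]
      subset_plus[OF sub_subspaces(3,4)] unfolding sub_h_def by blast+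
  have i3: "so (n - 2) \<subseteq> ?W"
  proof
    fix Z assume "Z \<in> so (n - 2)"
    then have "Z \<in> sub_tm n + u + ubar" using obD(8) by simp
    then obtain a b c where Z: "Z = a + b + c" "a \<in> sub_tm n" "b \<in> u" "c \<in> ubar"
      by (auto elim!: set_plus_elim)
    show "Z \<in> ?W"
      unfolding Z(1)
      by (intro cmat.subspace_add[OF W] subsetD[OF i2(5) Z(2)] subsetD[OF i2(2) Z(3)] subsetD[OF i2(4) Z(4)])
  qed
  have sym: "skew j i \<in> ?W" if "skew i j \<in> ?W" for i j
    unfolding skew_anti[of j i] using cmat.subspace_scale[OF W that] .
  have X: "skew (n - 1) i \<in> ?W" "skew n i \<in> ?W" if i: "i \<in> {1..n-2}" for i
  proof -
    have X: "elemX n i \<in> ?W" using i i2(1) unfolding sub_n_def by (blast intro: cmat.span_base)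
    have Y: "elemXbar n i \<in> ?W" using i i2(3) unfolding sub_nbar_def by (blast intro: cmat.span_base)
    have "skew (n - 1) i = smat (1/2) (elemX n i + elemXbar n i)"
      unfolding elemX_def elemXbar_def by (simp add: smat_def fun_eq_iff)
    then show "skew (n - 1) i \<in> ?W" using cmat.subspace_scale[OF W cmat.subspace_add[OF W X Y]] by (simp only:)
    have "skew n i = smat (- \<i>/2) (elemX n i - elemXbar n i)"
      unfolding elemX_def elemXbar_def by (simp add: smat_def fun_eq_iff algebra_simps)
    then show "skew n i \<in> ?W" using cmat.subspace_scale[OF W cmat.subspace_diff[OF W X Y]] by (simp only:)
  qed
  have Hs: "skew n (n - 1) \<in> ?W"
  proof -
    have "elemH n \<in> ?W" using i2(6) n2 unfolding sub_a_def by (auto intro: cmat.span_base)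
    moreover have "skew n (n - 1) = smat (- \<i>) (elemH n)" unfolding elemH_def by (simp add: smat_def fun_eq_iff)
    ultimately show ?thesis using cmat.subspace_scale[OF W] by (simp only:)
  qed
  have diag: "skew i i \<in> ?W" for i
  proof -
    have "skew i i = 0" by (simp add: skew_def)
    then show ?thesis using cmat.subspace_0[OF W] by (simp only:)
  qed
  have sk: "skew i j \<in> ?W" if i: "i \<in> {1..n}" and j: "j \<in> {1..n}" for i j
  proof -
    have c: "k \<in> {1..n-2} \<or> k = n - 1 \<or> k = n" if "k \<in> {1..n}" for k using that n2 by auto
    consider "i \<in> {1..n-2}" "j \<in> {1..n-2}" | "i = n - 1" "j \<in> {1..n-2}" | "i = n" "j \<in> {1..n-2}"
      | "j = n - 1" "i \<in> {1..n-2}" | "j = n" "i \<in> {1..n-2}" | "i = j" | "i = n" "j = n - 1" | "i = n - 1" "j = n"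
      using c[OF i] c[OF j] by blast
    then show ?thesis
    proof cases
      case 1 then show ?thesis by (rule subsetD[OF i3 skew_so])
    next
      case 2 then show ?thesis using X(1) by simp
    next
      case 3 then show ?thesis using X(2) by simp
    next
      case 4 then show ?thesis using sym[OF X(1)] by simp
    next
      case 5 then show ?thesis using sym[OF X(2)] by simp
    next
      case 6 then show ?thesis using diag by simp
    next
      case 7 then show ?thesis using Hs by simp
    next
      case 8 then show ?thesis using sym[OF Hs] by simp
    qed
  qed
  show "so n \<subseteq> ?W"
  proof
    fix Z assume Z: "Z \<in> so n"
    have "(\<Sum>i\<in>{1..n}. \<Sum>j\<in>{1..n}. smat (Z i j / 2) (skew i j)) \<in> ?W"
      by (intro cmat.subspace_sum[OF W] cmat.subspace_scale[OF W] sk)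
    then show "Z \<in> ?W" by (subst so_sum_skew[OF Z])
  qed
  have s: "sub_n n \<subseteq> so n" "sub_nbar n \<subseteq> so n" unfolding sub_n_eq using X_so by blast+
  have s': "u \<subseteq> so n" "ubar \<subseteq> so n" using obD(2,4) so_m by blast+
  show "?W \<subseteq> so n"
  proof
    fix x assume "x \<in> ?W"
    then obtain p q r where x: "x = p + q + r" "p \<in> sub_n n + u" "q \<in> sub_h n" "r \<in> sub_nbar n + ubar"
      by (elim set_plus_elim[of x] set_plus_elim[of _ "sub_n n + u"]) blast
    obtain a b where p: "p = a + b" "a \<in> sub_n n" "b \<in> u" using x(2) by (rule set_plus_elim)
    obtain c d where r: "r = c + d" "c \<in> sub_nbar n" "d \<in> ubar" using x(4) by (rule set_plus_elim)
    show "x \<in> so n"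
      unfolding x(1) p(1) r(1)
      by (intro lie_subalgebraD(1)[OF lie_subalgebra_so[of n]] subsetD[OF s(1) p(2)] subsetD[OF s(2) r(2)]
        subsetD[OF s'(1) p(3)] subsetD[OF s'(2) r(3)] subsetD[OF sub_h_so x(3)])
  qed
qed

text \<open>The rows n - 1 and n outside the last two columns separate the bivectors of the two null
  vectors, and the entry at (n, n - 1) isolates H. What remains lies in \<open>so (n - 2)\<close>,
  where the opposite Borel subalgebras give directness.\<close>

lemma so_direct:
  assumes x: "x \<in> sub_n n + u" and y: "y \<in> sub_h n" and z: "z \<in> sub_nbar n + ubar" and s: "x + y + z = 0"
  shows "x = 0 \<and> y = 0 \<and> z = 0"
proof -
  obtain a1 u1 where x': "x = a1 + u1" "a1 \<in> sub_n n" "u1 \<in> u" using x by (rule set_plus_elim)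
  obtain t1 A1 where y': "y = t1 + A1" "t1 \<in> sub_tm n" "A1 \<in> sub_a n" using y unfolding sub_h_def by (rule set_plus_elim)
  obtain b1 v1 where z': "z = b1 + v1" "b1 \<in> sub_nbar n" "v1 \<in> ubar" using z by (rule set_plus_elim)
  obtain w where w: "a1 = sk (\<nu> 1) w" "w \<in> vs (n - 2)" using x' sub_n_eq by blast
  obtain w' where w': "b1 = sk (\<nu> (-1)) w'" "w' \<in> vs (n - 2)" using z' sub_n_eq by blast
  obtain c where c: "A1 = smat c (elemH n)" using y'(3) n2 unfolding sub_a_def cmat.span_singleton by auto
  define r where "r = u1 + t1 + v1"
  have rm: "r \<in> so (n - 2)"
    unfolding r_def using x'(3) y'(2) z'(3) obD(2,4,5) by (intro lie_subalgebraD(1)[OF lie_subalgebra_so]) blast+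
  have r0: "r i j = 0" if "i \<notin> {1..n-2} \<or> j \<notin> {1..n-2}" for i j using rm that unfolding so_def by blast
  have e: "a1 i j + A1 i j + b1 i j + r i j = 0" for i j
  proof -
    have "(x + y + z) i j = 0" unfolding s by simp
    then show ?thesis unfolding x'(1) y'(1) z'(1) r_def by (simp add: algebra_simps)
  qed
  have ne: "n - 1 \<noteq> n" "n - 1 \<notin> {1..n-2}" "n \<notin> {1..n-2}" using n2 by auto
  have An: "elemH n n (n - 1) = \<i>" using ne by (simp add: elemH_def smat_def skew_def munit_def)
  have Az: "elemH n i j = 0" if "j \<notin> {n - 1, n}" for i j using that by (auto simp: elemH_def smat_def skew_def munit_def)
  have vn: "\<nu> 1 (n - 1) = 1" "\<nu> (-1) (n - 1) = 1" "\<nu> 1 n = \<i>" "\<nu> (-1) n = - \<i>" using nu1 ne by (simp_all add: unitv_def)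
  have vz: "\<nu> 1 j = 0" "\<nu> (-1) j = 0" if "j \<notin> {n - 1, n}" for j using nu1 that by (auto simp: unitv_def)
  have "w j = 0 \<and> w' j = 0" for j
  proof (cases "j \<in> {1..n-2}")
    case False
    then show ?thesis using w(2) w'(2) unfolding vs_def by blast
  next
    case True
    then have j: "j \<notin> {n - 1, n}" using n2 by auto
    have "w j + w' j = 0"
      using e[of "n - 1" j] r0[of "n - 1" j] ne unfolding w(1) w'(1) c by (simp add: sk_def smat_def Az[OF j] vn vz[OF j] del: One_nat_def)
    moreover have "\<i> * w j - \<i> * w' j = 0"
      using e[of n j] r0[of n j] ne unfolding w(1) w'(1) c by (simp add: sk_def smat_def Az[OF j] vn vz[OF j] del: One_nat_def)
    then have "\<i> * (w j - w' j) = 0" by (simp only: right_diff_distrib)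
    then have "w j = w' j" by simp
    ultimately show ?thesis by simp
  qed
  then have a0: "a1 = 0" "b1 = 0" unfolding w(1) w'(1) by (simp_all add: sk_def fun_eq_iff)
  have "c = 0" using e[of n "n - 1"] r0[of n "n - 1"] ne An unfolding a0 c by (simp add: smat_def)
  then have A0: "A1 = 0" unfolding c by (simp only: cmat.scale_zero_left)
  have "r i j = 0" for i j using e[of i j] unfolding a0 A0 by simp
  then have "u1 + t1 + v1 = 0" unfolding r_def[symmetric] by (intro ext) simp
  from obD(9)[OF x'(3) y'(2) z'(3) this] show ?thesis unfolding x'(1) y'(1) z'(1) a0 A0 by (simp only: add_0_left add_0_right)
qed

lemma so_pos_instance: "so_pos (sub_n n + u) (sub_nbar n + ubar) n"
proof (rule so_pos.intro)
  have e: "(1::int) = 1 \<or> (1::int) = - 1" "(- 1::int) = 1 \<or> (- 1::int) = - 1" by simp_all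
  note h1 = half[OF e(1) sub_n_eq(1) sub_subspaces(1) obD(1,2,6)]
  note h2 = half[OF e(2) sub_n_eq(2) sub_subspaces(2) obD(3,4,7)]
  show "triangular (so n) (sub_n n + u) (sub_h n) (sub_nbar n + ubar) n"
  proof
    show "lie_subalgebra (so n)" by (rule lie_subalgebra_so)
    show "so n \<subseteq> box n" by (rule so_box)
    show "lie_subalgebra (sub_n n + u)" by (rule h1(1))
    show "lie_subalgebra (sub_nbar n + ubar)" by (rule h2(1))
    show "lie_subalgebra (sub_h n)"
      unfolding lie_subalgebra_def using sub_h_subspace cmat.subspace_0[OF sub_h_subspace] sub_h_abel by simp
    show "so n = sub_n n + u + sub_h n + (sub_nbar n + ubar)" by (rule so_decomp)
    show "\<And>x y z. x \<in> sub_n n + u \<Longrightarrow> y \<in> sub_h n \<Longrightarrow> z \<in> sub_nbar n + ubar \<Longrightarrow> x + y + z = 0 \<Longrightarrow> x = 0 \<and> y = 0 \<and> z = 0"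
      by (rule so_direct)
    show "\<And>x y. x \<in> sub_h n \<Longrightarrow> y \<in> sub_h n \<Longrightarrow> lie x y = 0" by (rule sub_h_abel)
  qed
  show "\<And>x y. x \<in> sub_h n \<Longrightarrow> y \<in> sub_n n + u \<Longrightarrow> lie x y \<in> sub_n n + u" by (rule h1(2))
  show "\<And>x y. x \<in> sub_h n \<Longrightarrow> y \<in> sub_nbar n + ubar \<Longrightarrow> lie x y \<in> sub_nbar n + ubar" by (rule h2(2))
qed

end

text \<open>For n < 2 the truncated difference n - 2 is 0, and all the spaces involved are
  zero.\<close>

lemma so_pos_small:
  assumes ob: "opposite_borels (sub_m n) (sub_tm n) u ubar" and n: "n < 2"
  shows "so_pos (sub_n n + u) (sub_nbar n + ubar) n"
proof -
  have so0: "so k = {0}" if "k < 2" for k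
  proof -
    have "Z = 0" if "Z \<in> so k" for Z
    proof (intro ext)
      fix i j
      have "Z i j = 0"
      proof (cases "i = j")
        case True
        then show ?thesis using so_skewD[OF that, of i i] by simp
      next
        case False
        then have "\<not> (i \<in> {1..k} \<and> j \<in> {1..k})" using \<open>k < 2\<close> by auto
        then show ?thesis using that unfolding so_def by blast
      qed
      then show "Z i j = 0 i j" by simp
    qed
    moreover have "0 \<in> so k" using lie_subalgebraD(4)[OF lie_subalgebra_so] .
    ultimately show ?thesis by blast
  qed
  have st: "cmat.subspace (sub_tm n)" by (simp add: sub_tm_def)
  note obD = opposite_borelsD[OF ob st, unfolded sub_m_def]
  have u0: "u = {0}" "ubar = {0}"
    using obD(2,4) lie_subalgebraD(4)[OF obD(1)] lie_subalgebraD(4)[OF obD(3)] so0[of "n - 2"] n by auto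
  have s0: "sub_n n = {0}" "sub_nbar n = {0}" using n by (simp_all add: sub_n_def sub_nbar_def)
  have h0: "sub_h n = {0}" using sub_h_so[of n] so0[OF n] cmat.subspace_0[OF sub_h_subspace[of n]] by blast
  have p0: "{0} + {0} = ({0} :: cmat set)" by (simp add: set_plus_def)
  have l0: "lie 0 0 = 0" by (simp add: lie_def)
  have z: "lie_subalgebra {0}" using lie_subalgebra_so[of n] unfolding so0[OF n] .
  have "triangular {0} {0} {0} {0} n"
    by unfold_locales (use z l0 p0 so_box[of n] so0[OF n] in auto)
  then show ?thesis
    unfolding so_pos_def u0 s0 h0 p0 so0[OF n] using l0 by simp
qed

theorem theorem1p1:
  fixes n :: nat and u :: complex
  shows "Cn n u \<in> ring_center (uea (so n)) \<and>
    (\<forall>\<uu> \<uu>bar. opposite_borels (sub_m n) (sub_tm n) \<uu> \<uu>bar \<longrightarrow>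
       harish_chandra n \<uu> \<uu>bar (Cn n u) = hc_image n u)"
proof (intro conjI allI impI)
  show "Cn n u \<in> ring_center (uea (so n))" by (rule Cn_central)
  fix \<uu> \<uu>bar assume ob: "opposite_borels (sub_m n) (sub_tm n) \<uu> \<uu>bar"
  have "so_pos (sub_n n + \<uu>) (sub_nbar n + \<uu>bar) n"
    using so_pos_instance[OF ob] so_pos_small[OF ob] by linarith
  then show "harish_chandra n \<uu> \<uu>bar (Cn n u) = hc_image n u"
    unfolding harish_chandra_def Let_def by (rule so_pos.shifted_hc_proj_Cn)
qed

end
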